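(* Let $f=\{f_n\}:(A,d,\pi_n)\to(A',d,\pi_n)$ be any morphism of $A_\infty$-algebras over $K$. Define a family of module maps $$\widetilde f=\{f^n_{(i_1,\dots,i_k)}:T(A)_{n,q}\to T(A')_{n-k,q+k}\},\quad n\ge 0,\ q\ge 0,\ 0\le k\le n,\ 0\le i_1<\dots<i_k\le n,$$ by the following rules. 1) If $k=0$, then $f^n_{(\,)}=f_0^{\otimes n}$. 2) If $k\ge1$ and ($i_1=0$ or $i_k=n$), then $f^n_{(i_1,\dots,i_k)}=0$. 3) If $k\ge 1$, $i_1\ne 0$ and $i_k\neq n$, write (uniquely) $(i_1,\dots,i_k)=((j^1_1,\dots,j^1_{n_1}),\dots,(j^s_1,\dots,j^s_{n_s}))$ as a concatenation of maximal blocks of consecutive integers, i.e. $1\le s\le k$, $n_1,\dots,n_s\ge 1$, $n_1+\dots+n_s=k$, $j^m_{p+1}=j^m_p+1$ for $1\le p\le n_m-1$, $1\le m\le s$, and $j^{m+1}_1>j^m_{n_m}+1$ for $1\le m\le s-1$. Put $k_1=j^1_1$, $k_i=j^i_1-j^{i-1}_{n_{i-1}}-1$ for $2\le i\le s$, and $\gamma=\sum_{i=1}^{s-1}n_i(n_{i+1}+\dots+n_s)$. Then, on $T(A)_{n,q}$, $$f^n_{(i_1,\dots,i_k)}=(-1)^{k(q-1)+\gamma}\,f_0^{\otimes(k_1-1)}\otimes f_{n_1}\otimes f_0^{\otimes(k_2-1)}\otimes f_{n_2}\otimes\dots\otimes f_0^{\otimes(k_s-1)}\otimes f_{n_s}\otimes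 f_0^{\otimes(n-(k_1+\dots+k_s)-k)}.$$ Then $\widetilde f$ is a morphism of differential modules with $\infty$-simplicial faces $\widetilde f:(T(A),d,\widetilde\partial)\to(T(A'),d,\widetilde\partial)$.
   Context: **Conventions.** $K$ is a commutative ring with unity; all modules and maps are $K$-modules and $K$-linear maps. Tensor products of graded maps follow the Koszul rule: $(u\otimes v)(a\otimes b)=(-1)^{\deg(v)\deg(a)}u(a)\otimes v(b)$. A differential (bigraded) module $(X,d)$ is a bigraded module $X=\{X_{n,m}\}$, $n,m\ge0$, with $d:X_{*,\bullet}\to X_{*,\bullet-1}$, $d^2=0$. For a map $u$ between differential bigraded modules of bidegree $(a,b)$, $d(u)=du-(-1)^{a+b}ud$. For a permutation, $\mathrm{sign}(\sigma)\in\{0,1\}$ denotes its parity ($0$ for even, $1$ for odd). **Permuted tuples.** For $i_1<\dots<i_k$ nonnegative integers and $\sigma\in\Sigma_k$ (symmetric group), $\sigma$ permutes the components of $(i_1,\dots,i_k)$, giving $(\sigma(i_1),\dots,\sigma(i_k))$. Put $\widehat{\sigma(i_s)}=\sigma(i_s)-\alpha(\sigma(i_s))$, where $\alpha(\sigma(i_s))$ is the number of entries of $(\sigma(i_1),\dots,\sigma(i_k))$ to the right of $\sigma(i_s)$ that are smaller than $\sigma(i_s)$. Let $I_\sigma$ be the set of all partitions of $(\widehat{\sigma(i_1)},\dots,\widehat{\sigma(i_k)})$ into two tuples $(\widehat{\sigma(i_1)},\dots,\widehat{\sigma(i_m)})$ and $(\widehat{\sigma(i_{m+1})},\dots,\widehat{\sigma(i_k)})$,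 $1\le m\le k-1$, such that both tuples are strictly increasing. **Differential module with $\infty$-simplicial faces** $(X,d,\widetilde\partial)$: a differential module $(X,d)$ with maps $\widetilde\partial=\{\partial_{(i_1,\dots,i_k)}:X_{n,\bullet}\to X_{n-k,\bullet+k-1}\}$, $1\le k\le n$, $0\le i_1<\dots<i_k\le n$, such that $$d(\partial_{(i_1,\dots,i_k)})=\sum_{\sigma\in\Sigma_k}\sum_{I_\sigma}(-1)^{\mathrm{sign}(\sigma)+1}\partial_{(\widehat{\sigma(i_1)},\dots,\widehat{\sigma(i_m)})}\partial_{(\widehat{\sigma(i_{m+1})},\dots,\widehat{\sigma(i_k)})}.$$ **Morphism** $\widetilde f:(X,d,\widetilde\partial)\to(Y,d,\widetilde\partial)$ of differential modules with $\infty$-simplicial faces: a family of maps $f_{(i_1,\dots,i_k)}:X_{n,\bullet}\to Y_{n-k,\bullet+k}$, $0\le k\le n$, $0\le i_1<\dots<i_k\le n$ (written $f_{(\,)}$ for $k=0$), such that $d(f_{(\,)})=0$ and for $k\ge1$ $$d(f_{(i_1,\dots,i_k)})=-\partial_{(i_1,\dots,i_k)}f_{(\,)}+f_{(\,)}\partial_{(i_1,\dots,i_k)}+\sum_{\sigma\in\Sigma_k}\sum_{I_\sigma}(-1)^{\mathrm{sign}(\sigma)+1}\Big(\partial_{(\widehat{\sigma(i_1)},\dots,\widehat{\sigma(i_m)})}f_{(\widehat{\sigma(i_{m+1})},\dots,\widehat{\sigma(i_k)})}-f_{(\widehat{\sigma(i_1)},\dots,\widehat{\sigma(i_m)})}\partial_{(\widehat{\sigma(i_{m+1})},\dots,\widehat{\sigma(i_k)})}\Big).$$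 **$A_\infty$-algebra** $(A,d,\pi_n)$: a graded module $A=\{A_n\}_{n\ge0}$ with differential $d:A_\bullet\to A_{\bullet-1}$ and maps $\pi_n:(A^{\otimes(n+2)})_\bullet\to A_{\bullet+n}$, $n\ge0$, such that for all integers $n\ge-1$ $$d(\pi_{n+1})=\sum_{m=0}^n\sum_{t=1}^{m+2}(-1)^{t(n-m+1)+n+1}\pi_m(1^{\otimes(t-1)}\otimes\pi_{n-m}\otimes1^{\otimes(m-t+2)}),\quad d(\pi_{n+1})=d\pi_{n+1}+(-1)^n\pi_{n+1}d.$$ **Morphism of $A_\infty$-algebras** $f:(A,d,\pi_n)\to(A',d,\pi_n)$: maps $f_n:(A^{\otimes(n+1)})_\bullet\to A'_{\bullet+n}$, $n\ge0$, such that for all integers $n\ge-1$ $$d(f_{n+1})=\sum_{m=0}^n\sum_{t=1}^{m+1}(-1)^{t(n-m+1)+n+1}f_m(1^{\otimes(t-1)}\otimes\pi_{n-m}\otimes1^{\otimes(m-t+1)})-\sum_{m=0}^n\sum_{J_{n-m}}(-1)^{\varepsilon}\pi_m(f_{n_1}\otimes\dots\otimes f_{n_{m+2}}),$$ where $d(f_{n+1})=df_{n+1}+(-1)^nf_{n+1}d$, $J_{n-m}=\{n_1,\dots,n_{m+2}\ge0\mid n_1+\dots+n_{m+2}=n-m\}$, $\varepsilon=\sum_{i=1}^{m+1}(n_i+1)(n_{i+1}+\dots+n_{m+2})$. **Tensor module of an $A_\infty$-algebra.** $T(A)_{n,m}=(A^{\otimes n})_m$, $n,m\ge0$, with $d$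 the usual tensor product differential, and $\widetilde\partial=\{\partial^n_{(i_1,\dots,i_k)}:T(A)_{n,q}\to T(A)_{n-k,q+k-1}\}$ ($1\le k\le n$, $0\le i_1<\dots<i_k\le n$) given by $\partial^n_{(i_1,\dots,i_k)}=(-1)^{k(q-1)}1^{\otimes(j-1)}\otimes\pi_{k-1}\otimes1^{\otimes(n-k-j)}$ if $(i_1,\dots,i_k)=(j,j+1,\dots,j+k-1)$ with $1\le j\le n-k$, and $\partial^n_{(i_1,\dots,i_k)}=0$ otherwise. It is known that $(T(A),d,\widetilde\partial)$ is a differential module with $\infty$-simplicial faces. *)

theory Defs
  imports "HOL-Algebra.Module" "HOL-Algebra.AbelCoset" "HOL-Combinatorics.Permutations"
begin

section \<open>Linear maps, quotients and tensor powers\<close>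

definition lin_hom :: "'k ring \<Rightarrow> ('k, 'a) module \<Rightarrow> ('k, 'b) module \<Rightarrow> ('a \<Rightarrow> 'b) set" where
  "lin_hom K M N = {h \<in> carrier M \<rightarrow> carrier N.
     (\<forall>x\<in>carrier M. \<forall>y\<in>carrier M. h (x \<oplus>\<^bsub>M\<^esub> y) = h x \<oplus>\<^bsub>N\<^esub> h y) \<and>
     (\<forall>c\<in>carrier K. \<forall>x\<in>carrier M. h (c \<odot>\<^bsub>M\<^esub> x) = c \<odot>\<^bsub>N\<^esub> h x)}"

text \<open>The element \<open>(-1)\<^sup>e x\<close> of the module \<open>M\<close>.\<close>

definition signed :: "('k, 'a) module \<Rightarrow> int \<Rightarrow> 'a \<Rightarrow> 'a" where
  "signed M e x = (if even e then x else \<ominus>\<^bsub>M\<^esub> x)"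

text \<open>The record type of modules extends that of rings; the ring multiplication and unit of a
  module are irrelevant and left unspecified.\<close>

definition free_module :: "'k ring \<Rightarrow> 'w set \<Rightarrow> ('k, 'w \<Rightarrow> 'k) module" where
  "free_module K W =
     \<lparr>carrier = {p. (\<forall>w\<in>W. p w \<in> carrier K) \<and> (\<forall>w. w \<notin> W \<longrightarrow> p w = \<zero>\<^bsub>K\<^esub>) \<and>
                     finite {w. p w \<noteq> \<zero>\<^bsub>K\<^esub>}},
      monoid.mult = undefined, one = undefined,
      ring.zero = (\<lambda>w. \<zero>\<^bsub>K\<^esub>), add = (\<lambda>p r w. p w \<oplus>\<^bsub>K\<^esub> r w),
      smult = (\<lambda>c p w. c \<otimes>\<^bsub>K\<^esub> p w)\<rparr>"

definition free_gen :: "'k ring \<Rightarrow> 'w \<Rightarrow> 'w \<Rightarrow> 'k" where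
  "free_gen K w = (\<lambda>v. if v = w then \<one>\<^bsub>K\<^esub> else \<zero>\<^bsub>K\<^esub>)"

definition submodule_span :: "'k ring \<Rightarrow> ('k, 'a) module \<Rightarrow> 'a set \<Rightarrow> 'a set" where
  "submodule_span K M S = \<Inter>{N. submodule N K M \<and> S \<subseteq> N}"

definition quotient_module :: "('k, 'a) module \<Rightarrow> 'a set \<Rightarrow> ('k, 'a set) module" where
  "quotient_module M N =
     \<lparr>carrier = a_rcosets\<^bsub>M\<^esub> N,
      monoid.mult = undefined, one = undefined,
      ring.zero = N, add = (\<lambda>X Y. X <+>\<^bsub>M\<^esub> Y),
      smult = (\<lambda>c X. \<Union>x\<in>X. N +>\<^bsub>M\<^esub> (c \<odot>\<^bsub>M\<^esub> x))\<rparr>"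

text \<open>A word \<open>[(p\<^sub>1, a\<^sub>1), \<dots>, (p\<^sub>n, a\<^sub>n)]\<close> with \<open>a\<^sub>i\<close> in \<open>A p\<^sub>i\<close> stands for the homogeneous
  elementary tensor \<open>a\<^sub>1 \<otimes> \<dots> \<otimes> a\<^sub>n\<close>.  Degrees are recorded because the carriers of the \<open>A p\<close>
  need not be disjoint.\<close>

type_synonym 'a word = "(int \<times> 'a) list"

type_synonym ('k, 'a) tensor = "('a word \<Rightarrow> 'k) set"

definition wdeg :: "'a word \<Rightarrow> int" where
  "wdeg w = sum_list (map fst w)"

definition words :: "(int \<Rightarrow> ('k, 'a) module) \<Rightarrow> nat \<Rightarrow> int \<Rightarrow> 'a word set" where
  "words A n m = {w. length w = n \<and> (\<forall>(p, a)\<in>set w. a \<in> carrier (A p)) \<and> wdeg w = m}"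

text \<open>The multilinearity relations.  They only relate words with the same sequence of degrees, so
  the quotient below is the direct sum, over \<open>m\<^sub>1 + \<dots> + m\<^sub>n = m\<close>, of the
  \<open>A m\<^sub>1 \<otimes> \<dots> \<otimes> A m\<^sub>n\<close>; for \<open>n = 0\<close> it is \<open>K\<close>, concentrated in degree 0.\<close>

definition tensor_relations ::
    "'k ring \<Rightarrow> (int \<Rightarrow> ('k, 'a) module) \<Rightarrow> nat \<Rightarrow> int \<Rightarrow> ('a word \<Rightarrow> 'k) set" where
  "tensor_relations K A n m = submodule_span K (free_module K (words A n m))
     ({free_gen K (u @ (p, a \<oplus>\<^bsub>A p\<^esub> b) # v) \<ominus>\<^bsub>free_module K (words A n m)\<^esub>
         (free_gen K (u @ (p, a) # v) \<oplus>\<^bsub>free_module K (words A n m)\<^esub> free_gen K (u @ (p, b) # v))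
       | u v p a b. u @ (p, a) # v \<in> words A n m \<and> u @ (p, b) # v \<in> words A n m} \<union>
      {free_gen K (u @ (p, c \<odot>\<^bsub>A p\<^esub> a) # v) \<ominus>\<^bsub>free_module K (words A n m)\<^esub>
         (c \<odot>\<^bsub>free_module K (words A n m)\<^esub> free_gen K (u @ (p, a) # v))
       | u v p a c. c \<in> carrier K \<and> u @ (p, a) # v \<in> words A n m})"

text \<open>The module of elements of degree \<open>m\<close> of the \<open>n\<close>-th tensor power of the graded module \<open>A\<close>.\<close>

definition tensor_power ::
    "'k ring \<Rightarrow> (int \<Rightarrow> ('k, 'a) module) \<Rightarrow> nat \<Rightarrow> int \<Rightarrow> ('k, ('k, 'a) tensor) module" where
  "tensor_power K A n m =
     quotient_module (free_module K (words A n m)) (tensor_relations K A n m)"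

definition pure_tensor ::
    "'k ring \<Rightarrow> (int \<Rightarrow> ('k, 'a) module) \<Rightarrow> 'a word \<Rightarrow> ('k, 'a) tensor" where
  "pure_tensor K A w =
     tensor_relations K A (length w) (wdeg w)
       +>\<^bsub>free_module K (words A (length w) (wdeg w))\<^esub> free_gen K w"

text \<open>The linear map into \<open>M\<close> sending each \<open>pure_tensor K A w\<close> to \<open>\<phi> w\<close>.  It is computed on a
  representative of the coset, the choice of which does not matter if \<open>\<phi>\<close> is multilinear.\<close>

definition lin_ext ::
    "'k ring \<Rightarrow> ('k, 'b) module \<Rightarrow> ('a word \<Rightarrow> 'b) \<Rightarrow> ('k, 'a) tensor \<Rightarrow> 'b" where
  "lin_ext K M \<phi> X =
     (let p = (SOME p. p \<in> X) in \<Oplus>\<^bsub>M\<^esub>w\<in>{w. p w \<noteq> \<zero>\<^bsub>K\<^esub>}. p w \<odot>\<^bsub>M\<^esub> \<phi> w)"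


section \<open>Tensor products of graded maps\<close>

text \<open>A factor \<open>(r, e, g)\<close> is a graded map of degree \<open>e\<close> from the \<open>r\<close>-th tensor power of \<open>A\<close> to
  \<open>B\<close>, given by its values \<open>g w\<close> on elementary tensors.\<close>

type_synonym ('a, 'b) factor = "nat \<times> int \<times> ('a word \<Rightarrow> 'b)"

definition factors_deg :: "('a, 'b) factor list \<Rightarrow> int" where
  "factors_deg gs = (\<Sum>(r, e, g)\<leftarrow>gs. e)"

text \<open>Exponent of the sign in \<open>(g\<^sub>1 \<otimes> \<dots> \<otimes> g\<^sub>s)(w)\<close>: the Koszul rule
  \<open>(u \<otimes> v)(a \<otimes> b) = (-1)^(deg v * deg a) u a \<otimes> v b\<close> for \<open>u = g\<^sub>1\<close>, \<open>v = g\<^sub>2 \<otimes> \<dots> \<otimes> g\<^sub>s\<close>, iterated.\<close>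

fun koszul :: "('a, 'b) factor list \<Rightarrow> 'a word \<Rightarrow> int" where
  "koszul [] w = 0"
| "koszul ((r, e, g) # gs) w = factors_deg gs * wdeg (take r w) + koszul gs (drop r w)"

fun apply_factors :: "('a, 'b) factor list \<Rightarrow> 'a word \<Rightarrow> 'b word" where
  "apply_factors [] w = []"
| "apply_factors ((r, e, g) # gs) w =
     (wdeg (take r w) + e, g (take r w)) # apply_factors gs (drop r w)"

text \<open>The map \<open>g\<^sub>1 \<otimes> \<dots> \<otimes> g\<^sub>s\<close> on elements of degree \<open>q\<close>.\<close>

definition tensor_map ::
    "'k ring \<Rightarrow> (int \<Rightarrow> ('k, 'b) module) \<Rightarrow> ('a, 'b) factor list \<Rightarrow> int
      \<Rightarrow> ('k, 'a) tensor \<Rightarrow> ('k, 'b) tensor" where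
  "tensor_map K B gs q =
     lin_ext K (tensor_power K B (length gs) (q + factors_deg gs))
       (\<lambda>w. signed (tensor_power K B (length gs) (q + factors_deg gs)) (koszul gs w)
              (pure_tensor K B (apply_factors gs w)))"

definition id_factor :: "('a, 'a) factor" where
  "id_factor = (1, 0, \<lambda>w. snd (hd w))"

definition diff_factor :: "(int \<Rightarrow> 'a \<Rightarrow> 'a) \<Rightarrow> ('a, 'a) factor" where
  "diff_factor d = (1, -1, \<lambda>w. d (fst (hd w)) (snd (hd w)))"

text \<open>The factor given by a graded map \<open>g\<close> of degree \<open>e\<close> whose component on elements of degree
  \<open>q\<close> of the \<open>r\<close>-th tensor power is \<open>g q\<close>.\<close>

definition map_factor ::
    "'k ring \<Rightarrow> (int \<Rightarrow> ('k, 'a) module) \<Rightarrow> nat \<Rightarrow> nat \<Rightarrow> (int \<Rightarrow> ('k, 'a) tensor \<Rightarrow> 'b)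
      \<Rightarrow> ('a, 'b) factor" where
  "map_factor K A r e g = (r, int e, \<lambda>w. g (wdeg w) (pure_tensor K A w))"

definition pi_factor ::
    "'k ring \<Rightarrow> (int \<Rightarrow> ('k, 'a) module) \<Rightarrow> (nat \<Rightarrow> int \<Rightarrow> ('k, 'a) tensor \<Rightarrow> 'a) \<Rightarrow> nat
      \<Rightarrow> ('a, 'a) factor" where
  "pi_factor K A \<pi> n = map_factor K A (n + 2) n (\<pi> n)"

definition mor_factor ::
    "'k ring \<Rightarrow> (int \<Rightarrow> ('k, 'a) module) \<Rightarrow> (nat \<Rightarrow> int \<Rightarrow> ('k, 'a) tensor \<Rightarrow> 'b) \<Rightarrow> nat
      \<Rightarrow> ('a, 'b) factor" where
  "mor_factor K A f n = map_factor K A (n + 1) n (f n)"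

text \<open>The differential \<open>\<Sum>\<^sub>i 1 \<otimes> \<dots> \<otimes> d \<otimes> \<dots> \<otimes> 1\<close> of the \<open>n\<close>-th tensor power.\<close>

definition tensor_diff ::
    "'k ring \<Rightarrow> (int \<Rightarrow> ('k, 'a) module) \<Rightarrow> (int \<Rightarrow> 'a \<Rightarrow> 'a) \<Rightarrow> nat \<Rightarrow> int
      \<Rightarrow> ('k, 'a) tensor \<Rightarrow> ('k, 'a) tensor" where
  "tensor_diff K A d n q x =
     (\<Oplus>\<^bsub>tensor_power K A n (q - 1)\<^esub>i\<in>{..<n}.
        tensor_map K A
          (replicate i id_factor @ [diff_factor d] @ replicate (n - 1 - i) id_factor) q x)"


section \<open>A-infinity algebras and their morphisms\<close>

text \<open>A module graded by the nonnegative integers is extended by zero to negative degrees, so that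
  \<open>d\<close> is defined on \<open>A 0\<close> and no truncated subtraction of degrees occurs.\<close>

locale graded_differential_module = cring K
  for K :: "'k ring" and A :: "int \<Rightarrow> ('k, 'a) module" and d :: "int \<Rightarrow> 'a \<Rightarrow> 'a" +
  assumes module_A: "module K (A q)"
    and zero_A: "q < 0 \<Longrightarrow> carrier (A q) = {\<zero>\<^bsub>A q\<^esub>}"
    and d_hom: "d q \<in> lin_hom K (A q) (A (q - 1))"
    and d_d: "x \<in> carrier (A q) \<Longrightarrow> d (q - 1) (d q x) = \<zero>\<^bsub>A (q - 2)\<^esub>"

text \<open>The relations for \<open>d(\<pi>\<^sub>n\<^sub>+\<^sub>1)\<close>, \<open>n \<ge> -1\<close>, are stated with \<open>n\<close> in place of \<open>n + 1\<close>.\<close>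

locale A_infinity_algebra = graded_differential_module K A d
  for K :: "'k ring" and A :: "int \<Rightarrow> ('k, 'a) module" and d :: "int \<Rightarrow> 'a \<Rightarrow> 'a"
    and \<pi> :: "nat \<Rightarrow> int \<Rightarrow> ('k, 'a) tensor \<Rightarrow> 'a" +
  assumes pi_hom: "\<pi> n q \<in> lin_hom K (tensor_power K A (n + 2) q) (A (q + int n))"
    and pi_relation: "x \<in> carrier (tensor_power K A (n + 2) q) \<Longrightarrow>
      d (q + int n) (\<pi> n q x) \<oplus>\<^bsub>A (q + int n - 1)\<^esub>
        signed (A (q + int n - 1)) (int n - 1) (\<pi> n (q - 1) (tensor_diff K A d (n + 2) q x)) =
      (\<Oplus>\<^bsub>A (q + int n - 1)\<^esub>m\<in>{..<n}. \<Oplus>\<^bsub>A (q + int n - 1)\<^esub>t\<in>{1..m + 2}.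
         signed (A (q + int n - 1)) (int (t * (n - m) + n))
           (\<pi> m (q + int (n - 1 - m))
             (tensor_map K A (replicate (t - 1) id_factor @ [pi_factor K A \<pi> (n - 1 - m)]
                @ replicate (m + 2 - t) id_factor) q x)))"

locale A_infinity_morphism =
  source: A_infinity_algebra K A d \<pi> + target: A_infinity_algebra K A' d' \<pi>'
  for K :: "'k ring" and A :: "int \<Rightarrow> ('k, 'a) module" and d :: "int \<Rightarrow> 'a \<Rightarrow> 'a"
    and \<pi> :: "nat \<Rightarrow> int \<Rightarrow> ('k, 'a) tensor \<Rightarrow> 'a"
    and A' :: "int \<Rightarrow> ('k, 'b) module" and d' :: "int \<Rightarrow> 'b \<Rightarrow> 'b"
    and \<pi>' :: "nat \<Rightarrow> int \<Rightarrow> ('k, 'b) tensor \<Rightarrow> 'b"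
    and f :: "nat \<Rightarrow> int \<Rightarrow> ('k, 'a) tensor \<Rightarrow> 'b" +
  assumes f_hom: "f n q \<in> lin_hom K (tensor_power K A (n + 1) q) (A' (q + int n))"
    and f_relation: "x \<in> carrier (tensor_power K A (n + 1) q) \<Longrightarrow>
      d' (q + int n) (f n q x) \<oplus>\<^bsub>A' (q + int n - 1)\<^esub>
        signed (A' (q + int n - 1)) (int n - 1) (f n (q - 1) (tensor_diff K A d (n + 1) q x)) =
      (\<Oplus>\<^bsub>A' (q + int n - 1)\<^esub>m\<in>{..<n}. \<Oplus>\<^bsub>A' (q + int n - 1)\<^esub>t\<in>{1..m + 1}.
         signed (A' (q + int n - 1)) (int (t * (n - m) + n))
           (f m (q + int (n - 1 - m))
             (tensor_map K A (replicate (t - 1) id_factor @ [pi_factor K A \<pi> (n - 1 - m)]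
                @ replicate (m + 1 - t) id_factor) q x)))
      \<ominus>\<^bsub>A' (q + int n - 1)\<^esub>
      (\<Oplus>\<^bsub>A' (q + int n - 1)\<^esub>m\<in>{..<n}.
         \<Oplus>\<^bsub>A' (q + int n - 1)\<^esub>ns\<in>{ns. length ns = m + 2 \<and> sum_list ns = n - 1 - m}.
         signed (A' (q + int n - 1))
           (int (\<Sum>i<m + 1. (ns ! i + 1) * sum_list (drop (i + 1) ns)))
           (\<pi>' m (q + int (n - 1 - m)) (tensor_map K A' (map (mor_factor K A f) ns) q x)))"


section \<open>Differential modules with infinity-simplicial faces\<close>

definition index_tuples :: "nat \<Rightarrow> nat list set" where
  "index_tuples n = {is. sorted_wrt (<) is \<and> set is \<subseteq> {..n} \<and> length is \<le> n}"

text \<open>The truncated subtraction is harmless for tuples of distinct entries: at most \<open>js ! s\<close> of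
  them are smaller than \<open>js ! s\<close>.\<close>

definition hat :: "nat list \<Rightarrow> nat list" where
  "hat js = map (\<lambda>s. js ! s - card {t. s < t \<and> t < length js \<and> js ! t < js ! s}) [0..<length js]"

text \<open>The set \<open>I\<^sub>\<sigma>\<close>, for \<open>js\<close> the tuple of the hats of the permuted entries; a partition of \<open>js\<close>
  into two tuples is given by the position \<open>m\<close> at which \<open>js\<close> is cut.\<close>

definition cuts :: "nat list \<Rightarrow> nat set" where
  "cuts js = {m. 1 \<le> m \<and> m < length js \<and>
     sorted_wrt (<) (take m js) \<and> sorted_wrt (<) (drop m js)}"

definition perm_parity :: "(nat \<Rightarrow> nat) \<Rightarrow> int" where
  "perm_parity \<sigma> = (if evenperm \<sigma> then 0 else 1)"

text \<open>\<open>d(u) = d u - (-1)^(a + b) u d\<close> on elements of bidegree \<open>(n, q)\<close>, for \<open>u\<close> of bidegree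
  \<open>(a, b)\<close> with \<open>n + a = n'\<close>; only the components \<open>u q\<close> of \<open>u\<close> on bidegrees \<open>(n, q)\<close> matter.\<close>

definition map_diff ::
    "(nat \<Rightarrow> int \<Rightarrow> ('k, 'y) module) \<Rightarrow> (nat \<Rightarrow> int \<Rightarrow> 'x \<Rightarrow> 'x) \<Rightarrow> (nat \<Rightarrow> int \<Rightarrow> 'y \<Rightarrow> 'y)
      \<Rightarrow> nat \<Rightarrow> nat \<Rightarrow> int \<Rightarrow> (int \<Rightarrow> 'x \<Rightarrow> 'y) \<Rightarrow> int \<Rightarrow> 'x \<Rightarrow> 'y" where
  "map_diff Y dX dY n n' b u q x =
     dY n' (q + b) (u q x) \<ominus>\<^bsub>Y n' (q + b - 1)\<^esub>
       signed (Y n' (q + b - 1)) (int n' - int n + b) (u (q - 1) (dX n q x))"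

text \<open>As above, the second degree is extended by zero to negative integers.\<close>

locale infinity_simplicial_module = cring K
  for K :: "'k ring" and X :: "nat \<Rightarrow> int \<Rightarrow> ('k, 'x) module" and d :: "nat \<Rightarrow> int \<Rightarrow> 'x \<Rightarrow> 'x"
    and face :: "nat \<Rightarrow> int \<Rightarrow> nat list \<Rightarrow> 'x \<Rightarrow> 'x" +
  assumes graded_differential_module_X: "graded_differential_module K (X n) (d n)"
    and face_hom: "is \<in> index_tuples n \<Longrightarrow> is \<noteq> [] \<Longrightarrow> k = length is \<Longrightarrow>
      face n q is \<in> lin_hom K (X n q) (X (n - k) (q + int k - 1))"
    and face_relation: "is \<in> index_tuples n \<Longrightarrow> is \<noteq> [] \<Longrightarrow> k = length is \<Longrightarrow>
      x \<in> carrier (X n q) \<Longrightarrow>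
      map_diff X d d n (n - k) (int k - 1) (\<lambda>q. face n q is) q x =
      (\<Oplus>\<^bsub>X (n - k) (q + int k - 2)\<^esub>\<sigma>\<in>{\<sigma>. \<sigma> permutes {..<k}}.
       \<Oplus>\<^bsub>X (n - k) (q + int k - 2)\<^esub>m\<in>cuts (hat (permute_list \<sigma> is)).
         let l = take m (hat (permute_list \<sigma> is)); r = drop m (hat (permute_list \<sigma> is)) in
         signed (X (n - k) (q + int k - 2)) (perm_parity \<sigma> + 1)
           (face (n - length r) (q + int (length r) - 1) l (face n q r x)))"

locale infinity_simplicial_morphism =
  source: infinity_simplicial_module K X dX faceX + target: infinity_simplicial_module K Y dY faceY
  for K :: "'k ring"
    and X :: "nat \<Rightarrow> int \<Rightarrow> ('k, 'x) module" and dX :: "nat \<Rightarrow> int \<Rightarrow> 'x \<Rightarrow> 'x"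
    and faceX :: "nat \<Rightarrow> int \<Rightarrow> nat list \<Rightarrow> 'x \<Rightarrow> 'x"
    and Y :: "nat \<Rightarrow> int \<Rightarrow> ('k, 'y) module" and dY :: "nat \<Rightarrow> int \<Rightarrow> 'y \<Rightarrow> 'y"
    and faceY :: "nat \<Rightarrow> int \<Rightarrow> nat list \<Rightarrow> 'y \<Rightarrow> 'y"
    and F :: "nat \<Rightarrow> int \<Rightarrow> nat list \<Rightarrow> 'x \<Rightarrow> 'y" +
  assumes F_hom: "is \<in> index_tuples n \<Longrightarrow> k = length is \<Longrightarrow>
      F n q is \<in> lin_hom K (X n q) (Y (n - k) (q + int k))"
    and F_nil_relation: "x \<in> carrier (X n q) \<Longrightarrow>
      map_diff Y dX dY n n 0 (\<lambda>q. F n q []) q x = \<zero>\<^bsub>Y n (q - 1)\<^esub>"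
    and F_relation: "is \<in> index_tuples n \<Longrightarrow> is \<noteq> [] \<Longrightarrow> k = length is \<Longrightarrow>
      x \<in> carrier (X n q) \<Longrightarrow>
      map_diff Y dX dY n (n - k) (int k) (\<lambda>q. F n q is) q x =
      \<ominus>\<^bsub>Y (n - k) (q + int k - 1)\<^esub> (faceY n q is (F n q [] x))
      \<oplus>\<^bsub>Y (n - k) (q + int k - 1)\<^esub> F (n - k) (q + int k - 1) [] (faceX n q is x)
      \<oplus>\<^bsub>Y (n - k) (q + int k - 1)\<^esub>
      (\<Oplus>\<^bsub>Y (n - k) (q + int k - 1)\<^esub>\<sigma>\<in>{\<sigma>. \<sigma> permutes {..<k}}.
       \<Oplus>\<^bsub>Y (n - k) (q + int k - 1)\<^esub>m\<in>cuts (hat (permute_list \<sigma> is)).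
         let l = take m (hat (permute_list \<sigma> is)); r = drop m (hat (permute_list \<sigma> is)) in
         signed (Y (n - k) (q + int k - 1)) (perm_parity \<sigma> + 1)
           (faceY (n - length r) (q + int (length r)) l (F n q r x)
            \<ominus>\<^bsub>Y (n - k) (q + int k - 1)\<^esub>
            F (n - length r) (q + int (length r) - 1) l (faceX n q r x)))"


section \<open>The tensor module of an A-infinity algebra\<close>

text \<open>Its underlying bigraded module is \<open>tensor_power K A\<close>, its differential \<open>tensor_diff K A d\<close>.\<close>

definition tensor_face ::
    "'k ring \<Rightarrow> (int \<Rightarrow> ('k, 'a) module) \<Rightarrow> (nat \<Rightarrow> int \<Rightarrow> ('k, 'a) tensor \<Rightarrow> 'a)
      \<Rightarrow> nat \<Rightarrow> int \<Rightarrow> nat list \<Rightarrow> ('k, 'a) tensor \<Rightarrow> ('k, 'a) tensor" where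
  "tensor_face K A \<pi> n q is x =
     (let k = length is; j = hd is; T = tensor_power K A (n - k) (q + int k - 1) in
      if is = [j..<j + k] \<and> 1 \<le> j \<and> j \<le> n - k
      then signed T (int k * (q - 1))
             (tensor_map K A (replicate (j - 1) id_factor @ [pi_factor K A \<pi> (k - 1)]
                @ replicate (n - k - j) id_factor) q x)
      else \<zero>\<^bsub>T\<^esub>)"

text \<open>The decomposition of a strictly increasing tuple into maximal blocks of consecutive integers.\<close>

fun blocks :: "nat list \<Rightarrow> nat list list" where
  "blocks [] = []"
| "blocks [i] = [[i]]"
| "blocks (i # j # is) =
     (if j = i + 1 then (i # hd (blocks (j # is))) # tl (blocks (j # is))
      else [i] # blocks (j # is))"

text \<open>The number \<open>k\<^sub>i\<close> attached to the \<open>i\<close>-th block; blocks are counted from 0 here.\<close>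

definition block_gap :: "nat list list \<Rightarrow> nat \<Rightarrow> nat" where
  "block_gap bs i = (if i = 0 then hd (bs ! 0) else hd (bs ! i) - last (bs ! (i - 1)) - 1)"

definition block_sign :: "nat list list \<Rightarrow> nat" where
  "block_sign bs =
     (\<Sum>i<length bs - 1. length (bs ! i) * sum_list (map length (drop (i + 1) bs)))"

definition tensor_morphism ::
    "'k ring \<Rightarrow> (int \<Rightarrow> ('k, 'a) module) \<Rightarrow> (int \<Rightarrow> ('k, 'b) module)
      \<Rightarrow> (nat \<Rightarrow> int \<Rightarrow> ('k, 'a) tensor \<Rightarrow> 'b)
      \<Rightarrow> nat \<Rightarrow> int \<Rightarrow> nat list \<Rightarrow> ('k, 'a) tensor \<Rightarrow> ('k, 'b) tensor" where
  "tensor_morphism K A A' f n q is x =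
     (let k = length is; T = tensor_power K A' (n - k) (q + int k); bs = blocks is; s = length bs in
      if k = 0 then tensor_map K A' (replicate n (mor_factor K A f 0)) q x
      else if hd is = 0 \<or> last is = n then \<zero>\<^bsub>T\<^esub>
      else signed T (int k * (q - 1) + int (block_sign bs))
             (tensor_map K A'
               (concat (map (\<lambda>i. replicate (block_gap bs i - 1) (mor_factor K A f 0)
                                   @ [mor_factor K A f (length (bs ! i))]) [0..<s])
                @ replicate (n - (\<Sum>i<s. block_gap bs i) - k) (mor_factor K A f 0)) q x))"

end

theory Submission
  imports Defs
begin

text \<open>All maps are determined by their values on elementary tensors, where the Koszul signs are explicit
  integers.  Writing \<open>d\<close> as the operation of arity 1, the relations of \<open>A\<^sub>\<infinity>\<close>-algebras and of their
  morphisms become homogeneous: \<open>\<Sum> \<plusminus> \<pi> \<circ> (1 \<otimes> \<pi> \<otimes> 1) = 0\<close> and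
  \<open>\<Sum> \<plusminus> \<pi> \<circ> (f \<otimes> \<dots> \<otimes> f) = \<Sum> \<plusminus> f \<circ> (1 \<otimes> \<pi> \<otimes> 1)\<close>.

  A permutation together with a cut of the tuple of hats is the same as a subset \<open>R\<close> of the entries
  of the index tuple, the sign counting the inversions.  An index tuple without the entries \<open>0\<close> and
  \<open>n\<close> is a composition of \<open>n\<close>, that is, a way to cut a word of length \<open>n\<close> into groups, and the map
  \<open>f\<close> attached to it applies one component of the morphism to each group.  A composite of a face and
  such a map is nonzero only if all entries on the face side lie in a single group.
  Hence the relation splits into a sum over the groups, and for each group it is the relation of the
  morphism, tensored with the maps attached to the other groups.  The relation for the faces of the
  tensor module is proved in the same way; there the operations applied at disjoint places of the
  word cancel in pairs by the Koszul rule.\<close>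

section \<open>Finite sums and linear maps\<close>

text \<open>Counting \<open>d\<close> as an operation of arity 1 is consistent with the signs: at
  \<open>k = 0\<close> the Koszul exponent \<open>(k - 1) * deg\<close> and the factor
  \<open>k\<close> in the exponents of the relations reduce to the signs of the tensor differential,
  up to one sign shared by all these terms. That only one group is affected has two different
  reasons. When a face is applied first, its tuple is a run of gaps, and a run cannot pass a
  boundary between groups. When a face is applied last, its tuple consists of hats; if these form a
  run, counting shows that the original entries span an interval made up of entries only. All terms
  affecting a fixed group share one exponent, up to the exponents in the morphism relation for that
  group. This is a polynomial identity mod 2 with one combinatorial input: for a splitting of the
  group, \<epsilon> plus the internal inversions equals \<gamma> plus (number of pieces - 1) times
  the total of the pieces. The two terms with the unindexed map of the morphism fit the same pattern
  with \<open>R\<close> empty or everything, so the relation is proved as an equality of two sums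
  without subtraction.\<close>

lemma (in abelian_monoid) finsum_Sigma:
  assumes "finite I" "\<And>i. i \<in> I \<Longrightarrow> finite (J i)"
    and "\<And>i j. i \<in> I \<Longrightarrow> j \<in> J i \<Longrightarrow> f i j \<in> carrier G"
  shows "(\<Oplus>i\<in>I. \<Oplus>j\<in>J i. f i j) = (\<Oplus>p\<in>Sigma I J. f (fst p) (snd p))"
proof -
  have "(\<Oplus>p\<in>(\<Union>i\<in>I. Pair i ` J i). f (fst p) (snd p)) =
      (\<Oplus>i\<in>I. \<Oplus>p\<in>Pair i ` J i. f (fst p) (snd p))"
    by (rule add.finprod_UN_disjoint) (use assms in \<open>auto simp: pairwise_def disjnt_def\<close>)
  also have "\<dots> = (\<Oplus>i\<in>I. \<Oplus>j\<in>J i. f i j)"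
  proof (rule add.finprod_cong')
    fix i assume i: "i \<in> I"
    have "(\<Oplus>p\<in>Pair i ` J i. f (fst p) (snd p)) = (\<Oplus>j\<in>J i. f (fst (i, j)) (snd (i, j)))"
      by (rule finsum_reindex) (use assms i in \<open>auto simp: inj_on_def\<close>)
    then show "(\<Oplus>p\<in>Pair i ` J i. f (fst p) (snd p)) = (\<Oplus>j\<in>J i. f i j)" by simp
  qed (use assms in \<open>auto intro!: finsum_closed\<close>)
  also have "(\<Union>i\<in>I. Pair i ` J i) = Sigma I J" by auto
  finally show ?thesis by simp
qed

text \<open>Closure is asked of the new summands only, since the old ones inherit it through the
  equations.\<close>

lemma (in abelian_monoid) finsum_eq_cong:
  assumes "A = B" "\<And>i. i \<in> B \<Longrightarrow> f i = g i" "\<And>i. i \<in> B \<Longrightarrow> g i \<in> carrier G"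
  shows "finsum G f A = finsum G g B"
  using assms by (intro add.finprod_cong') auto

lemma (in abelian_monoid) finsum_bij:
  assumes "bij_betw h A B" "\<And>y. y \<in> B \<Longrightarrow> f y \<in> carrier G"
  shows "finsum G f B = finsum G (\<lambda>x. f (h x)) A"
  using assms finsum_reindex[of f h A] unfolding bij_betw_def by auto

lemma (in abelian_monoid) finsum_subset:
  assumes "finite B" "A \<subseteq> B" "\<And>i. i \<in> B - A \<Longrightarrow> f i = \<zero>" "\<And>i. i \<in> A \<Longrightarrow> f i \<in> carrier G"
  shows "finsum G f B = finsum G f A"
proof -
  have "f i \<in> carrier G" if "i \<in> B" for i using assms that by (cases "i \<in> A") auto
  then show ?thesis using assms by (intro add.finprod_mono_neutral_cong_right) auto
qed

lemma (in abelian_monoid) finsum_remove: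
  assumes "finite A" "a \<in> A" "\<And>i. i \<in> A \<Longrightarrow> f i \<in> carrier G"
  shows "finsum G f A = f a \<oplus> finsum G f (A - {a})"
proof -
  have "finsum G f (insert a (A - {a})) = f a \<oplus> finsum G f (A - {a})"
    using assms by (intro finsum_insert) auto
  then show ?thesis using assms(2) by (simp add: insert_absorb)
qed

lemma (in abelian_group) a_inv_zero [simp]: "\<ominus> \<zero> = \<zero>"
  unfolding a_inv_def by (rule add.inv_one)

lemma (in abelian_group) finsum_uminus:
  assumes "\<And>i. i \<in> A \<Longrightarrow> f i \<in> carrier G"
  shows "(\<Oplus>i\<in>A. \<ominus> f i) = \<ominus> finsum G f A"
  using assms
proof (induction A rule: infinite_finite_induct)
  case (insert x F)
  then have "(\<Oplus>i\<in>insert x F. \<ominus> f i) = \<ominus> f x \<oplus> (\<Oplus>i\<in>F. \<ominus> f i)"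
    by (intro finsum_insert) auto
  moreover have "finsum G f (insert x F) = f x \<oplus> finsum G f F"
    using insert by (intro finsum_insert) auto
  ultimately show ?case using insert by (simp add: minus_add finsum_closed Pi_def)
qed auto

section \<open>Linear maps between modules\<close>

lemma lin_homI:
  assumes "\<And>x. x \<in> carrier M \<Longrightarrow> h x \<in> carrier N"
    and "\<And>x y. x \<in> carrier M \<Longrightarrow> y \<in> carrier M \<Longrightarrow> h (x \<oplus>\<^bsub>M\<^esub> y) = h x \<oplus>\<^bsub>N\<^esub> h y"
    and "\<And>c x. c \<in> carrier K \<Longrightarrow> x \<in> carrier M \<Longrightarrow> h (c \<odot>\<^bsub>M\<^esub> x) = c \<odot>\<^bsub>N\<^esub> h x"
  shows "h \<in> lin_hom K M N"
  using assms by (auto simp: lin_hom_def)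

lemma lin_hom_closed: "h \<in> lin_hom K M N \<Longrightarrow> x \<in> carrier M \<Longrightarrow> h x \<in> carrier N"
  by (auto simp: lin_hom_def)

lemma lin_hom_add_apply:
  "h \<in> lin_hom K M N \<Longrightarrow> x \<in> carrier M \<Longrightarrow> y \<in> carrier M \<Longrightarrow> h (x \<oplus>\<^bsub>M\<^esub> y) = h x \<oplus>\<^bsub>N\<^esub> h y"
  by (auto simp: lin_hom_def)

lemma lin_hom_smult_apply:
  "h \<in> lin_hom K M N \<Longrightarrow> c \<in> carrier K \<Longrightarrow> x \<in> carrier M \<Longrightarrow> h (c \<odot>\<^bsub>M\<^esub> x) = c \<odot>\<^bsub>N\<^esub> h x"
  by (auto simp: lin_hom_def)

lemma lin_hom_cong:
  assumes "h \<in> lin_hom K M N" "module K M" "\<And>x. x \<in> carrier M \<Longrightarrow> h x = g x"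
  shows "g \<in> lin_hom K M N"
proof -
  interpret M: module K M by fact
  show ?thesis
    using assms(1) by (intro lin_homI) (auto simp: assms(3)[symmetric] lin_hom_def)
qed

lemma lin_hom_compose:
  "h \<in> lin_hom K M N \<Longrightarrow> g \<in> lin_hom K N P \<Longrightarrow> (\<lambda>x. g (h x)) \<in> lin_hom K M P"
  by (rule lin_homI) (auto simp: lin_hom_closed lin_hom_add_apply lin_hom_smult_apply)

lemma lin_hom_zero_map:
  assumes "module K N"
  shows "(\<lambda>x. \<zero>\<^bsub>N\<^esub>) \<in> lin_hom K M N"
proof -
  interpret N: module K N by fact
  show ?thesis by (rule lin_homI) auto
qed

lemma lin_hom_add:
  assumes "module K N" "h \<in> lin_hom K M N" "g \<in> lin_hom K M N"
  shows "(\<lambda>x. h x \<oplus>\<^bsub>N\<^esub> g x) \<in> lin_hom K M N"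
proof -
  interpret N: module K N by fact
  show ?thesis
    by (rule lin_homI) (use assms in \<open>auto simp: lin_hom_closed lin_hom_add_apply
      lin_hom_smult_apply N.a_ac N.smult_r_distr\<close>)
qed

lemma lin_hom_uminus:
  assumes "module K N" "h \<in> lin_hom K M N"
  shows "(\<lambda>x. \<ominus>\<^bsub>N\<^esub> h x) \<in> lin_hom K M N"
proof -
  interpret N: module K N by fact
  show ?thesis
    by (rule lin_homI) (use assms in \<open>auto simp: lin_hom_closed lin_hom_add_apply
      lin_hom_smult_apply N.minus_add N.smult_r_minus\<close>)
qed

lemma lin_hom_signed:
  assumes "module K N" "h \<in> lin_hom K M N"
  shows "(\<lambda>x. signed N e (h x)) \<in> lin_hom K M N"
  using assms by (cases "even e") (auto simp: signed_def lin_hom_uminus)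

lemma lin_hom_finsum:
  assumes "module K M" "module K N" "\<And>i. i \<in> I \<Longrightarrow> h i \<in> lin_hom K M N"
  shows "(\<lambda>x. \<Oplus>\<^bsub>N\<^esub>i\<in>I. h i x) \<in> lin_hom K M N"
proof -
  interpret N: module K N by fact
  show ?thesis
    using assms(3)
  proof (induction I rule: infinite_finite_induct)
    case (insert i F)
    have "(\<lambda>x. h i x \<oplus>\<^bsub>N\<^esub> (\<Oplus>\<^bsub>N\<^esub>j\<in>F. h j x)) \<in> lin_hom K M N"
      using insert by (intro lin_hom_add assms(2)) auto
    then show ?case
    proof (rule lin_hom_cong)
      fix x assume "x \<in> carrier M"
      then show "h i x \<oplus>\<^bsub>N\<^esub> (\<Oplus>\<^bsub>N\<^esub>j\<in>F. h j x) = (\<Oplus>\<^bsub>N\<^esub>j\<in>insert i F. h j x)"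
        using insert by (intro N.finsum_insert[symmetric]) (auto intro: lin_hom_closed)
    qed (rule assms)
  qed (auto simp: lin_hom_zero_map assms)
qed

lemma lin_hom_zero:
  assumes "module K M" "module K N" "h \<in> lin_hom K M N"
  shows "h \<zero>\<^bsub>M\<^esub> = \<zero>\<^bsub>N\<^esub>"
proof -
  interpret M: module K M by fact
  interpret N: module K N by fact
  have "h (\<zero>\<^bsub>K\<^esub> \<odot>\<^bsub>M\<^esub> \<zero>\<^bsub>M\<^esub>) = \<zero>\<^bsub>K\<^esub> \<odot>\<^bsub>N\<^esub> h \<zero>\<^bsub>M\<^esub>"
    using assms by (intro lin_hom_smult_apply) auto
  then show ?thesis using assms by (simp add: lin_hom_closed)
qed

lemma lin_hom_a_inv:
  assumes "module K M" "module K N" "h \<in> lin_hom K M N" "x \<in> carrier M"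
  shows "h (\<ominus>\<^bsub>M\<^esub> x) = \<ominus>\<^bsub>N\<^esub> h x"
proof -
  interpret M: module K M by fact
  interpret N: module K N by fact
  have "h (\<ominus>\<^bsub>M\<^esub> x) \<oplus>\<^bsub>N\<^esub> h x = h \<zero>\<^bsub>M\<^esub>"
    using assms lin_hom_add_apply[OF assms(3), of "\<ominus>\<^bsub>M\<^esub> x" x] by (simp add: M.l_neg)
  then show ?thesis
    using assms by (intro N.minus_equality[symmetric]) (auto simp: lin_hom_zero lin_hom_closed)
qed

lemma lin_hom_signed_apply:
  assumes "module K M" "module K N" "h \<in> lin_hom K M N" "x \<in> carrier M"
  shows "h (signed M e x) = signed N e (h x)"
  using assms by (simp add: signed_def lin_hom_a_inv)

lemma lin_hom_finsum_apply:
  assumes "module K M" "module K N" "h \<in> lin_hom K M N" "\<And>i. i \<in> I \<Longrightarrow> g i \<in> carrier M"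
  shows "h (\<Oplus>\<^bsub>M\<^esub>i\<in>I. g i) = (\<Oplus>\<^bsub>N\<^esub>i\<in>I. h (g i))"
proof -
  interpret M: module K M by fact
  interpret N: module K N by fact
  show ?thesis
    using assms(4)
  proof (induction I rule: infinite_finite_induct)
    case (insert i F)
    have "h (\<Oplus>\<^bsub>M\<^esub>i\<in>insert i F. g i) = h (g i \<oplus>\<^bsub>M\<^esub> (\<Oplus>\<^bsub>M\<^esub>i\<in>F. g i))"
      using insert by (subst M.finsum_insert) auto
    also have "\<dots> = h (g i) \<oplus>\<^bsub>N\<^esub> h (\<Oplus>\<^bsub>M\<^esub>i\<in>F. g i)"
      using insert by (intro lin_hom_add_apply[OF assms(3)]) (auto intro!: M.finsum_closed)
    also have "\<dots> = (\<Oplus>\<^bsub>N\<^esub>i\<in>insert i F. h (g i))"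
      using insert assms(3) by (subst N.finsum_insert) (auto intro: lin_hom_closed)
    finally show ?case .
  qed (auto simp: lin_hom_zero[OF assms(1-3)])
qed

section \<open>Elements up to sign\<close>

lemma signed_closed: "module K M \<Longrightarrow> x \<in> carrier M \<Longrightarrow> signed M e x \<in> carrier M"
  by (auto simp: signed_def module_def abelian_group.a_inv_closed)

lemma signed_signed:
  assumes "module K M" "x \<in> carrier M"
  shows "signed M e (signed M e' x) = signed M (e + e') x"
proof -
  interpret M: module K M by fact
  show ?thesis using assms by (auto simp: signed_def)
qed

text \<open>Only the parity of an exponent matters, so every comparison of signs below reduces to
  the evenness of a difference of integers.\<close>

lemma signed_cong: "even (e - e') \<Longrightarrow> signed M e x = signed M e' x"
  by (auto simp: signed_def)

lemma signed_zero:
  assumes "module K M"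
  shows "signed M e \<zero>\<^bsub>M\<^esub> = \<zero>\<^bsub>M\<^esub>"
proof -
  interpret M: module K M by fact
  show ?thesis by (auto simp: signed_def)
qed

lemma signed_finsum:
  assumes "module K M" "\<And>i. i \<in> I \<Longrightarrow> g i \<in> carrier M"
  shows "signed M e (\<Oplus>\<^bsub>M\<^esub>i\<in>I. g i) = (\<Oplus>\<^bsub>M\<^esub>i\<in>I. signed M e (g i))"
proof -
  interpret M: module K M by fact
  show ?thesis using assms(2) by (auto simp: signed_def M.finsum_uminus)
qed

lemma signed_Suc:
  assumes "module K M" "x \<in> carrier M"
  shows "signed M (e + 1) x = \<ominus>\<^bsub>M\<^esub> signed M e x"
proof -
  interpret M: module K M by fact
  show ?thesis using assms by (auto simp: signed_def)
qed


section \<open>Free modules and quotients\<close>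

locale ground_ring = cring K for K :: "'k ring" (structure)
begin

lemma free_module_simps [simp]:
  "\<zero>\<^bsub>free_module K W\<^esub> = (\<lambda>w. \<zero>)"
  "p \<oplus>\<^bsub>free_module K W\<^esub> r = (\<lambda>w. p w \<oplus> r w)"
  "c \<odot>\<^bsub>free_module K W\<^esub> p = (\<lambda>w. c \<otimes> p w)"
  by (simp_all add: free_module_def)

lemma free_module_carrier:
  "p \<in> carrier (free_module K W) \<longleftrightarrow>
    (\<forall>w. p w \<in> carrier K) \<and> (\<forall>w. w \<notin> W \<longrightarrow> p w = \<zero>) \<and> finite {w. p w \<noteq> \<zero>}"
  by (auto simp: free_module_def)

lemma free_module_module: "module K (free_module K W)"
proof (rule moduleI)
  have add: "p \<oplus>\<^bsub>free_module K W\<^esub> r \<in> carrier (free_module K W)"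
    if "p \<in> carrier (free_module K W)" "r \<in> carrier (free_module K W)" for p r
  proof -
    have "{w. p w \<oplus> r w \<noteq> \<zero>} \<subseteq> {w. p w \<noteq> \<zero>} \<union> {w. r w \<noteq> \<zero>}" by auto
    then have "finite {w. p w \<oplus> r w \<noteq> \<zero>}"
      using that by (auto simp: free_module_carrier intro: finite_subset)
    then show ?thesis using that by (simp add: free_module_carrier)
  qed
  have smult: "c \<odot>\<^bsub>free_module K W\<^esub> p \<in> carrier (free_module K W)"
    if "p \<in> carrier (free_module K W)" "c \<in> carrier K" for p c
  proof -
    have "{w. c \<otimes> p w \<noteq> \<zero>} \<subseteq> {w. p w \<noteq> \<zero>}" using that by auto
    then have "finite {w. c \<otimes> p w \<noteq> \<zero>}"
      using that by (auto simp: free_module_carrier intro: finite_subset)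
    then show ?thesis using that by (simp add: free_module_carrier)
  qed
  show "abelian_group (free_module K W)"
  proof (rule abelian_groupI)
    fix x assume x: "x \<in> carrier (free_module K W)"
    have "\<ominus> \<one> \<odot>\<^bsub>free_module K W\<^esub> x \<in> carrier (free_module K W)"
      using x by (intro smult) auto
    moreover have "\<ominus> \<one> \<odot>\<^bsub>free_module K W\<^esub> x \<oplus>\<^bsub>free_module K W\<^esub> x = \<zero>\<^bsub>free_module K W\<^esub>"
      using x by (auto simp: free_module_carrier l_minus l_neg)
    ultimately show "\<exists>y\<in>carrier (free_module K W). y \<oplus>\<^bsub>free_module K W\<^esub> x = \<zero>\<^bsub>free_module K W\<^esub>"
      by blast
  next
    fix x y z assume "x \<in> carrier (free_module K W)" "y \<in> carrier (free_module K W)"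
      "z \<in> carrier (free_module K W)"
    then show "x \<oplus>\<^bsub>free_module K W\<^esub> y \<oplus>\<^bsub>free_module K W\<^esub> z =
        x \<oplus>\<^bsub>free_module K W\<^esub> (y \<oplus>\<^bsub>free_module K W\<^esub> z)"
      by (intro ext) (simp add: free_module_carrier a_assoc)
  next
    fix x y assume "x \<in> carrier (free_module K W)" "y \<in> carrier (free_module K W)"
    then show "x \<oplus>\<^bsub>free_module K W\<^esub> y = y \<oplus>\<^bsub>free_module K W\<^esub> x"
      by (intro ext) (simp add: free_module_carrier a_comm)
  qed (use add in \<open>auto simp: free_module_carrier\<close>)
  show "c \<odot>\<^bsub>free_module K W\<^esub> p \<in> carrier (free_module K W)"
    if "c \<in> carrier K" "p \<in> carrier (free_module K W)" for p c
    using smult that by blast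
qed (auto simp: free_module_carrier l_distr r_distr m_assoc is_cring)

lemma free_gen_carrier: "w \<in> W \<Longrightarrow> free_gen K w \<in> carrier (free_module K W)"
  by (auto simp: free_module_carrier free_gen_def)

text \<open>The sum that \<open>lin_ext\<close> evaluates on a representative of a coset. Kept
  separate so that independence of the representative becomes the vanishing of this map on the
  relations.\<close>

definition free_ext :: "('k, 'b) module \<Rightarrow> ('w \<Rightarrow> 'b) \<Rightarrow> ('w \<Rightarrow> 'k) \<Rightarrow> 'b" where
  "free_ext M \<phi> p = (\<Oplus>\<^bsub>M\<^esub>w\<in>{w. p w \<noteq> \<zero>}. p w \<odot>\<^bsub>M\<^esub> \<phi> w)"

text \<open>The support of a sum or of a multiple may be smaller than expected; evaluating over a
  common finite superset makes additivity and homogeneity termwise.\<close>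

lemma free_ext_superset:
  assumes "module K M" "\<And>w. w \<in> W \<Longrightarrow> \<phi> w \<in> carrier M" "p \<in> carrier (free_module K W)"
    and "finite F" "{w. p w \<noteq> \<zero>} \<subseteq> F" "F \<subseteq> W"
  shows "free_ext M \<phi> p = (\<Oplus>\<^bsub>M\<^esub>w\<in>F. p w \<odot>\<^bsub>M\<^esub> \<phi> w)"
proof -
  interpret M: module K M by fact
  show ?thesis
    unfolding free_ext_def
    by (rule M.finsum_subset[symmetric])
      (use assms in \<open>auto simp: free_module_carrier subset_eq\<close>)
qed

lemma free_ext_lin_hom:
  assumes "module K M" "\<And>w. w \<in> W \<Longrightarrow> \<phi> w \<in> carrier M"
  shows "free_ext M \<phi> \<in> lin_hom K (free_module K W) M"
proof (rule lin_homI)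
  interpret M: module K M by fact
  interpret F: module K "free_module K W" by (rule free_module_module)
  have supp: "finite {w. p w \<noteq> \<zero>} \<and> {w. p w \<noteq> \<zero>} \<subseteq> W" if "p \<in> carrier (free_module K W)" for p
    using that by (auto simp: free_module_carrier)
  have cl: "p w \<odot>\<^bsub>M\<^esub> \<phi> w \<in> carrier M" if "p \<in> carrier (free_module K W)" "w \<in> W" for p w
    using that assms by (auto simp: free_module_carrier)
  show "free_ext M \<phi> p \<in> carrier M" if "p \<in> carrier (free_module K W)" for p
    unfolding free_ext_def using supp[OF that] cl[OF that] by (intro M.finsum_closed) auto
  show "free_ext M \<phi> (p \<oplus>\<^bsub>free_module K W\<^esub> r) = free_ext M \<phi> p \<oplus>\<^bsub>M\<^esub> free_ext M \<phi> r"
    if p: "p \<in> carrier (free_module K W)" and r: "r \<in> carrier (free_module K W)" for p r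
  proof -
    let ?F = "{w. p w \<noteq> \<zero>} \<union> {w. r w \<noteq> \<zero>}"
    have F: "finite ?F" "?F \<subseteq> W" using supp p r by auto
    have sub: "{w. (p \<oplus>\<^bsub>free_module K W\<^esub> r) w \<noteq> \<zero>} \<subseteq> ?F" by auto
    have "free_ext M \<phi> (p \<oplus>\<^bsub>free_module K W\<^esub> r) =
        (\<Oplus>\<^bsub>M\<^esub>w\<in>?F. (p \<oplus>\<^bsub>free_module K W\<^esub> r) w \<odot>\<^bsub>M\<^esub> \<phi> w)"
      by (rule free_ext_superset[OF assms F.a_closed[OF p r] F(1) sub F(2)])
    also have "\<dots> = (\<Oplus>\<^bsub>M\<^esub>w\<in>?F. (p w \<odot>\<^bsub>M\<^esub> \<phi> w) \<oplus>\<^bsub>M\<^esub> (r w \<odot>\<^bsub>M\<^esub> \<phi> w))"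
    proof (rule M.finsum_eq_cong)
      fix w assume "w \<in> ?F"
      then have w: "w \<in> W" using F by blast
      then show "(p w \<odot>\<^bsub>M\<^esub> \<phi> w) \<oplus>\<^bsub>M\<^esub> (r w \<odot>\<^bsub>M\<^esub> \<phi> w) \<in> carrier M"
        using cl p r by blast
      show "(p \<oplus>\<^bsub>free_module K W\<^esub> r) w \<odot>\<^bsub>M\<^esub> \<phi> w =
          (p w \<odot>\<^bsub>M\<^esub> \<phi> w) \<oplus>\<^bsub>M\<^esub> (r w \<odot>\<^bsub>M\<^esub> \<phi> w)"
        using w p r assms(2) by (simp add: free_module_carrier M.smult_l_distr)
    qed simp
    also have "\<dots> = (\<Oplus>\<^bsub>M\<^esub>w\<in>?F. p w \<odot>\<^bsub>M\<^esub> \<phi> w) \<oplus>\<^bsub>M\<^esub> (\<Oplus>\<^bsub>M\<^esub>w\<in>?F. r w \<odot>\<^bsub>M\<^esub> \<phi> w)"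
      using F cl p r by (intro M.finsum_addf) auto
    also have "\<dots> = free_ext M \<phi> p \<oplus>\<^bsub>M\<^esub> free_ext M \<phi> r"
      using free_ext_superset[OF assms p F(1) Un_upper1 F(2)]
        free_ext_superset[OF assms r F(1) Un_upper2 F(2)] by simp
    finally show ?thesis .
  qed
  show "free_ext M \<phi> (c \<odot>\<^bsub>free_module K W\<^esub> p) = c \<odot>\<^bsub>M\<^esub> free_ext M \<phi> p"
    if c: "c \<in> carrier K" and p: "p \<in> carrier (free_module K W)" for c p
  proof -
    let ?F = "{w. p w \<noteq> \<zero>}"
    have F: "finite ?F" "?F \<subseteq> W" using supp p by auto
    have sub: "{w. (c \<odot>\<^bsub>free_module K W\<^esub> p) w \<noteq> \<zero>} \<subseteq> ?F" using c by auto
    have "free_ext M \<phi> (c \<odot>\<^bsub>free_module K W\<^esub> p) =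
        (\<Oplus>\<^bsub>M\<^esub>w\<in>?F. (c \<odot>\<^bsub>free_module K W\<^esub> p) w \<odot>\<^bsub>M\<^esub> \<phi> w)"
      by (rule free_ext_superset[OF assms F.smult_closed[OF c p] F(1) sub F(2)])
    also have "\<dots> = (\<Oplus>\<^bsub>M\<^esub>w\<in>?F. c \<odot>\<^bsub>M\<^esub> (p w \<odot>\<^bsub>M\<^esub> \<phi> w))"
    proof (rule M.finsum_eq_cong)
      fix w assume "w \<in> ?F"
      then have w: "w \<in> W" using F by blast
      then show "c \<odot>\<^bsub>M\<^esub> (p w \<odot>\<^bsub>M\<^esub> \<phi> w) \<in> carrier M"
        using cl p c by blast
      show "(c \<odot>\<^bsub>free_module K W\<^esub> p) w \<odot>\<^bsub>M\<^esub> \<phi> w = c \<odot>\<^bsub>M\<^esub> (p w \<odot>\<^bsub>M\<^esub> \<phi> w)"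
        using w p c assms(2) by (simp add: free_module_carrier M.smult_assoc1)
    qed simp
    also have "\<dots> = c \<odot>\<^bsub>M\<^esub> free_ext M \<phi> p"
      unfolding free_ext_def using F cl p c by (intro M.finsum_smult_ldistr[symmetric]) auto
    finally show ?thesis .
  qed
qed

lemma free_ext_gen:
  assumes "module K M" "\<phi> w \<in> carrier M"
  shows "free_ext M \<phi> (free_gen K w) = \<phi> w"
proof -
  interpret M: module K M by fact
  have "free_ext M \<phi> (free_gen K w) = (\<Oplus>\<^bsub>M\<^esub>v\<in>{w}. free_gen K w v \<odot>\<^bsub>M\<^esub> \<phi> v)"
    by (rule free_ext_superset[where W = "{w}"])
      (use assms in \<open>auto simp: free_gen_def free_module_carrier\<close>)
  also have "\<dots> = \<phi> w" using assms by (simp add: free_gen_def)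
  finally show ?thesis .
qed

text \<open>Induction on the support: \<open>p\<close> is its coefficient at \<open>w\<close> times
  the generator of \<open>w\<close>, plus the function with that coefficient erased.\<close>

lemma free_module_ext:
  assumes "module K M" and g: "g \<in> lin_hom K (free_module K W) M"
    and h: "h \<in> lin_hom K (free_module K W) M"
    and eq: "\<And>w. w \<in> W \<Longrightarrow> g (free_gen K w) = h (free_gen K w)"
    and p: "p \<in> carrier (free_module K W)"
  shows "g p = h p"
proof -
  interpret M: module K M by fact
  interpret F: module K "free_module K W" by (rule free_module_module)
  have "finite {w. p w \<noteq> \<zero>}" using p by (simp add: free_module_carrier)
  then show ?thesis
    using p
  proof (induction "{w. p w \<noteq> \<zero>}" arbitrary: p rule: finite_induct)
    case empty
    then have "p = \<zero>\<^bsub>free_module K W\<^esub>" by auto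
    then show ?case
      using lin_hom_zero[OF free_module_module assms(1) g] lin_hom_zero[OF free_module_module assms(1) h]
      by simp
  next
    case (insert w S)
    then have w: "w \<in> W" and pw: "p w \<in> carrier K" by (auto simp: free_module_carrier)
    let ?r = "p(w := \<zero>)"
    have S: "S = {v. ?r v \<noteq> \<zero>}" using insert(2,4) by auto
    have r: "?r \<in> carrier (free_module K W)"
      using insert(1,5) S by (auto simp: free_module_carrier)
    have p: "p = (p w \<odot>\<^bsub>free_module K W\<^esub> free_gen K w) \<oplus>\<^bsub>free_module K W\<^esub> ?r"
      using insert(5) by (auto simp: free_gen_def free_module_carrier)
    have G: "free_gen K w \<in> carrier (free_module K W)" using w by (rule free_gen_carrier)
    have "k p = p w \<odot>\<^bsub>M\<^esub> k (free_gen K w) \<oplus>\<^bsub>M\<^esub> k ?r"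
      if k: "k \<in> lin_hom K (free_module K W) M" for k
      using lin_hom_add_apply[OF k F.smult_closed[OF pw G] r] lin_hom_smult_apply[OF k pw G]
        p by metis
    then show ?case using g h insert(3)[OF S r] eq[OF w] by metis
  qed
qed

end

section \<open>Submodules, quotients and generated submodules\<close>

lemma submodule_abelian_subgroup:
  assumes "module K M" "submodule N K M"
  shows "abelian_subgroup N M"
proof -
  interpret M: module K M by fact
  show ?thesis
    using assms(2) by (intro abelian_subgroupI3 additive_subgroup.intro)
      (auto simp: submodule_def M.abelian_group_axioms)
qed

text \<open>The scalar multiple of a coset is defined as a union over its members. It is a single
  coset because \<open>N\<close> is closed under scalars, so that all members contribute the same
  one.\<close>

lemma quotient_module_hom:
  assumes "module K M" "submodule N K M"
  shows "module K (quotient_module M N)"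
    and "(\<lambda>x. N +>\<^bsub>M\<^esub> x) \<in> lin_hom K M (quotient_module M N)"
proof -
  interpret M: module K M by fact
  interpret S: abelian_subgroup N M using submodule_abelian_subgroup assms .
  let ?Q = "quotient_module M N"
  have NM: "N \<subseteq> carrier M" by (rule S.a_subset)
  have carr: "carrier ?Q = (\<lambda>x. N +>\<^bsub>M\<^esub> x) ` carrier M"
    by (auto simp: quotient_module_def A_RCOSETS_def')
  have cl: "N +>\<^bsub>M\<^esub> x \<in> carrier ?Q" if "x \<in> carrier M" for x
    using that carr by auto
  have zero: "\<zero>\<^bsub>?Q\<^esub> = N +>\<^bsub>M\<^esub> \<zero>\<^bsub>M\<^esub>"
    using NM by (simp add: quotient_module_def)
  have add: "(N +>\<^bsub>M\<^esub> x) \<oplus>\<^bsub>?Q\<^esub> (N +>\<^bsub>M\<^esub> y) = N +>\<^bsub>M\<^esub> (x \<oplus>\<^bsub>M\<^esub> y)"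
    if "x \<in> carrier M" "y \<in> carrier M" for x y
    using that by (simp add: quotient_module_def S.a_rcos_sum)
  have smult: "c \<odot>\<^bsub>?Q\<^esub> (N +>\<^bsub>M\<^esub> x) = N +>\<^bsub>M\<^esub> (c \<odot>\<^bsub>M\<^esub> x)"
    if c: "c \<in> carrier K" and x: "x \<in> carrier M" for c x
  proof -
    have "N +>\<^bsub>M\<^esub> (c \<odot>\<^bsub>M\<^esub> y) = N +>\<^bsub>M\<^esub> (c \<odot>\<^bsub>M\<^esub> x)" if y: "y \<in> N +>\<^bsub>M\<^esub> x" for y
    proof -
      obtain z where z: "z \<in> N" "y = z \<oplus>\<^bsub>M\<^esub> x"
        using y by (auto simp: a_r_coset_def')
      have "c \<odot>\<^bsub>M\<^esub> y = c \<odot>\<^bsub>M\<^esub> z \<oplus>\<^bsub>M\<^esub> c \<odot>\<^bsub>M\<^esub> x"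
        using z x c NM by (auto simp: M.smult_r_distr)
      moreover have "c \<odot>\<^bsub>M\<^esub> z \<in> N" using assms(2) c z by (simp add: submodule.smult_closed)
      ultimately have "c \<odot>\<^bsub>M\<^esub> y \<in> N +>\<^bsub>M\<^esub> (c \<odot>\<^bsub>M\<^esub> x)" by (auto simp: a_r_coset_def')
      then show ?thesis
        using S.a_repr_independence'[of "c \<odot>\<^bsub>M\<^esub> y" "c \<odot>\<^bsub>M\<^esub> x"] c x by auto
    qed
    moreover have "x \<in> N +>\<^bsub>M\<^esub> x" using x by (rule S.a_rcos_self)
    ultimately have "(\<Union>y\<in>N +>\<^bsub>M\<^esub> x. N +>\<^bsub>M\<^esub> (c \<odot>\<^bsub>M\<^esub> y)) = N +>\<^bsub>M\<^esub> (c \<odot>\<^bsub>M\<^esub> x)"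
      by blast
    then show ?thesis by (simp add: quotient_module_def)
  qed
  show hom: "(\<lambda>x. N +>\<^bsub>M\<^esub> x) \<in> lin_hom K M ?Q"
    by (rule lin_homI) (auto simp: cl add smult)
  show "module K ?Q"
  proof (rule moduleI)
    show "cring K" by (rule M.is_cring)
    show "abelian_group ?Q"
    proof (rule abelian_groupI)
      fix X assume "X \<in> carrier ?Q"
      then obtain x where x: "x \<in> carrier M" "X = N +>\<^bsub>M\<^esub> x" using carr by auto
      then have "(N +>\<^bsub>M\<^esub> (\<ominus>\<^bsub>M\<^esub> x)) \<oplus>\<^bsub>?Q\<^esub> X = \<zero>\<^bsub>?Q\<^esub>"
        by (simp add: add zero M.l_neg)
      then show "\<exists>Y\<in>carrier ?Q. Y \<oplus>\<^bsub>?Q\<^esub> X = \<zero>\<^bsub>?Q\<^esub>" using x cl M.a_inv_closed by blast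
    qed (auto simp: carr add zero M.a_ac simp del: M.a_coset_add_zero)
  qed (auto simp: carr add smult M.smult_l_distr M.smult_r_distr M.smult_assoc1)
qed

lemma submodule_span_submodule:
  assumes "module K M" "S \<subseteq> carrier M"
  shows "submodule (submodule_span K M S) K M" "S \<subseteq> submodule_span K M S"
proof -
  interpret M: module K M by fact
  show "S \<subseteq> submodule_span K M S" by (auto simp: submodule_span_def)
  \<comment> \<open>The carrier belongs to the family of submodules containing \<open>S\<close>, so
    the intersection lies inside it.\<close>
  have C: "submodule (carrier M) K M" by (rule M.submoduleI) auto
  note E = M.submoduleE
  have "\<zero>\<^bsub>M\<^esub> \<in> N" if "submodule N K M" for N
    using subgroup.one_closed[OF submodule.axioms(1)[OF that]] by simp
  then show "submodule (submodule_span K M S) K M"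
    unfolding submodule_span_def
    by (intro M.submoduleI) (use C assms(2) in \<open>auto simp: E(3-5)\<close>)
qed

lemma submodule_span_least:
  "submodule N K M \<Longrightarrow> S \<subseteq> N \<Longrightarrow> submodule_span K M S \<subseteq> N"
  by (auto simp: submodule_span_def)

lemma lin_hom_kernel_submodule:
  assumes "module K M" "module K N" "h \<in> lin_hom K M N"
  shows "submodule {x \<in> carrier M. h x = \<zero>\<^bsub>N\<^esub>} K M"
proof -
  interpret M: module K M by fact
  interpret N: module K N by fact
  show ?thesis
    by (rule M.submoduleI) (use assms in \<open>auto simp: lin_hom_zero lin_hom_a_inv lin_hom_add_apply
      lin_hom_smult_apply\<close>)
qed

section \<open>Tensor powers\<close>

definition wf_word :: "(int \<Rightarrow> ('k, 'a) module) \<Rightarrow> 'a word \<Rightarrow> bool" where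
  "wf_word A w \<longleftrightarrow> (\<forall>(p, a)\<in>set w. a \<in> carrier (A p))"

lemma wf_word_simps [simp]:
  "wf_word A []"
  "wf_word A ((p, a) # w) \<longleftrightarrow> a \<in> carrier (A p) \<and> wf_word A w"
  "wf_word A (u @ v) \<longleftrightarrow> wf_word A u \<and> wf_word A v"
  by (auto simp: wf_word_def)

lemma wf_word_take [simp]: "wf_word A w \<Longrightarrow> wf_word A (take n w)"
  by (auto simp: wf_word_def dest: in_set_takeD)

lemma wf_word_drop [simp]: "wf_word A w \<Longrightarrow> wf_word A (drop n w)"
  by (auto simp: wf_word_def dest: in_set_dropD)

lemma wdeg_simps [simp]:
  "wdeg [] = 0" "wdeg (x # w) = fst x + wdeg w" "wdeg (u @ v) = wdeg u + wdeg v"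
  by (auto simp: wdeg_def)

lemma words_iff: "w \<in> words A n q \<longleftrightarrow> length w = n \<and> wf_word A w \<and> wdeg w = q"
  by (auto simp: words_def wf_word_def)

text \<open>Linearity in a slot is required for every choice of degrees with the given total,
  matching the relations, which never change degrees. The first clause covers the empty word, which
  has no slot.\<close>

definition multilinear ::
    "'k ring \<Rightarrow> (int \<Rightarrow> ('k, 'a) module) \<Rightarrow> nat \<Rightarrow> int \<Rightarrow> ('k, 'b) module
      \<Rightarrow> ('a word \<Rightarrow> 'b) \<Rightarrow> bool" where
  "multilinear K A n q M \<phi> \<longleftrightarrow>
     (\<forall>w\<in>words A n q. \<phi> w \<in> carrier M) \<and>
     (\<forall>u p v. length u + length v + 1 = n \<and> wf_word A u \<and> wf_word A v \<and> wdeg u + p + wdeg v = q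
        \<longrightarrow> (\<lambda>a. \<phi> (u @ (p, a) # v)) \<in> lin_hom K (A p) M)"

lemma multilinear_closed: "multilinear K A n q M \<phi> \<Longrightarrow> w \<in> words A n q \<Longrightarrow> \<phi> w \<in> carrier M"
  by (auto simp: multilinear_def)

lemma multilinear_slot:
  "multilinear K A n q M \<phi> \<Longrightarrow> length u + length v + 1 = n \<Longrightarrow> wf_word A u \<Longrightarrow> wf_word A v
    \<Longrightarrow> wdeg u + p + wdeg v = q \<Longrightarrow> (\<lambda>a. \<phi> (u @ (p, a) # v)) \<in> lin_hom K (A p) M"
  by (auto simp: multilinear_def)

locale graded_module = ground_ring K
  for K :: "'k ring" (structure) and A :: "int \<Rightarrow> ('k, 'a) module" +
  assumes module_graded: "module K (A q)"
begin

abbreviation F where "F n q \<equiv> free_module K (words A n q)"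
abbreviation N where "N n q \<equiv> tensor_relations K A n q"
abbreviation T where "T n q \<equiv> tensor_power K A n q"

lemma slot_words:
  assumes "u @ (p, a) # v \<in> words A n q"
  shows "b \<in> carrier (A p) \<Longrightarrow> u @ (p, b) # v \<in> words A n q" "a \<in> carrier (A p)"
    "length u + length v + 1 = n" "wf_word A u" "wf_word A v" "wdeg u + p + wdeg v = q"
  using assms by (auto simp: words_iff)

text \<open>Packages the relations as two kinds of generators and a minimality property, so that the
  unwieldy generating set never has to be unfolded again.\<close>

lemma tensor_relations_submodule:
  "submodule (N n q) K (F n q)"
  "u @ (p, a) # v \<in> words A n q \<Longrightarrow> b \<in> carrier (A p) \<Longrightarrow>
     free_gen K (u @ (p, a \<oplus>\<^bsub>A p\<^esub> b) # v) \<ominus>\<^bsub>F n q\<^esub>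
       (free_gen K (u @ (p, a) # v) \<oplus>\<^bsub>F n q\<^esub> free_gen K (u @ (p, b) # v)) \<in> N n q"
  "u @ (p, a) # v \<in> words A n q \<Longrightarrow> c \<in> carrier K \<Longrightarrow>
     free_gen K (u @ (p, c \<odot>\<^bsub>A p\<^esub> a) # v) \<ominus>\<^bsub>F n q\<^esub>
       (c \<odot>\<^bsub>F n q\<^esub> free_gen K (u @ (p, a) # v)) \<in> N n q"
  "submodule H K (F n q) \<Longrightarrow>
    (\<And>u p a v b. u @ (p, a) # v \<in> words A n q \<Longrightarrow> b \<in> carrier (A p) \<Longrightarrow>
      free_gen K (u @ (p, a \<oplus>\<^bsub>A p\<^esub> b) # v) \<ominus>\<^bsub>F n q\<^esub>
       (free_gen K (u @ (p, a) # v) \<oplus>\<^bsub>F n q\<^esub> free_gen K (u @ (p, b) # v)) \<in> H) \<Longrightarrow>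
    (\<And>u p a v c. u @ (p, a) # v \<in> words A n q \<Longrightarrow> c \<in> carrier K \<Longrightarrow>
      free_gen K (u @ (p, c \<odot>\<^bsub>A p\<^esub> a) # v) \<ominus>\<^bsub>F n q\<^esub>
       (c \<odot>\<^bsub>F n q\<^esub> free_gen K (u @ (p, a) # v)) \<in> H) \<Longrightarrow> N n q \<subseteq> H"
proof -
  let ?S = "{free_gen K (u @ (p, a \<oplus>\<^bsub>A p\<^esub> b) # v) \<ominus>\<^bsub>F n q\<^esub>
         (free_gen K (u @ (p, a) # v) \<oplus>\<^bsub>F n q\<^esub> free_gen K (u @ (p, b) # v))
       | u v p a b. u @ (p, a) # v \<in> words A n q \<and> u @ (p, b) # v \<in> words A n q} \<union>
      {free_gen K (u @ (p, c \<odot>\<^bsub>A p\<^esub> a) # v) \<ominus>\<^bsub>F n q\<^esub>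
         (c \<odot>\<^bsub>F n q\<^esub> free_gen K (u @ (p, a) # v))
       | u v p a c. c \<in> carrier K \<and> u @ (p, a) # v \<in> words A n q}"
  interpret F: module K "F n q" by (rule free_module_module)
  have add: "u @ (p, a \<oplus>\<^bsub>A p\<^esub> b) # v \<in> words A n q"
    if "u @ (p, a) # v \<in> words A n q" "u @ (p, b) # v \<in> words A n q" for u p a b v
  proof -
    interpret Ap: module K "A p" by (rule module_graded)
    show ?thesis using that by (intro slot_words(1)[OF that(1)]) (auto dest: slot_words(2))
  qed
  have smult: "u @ (p, c \<odot>\<^bsub>A p\<^esub> a) # v \<in> words A n q"
    if "u @ (p, a) # v \<in> words A n q" "c \<in> carrier K" for u p a c v
  proof -
    interpret Ap: module K "A p" by (rule module_graded)
    show ?thesis using that by (intro slot_words(1)[OF that(1)]) (auto dest: slot_words(2))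
  qed
  have S: "?S \<subseteq> carrier (F n q)"
  proof
    fix x assume "x \<in> ?S"
    then consider u v p a b where "x = free_gen K (u @ (p, a \<oplus>\<^bsub>A p\<^esub> b) # v) \<ominus>\<^bsub>F n q\<^esub>
         (free_gen K (u @ (p, a) # v) \<oplus>\<^bsub>F n q\<^esub> free_gen K (u @ (p, b) # v))"
         "u @ (p, a) # v \<in> words A n q" "u @ (p, b) # v \<in> words A n q"
       | u v p a c where "x = free_gen K (u @ (p, c \<odot>\<^bsub>A p\<^esub> a) # v) \<ominus>\<^bsub>F n q\<^esub>
         (c \<odot>\<^bsub>F n q\<^esub> free_gen K (u @ (p, a) # v))" "c \<in> carrier K" "u @ (p, a) # v \<in> words A n q"
      by blast
    then show "x \<in> carrier (F n q)"
    proof cases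
      case 1
      then show ?thesis
        by (simp del: free_module_simps add: F.minus_closed F.a_closed free_gen_carrier add)
    next
      case 2
      then show ?thesis
        by (simp del: free_module_simps add: F.minus_closed F.smult_closed free_gen_carrier smult)
    qed
  qed
  note span = submodule_span_submodule[OF free_module_module S, folded tensor_relations_def]
  show "submodule (N n q) K (F n q)" by (rule span(1))
  show "free_gen K (u @ (p, a \<oplus>\<^bsub>A p\<^esub> b) # v) \<ominus>\<^bsub>F n q\<^esub>
       (free_gen K (u @ (p, a) # v) \<oplus>\<^bsub>F n q\<^esub> free_gen K (u @ (p, b) # v)) \<in> N n q"
    if "u @ (p, a) # v \<in> words A n q" "b \<in> carrier (A p)"
    using slot_words(1)[OF that] that(1) by (intro subsetD[OF span(2)]) blast
  show "free_gen K (u @ (p, c \<odot>\<^bsub>A p\<^esub> a) # v) \<ominus>\<^bsub>F n q\<^esub>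
       (c \<odot>\<^bsub>F n q\<^esub> free_gen K (u @ (p, a) # v)) \<in> N n q"
    if "u @ (p, a) # v \<in> words A n q" "c \<in> carrier K"
    using that by (intro subsetD[OF span(2)]) blast
  show "N n q \<subseteq> H" if H: "submodule H K (F n q)"
    and 1: "\<And>u p a v b. u @ (p, a) # v \<in> words A n q \<Longrightarrow> b \<in> carrier (A p) \<Longrightarrow>
      free_gen K (u @ (p, a \<oplus>\<^bsub>A p\<^esub> b) # v) \<ominus>\<^bsub>F n q\<^esub>
       (free_gen K (u @ (p, a) # v) \<oplus>\<^bsub>F n q\<^esub> free_gen K (u @ (p, b) # v)) \<in> H"
    and 2: "\<And>u p a v c. u @ (p, a) # v \<in> words A n q \<Longrightarrow> c \<in> carrier K \<Longrightarrow>
      free_gen K (u @ (p, c \<odot>\<^bsub>A p\<^esub> a) # v) \<ominus>\<^bsub>F n q\<^esub>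
       (c \<odot>\<^bsub>F n q\<^esub> free_gen K (u @ (p, a) # v)) \<in> H"
    unfolding tensor_relations_def
  proof (rule submodule_span_least[OF H], rule subsetI)
    fix x assume "x \<in> ?S"
    then consider u v p a b where "x = free_gen K (u @ (p, a \<oplus>\<^bsub>A p\<^esub> b) # v) \<ominus>\<^bsub>F n q\<^esub>
         (free_gen K (u @ (p, a) # v) \<oplus>\<^bsub>F n q\<^esub> free_gen K (u @ (p, b) # v))"
         "u @ (p, a) # v \<in> words A n q" "u @ (p, b) # v \<in> words A n q"
       | u v p a c where "x = free_gen K (u @ (p, c \<odot>\<^bsub>A p\<^esub> a) # v) \<ominus>\<^bsub>F n q\<^esub>
         (c \<odot>\<^bsub>F n q\<^esub> free_gen K (u @ (p, a) # v))" "c \<in> carrier K" "u @ (p, a) # v \<in> words A n q"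
      by blast
    then show "x \<in> H"
      by cases (use 1 2 slot_words(2) in blast)+
  qed
qed

lemma tensor_power_module: "module K (T n q)"
  unfolding tensor_power_def
  by (intro quotient_module_hom free_module_module tensor_relations_submodule)

lemma tensor_proj_hom: "(\<lambda>x. N n q +>\<^bsub>F n q\<^esub> x) \<in> lin_hom K (F n q) (T n q)"
  unfolding tensor_power_def
  by (intro quotient_module_hom free_module_module tensor_relations_submodule)

lemma tensor_proj_zero:
  assumes "x \<in> N n q"
  shows "N n q +>\<^bsub>F n q\<^esub> x = \<zero>\<^bsub>T n q\<^esub>"
proof -
  interpret S: abelian_subgroup "N n q" "F n q"
    by (rule submodule_abelian_subgroup[OF free_module_module tensor_relations_submodule(1)])
  show ?thesis using S.a_rcos_const[OF assms] by (simp add: tensor_power_def quotient_module_def)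
qed

lemma tensor_power_carrier: "carrier (T n q) = (\<lambda>x. N n q +>\<^bsub>F n q\<^esub> x) ` carrier (F n q)"
  by (auto simp: tensor_power_def quotient_module_def A_RCOSETS_def')

lemma pure_tensor_eq: "w \<in> words A n q \<Longrightarrow> pure_tensor K A w = N n q +>\<^bsub>F n q\<^esub> free_gen K w"
  by (auto simp: pure_tensor_def words_iff)

lemma tensor_proj_eq:
  assumes "x \<in> carrier (F n q)" "y \<in> carrier (F n q)" "x \<ominus>\<^bsub>F n q\<^esub> y \<in> N n q"
  shows "N n q +>\<^bsub>F n q\<^esub> x = N n q +>\<^bsub>F n q\<^esub> y"
proof -
  interpret F: module K "F n q" by (rule free_module_module)
  interpret T: module K "T n q" by (rule tensor_power_module)
  note P = tensor_proj_hom[of n q]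
  have "\<zero>\<^bsub>T n q\<^esub> = N n q +>\<^bsub>F n q\<^esub> (x \<oplus>\<^bsub>F n q\<^esub> (\<ominus>\<^bsub>F n q\<^esub> y))"
    using tensor_proj_zero[OF assms(3)] by (simp only: a_minus_def)
  also have "\<dots> = (N n q +>\<^bsub>F n q\<^esub> x) \<oplus>\<^bsub>T n q\<^esub> (N n q +>\<^bsub>F n q\<^esub> (\<ominus>\<^bsub>F n q\<^esub> y))"
    by (rule lin_hom_add_apply[OF P]) (use assms F.a_inv_closed in auto)
  also have "N n q +>\<^bsub>F n q\<^esub> (\<ominus>\<^bsub>F n q\<^esub> y) = \<ominus>\<^bsub>T n q\<^esub> (N n q +>\<^bsub>F n q\<^esub> y)"
    by (rule lin_hom_a_inv[OF free_module_module tensor_power_module P assms(2)])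
  finally show ?thesis
    using lin_hom_closed[OF P] assms by (metis T.minus_minus T.minus_equality T.a_inv_closed)
qed

text \<open>Each slot identity is one defining relation, read in the quotient.\<close>

lemma pure_tensor_multilinear: "multilinear K A n q (T n q) (pure_tensor K A)"
proof -
  interpret F: module K "F n q" by (rule free_module_module)
  note P = tensor_proj_hom[of n q]
  have cl: "pure_tensor K A w \<in> carrier (T n q)" if "w \<in> words A n q" for w
    using lin_hom_closed[OF P free_gen_carrier[OF that]] by (simp only: pure_tensor_eq[OF that])
  moreover have "(\<lambda>a. pure_tensor K A (u @ (p, a) # v)) \<in> lin_hom K (A p) (T n q)"
    if "length u + length v + 1 = n \<and> wf_word A u \<and> wf_word A v \<and> wdeg u + p + wdeg v = q" for u p v
  proof (rule lin_homI)
    interpret Ap: module K "A p" by (rule module_graded)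
    have W: "u @ (p, a) # v \<in> words A n q" if "a \<in> carrier (A p)" for a
      using that \<open>length u + length v + 1 = n \<and> _\<close> by (auto simp: words_iff)
    note G = free_gen_carrier[OF W]
    show "pure_tensor K A (u @ (p, a) # v) \<in> carrier (T n q)" if "a \<in> carrier (A p)" for a
      using W that cl by blast
    show "pure_tensor K A (u @ (p, a \<oplus>\<^bsub>A p\<^esub> b) # v) =
        pure_tensor K A (u @ (p, a) # v) \<oplus>\<^bsub>T n q\<^esub> pure_tensor K A (u @ (p, b) # v)"
      if a: "a \<in> carrier (A p)" and b: "b \<in> carrier (A p)" for a b
      using tensor_proj_eq[OF G[OF Ap.a_closed[OF a b]] F.a_closed[OF G[OF a] G[OF b]]
          tensor_relations_submodule(2)[OF W[OF a] b]]
      by (simp only: pure_tensor_eq[OF W[OF Ap.a_closed[OF a b]]] pure_tensor_eq[OF W[OF a]]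
          pure_tensor_eq[OF W[OF b]] lin_hom_add_apply[OF P G[OF a] G[OF b]])
    show "pure_tensor K A (u @ (p, c \<odot>\<^bsub>A p\<^esub> a) # v) = c \<odot>\<^bsub>T n q\<^esub> pure_tensor K A (u @ (p, a) # v)"
      if c: "c \<in> carrier K" and a: "a \<in> carrier (A p)" for c a
      using tensor_proj_eq[OF G[OF Ap.smult_closed[OF c a]] F.smult_closed[OF c G[OF a]]
          tensor_relations_submodule(3)[OF W[OF a] c]]
      by (simp only: pure_tensor_eq[OF W[OF Ap.smult_closed[OF c a]]] pure_tensor_eq[OF W[OF a]]
          lin_hom_smult_apply[OF P c G[OF a]])
  qed
  ultimately show ?thesis by (auto simp: multilinear_def)
qed

lemmas pure_tensor_closed = multilinear_closed[OF pure_tensor_multilinear]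

lemma tensor_power_ext:
  assumes M: "module K M" and g: "g \<in> lin_hom K (T n q) M" and h: "h \<in> lin_hom K (T n q) M"
    and eq: "\<And>w. w \<in> words A n q \<Longrightarrow> g (pure_tensor K A w) = h (pure_tensor K A w)"
    and x: "x \<in> carrier (T n q)"
  shows "g x = h x"
proof -
  note P = tensor_proj_hom[of n q]
  obtain p where p: "p \<in> carrier (F n q)" "x = N n q +>\<^bsub>F n q\<^esub> p"
    using x by (auto simp: tensor_power_carrier)
  show ?thesis
    unfolding p(2)
    by (rule free_module_ext[OF M lin_hom_compose[OF P g] lin_hom_compose[OF P h] _ p(1)])
      (use eq in \<open>auto simp: pure_tensor_eq\<close>)
qed

text \<open>The kernel is a submodule, and multilinearity puts both kinds of generators into it;
  minimality of the relations does the rest.\<close>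

lemma free_ext_relations:
  assumes M: "module K M" and \<phi>: "multilinear K A n q M \<phi>" and z: "z \<in> N n q"
  shows "free_ext M \<phi> z = \<zero>\<^bsub>M\<^esub>"
proof -
  interpret F: module K "F n q" by (rule free_module_module)
  interpret M: module K M by fact
  have E: "free_ext M \<phi> \<in> lin_hom K (F n q) M"
    by (rule free_ext_lin_hom[OF M]) (rule multilinear_closed[OF \<phi>])
  let ?H = "{x \<in> carrier (F n q). free_ext M \<phi> x = \<zero>\<^bsub>M\<^esub>}"
  have gen: "free_ext M \<phi> (free_gen K w) = \<phi> w" if "w \<in> words A n q" for w
    by (rule free_ext_gen[OF M]) (rule multilinear_closed[OF \<phi> that])
  have diff: "x \<ominus>\<^bsub>F n q\<^esub> y \<in> ?H"
    if "x \<in> carrier (F n q)" "y \<in> carrier (F n q)" "free_ext M \<phi> x = free_ext M \<phi> y" for x y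
  proof -
    have "free_ext M \<phi> (x \<oplus>\<^bsub>F n q\<^esub> (\<ominus>\<^bsub>F n q\<^esub> y)) = free_ext M \<phi> x \<oplus>\<^bsub>M\<^esub> (\<ominus>\<^bsub>M\<^esub> free_ext M \<phi> y)"
      by (simp only: lin_hom_add_apply[OF E that(1) F.a_inv_closed[OF that(2)]]
          lin_hom_a_inv[OF free_module_module M E that(2)])
    also have "\<dots> = \<zero>\<^bsub>M\<^esub>" unfolding that(3) by (rule M.r_neg[OF lin_hom_closed[OF E that(2)]])
    finally show ?thesis using F.minus_closed[OF that(1,2)] unfolding a_minus_def by blast
  qed
  have "N n q \<subseteq> ?H"
  proof (rule tensor_relations_submodule(4)[OF lin_hom_kernel_submodule[OF free_module_module M E]])
    fix u p a v b assume w: "u @ (p, a) # v \<in> words A n q" and b: "b \<in> carrier (A p)"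
    interpret Ap: module K "A p" by (rule module_graded)
    note W = slot_words(1)[OF w] and a = slot_words(2)[OF w]
    note ab = Ap.a_closed[OF a b]
    note L = multilinear_slot[OF \<phi> slot_words(3-6)[OF w]]
    note G = free_gen_carrier[OF W]
    show "free_gen K (u @ (p, a \<oplus>\<^bsub>A p\<^esub> b) # v) \<ominus>\<^bsub>F n q\<^esub>
       (free_gen K (u @ (p, a) # v) \<oplus>\<^bsub>F n q\<^esub> free_gen K (u @ (p, b) # v)) \<in> ?H"
    proof (rule diff)
      show "free_ext M \<phi> (free_gen K (u @ (p, a \<oplus>\<^bsub>A p\<^esub> b) # v)) =
        free_ext M \<phi> (free_gen K (u @ (p, a) # v) \<oplus>\<^bsub>F n q\<^esub> free_gen K (u @ (p, b) # v))"
        by (simp only: lin_hom_add_apply[OF E G[OF a] G[OF b]] gen[OF W[OF a]] gen[OF W[OF b]]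
            gen[OF W[OF ab]] lin_hom_add_apply[OF L a b])
    qed (intro G ab F.a_closed a b)+
  next
    fix u p a v c assume w: "u @ (p, a) # v \<in> words A n q" and c: "c \<in> carrier K"
    interpret Ap: module K "A p" by (rule module_graded)
    note W = slot_words(1)[OF w] and a = slot_words(2)[OF w]
    note ca = Ap.smult_closed[OF c a]
    note L = multilinear_slot[OF \<phi> slot_words(3-6)[OF w]]
    note G = free_gen_carrier[OF W]
    show "free_gen K (u @ (p, c \<odot>\<^bsub>A p\<^esub> a) # v) \<ominus>\<^bsub>F n q\<^esub>
       (c \<odot>\<^bsub>F n q\<^esub> free_gen K (u @ (p, a) # v)) \<in> ?H"
    proof (rule diff)
      show "free_ext M \<phi> (free_gen K (u @ (p, c \<odot>\<^bsub>A p\<^esub> a) # v)) =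
        free_ext M \<phi> (c \<odot>\<^bsub>F n q\<^esub> free_gen K (u @ (p, a) # v))"
        by (simp only: lin_hom_smult_apply[OF E c G[OF a]] gen[OF W[OF a]]
            gen[OF W[OF ca]] lin_hom_smult_apply[OF L c a])
    qed (intro G ca F.smult_closed a c)+
  qed
  then show ?thesis using z by auto
qed

lemma lin_ext_proj:
  assumes M: "module K M" and \<phi>: "multilinear K A n q M \<phi>" and p: "p \<in> carrier (F n q)"
  shows "lin_ext K M \<phi> (N n q +>\<^bsub>F n q\<^esub> p) = free_ext M \<phi> p"
proof -
  interpret M: module K M by fact
  interpret S: abelian_subgroup "N n q" "F n q"
    by (rule submodule_abelian_subgroup[OF free_module_module tensor_relations_submodule(1)])
  have E: "free_ext M \<phi> \<in> lin_hom K (F n q) M"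
    by (rule free_ext_lin_hom[OF M]) (rule multilinear_closed[OF \<phi>])
  let ?X = "N n q +>\<^bsub>F n q\<^esub> p"
  \<comment> \<open>\<open>lin_ext\<close> computes on this unknown representative. It differs from
    \<open>p\<close> by a relation, which \<open>free_ext\<close> kills.\<close>
  define r where "r = (SOME r. r \<in> ?X)"
  have "r \<in> ?X" unfolding r_def by (rule someI[of _ p]) (rule S.a_rcos_self[OF p])
  then obtain z where z: "z \<in> N n q" "r = z \<oplus>\<^bsub>F n q\<^esub> p"
    by (auto simp: a_r_coset_def' simp del: free_module_simps)
  have "free_ext M \<phi> r = free_ext M \<phi> z \<oplus>\<^bsub>M\<^esub> free_ext M \<phi> p"
    unfolding z(2) using S.a_subset z(1) p by (intro lin_hom_add_apply[OF E]) auto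
  also have "\<dots> = free_ext M \<phi> p"
    using free_ext_relations[OF M \<phi> z(1)] lin_hom_closed[OF E p] by simp
  finally show ?thesis by (simp add: lin_ext_def Let_def r_def free_ext_def)
qed

lemma lin_ext_hom:
  assumes M: "module K M" and \<phi>: "multilinear K A n q M \<phi>"
  shows "lin_ext K M \<phi> \<in> lin_hom K (T n q) M"
proof (rule lin_homI)
  interpret F: module K "F n q" by (rule free_module_module)
  have E: "free_ext M \<phi> \<in> lin_hom K (F n q) M"
    by (rule free_ext_lin_hom[OF M]) (rule multilinear_closed[OF \<phi>])
  note P = tensor_proj_hom[of n q] and L = lin_ext_proj[OF assms]
  show "lin_ext K M \<phi> x \<in> carrier M" if "x \<in> carrier (T n q)" for x
    using that lin_hom_closed[OF E] by (auto simp: tensor_power_carrier L)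
  show "lin_ext K M \<phi> (x \<oplus>\<^bsub>T n q\<^esub> y) = lin_ext K M \<phi> x \<oplus>\<^bsub>M\<^esub> lin_ext K M \<phi> y"
    if xy: "x \<in> carrier (T n q)" "y \<in> carrier (T n q)" for x y
  proof -
    obtain a b where ab: "a \<in> carrier (F n q)" "b \<in> carrier (F n q)"
      "x = N n q +>\<^bsub>F n q\<^esub> a" "y = N n q +>\<^bsub>F n q\<^esub> b"
      using xy by (auto simp: tensor_power_carrier)
    show ?thesis
      unfolding ab(3,4) lin_hom_add_apply[OF P ab(1,2), symmetric] L[OF ab(1)] L[OF ab(2)]
        L[OF F.a_closed[OF ab(1,2)]]
      by (rule lin_hom_add_apply[OF E ab(1,2)])
  qed
  show "lin_ext K M \<phi> (c \<odot>\<^bsub>T n q\<^esub> x) = c \<odot>\<^bsub>M\<^esub> lin_ext K M \<phi> x"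
    if c: "c \<in> carrier K" and x: "x \<in> carrier (T n q)" for c x
  proof -
    obtain a where a: "a \<in> carrier (F n q)" "x = N n q +>\<^bsub>F n q\<^esub> a"
      using x by (auto simp: tensor_power_carrier)
    show ?thesis
      unfolding a(2) lin_hom_smult_apply[OF P c a(1), symmetric] L[OF a(1)]
        L[OF F.smult_closed[OF c a(1)]]
      by (rule lin_hom_smult_apply[OF E c a(1)])
  qed
qed

lemma lin_ext_pure:
  assumes M: "module K M" and \<phi>: "multilinear K A n q M \<phi>" and w: "w \<in> words A n q"
  shows "lin_ext K M \<phi> (pure_tensor K A w) = \<phi> w"
  unfolding pure_tensor_eq[OF w] lin_ext_proj[OF M \<phi> free_gen_carrier[OF w]]
  by (rule free_ext_gen[OF M]) (rule multilinear_closed[OF \<phi> w])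

text \<open>Used to see that tensor powers vanish in negative degrees, where some letter must be
  zero.\<close>

lemma pure_slot_zero:
  assumes "length u + length v + 1 = n" "wf_word A u" "wf_word A v" "wdeg u + p + wdeg v = q"
  shows "pure_tensor K A (u @ (p, \<zero>\<^bsub>A p\<^esub>) # v) = \<zero>\<^bsub>T n q\<^esub>"
  by (rule lin_hom_zero[OF module_graded tensor_power_module
      multilinear_slot[OF pure_tensor_multilinear assms]])

end

section \<open>Tensor products of multilinear factors\<close>

definition arity :: "('a, 'b) factor list \<Rightarrow> nat" where
  "arity gs = sum_list (map fst gs)"

lemma arity_simps [simp]:
  "arity [] = 0" "arity (g # gs) = fst g + arity gs" "arity (gs @ hs) = arity gs + arity hs"
  by (auto simp: arity_def)

lemma factors_deg_simps [simp]:
  "factors_deg [] = 0" "factors_deg (g # gs) = fst (snd g) + factors_deg gs"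
  "factors_deg (gs @ hs) = factors_deg gs + factors_deg hs"
  by (auto simp: factors_deg_def split_def)

text \<open>All degrees \<open>q\<close> at once, because one and the same factor is applied to
  words of varying degree.\<close>

definition factor_ok ::
    "'k ring \<Rightarrow> (int \<Rightarrow> ('k, 'a) module) \<Rightarrow> (int \<Rightarrow> ('k, 'b) module) \<Rightarrow> ('a, 'b) factor \<Rightarrow> bool" where
  "factor_ok K A B g \<longleftrightarrow>
     (\<forall>q. multilinear K A (fst g) q (B (q + fst (snd g))) (snd (snd g)))"

lemma apply_factors_append:
  "length u = arity gs \<Longrightarrow> apply_factors (gs @ hs) (u @ v) = apply_factors gs u @ apply_factors hs v"
  by (induction gs u rule: apply_factors.induct) auto

text \<open>The middle term is the sign for moving all of \<open>hs\<close> past the letters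
  consumed by \<open>gs\<close>. This allows a tensor product of maps to be cut between any two
  factors.\<close>

lemma koszul_append:
  "length u = arity gs \<Longrightarrow>
    koszul (gs @ hs) (u @ v) = koszul gs u + factors_deg hs * wdeg u + koszul hs v"
proof (induction gs u rule: koszul.induct)
  case (2 r e g gs w)
  have "wdeg (take r w) + wdeg (drop r w) = wdeg w"
    using wdeg_simps(3)[of "take r w" "drop r w"] by simp
  then show ?case using 2 by (auto simp: algebra_simps) (metis distrib_left)
qed auto

lemma length_apply_factors [simp]: "length (apply_factors gs w) = length gs"
  by (induction gs w rule: apply_factors.induct) auto

lemma wdeg_apply_factors:
  "length w = arity gs \<Longrightarrow> wdeg (apply_factors gs w) = wdeg w + factors_deg gs"
proof (induction gs w rule: apply_factors.induct)
  case (2 r e g gs w)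
  have "wdeg (take r w) + wdeg (drop r w) = wdeg w"
    using wdeg_simps(3)[of "take r w" "drop r w"] by simp
  then show ?case using 2 by auto
qed auto

lemma factor_ok_closed:
  "factor_ok K A B (r, e, g) \<Longrightarrow> wf_word A w \<Longrightarrow> length w = r \<Longrightarrow> g w \<in> carrier (B (wdeg w + e))"
  by (auto simp: factor_ok_def multilinear_def words_iff)

lemma wf_apply_factors:
  "\<forall>g\<in>set gs. factor_ok K A B g \<Longrightarrow> length w = arity gs \<Longrightarrow> wf_word A w
    \<Longrightarrow> wf_word B (apply_factors gs w)"
  by (induction gs w rule: apply_factors.induct) (auto intro!: factor_ok_closed)

text \<open>The exponent sees degrees only, hence stays constant while a letter varies within its
  slot.\<close>

lemma koszul_degrees: "map fst w = map fst w' \<Longrightarrow> koszul gs w = koszul gs w'"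
proof (induction gs w arbitrary: w' rule: koszul.induct)
  case (2 r e g gs w)
  have "wdeg (take r w) = wdeg (take r w')" using 2(2) by (simp add: wdeg_def take_map[symmetric])
  moreover have "koszul gs (drop r w) = koszul gs (drop r w')"
    using 2(2) by (intro 2(1)) (simp add: drop_map[symmetric])
  ultimately show ?case by simp
qed auto

locale graded_modules = source: graded_module K A + target: graded_module K B
  for K :: "'k ring" (structure) and A :: "int \<Rightarrow> ('k, 'a) module" and B :: "int \<Rightarrow> ('k, 'b) module"
begin

text \<open>The prefix \<open>s\<close> of finished outputs serves the induction over the factors: a
  factor lying wholly to the left of the slot hands its output over to \<open>s\<close>, while the
  factor containing the slot is a linear map followed by a slot of the target tensor.\<close>

lemma apply_factors_slot:
  assumes "\<forall>g\<in>set gs. factor_ok K A B g" "length u + length v + 1 = arity gs"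
    "wf_word A u" "wf_word A v" "wf_word B s" "n = length s + length gs"
    "q = wdeg s + wdeg u + p + wdeg v + factors_deg gs"
  shows "(\<lambda>a. pure_tensor K B (s @ apply_factors gs (u @ (p, a) # v)))
    \<in> lin_hom K (A p) (tensor_power K B n q)"
  using assms
proof (induction gs arbitrary: u s n q)
  case (Cons f gs)
  obtain r e g where f: "f = (r, e, g)" by (cases f) auto
  show ?case
  proof (cases "length u < r")
    case True
    define v1 v2 where "v1 = take (r - length u - 1) v" and "v2 = drop (r - length u - 1) v"
    have v: "v = v1 @ v2" by (simp add: v1_def v2_def)
    have len: "length u + length v1 + 1 = r" "length v2 = arity gs"
      using Cons.prems(2) True by (auto simp: v1_def v2_def f)
    have eq: "apply_factors (f # gs) (u @ (p, a) # v) =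
      (wdeg u + p + wdeg v1 + e, g (u @ (p, a) # v1)) # apply_factors gs v2" for a
    proof -
      have "take r (u @ (p, a) # v) = u @ (p, a) # v1" "drop r (u @ (p, a) # v) = v2"
        using len(1) by (auto simp: v take_Cons' drop_Cons')
      then show ?thesis by (simp add: f algebra_simps)
    qed
    have "(\<lambda>a. g (u @ (p, a) # v1)) \<in> lin_hom K (A p) (B (wdeg u + p + wdeg v1 + e))"
      using Cons.prems(1,3,4) len(1)
      by (intro multilinear_slot[of K A r "wdeg u + p + wdeg v1"]) (auto simp: factor_ok_def f v)
    moreover have "(\<lambda>b. pure_tensor K B (s @ (wdeg u + p + wdeg v1 + e, b) # apply_factors gs v2))
      \<in> lin_hom K (B (wdeg u + p + wdeg v1 + e)) (tensor_power K B n q)"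
      using Cons.prems len
      by (intro multilinear_slot[OF target.pure_tensor_multilinear])
        (auto simp: f v wdeg_apply_factors intro!: wf_apply_factors)
    ultimately show ?thesis unfolding eq by (rule lin_hom_compose)
  next
    case False
    define u1 u2 where "u1 = take r u" and "u2 = drop r u"
    have u: "u = u1 @ u2" by (simp add: u1_def u2_def)
    have len: "length u1 = r" using False by (simp add: u1_def)
    have eq: "s @ apply_factors (f # gs) (u @ (p, a) # v) =
      (s @ [(wdeg u1 + e, g u1)]) @ apply_factors gs (u2 @ (p, a) # v)" for a
      by (simp add: f u len)
    show ?thesis
      unfolding eq
      by (rule Cons.IH) (use Cons.prems len in \<open>auto simp: f u intro!: factor_ok_closed\<close>)
  qed
next
  case Nil
  from Nil.prems(2) have False by simp
  then show ?case ..
qed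

lemma apply_factors_words:
  assumes "\<forall>g\<in>set gs. factor_ok K A B g" "arity gs = n" "w \<in> words A n q"
  shows "apply_factors gs w \<in> words B (length gs) (q + factors_deg gs)"
  using assms by (auto simp: words_iff wdeg_apply_factors intro!: wf_apply_factors)

lemma signed_apply_factors_multilinear:
  assumes "\<forall>g\<in>set gs. factor_ok K A B g" "arity gs = n"
  shows "multilinear K A n q (tensor_power K B (length gs) (q + factors_deg gs))
    (\<lambda>w. signed (tensor_power K B (length gs) (q + factors_deg gs)) (koszul gs w)
      (pure_tensor K B (apply_factors gs w)))"
  unfolding multilinear_def
proof (intro conjI ballI allI impI)
  fix w assume "w \<in> words A n q"
  then show "signed (tensor_power K B (length gs) (q + factors_deg gs)) (koszul gs w)
      (pure_tensor K B (apply_factors gs w)) \<in> carrier (tensor_power K B (length gs) (q + factors_deg gs))"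
    by (intro signed_closed[OF target.tensor_power_module] target.pure_tensor_closed
        apply_factors_words[OF assms])
next
  fix u :: "'a word" and v p
  assume *: "length u + length v + 1 = n \<and> wf_word A u \<and> wf_word A v \<and> wdeg u + p + wdeg v = q"
  \<comment> \<open>Any letter may stand in the slot, since the exponent depends on the degrees
    alone.\<close>
  define e where "e = koszul gs (u @ (p, undefined) # v)"
  have k: "koszul gs (u @ (p, a) # v) = e" for a
    unfolding e_def by (rule koszul_degrees) simp
  have "(\<lambda>a. pure_tensor K B ([] @ apply_factors gs (u @ (p, a) # v)))
    \<in> lin_hom K (A p) (tensor_power K B (length gs) (q + factors_deg gs))"
    by (rule apply_factors_slot) (use assms * in auto)
  then show "(\<lambda>a. signed (tensor_power K B (length gs) (q + factors_deg gs))
      (koszul gs (u @ (p, a) # v)) (pure_tensor K B (apply_factors gs (u @ (p, a) # v))))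
    \<in> lin_hom K (A p) (tensor_power K B (length gs) (q + factors_deg gs))"
    using lin_hom_signed[OF target.tensor_power_module] by (simp add: k)
qed

lemma tensor_map_hom:
  assumes "\<forall>g\<in>set gs. factor_ok K A B g" "arity gs = n" "length gs = m" "q + factors_deg gs = q'"
  shows "tensor_map K B gs q \<in> lin_hom K (tensor_power K A n q) (tensor_power K B m q')"
  unfolding tensor_map_def assms(3,4)[symmetric]
  by (rule source.lin_ext_hom[OF target.tensor_power_module
      signed_apply_factors_multilinear[OF assms(1,2)]])

lemma tensor_map_pure:
  assumes "\<forall>g\<in>set gs. factor_ok K A B g" "arity gs = n" "length gs = m" "q + factors_deg gs = q'"
    and "w \<in> words A n q"
  shows "tensor_map K B gs q (pure_tensor K A w) =
    signed (tensor_power K B m q') (koszul gs w) (pure_tensor K B (apply_factors gs w))"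
  unfolding tensor_map_def assms(3,4)[symmetric]
  by (rule source.lin_ext_pure[OF target.tensor_power_module
      signed_apply_factors_multilinear[OF assms(1,2)] assms(5)])

lemma map_factor_ok:
  assumes "\<And>q. g q \<in> lin_hom K (tensor_power K A r q) (B (q + int e))"
  shows "factor_ok K A B (map_factor K A r e g)"
  unfolding factor_ok_def map_factor_def multilinear_def fst_conv snd_conv
proof (intro conjI ballI allI impI)
  fix q w assume "w \<in> words A r q"
  then show "g (wdeg w) (pure_tensor K A w) \<in> carrier (B (q + int e))"
    using lin_hom_closed[OF assms source.pure_tensor_closed] by (auto simp: words_iff)
next
  fix q and u :: "'a word" and p v
  assume *: "length u + length v + 1 = r \<and> wf_word A u \<and> wf_word A v \<and> wdeg u + p + wdeg v = q"
  \<comment> \<open>The component of \<open>g\<close> is selected by the degree of the word, which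
    is fixed while the letter varies.\<close>
  then have W: "wdeg (u @ (p, a) # v) = q" for a by simp
  show "(\<lambda>a. g (wdeg (u @ (p, a) # v)) (pure_tensor K A (u @ (p, a) # v)))
      \<in> lin_hom K (A p) (B (q + int e))"
    unfolding W
    by (rule lin_hom_compose[OF multilinear_slot[OF source.pure_tensor_multilinear] assms])
      (use * in auto)
qed

end

lemma (in graded_module) id_factor_ok: "factor_ok K A A id_factor"
  by (auto simp: factor_ok_def id_factor_def multilinear_def words_iff length_Suc_conv
      intro!: lin_homI)

lemma (in graded_module) diff_factor_ok:
  assumes d: "\<And>q. d q \<in> lin_hom K (A q) (A (q - 1))"
  shows "factor_ok K A A (diff_factor d)"
  by (auto simp: factor_ok_def diff_factor_def multilinear_def words_iff length_Suc_conv
      lin_hom_closed[OF d] lin_hom_add_apply[OF d] lin_hom_smult_apply[OF d] intro!: lin_homI)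

section \<open>Shuffles\<close>

fun inversions :: "nat list \<Rightarrow> nat" where
  "inversions [] = 0"
| "inversions (x # xs) = length (filter (\<lambda>y. y < x) xs) + inversions xs"

lemma inversions_swap: "b < a \<Longrightarrow> inversions (xs @ a # b # ys) = Suc (inversions (xs @ b # a # ys))"
  by (induction xs) auto

lemma unsorted_adjacent:
  "\<not> sorted zs \<Longrightarrow> \<exists>xs a b ys. zs = xs @ a # b # ys \<and> b < (a :: nat)"
proof (induction zs)
  case (Cons x zs)
  show ?case
  proof (cases "sorted zs")
    case True
    then obtain b ys where zs: "zs = b # ys" using Cons.prems by (cases zs) auto
    then have "b < x" using Cons.prems True by fastforce
    then show ?thesis using zs by (metis append_Nil)
  next
    case False
    then show ?thesis using Cons.IH by (metis append_Cons)
  qed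
qed auto

lemma permute_list_inj:
  assumes "distinct xs" "\<sigma> permutes {..<length xs}" "\<tau> permutes {..<length xs}"
    and "permute_list \<sigma> xs = permute_list \<tau> xs"
  shows "\<sigma> = \<tau>"
proof
  fix i show "\<sigma> i = \<tau> i"
  proof (cases "i < length xs")
    case True
    have "xs ! \<sigma> i = xs ! \<tau> i"
      using assms True by (metis permute_list_nth)
    moreover have "\<sigma> i < length xs" "\<tau> i < length xs"
      using permutes_in_image[OF assms(2)] permutes_in_image[OF assms(3)] True by auto
    ultimately show ?thesis using assms(1) by (simp add: nth_eq_iff_index_eq)
  next
    case False
    then show ?thesis using assms(2,3) by (simp add: permutes_not_in)
  qed
qed

text \<open>Bubble sort: at an adjacent descent, composing with the transposition of the two places
  flips the parity of the permutation and removes exactly one inversion. Without a descent the list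
  is sorted, which forces the identity.\<close>

lemma evenperm_inversions:
  assumes xs: "sorted_wrt (<) xs" and "\<sigma> permutes {..<length xs}"
  shows "evenperm \<sigma> \<longleftrightarrow> even (inversions (permute_list \<sigma> xs))"
  using assms(2)
proof (induction "inversions (permute_list \<sigma> xs)" arbitrary: \<sigma> rule: less_induct)
  case (less \<sigma>)
  have dist: "distinct xs" using xs strict_sorted_iff by auto
  show ?case
  proof (cases "sorted (permute_list \<sigma> xs)")
    case True
    have m: "mset (permute_list \<sigma> xs) = mset xs" using less.prems by simp
    have "sorted xs" using xs strict_sorted_iff by auto
    then have eq: "permute_list \<sigma> xs = xs"
      using True m by (metis properties_for_sort)
    then have "\<sigma> = id"
      by (intro permute_list_inj[OF dist less.prems permutes_id]) simp
    moreover have "inversions xs = 0"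
      using xs by (induction xs) (auto simp: filter_empty_conv)
    ultimately show ?thesis using eq by simp
  next
    case False
    then obtain us a b vs where d: "permute_list \<sigma> xs = us @ a # b # vs" and ba: "b < a"
      using unsorted_adjacent by blast
    let ?i = "length us"
    let ?\<tau> = "transpose ?i (Suc ?i)"
    have len: "length xs = length (us @ a # b # vs)" using d by (metis length_permute_list)
    have \<tau>: "?\<tau> permutes {..<length xs}" using len by (intro permutes_swap_id) auto
    have "permute_list (\<sigma> \<circ> ?\<tau>) xs = permute_list ?\<tau> (us @ a # b # vs)"
      using \<tau> by (simp add: permute_list_compose d)
    also have "\<dots> = us @ b # a # vs"
    proof (rule nth_equalityI)
      fix j assume "j < length (permute_list ?\<tau> (us @ a # b # vs))"
      then have j: "j < length (us @ a # b # vs)" by simp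
      have "permute_list ?\<tau> (us @ a # b # vs) ! j = (us @ a # b # vs) ! ?\<tau> j"
        using j \<tau> len by (simp add: permute_list_nth)
      also have "\<dots> = (us @ b # a # vs) ! j"
        by (cases "j = ?i"; cases "j = Suc ?i")
          (auto simp: nth_append transpose_def nth_Cons split: nat.splits)
      finally show "permute_list ?\<tau> (us @ a # b # vs) ! j = (us @ b # a # vs) ! j" .
    qed simp
    finally have eq: "permute_list (\<sigma> \<circ> ?\<tau>) xs = us @ b # a # vs" .
    have inv: "inversions (permute_list \<sigma> xs) = Suc (inversions (permute_list (\<sigma> \<circ> ?\<tau>) xs))"
      unfolding eq d by (rule inversions_swap[OF ba])
    have p: "\<sigma> \<circ> ?\<tau> permutes {..<length xs}" by (rule permutes_compose[OF \<tau> less.prems])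
    have "evenperm (\<sigma> \<circ> ?\<tau>) \<longleftrightarrow> even (inversions (permute_list (\<sigma> \<circ> ?\<tau>) xs))"
      by (rule less.hyps) (use inv p in auto)
    moreover have "evenperm (\<sigma> \<circ> ?\<tau>) \<longleftrightarrow> evenperm \<sigma> = evenperm ?\<tau>"
      using less.prems \<tau> by (intro evenperm_comp) (auto simp: permutation_permutes)
    moreover have "\<not> evenperm ?\<tau>" by (simp add: evenperm_swap)
    ultimately show ?thesis using inv by auto
  qed
qed

section \<open>Hats of a permuted tuple\<close>

lemma hat_Nil [simp]: "hat [] = []"
  by (simp add: hat_def)

lemma hat_Cons: "hat (x # xs) = (x - length (filter (\<lambda>y. y < x) xs)) # hat xs"
proof -
  have 1: "card {t. 0 < t \<and> t < length (x # xs) \<and> (x # xs) ! t < x} = length (filter (\<lambda>y. y < x) xs)"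
  proof -
    have "{t. 0 < t \<and> t < length (x # xs) \<and> (x # xs) ! t < x} = Suc ` {t. t < length xs \<and> xs ! t < x}"
    proof (rule Set.set_eqI)
      fix t show "t \<in> {t. 0 < t \<and> t < length (x # xs) \<and> (x # xs) ! t < x} \<longleftrightarrow>
          t \<in> Suc ` {t. t < length xs \<and> xs ! t < x}"
        by (cases t) (auto simp: inj_image_mem_iff)
    qed
    then show ?thesis by (simp add: card_image length_filter_conv_card)
  qed
  have 2: "card {t. Suc s < t \<and> t < length (x # xs) \<and> (x # xs) ! t < xs ! s} =
      card {t. s < t \<and> t < length xs \<and> xs ! t < xs ! s}" for s
  proof -
    have "{t. Suc s < t \<and> t < length (x # xs) \<and> (x # xs) ! t < xs ! s} =
      Suc ` {t. s < t \<and> t < length xs \<and> xs ! t < xs ! s}"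
    proof (rule Set.set_eqI)
      fix t show "t \<in> {t. Suc s < t \<and> t < length (x # xs) \<and> (x # xs) ! t < xs ! s} \<longleftrightarrow>
          t \<in> Suc ` {t. s < t \<and> t < length xs \<and> xs ! t < xs ! s}"
        by (cases t) (auto simp: inj_image_mem_iff)
    qed
    then show ?thesis by (simp add: card_image)
  qed
  have "hat (x # xs) = (x - card {t. 0 < t \<and> t < length (x # xs) \<and> (x # xs) ! t < x}) #
      map (\<lambda>s. xs ! s - card {t. Suc s < t \<and> t < length (x # xs) \<and> (x # xs) ! t < xs ! s}) [0..<length xs]"
    unfolding hat_def by (simp add: upt_conv_Cons map_Suc_upt[symmetric] del: upt_Suc)
  then show ?thesis unfolding 1 2 by (simp add: hat_def)
qed

lemma length_hat [simp]: "length (hat js) = length js"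
  by (simp add: hat_def)

text \<open>A hat depends only on the entries to its right, hence is unchanged in a suffix.\<close>

lemma drop_hat: "drop m (hat js) = hat (drop m js)"
  by (induction js arbitrary: m) (auto simp: hat_Cons drop_Cons' )

lemma filter_less_empty: "\<forall>y\<in>set xs. x < (y::nat) \<Longrightarrow> filter (\<lambda>y. y < x) xs = []"
  by (auto simp: filter_empty_conv)

lemma hat_sorted: "sorted_wrt (<) js \<Longrightarrow> hat js = js"
  by (induction js) (auto simp: hat_Cons filter_less_empty)

lemma hat_append_sorted:
  "sorted_wrt (<) ls \<Longrightarrow>
    take (length ls) (hat (ls @ rs)) = map (\<lambda>l. l - length (filter (\<lambda>r. r < l) rs)) ls"
proof (induction ls)
  case (Cons x ls)
  then have "filter (\<lambda>y. y < x) ls = []" by (auto simp: filter_empty_conv)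
  then show ?case using Cons by (simp add: hat_Cons)
qed simp

text \<open>Raising the threshold from \<open>a\<close> to \<open>b\<close> adds only elements
  strictly between them, \<open>a\<close> being absent, and there are \<open>b - a - 1\<close> such
  integers. This is what keeps the hats of increasing entries strictly increasing.\<close>

lemma filter_less_gap:
  assumes "distinct zs" "a < b" "a \<notin> set zs"
  shows "length (filter (\<lambda>z. z < b) zs) \<le> length (filter (\<lambda>z. z < (a::nat)) zs) + (b - a - 1)"
proof -
  have "length (filter (\<lambda>z. z < b) zs) =
      length (filter (\<lambda>z. z < a) zs) + length (filter (\<lambda>z. a \<le> z \<and> z < b) zs)"
    using assms(2) by (induction zs) auto
  moreover have "length (filter (\<lambda>z. a \<le> z \<and> z < b) zs) = card (set (filter (\<lambda>z. a \<le> z \<and> z < b) zs))"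
    by (rule distinct_card[symmetric]) (simp add: assms(1))
  moreover have "card (set (filter (\<lambda>z. a \<le> z \<and> z < b) zs)) \<le> card {a<..<b}"
    by (rule card_mono) (use assms(3) in \<open>auto simp: order_le_less\<close>)
  ultimately show ?thesis by simp
qed

lemma filter_less_le: "distinct zs \<Longrightarrow> length (filter (\<lambda>z. z < (a::nat)) zs) \<le> a"
proof -
  assume d: "distinct zs"
  have "length (filter (\<lambda>z. z < a) zs) = card (set (filter (\<lambda>z. z < a) zs))"
    by (rule distinct_card[symmetric]) (simp add: d)
  also have "\<dots> \<le> card {..<a}" by (rule card_mono) auto
  finally show ?thesis by simp
qed

text \<open>For neighbours \<open>x < y\<close> the counts grow by at most \<open>y - x - 1\<close>,
  so the hats still increase strictly. For \<open>y < x\<close> the entry \<open>y\<close> adds 1 to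
  the count of \<open>x\<close>, and the same bound leaves the hat of \<open>x\<close> at least that
  of \<open>y\<close>. Hence the condition defining \<open>I\<^sub>\<sigma>\<close> can be tested on
  the entries themselves.\<close>

lemma sorted_hat_iff:
  "distinct (xs @ zs) \<Longrightarrow> sorted_wrt (<) (take (length xs) (hat (xs @ zs))) \<longleftrightarrow> sorted_wrt (<) xs"
proof (induction xs rule: induct_list012)
  case (3 x y xs)
  let ?l = "xs @ zs"
  have d: "distinct ?l" "x \<notin> set ?l" "y \<notin> set ?l" "x \<noteq> y" using 3 by auto
  let ?c = "\<lambda>a. length (filter (\<lambda>z. z < a) ?l)"
  have "x - length (filter (\<lambda>z. z < x) (y # ?l)) < y - ?c y \<longleftrightarrow> x < y"
  proof (cases "x < y")
    case True
    then show ?thesis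
      using filter_less_gap[OF d(1) True d(2)] filter_less_le[OF d(1), of x] by auto
  next
    case False
    then have "y < x" using d by simp
    then show ?thesis
      using filter_less_gap[OF d(1) _ d(3), of x] filter_less_le[OF d(1), of y] by auto
  qed
  moreover have "take (length (x # y # xs)) (hat ((x # y # xs) @ zs)) =
      (x - length (filter (\<lambda>z. z < x) (y # ?l))) # take (length (y # xs)) (hat ((y # xs) @ zs))"
    and "take (length (y # xs)) (hat ((y # xs) @ zs)) = (y - ?c y) # take (length xs) (hat ?l)"
    by (simp_all add: hat_Cons)
  moreover have "sorted_wrt (<) (take (length (y # xs)) (hat ((y # xs) @ zs))) \<longleftrightarrow> sorted_wrt (<) (y # xs)"
    using 3 by auto
  ultimately show ?case by (simp only: sorted_wrt2[OF transp_on_less])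
next
  case (2 x)
  then show ?case by (simp add: hat_Cons)
qed simp

lemma cuts_hat:
  assumes "distinct js"
  shows "cuts (hat js) =
    {m. 1 \<le> m \<and> m < length js \<and> sorted_wrt (<) (take m js) \<and> sorted_wrt (<) (drop m js)}"
proof -
  have "sorted_wrt (<) (take m (hat js)) \<longleftrightarrow> sorted_wrt (<) (take m js)" if "m < length js" for m
    using sorted_hat_iff[of "take m js" "drop m js"] that assms by (simp add: min_def)
  moreover have "sorted_wrt (<) (drop m (hat js)) \<longleftrightarrow> sorted_wrt (<) (drop m js)" for m
    using sorted_hat_iff[of "drop m js" "[]"] assms by (simp add: drop_hat distinct_drop)
  ultimately show ?thesis by (auto simp: cuts_def)
qed

text \<open>For a subset \<open>R\<close> of the entries of \<open>is\<close>, \<open>shift is R\<close> is the tuple of the hats of the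
  entries outside \<open>R\<close>, moved in front of those in \<open>R\<close>, and \<open>crossings is R\<close> is the number of
  inversions of this shuffle.\<close>

definition shift :: "nat list \<Rightarrow> nat set \<Rightarrow> nat list" where
  "shift is R = map (\<lambda>l. l - card {r \<in> R. r < l}) (filter (\<lambda>l. l \<notin> R) is)"

definition crossings :: "nat list \<Rightarrow> nat set \<Rightarrow> nat" where
  "crossings is R = (\<Sum>l\<leftarrow>filter (\<lambda>l. l \<notin> R) is. card {r \<in> R. r < l})"

lemma inversions_append_sorted:
  "sorted_wrt (<) ls \<Longrightarrow> sorted_wrt (<) rs \<Longrightarrow>
    inversions (ls @ rs) = (\<Sum>l\<leftarrow>ls. length (filter (\<lambda>r. r < l) rs))"
proof (induction ls)
  case Nil
  then show ?case by (induction rs) (auto simp: filter_empty_conv)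
next
  case (Cons x ls)
  then have "filter (\<lambda>y. y < x) ls = []" by (auto simp: filter_empty_conv)
  then show ?case using Cons by simp
qed

text \<open>A permutation with a cut is sent to the set of entries behind the cut. Both parts are
  strictly increasing, hence determined by their sets, which makes this a bijection onto the subsets
  that are neither empty nor everything. Since \<open>perm_parity\<close> is only the parity of the
  crossing number, \<open>h\<close> must not distinguish exponents of equal parity.\<close>

lemma (in abelian_monoid) finsum_shuffles:
  fixes "is" :: "nat list" and h :: "int \<Rightarrow> nat list \<Rightarrow> nat list \<Rightarrow> 'a"
  assumes "is": "sorted_wrt (<) is"
    and h: "\<And>e e' l r. even (e - e') \<Longrightarrow> h e l r = h e' l r"
    and closed: "\<And>R. R \<subseteq> set is \<Longrightarrow> R \<noteq> {} \<Longrightarrow> R \<noteq> set is \<Longrightarrow>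
      h (int (crossings is R)) (shift is R) (filter (\<lambda>i. i \<in> R) is) \<in> carrier G"
  shows "(\<Oplus>\<sigma>\<in>{\<sigma>. \<sigma> permutes {..<length is}}. \<Oplus>m\<in>cuts (hat (permute_list \<sigma> is)).
      h (perm_parity \<sigma>) (take m (hat (permute_list \<sigma> is))) (drop m (hat (permute_list \<sigma> is)))) =
    (\<Oplus>R\<in>Pow (set is) - {{}, set is}.
      h (int (crossings is R)) (shift is R) (filter (\<lambda>i. i \<in> R) is))"
    (is "(\<Oplus>\<sigma>\<in>?P. \<Oplus>m\<in>?C \<sigma>. ?g \<sigma> m) = finsum G ?f ?B")
proof -
  let ?\<Phi> = "\<lambda>p. set (drop (snd p) (permute_list (fst p) is))"
  have dist: "distinct is" using "is" strict_sorted_iff by auto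
  have uniq: "xs = filter (\<lambda>i. i \<in> R) is" if "sorted_wrt (<) xs" "set xs = R \<inter> set is" for xs R
    using that "is" by (intro strict_sorted_equal) (auto simp: sorted_wrt_filter)
  have perm: "set (permute_list \<sigma> is) = set is" "distinct (permute_list \<sigma> is)"
    if "\<sigma> permutes {..<length is}" for \<sigma>
    using that dist by auto
  have split: "take m (permute_list \<sigma> is) = filter (\<lambda>i. i \<notin> R) is"
      "drop m (permute_list \<sigma> is) = filter (\<lambda>i. i \<in> R) is"
      "sorted_wrt (<) (take m (permute_list \<sigma> is))" "sorted_wrt (<) (drop m (permute_list \<sigma> is))"
      "R \<subseteq> set is" "R \<noteq> {}" "R \<noteq> set is" "m = length is - card R"
    if \<sigma>: "\<sigma> \<in> ?P" and m: "m \<in> ?C \<sigma>" and R: "R = ?\<Phi> (\<sigma>, m)" for \<sigma> m R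
  proof -
    let ?js = "permute_list \<sigma> is"
    note p = perm[of \<sigma>]
    have m': "1 \<le> m" "m < length is" "sorted_wrt (<) (take m ?js)" "sorted_wrt (<) (drop m ?js)"
      using m \<sigma> p(2) by (auto simp: cuts_hat)
    then show "sorted_wrt (<) (take m ?js)" "sorted_wrt (<) (drop m ?js)" by auto
    have un: "set (take m ?js) \<union> R = set is"
      using p(1) \<sigma> R by (metis append_take_drop_id fst_conv mem_Collect_eq set_append snd_conv)
    have disj: "set (take m ?js) \<inter> R = {}"
      using p(2) \<sigma> R by (metis append_take_drop_id distinct_append fst_conv mem_Collect_eq snd_conv)
    show sub: "R \<subseteq> set is" using un by auto
    show "R \<noteq> {}" using m' R by auto
    show "R \<noteq> set is"
    proof
      assume "R = set is"
      then have "set (take m ?js) \<subseteq> R" using un by (metis Un_upper1)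
      then have "set (take m ?js) = {}" using disj by (metis inf.absorb1)
      moreover have "length (take m ?js) = m" using m' by simp
      ultimately show False using m'(1) by simp
    qed
    show "drop m ?js = filter (\<lambda>i. i \<in> R) is" using sub R m'(4) by (intro uniq) auto
    have "take m ?js = filter (\<lambda>i. i \<in> - R) is" using un disj m'(3) by (intro uniq) auto
    then show "take m ?js = filter (\<lambda>i. i \<notin> R) is" by simp
    have "card R = length (drop m ?js)"
      unfolding R using p(2) \<sigma> by (simp add: distinct_card)
    then show "m = length is - card R" using m'(2) by simp
  qed
  have bij: "bij_betw ?\<Phi> (Sigma ?P ?C) ?B"
  proof (rule bij_betwI')
    fix x y assume x: "x \<in> Sigma ?P ?C" and y: "y \<in> Sigma ?P ?C"
    obtain \<sigma> m \<tau> n where xy: "x = (\<sigma>, m)" "y = (\<tau>, n)" by (cases x, cases y)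
    show "?\<Phi> x = ?\<Phi> y \<longleftrightarrow> x = y"
    proof
      assume eq: "?\<Phi> x = ?\<Phi> y"
      note sx = split[of \<sigma> m "?\<Phi> x"] and sy = split[of \<tau> n "?\<Phi> x"]
      have "m = n" using sx(8) sy(8) x y xy eq by auto
      moreover have "permute_list \<sigma> is = permute_list \<tau> is"
        using sx(1,2) sy(1,2) x y xy eq
        by (metis SigmaD1 SigmaD2 append_take_drop_id fst_conv snd_conv)
      then have "\<sigma> = \<tau>" using x y xy by (intro permute_list_inj[OF dist]) auto
      ultimately show "x = y" using xy by simp
    qed simp
  next
    fix x assume "x \<in> Sigma ?P ?C"
    then show "?\<Phi> x \<in> ?B" using split(5-7)[of "fst x" "snd x" "?\<Phi> x"] by auto
  next
    fix R assume R: "R \<in> ?B"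
    let ?l = "filter (\<lambda>i. i \<notin> R) is" and ?r = "filter (\<lambda>i. i \<in> R) is"
    \<comment> \<open>Surjectivity: listing the complement of \<open>R\<close> before
      \<open>R\<close> rearranges the tuple, and the cut is the length of the complement.\<close>
    have "mset (?l @ ?r) = mset is" by (induction "is") auto
    then obtain \<sigma> where \<sigma>: "\<sigma> permutes {..<length is}" "permute_list \<sigma> is = ?l @ ?r"
      using mset_eq_permutation by metis
    have "?l \<noteq> []" "?r \<noteq> []" using R by (auto simp: filter_empty_conv)
    moreover have len: "length is = length ?l + length ?r" by (induction "is") auto
    ultimately have "length ?l \<in> cuts (hat (permute_list \<sigma> is))"
      using "is" perm(2)[OF \<sigma>(1)]
      by (subst cuts_hat) (auto simp: \<sigma>(2) sorted_wrt_filter Suc_le_eq)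
    moreover have "set ?r = R" using R by auto
    ultimately show "\<exists>x\<in>Sigma ?P ?C. R = ?\<Phi> x"
      using \<sigma> by (intro bexI[of _ "(\<sigma>, length ?l)"]) auto
  qed
  have g: "?g \<sigma> m = ?f (?\<Phi> (\<sigma>, m))" if \<sigma>: "\<sigma> \<in> ?P" and m: "m \<in> ?C \<sigma>" for \<sigma> m
  proof -
    let ?js = "permute_list \<sigma> is"
    define R where "R = ?\<Phi> (\<sigma>, m)"
    note s = split[OF \<sigma> m R_def]
    have js: "?js = filter (\<lambda>i. i \<notin> R) is @ filter (\<lambda>i. i \<in> R) is"
      using s(1,2) by (metis append_take_drop_id)
    have cnt: "length (filter (\<lambda>r. r < l) (filter (\<lambda>i. i \<in> R) is)) = card {r \<in> R. r < l}" for l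
    proof -
      have "length (filter (\<lambda>r. r < l) (filter (\<lambda>i. i \<in> R) is)) =
          card (set (filter (\<lambda>r. r < l) (filter (\<lambda>i. i \<in> R) is)))"
        using dist by (intro distinct_card[symmetric]) simp
      also have "set (filter (\<lambda>r. r < l) (filter (\<lambda>i. i \<in> R) is)) = {r \<in> R. r < l}"
        using s(5) by auto
      finally show ?thesis .
    qed
    have len: "m = length (filter (\<lambda>i. i \<notin> R) is)"
    proof -
      have "m < length is" using m by (auto simp: cuts_def)
      then have "length (take m ?js) = m" by simp
      then show ?thesis unfolding s(1) by simp
    qed
    have "take m (hat ?js) = shift is R"
      unfolding js shift_def len
      using hat_append_sorted[of "filter (\<lambda>i. i \<notin> R) is" "filter (\<lambda>i. i \<in> R) is"] "is"
      by (simp add: sorted_wrt_filter cnt del: filter_filter)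
    moreover have "drop m (hat ?js) = filter (\<lambda>i. i \<in> R) is"
      using s(2,4) by (simp add: drop_hat hat_sorted)
    moreover have "even (perm_parity \<sigma> - int (crossings is R))"
    proof -
      have "inversions ?js = crossings is R"
        unfolding js crossings_def using "is"
        by (subst inversions_append_sorted) (auto simp: sorted_wrt_filter cnt simp del: filter_filter)
      then show ?thesis
        using evenperm_inversions[OF "is", of \<sigma>] \<sigma> by (auto simp: perm_parity_def)
    qed
    ultimately show ?thesis unfolding R_def[symmetric] using h by metis
  qed
  have fin: "finite ?P" by (simp add: finite_permutations)
  have finC: "finite (?C \<sigma>)" for \<sigma> by (rule finite_subset[of _ "{..length is}"]) (auto simp: cuts_def)
  have cl: "?f (?\<Phi> (\<sigma>, m)) \<in> carrier G" if "\<sigma> \<in> ?P" "m \<in> ?C \<sigma>" for \<sigma> m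
    using split(5-7)[OF that refl] by (intro closed) auto
  have "(\<Oplus>\<sigma>\<in>?P. \<Oplus>m\<in>?C \<sigma>. ?g \<sigma> m) = (\<Oplus>p\<in>Sigma ?P ?C. ?g (fst p) (snd p))"
    by (rule finsum_Sigma[OF fin finC]) (use g cl in auto)
  also have "\<dots> = (\<Oplus>p\<in>Sigma ?P ?C. ?f (?\<Phi> p))"
    by (rule finsum_eq_cong) (use g cl in auto)
  also have "\<dots> = finsum G ?f ?B"
    by (rule finsum_bij[OF bij, symmetric]) (use closed in auto)
  finally show ?thesis .
qed

section \<open>Index tuples as compositions\<close>

text \<open>A subset of the \<open>n - 1\<close> positions between consecutive letters of a word of length \<open>n\<close> cuts
  the word into groups, two letters being in the same group if all positions between them belong
  to the subset.  The list \<open>ms\<close> records the lengths of the groups, diminished by one.\<close>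

primrec gaps :: "nat \<Rightarrow> nat list \<Rightarrow> nat list" where
  "gaps p [] = []"
| "gaps p (m # ms) = [p + 1..<p + m + 1] @ gaps (p + m + 1) ms"

text \<open>The length of the word: each group has one letter more than its entry in the
  list.\<close>

definition letters :: "nat list \<Rightarrow> nat" where
  "letters ms = sum_list ms + length ms"

lemma letters_simps [simp]:
  "letters [] = 0" "letters (m # ms) = m + 1 + letters ms"
  "letters (us @ vs) = letters us + letters vs"
  by (auto simp: letters_def)

lemma gaps_append: "gaps p (us @ vs) = gaps p us @ gaps (p + letters us) vs"
  by (induction us arbitrary: p) (auto simp: algebra_simps)

lemma gaps_bounds: "i \<in> set (gaps p ms) \<Longrightarrow> p < i \<and> i < p + letters ms"
  by (induction ms arbitrary: p) fastforce+

lemma sorted_gaps: "sorted_wrt (<) (gaps p ms)"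
  by (induction ms arbitrary: p) (auto simp: sorted_wrt_append dest: gaps_bounds)

lemma length_gaps [simp]: "length (gaps p ms) = sum_list ms"
  by (induction ms arbitrary: p) auto

lemma gaps_replicate_0 [simp]: "gaps p (replicate n 0) = []"
  by (induction n arbitrary: p) auto

lemma letters_replicate_0 [simp]: "letters (replicate n 0) = n"
  by (simp add: letters_def sum_list_replicate)

text \<open>Induction on the number of letters: if the first gap \<open>p + 1\<close> is present, it
  enlarges the first group of the rest; otherwise the first letter forms a group by itself. One
  letter is needed for a first group to exist.\<close>

lemma gaps_ex:
  "sorted_wrt (<) is \<Longrightarrow> set is \<subseteq> {p<..<p + n} \<Longrightarrow> n \<ge> 1 \<Longrightarrow>
    \<exists>m ms. letters (m # ms) = n \<and> gaps p (m # ms) = is"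
proof (induction n arbitrary: p "is")
  case (Suc n)
  show ?case
  proof (cases "n = 0")
    case True
    then have "{p<..<p + Suc n} = {}" by auto
    then have "is = []" using Suc.prems by auto
    then show ?thesis using True by (intro exI[of _ 0] exI[of _ "[]"]) auto
  next
    case False
    show ?thesis
    proof (cases "is \<noteq> [] \<and> hd is = p + 1")
      case True
      then obtain js where "is": "is = (p + 1) # js" by (cases "is") auto
      then have "set js \<subseteq> {p + 1<..<p + 1 + n}" using Suc.prems by auto
      then obtain m ms where m: "letters (m # ms) = n" "gaps (p + 1) (m # ms) = js"
        using Suc.IH[of js "p + 1"] Suc.prems(1) False "is" by auto
      have "gaps p (Suc m # ms) = is" using m(2) unfolding "is"
        by (simp add: upt_conv_Cons del: upt_Suc)
      moreover have "letters (Suc m # ms) = Suc n" using m(1) by simp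
      ultimately show ?thesis by blast
    next
      case h: False
      have "p + 1 \<notin> set is"
      proof
        assume "p + 1 \<in> set is"
        then obtain a js where "is": "is = a # js" "p + 1 \<in> insert a (set js)" by (cases "is") auto
        then have "a \<noteq> p + 1" using h by auto
        then show False using "is" Suc.prems by fastforce
      qed
      then have "set is \<subseteq> {p + 1<..<p + 1 + n}"
        using Suc.prems(2) by (force simp: subset_iff intro: le_neq_implies_less)
      then obtain m ms where m: "letters (m # ms) = n" "gaps (p + 1) (m # ms) = is"
        using Suc.IH[of "is" "p + 1"] Suc.prems(1) False by auto
      then show ?thesis by (intro exI[of _ 0] exI[of _ "m # ms"]) simp
    qed
  qed
qed simp

lemma gaps_boundary: "p + m + 1 \<notin> set (gaps p (m # ms))"
  by (auto dest: gaps_bounds)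

text \<open>The first group ends at the first absent position \<open>p + m + 1\<close>. The letter
  counts must agree because trailing groups of one letter leave no trace among the gaps.\<close>

lemma gaps_inj: "gaps p ms = gaps p ms' \<Longrightarrow> letters ms = letters ms' \<Longrightarrow> ms = ms'"
proof (induction ms arbitrary: p ms')
  case Nil
  then show ?case by (cases ms') auto
next
  case (Cons m ms)
  then obtain m' ns where ms': "ms' = m' # ns" by (cases ms') auto
  have "\<not> m < m'"
  proof
    assume "m < m'"
    then have "p + m + 1 \<in> set (gaps p ms')" by (simp add: ms' del: upt_Suc)
    then show False using gaps_boundary Cons.prems(1) by metis
  qed
  moreover have "\<not> m' < m"
  proof
    assume "m' < m"
    then have "p + m' + 1 \<in> set (gaps p (m # ms))" by (simp del: upt_Suc)
    then show False using gaps_boundary Cons.prems(1) ms' by metis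
  qed
  ultimately have m: "m' = m" by simp
  have "gaps (p + m + 1) ms = gaps (p + m + 1) ns" using Cons.prems(1) unfolding ms' m by simp
  then have "ms = ns" using Cons.prems(2) unfolding ms' m by (intro Cons.IH) auto
  then show ?case by (simp add: ms' m)
qed

text \<open>The boundary \<open>p + m + 1\<close> behind a group is not a gap, so no run passes it.
  Letters are counted from 0 and gaps from 1, whence the offset \<open>t + 1\<close>.\<close>

lemma run_in_group:
  "{j..<j + k} \<subseteq> set (gaps p ms) \<Longrightarrow> 1 \<le> k \<Longrightarrow>
    \<exists>i<length ms. \<exists>t. t + k \<le> ms ! i \<and> j = p + letters (take i ms) + t + 1"
proof (induction ms arbitrary: p)
  case (Cons m ms)
  have j: "j \<in> set (gaps p (m # ms))" using Cons.prems by (auto simp: subset_iff)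
  have b: "p + m + 1 \<notin> {j..<j + k}" using Cons.prems(1) gaps_boundary by blast
  show ?case
  proof (cases "j \<le> p + m")
    case True
    moreover have "p < j" using gaps_bounds[OF j] by simp
    ultimately show ?thesis using b by (intro exI[of _ 0]) (auto intro!: exI[of _ "j - p - 1"])
  next
    case False
    then have "p + m + 1 < j" using b Cons.prems(2) by auto
    then have "{j..<j + k} \<subseteq> set (gaps (p + m + 1) ms)" using Cons.prems(1) by fastforce
    then obtain i t where "i < length ms" "t + k \<le> ms ! i" "j = p + m + 1 + letters (take i ms) + t + 1"
      using Cons.IH Cons.prems(2) by blast
    then show ?thesis by (intro exI[of _ "Suc i"]) (auto intro!: exI[of _ t])
  qed
qed (auto simp: subset_iff)

lemma split_group: "i < length ms \<Longrightarrow> ms = take i ms @ ms ! i # drop (Suc i) ms"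
  by (simp add: id_take_nth_drop)

lemma gaps_group:
  "gaps 0 (us @ m # vs) =
    gaps 0 us @ [letters us + 1..<letters us + m + 1] @ gaps (letters us + m + 1) vs"
  by (simp add: gaps_append)

lemma letters_take_mono:
  assumes "i < j" "j < length ms"
  shows "letters (take i ms) + ms ! i + 1 \<le> letters (take j ms)"
proof -
  have "take (Suc i) ms = take i ms @ [ms ! i]" using assms by (simp add: take_Suc_conv_app_nth)
  then have 1: "letters (take (Suc i) ms) = letters (take i ms) + ms ! i + 1" by simp
  have "take j ms = take (Suc i) ms @ take (j - Suc i) (drop (Suc i) ms)"
    using assms take_add[of "Suc i" "j - Suc i" ms] by simp
  then show ?thesis by (metis 1 le_add1 letters_simps(3))
qed

section \<open>Shuffles of the gaps of a composition\<close>

lemma crossings_append: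
  "crossings (xs @ ys) R = crossings xs R + crossings ys R"
  "shift (xs @ ys) R = shift xs R @ shift ys R"
  by (auto simp: crossings_def shift_def)

lemma shift_const:
  assumes "\<And>l. l \<in> set xs \<Longrightarrow> l \<notin> R" "\<And>l. l \<in> set xs \<Longrightarrow> card {r \<in> R. r < l} = c"
  shows "shift xs R = map (\<lambda>l. l - c) xs" "crossings xs R = length xs * c"
proof -
  have f: "filter (\<lambda>l. l \<notin> R) xs = xs" using assms(1) by (simp add: filter_id_conv)
  show "shift xs R = map (\<lambda>l. l - c) xs" unfolding shift_def f using assms(2) by simp
  have m: "map (\<lambda>l. card {r \<in> R. r < l}) xs = map (\<lambda>l. c) xs" using assms(2) by simp
  then show "crossings xs R = length xs * c"
    unfolding crossings_def f m by (simp add: sum_list_triv)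
qed

lemma shift_inside:
  "set xs \<subseteq> R \<Longrightarrow> shift xs R = []" "set xs \<subseteq> R \<Longrightarrow> crossings xs R = 0"
proof -
  assume "set xs \<subseteq> R"
  then have "filter (\<lambda>l. l \<notin> R) xs = []" by (auto simp: filter_empty_conv)
  then show "shift xs R = []" "crossings xs R = 0" by (auto simp: shift_def crossings_def)
qed

lemma map_upt_minus: "c \<le> a \<Longrightarrow> map (\<lambda>l. l - c) [a..<b] = [a - c..<b - c]"
  by (rule nth_equalityI) auto

lemma gaps_minus: "c \<le> p \<Longrightarrow> map (\<lambda>l. l - c) (gaps p ms) = gaps (p - c) ms"
  by (induction ms arbitrary: p) (auto simp: map_upt_minus Suc_diff_le simp del: upt_Suc)

text \<open>The combinatorics of \<open>f\<close> after a face: a run of \<open>k\<close> gaps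
  merges \<open>k + 1\<close> letters of the group into one, so the group shrinks to
  \<open>m - k\<close>. Only entries above the run have inversions, \<open>k\<close> each: the
  remaining \<open>m - t - k\<close> gaps of the group and all gaps of \<open>vs\<close>.\<close>

lemma shift_run:
  assumes "t + k \<le> m" and R: "R = {letters us + t + 1..<letters us + t + 1 + k}"
  shows "filter (\<lambda>l. l \<in> R) (gaps 0 (us @ m # vs)) = [letters us + t + 1..<letters us + t + 1 + k]"
    and "shift (gaps 0 (us @ m # vs)) R = gaps 0 (us @ (m - k) # vs)"
    and "crossings (gaps 0 (us @ m # vs)) R = k * ((m - t - k) + sum_list vs)"
    and "R \<subseteq> set (gaps 0 (us @ m # vs))"
proof -
  let ?p = "letters us"
  have up: "[?p + 1..<?p + m + 1] =
      [?p + 1..<?p + t + 1] @ [?p + t + 1..<?p + t + 1 + k] @ [?p + t + 1 + k..<?p + m + 1]"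
    using assms(1) upt_add_eq_append[of "?p + 1" "?p + t + 1" "m - t"]
      upt_add_eq_append[of "?p + t + 1" "?p + t + 1 + k" "m - t - k"]
    by (simp add: ac_simps)
  let ?v = "gaps (?p + m + 1) vs"
  have "is": "gaps 0 (us @ m # vs) = gaps 0 us @ [?p + 1..<?p + t + 1] @
      [?p + t + 1..<?p + t + 1 + k] @ [?p + t + 1 + k..<?p + m + 1] @ ?v"
    unfolding gaps_group up by simp
  have low: "shift xs R = xs \<and> crossings xs R = 0 \<and> filter (\<lambda>l. l \<in> R) xs = []"
    if "\<And>l. l \<in> set xs \<Longrightarrow> l < ?p + t + 1" for xs
  proof -
    have "{r \<in> R. r < l} = {}" if "l \<in> set xs" for l
      using \<open>\<And>l. l \<in> set xs \<Longrightarrow> l < ?p + t + 1\<close>[OF that] R by auto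
    then have c: "card {r \<in> R. r < l} = 0" if "l \<in> set xs" for l using that by (simp only:) simp
    have n: "l \<notin> R" if "l \<in> set xs" for l
      using \<open>\<And>l. l \<in> set xs \<Longrightarrow> l < ?p + t + 1\<close>[OF that] R by auto
    show ?thesis using shift_const[of xs R 0, OF n c] n by (auto simp: filter_empty_conv)
  qed
  have high: "shift xs R = map (\<lambda>l. l - k) xs \<and> crossings xs R = length xs * k
      \<and> filter (\<lambda>l. l \<in> R) xs = []"
    if "\<And>l. l \<in> set xs \<Longrightarrow> ?p + t + 1 + k \<le> l" for xs
  proof -
    have "{r \<in> R. r < l} = R" if "l \<in> set xs" for l
      using \<open>\<And>l. l \<in> set xs \<Longrightarrow> _ \<le> l\<close>[OF that] R by auto
    then have c: "card {r \<in> R. r < l} = k" if "l \<in> set xs" for l using that R by (simp only:) simp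
    have n: "l \<notin> R" if "l \<in> set xs" for l
      using \<open>\<And>l. l \<in> set xs \<Longrightarrow> _ \<le> l\<close>[OF that] R by auto
    show ?thesis using shift_const[of xs R k, OF n c] n by (auto simp: filter_empty_conv)
  qed
  have us: "l \<in> set (gaps 0 us) \<Longrightarrow> l < ?p + t + 1" for l using gaps_bounds[of l 0 us] by simp
  have vs: "l \<in> set ?v \<Longrightarrow> ?p + t + 1 + k \<le> l" for l
    using gaps_bounds[of l "?p + m + 1" vs] assms(1) by simp
  note l1 = low[of "gaps 0 us", OF us] and h2 = high[of ?v, OF vs]
  have l2: "shift [?p + 1..<?p + t + 1] R = [?p + 1..<?p + t + 1] \<and>
      crossings [?p + 1..<?p + t + 1] R = 0 \<and> filter (\<lambda>l. l \<in> R) [?p + 1..<?p + t + 1] = []"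
    by (rule low) (simp del: upt_Suc)
  have h1: "shift [?p + t + 1 + k..<?p + m + 1] R = map (\<lambda>l. l - k) [?p + t + 1 + k..<?p + m + 1] \<and>
      crossings [?p + t + 1 + k..<?p + m + 1] R = length [?p + t + 1 + k..<?p + m + 1] * k \<and>
      filter (\<lambda>l. l \<in> R) [?p + t + 1 + k..<?p + m + 1] = []"
    by (rule high) (simp del: upt_Suc)
  have mid: "filter (\<lambda>l. l \<in> R) [?p + t + 1..<?p + t + 1 + k] = [?p + t + 1..<?p + t + 1 + k]"
    by (simp add: R filter_id_conv del: upt_Suc)
  have in_R: "set [?p + t + 1..<?p + t + 1 + k] \<subseteq> R" by (auto simp: R)
  show "filter (\<lambda>l. l \<in> R) (gaps 0 (us @ m # vs)) = [?p + t + 1..<?p + t + 1 + k]"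
    unfolding "is" filter_append mid using l1 l2 h1 h2 by (simp del: upt_Suc)
  have "[?p + 1..<?p + (m - k) + 1] = [?p + 1..<?p + t + 1] @ [?p + t + 1..<?p + (m - k) + 1]"
    using assms(1) upt_add_eq_append[of "?p + 1" "?p + t + 1" "m - k - t"] by (simp add: ac_simps)
  then have "gaps 0 (us @ (m - k) # vs) = gaps 0 us @ [?p + 1..<?p + t + 1] @
      [?p + t + 1..<?p + (m - k) + 1] @ gaps (?p + (m - k) + 1) vs"
    unfolding gaps_group by (simp only: append_assoc)
  moreover have "map (\<lambda>l. l - k) [?p + t + 1 + k..<?p + m + 1] = [?p + t + 1..<?p + (m - k) + 1]"
  proof -
    have "?p + t + 1 + k - k = ?p + t + 1" "?p + m + 1 - k = ?p + (m - k) + 1" using assms(1) by auto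
    then show ?thesis by (subst map_upt_minus) (simp_all only: le_add2)
  qed
  moreover have "map (\<lambda>l. l - k) ?v = gaps (?p + (m - k) + 1) vs"
  proof -
    have e: "?p + m + 1 - k = ?p + (m - k) + 1" and le: "k \<le> ?p + m + 1" using assms(1) by auto
    show ?thesis unfolding gaps_minus[OF le] e ..
  qed
  ultimately show "shift (gaps 0 (us @ m # vs)) R = gaps 0 (us @ (m - k) # vs)"
    unfolding "is" crossings_append shift_inside(1)[OF in_R] using l1 l2 h1 h2 by (simp del: upt_Suc)
  have "crossings (gaps 0 (us @ m # vs)) R = (m - t - k) * k + sum_list vs * k"
    unfolding "is" crossings_append shift_inside(2)[OF in_R] using l1 l2 h1 h2 assms(1)
    by (simp del: upt_Suc)
  then show "crossings (gaps 0 (us @ m # vs)) R = k * ((m - t - k) + sum_list vs)"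
    by (simp add: algebra_simps)
  show "R \<subseteq> set (gaps 0 (us @ m # vs))" unfolding "is" using in_R by (auto simp: R)
qed

text \<open>When a group is split into \<open>ns\<close>, this counts the pairs of a gap inside a
  piece and a later boundary between pieces. They are the inversions internal to the group.\<close>

fun weight :: "nat list \<Rightarrow> nat" where
  "weight [] = 0"
| "weight (n # ns) = n * length ns + weight ns"

text \<open>\<open>U\<close> and \<open>V\<close> are the parts of \<open>R\<close> to the left and
  right of the group. Missing from \<open>R\<close> are the boundaries between the pieces. A
  boundary is lowered by the number of elements of \<open>R\<close> below it, so from one boundary
  to the next the hat grows by one only. The induction moves the first piece into
  \<open>U\<close>.\<close>

lemma shift_group:
  assumes "letters ns = m + 1" "finite U" "card U = c" "\<And>r. r \<in> U \<Longrightarrow> r \<le> p"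
    and "\<And>r. r \<in> V \<Longrightarrow> p + m + 1 < r" "c \<le> p"
  shows "filter (\<lambda>l. l \<in> U \<union> set (gaps p ns) \<union> V) [p + 1..<p + m + 1] = gaps p ns \<and>
    shift [p + 1..<p + m + 1] (U \<union> set (gaps p ns) \<union> V) = [p + 1 - c..<p + length ns - c] \<and>
    crossings [p + 1..<p + m + 1] (U \<union> set (gaps p ns) \<union> V) = (length ns - 1) * c + weight ns"
  using assms
proof (induction ns arbitrary: p m U c)
  case (Cons n ns)
  let ?R = "U \<union> set (gaps p (n # ns)) \<union> V"
  let ?b = "[p + 1..<p + n + 1]"
  have b: "set ?b \<subseteq> ?R" by auto
  have fb: "filter (\<lambda>l. l \<in> ?R) ?b = ?b" using b by (auto simp: filter_id_conv subset_iff)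
  show ?case
  proof (cases "ns = []")
    case True
    then have "m = n" using Cons.prems(1) by simp
    then show ?thesis using shift_inside[OF b] fb True by (simp del: upt_Suc)
  next
    case False
    then have n1: "letters ns \<ge> 1" by (cases ns) auto
    define m' where "m' = letters ns - 1"
    have m': "letters ns = m' + 1" "m = n + m' + 1" using Cons.prems(1) n1 by (auto simp: m'_def)
    let ?x = "p + n + 1"
    have up: "[p + 1..<p + m + 1] = ?b @ [?x] @ [?x + 1..<?x + m' + 1]"
    proof -
      have "[p + 1..<p + m + 1] = ?b @ [?x..<?x + m' + 1]"
        using upt_add_eq_append[of "p + 1" "p + n + 1" "m' + 1"] m'(2) by (simp add: ac_simps)
      then show ?thesis by (simp add: upt_conv_Cons del: upt_Suc)
    qed
    let ?U = "U \<union> set ?b"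
    have "U \<inter> set ?b = {}" using Cons.prems(4) by fastforce
    then have U: "card ?U = c + n"
      using Cons.prems(2,3) by (simp add: card_Un_disjoint del: upt_Suc)
    have R: "?R = ?U \<union> set (gaps ?x ns) \<union> V" by auto
    have IH: "filter (\<lambda>l. l \<in> ?R) [?x + 1..<?x + m' + 1] = gaps ?x ns \<and>
      shift [?x + 1..<?x + m' + 1] ?R = [?x + 1 - (c + n)..<?x + length ns - (c + n)] \<and>
      crossings [?x + 1..<?x + m' + 1] ?R = (length ns - 1) * (c + n) + weight ns"
      unfolding R
    proof (rule Cons.IH[OF m'(1) _ U])
      show "r \<le> ?x" if "r \<in> ?U" for r using that Cons.prems(4)[of r] by auto
      show "?x + m' + 1 < r" if "r \<in> V" for r using Cons.prems(5)[OF that] m'(2) by simp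
    qed (use Cons.prems in auto)
    have xV: "r \<in> V \<Longrightarrow> ?x < r" for r using Cons.prems(5)[of r] m'(2) by simp
    have xN: "?x \<notin> ?R"
      unfolding R using xV Cons.prems(4)[of ?x] gaps_bounds[of ?x ?x ns] by auto
    have "{r \<in> ?R. r < ?x} = ?U"
      unfolding R using xV gaps_bounds[of _ ?x ns] Cons.prems(4) by fastforce
    then have "card {r \<in> ?R. r < ?x} = c + n" using U by simp
    then have sx: "shift [?x] ?R = [?x - (c + n)] \<and> crossings [?x] ?R = c + n
        \<and> filter (\<lambda>l. l \<in> ?R) [?x] = []"
      using xN by (simp add: shift_def crossings_def)
    have l1: "length ns \<ge> 1" using False by (cases ns) auto
    have e: "[p + 1 - c..<p + length (n # ns) - c] =
        [?x - (c + n)] @ [?x + 1 - (c + n)..<?x + length ns - (c + n)]"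
      using Cons.prems(6) l1 by (simp add: upt_conv_Cons Suc_diff_le del: upt_Suc)
    have "(length ns - 1) * (c + n) + (c + n) = length ns * (c + n)"
      using l1 by (cases "length ns") auto
    then show ?thesis
      unfolding up e filter_append fb crossings_append shift_inside[OF b] using IH sx
      by (simp del: upt_Suc add: algebra_simps)
  qed
qed simp

text \<open>The combinatorics of a face after \<open>f\<close>: \<open>R\<close> refines the group
  \<open>m\<close> into the pieces \<open>ns\<close>, and the face acts on the outputs of these
  pieces, which stand behind the \<open>length us\<close> outputs of the earlier groups. Each of the
  \<open>length ns - 1\<close> boundaries has all gaps of \<open>us\<close> below it, which gives
  the first summand of the crossing number.\<close>

lemma shift_split:
  assumes "letters ns = m + 1" and R: "R = set (gaps 0 (us @ ns @ vs))"
  shows "filter (\<lambda>l. l \<in> R) (gaps 0 (us @ m # vs)) = gaps 0 (us @ ns @ vs)"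
    and "shift (gaps 0 (us @ m # vs)) R = [length us + 1..<length us + length ns]"
    and "crossings (gaps 0 (us @ m # vs)) R = (length ns - 1) * sum_list us + weight ns"
    and "R \<subseteq> set (gaps 0 (us @ m # vs))"
    and "set (gaps 0 (us @ m # vs)) - R \<subseteq> {letters us<..letters us + m}"
proof -
  let ?p = "letters us"
  let ?u = "gaps 0 us" and ?v = "gaps (?p + m + 1) vs"
  have R': "R = set ?u \<union> set (gaps ?p ns) \<union> set ?v"
    unfolding R by (auto simp: gaps_append assms(1) add.assoc)
  have "is": "gaps 0 (us @ m # vs) = ?u @ [?p + 1..<?p + m + 1] @ ?v" by (rule gaps_group)
  have "filter (\<lambda>l. l \<in> R) [?p + 1..<?p + m + 1] = gaps ?p ns \<and>
    shift [?p + 1..<?p + m + 1] R = [?p + 1 - sum_list us..<?p + length ns - sum_list us] \<and>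
    crossings [?p + 1..<?p + m + 1] R = (length ns - 1) * sum_list us + weight ns"
    unfolding R'
  proof (rule shift_group[OF assms(1)])
    have "distinct ?u" using sorted_gaps strict_sorted_iff by auto
    then show "card (set ?u) = sum_list us" by (simp add: distinct_card)
    show "r \<le> ?p" if "r \<in> set ?u" for r using gaps_bounds[OF that] by simp
    show "?p + m + 1 < r" if "r \<in> set ?v" for r using gaps_bounds[OF that] by simp
    show "sum_list us \<le> ?p" by (simp add: letters_def)
  qed simp
  moreover have "set ?u \<subseteq> R" "set ?v \<subseteq> R" by (auto simp: R')
  moreover have "filter (\<lambda>l. l \<in> R) ?u = ?u" "filter (\<lambda>l. l \<in> R) ?v = ?v"
    by (auto simp: R' filter_id_conv)
  moreover have "gaps 0 (us @ ns @ vs) = ?u @ gaps ?p ns @ ?v"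
    by (simp add: gaps_append assms(1) add.assoc)
  moreover have "?p + 1 - sum_list us = length us + 1"
    "?p + length ns - sum_list us = length us + length ns"
    by (auto simp: letters_def)
  ultimately show "filter (\<lambda>l. l \<in> R) (gaps 0 (us @ m # vs)) = gaps 0 (us @ ns @ vs)"
    and "shift (gaps 0 (us @ m # vs)) R = [length us + 1..<length us + length ns]"
    and "crossings (gaps 0 (us @ m # vs)) R = (length ns - 1) * sum_list us + weight ns"
    unfolding "is" filter_append crossings_append
    by (simp_all add: shift_inside del: upt_Suc)
  have "set (gaps ?p ns) \<subseteq> set [?p + 1..<?p + m + 1]"
    using gaps_bounds[of _ ?p ns] assms(1) by fastforce
  then show "R \<subseteq> set (gaps 0 (us @ m # vs))"
    unfolding "is" R' by auto
  show "set (gaps 0 (us @ m # vs)) - R \<subseteq> {letters us<..letters us + m}"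
    unfolding "is" R' by auto
qed

text \<open>Let \<open>x\<close> and \<open>y\<close> be the first and last entries outside
  \<open>R\<close>. As the hats form a run, \<open>y - x + 1\<close> is the number of entries
  outside \<open>R\<close> plus the number of elements of \<open>R\<close> between \<open>x\<close>
  and \<open>y\<close>. So every integer from \<open>x\<close> to \<open>y\<close> is an entry, and
  the entries outside \<open>R\<close> cannot be spread over several groups.\<close>

lemma shift_interval:
  assumes "is": "sorted_wrt (<) is" and R: "R \<subseteq> set is" "R \<noteq> set is"
    and run: "shift is R = [j..<j + length (shift is R)]"
  shows "\<exists>a k. 1 \<le> k \<and> {a..<a + k} \<subseteq> set is \<and> set is - R \<subseteq> {a..<a + k}"
proof -
  let ?L = "filter (\<lambda>l. l \<notin> R) is"
  let ?c = "\<lambda>l. card {r \<in> R. r < l}"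
  have finR: "finite R" using R(1) finite_subset by blast
  have ne: "?L \<noteq> []" using R by (auto simp: filter_empty_conv)
  define x y where "x = hd ?L" and "y = last ?L"
  have sL: "sorted_wrt (<) ?L" using "is" by (simp add: sorted_wrt_filter)
  have mem: "x \<in> set ?L" "y \<in> set ?L" using ne by (auto simp: x_def y_def simp del: set_filter)
  have bounds: "x \<le> l \<and> l \<le> y" if l: "l \<in> set ?L" for l
  proof -
    obtain i where i: "i < length ?L" "?L ! i = l"
      using l unfolding in_set_conv_nth by blast
    have sorted: "sorted ?L" using sL strict_sorted_iff by blast
    have "?L ! 0 \<le> ?L ! i" by (rule sorted_nth_mono[OF sorted _ i(1)]) simp
    moreover have "?L ! i \<le> ?L ! (length ?L - 1)"
      by (rule sorted_nth_mono[OF sorted]) (use i(1) in linarith)+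
    ultimately show ?thesis unfolding x_def y_def hd_conv_nth[OF ne] last_conv_nth[OF ne] i(2) ..
  qed
  have xy: "x \<le> y" using bounds mem by blast
  have len: "length (shift is R) = length ?L" by (simp add: shift_def)
  have c_le: "?c l \<le> l" for l
    using card_mono[of "{..<l}" "{r \<in> R. r < l}"] by auto
  have "hd (shift is R) = x - ?c x" "last (shift is R) = y - ?c y"
    unfolding shift_def x_def y_def using ne by (simp_all add: hd_map last_map)
  moreover have "hd [j..<j + length ?L] = j" "last [j..<j + length ?L] = j + length ?L - 1"
    using ne by (simp_all add: hd_upt last_upt)
  ultimately have e: "x - ?c x = j" "y - ?c y = j + length ?L - 1"
    using run unfolding len by auto
  have "?c y = ?c x + card {r \<in> R. x \<le> r \<and> r < y}"
  proof -
    have "{r \<in> R. r < y} = {r \<in> R. r < x} \<union> {r \<in> R. x \<le> r \<and> r < y}" using xy by auto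
    moreover have "card ({r \<in> R. r < x} \<union> {r \<in> R. x \<le> r \<and> r < y}) =
        ?c x + card {r \<in> R. x \<le> r \<and> r < y}"
      by (rule card_Un_disjoint) (use finR in auto)
    ultimately show ?thesis by argo
  qed
  then have eq: "y + 1 - x = length ?L + card {r \<in> R. x \<le> r \<and> r < y}"
    using e c_le[of x] c_le[of y] ne by (cases ?L) auto
  have "card (set ?L \<union> {r \<in> R. x \<le> r \<and> r < y}) = card (set ?L) + card {r \<in> R. x \<le> r \<and> r < y}"
    using finR by (intro card_Un_disjoint) auto
  also have "card (set ?L) = length ?L"
    using sL strict_sorted_iff by (intro distinct_card) blast
  finally have "card (set ?L \<union> {r \<in> R. x \<le> r \<and> r < y}) = card {x..y}"
    using eq by simp
  moreover have "set ?L \<union> {r \<in> R. x \<le> r \<and> r < y} \<subseteq> {x..y}" using bounds by auto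
  ultimately have "{x..y} = set ?L \<union> {r \<in> R. x \<le> r \<and> r < y}"
    by (metis card_subset_eq finite_atLeastAtMost)
  then have "{x..y} \<subseteq> set is" using R by auto
  moreover have "set is - R \<subseteq> {x..y}" using bounds by auto
  moreover have "{x..y} = {x..<x + (y + 1 - x)}" using xy by auto
  ultimately show ?thesis using xy by (intro exI[of _ x] exI[of _ "y + 1 - x"]) auto
qed

section \<open>Sums over sets of gaps, distributed over the groups\<close>

context abelian_monoid
begin

text \<open>A nonempty run determines its group, its offset there and its length, so each subset on
  which \<open>X\<close> may be nonzero is listed exactly once.\<close>

lemma finsum_runs:
  assumes closed: "\<And>R. R \<subseteq> set (gaps 0 ms) \<Longrightarrow> X R \<in> carrier G"
    and zero: "\<And>R. R \<subseteq> set (gaps 0 ms) \<Longrightarrow> R \<noteq> {} \<Longrightarrow> \<not> (\<exists>j k. R = {j..<j + k}) \<Longrightarrow> X R = \<zero>"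
  shows "finsum G X (Pow (set (gaps 0 ms)) - {{}}) =
    (\<Oplus>i\<in>{..<length ms}. \<Oplus>p\<in>{(t, k). 1 \<le> k \<and> t + k \<le> ms ! i}.
      X {letters (take i ms) + fst p + 1..<letters (take i ms) + fst p + 1 + snd p})"
    (is "_ = (\<Oplus>i\<in>?I. \<Oplus>p\<in>?J i. X (?r i p))")
proof -
  let ?S = "set (gaps 0 ms)"
  let ?B = "{R. R \<subseteq> ?S \<and> R \<noteq> {} \<and> (\<exists>j k. R = {j..<j + k})}"
  have sub: "?r i p \<subseteq> ?S" if "i \<in> ?I" "p \<in> ?J i" for i p
  proof -
    have i: "i < length ms" and le: "fst p + snd p \<le> ms ! i" using that by auto
    show ?thesis
      using shift_run(4)[OF le refl, of "take i ms" "drop (Suc i) ms"]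
      unfolding split_group[OF i, symmetric] .
  qed
  have fin: "finite (?J i)" for i
    by (rule finite_subset[of _ "{..ms ! i} \<times> {..ms ! i}"]) auto
  have bij: "bij_betw (\<lambda>q. ?r (fst q) (snd q)) (Sigma ?I ?J) ?B"
  proof (rule bij_betwI')
    fix x y assume x: "x \<in> Sigma ?I ?J" and y: "y \<in> Sigma ?I ?J"
    obtain i t k i' t' k' where xy: "x = (i, t, k)" "y = (i', t', k')"
      by (cases x, cases y) auto
    have b: "1 \<le> k" "t + k \<le> ms ! i" "1 \<le> k'" "t' + k' \<le> ms ! i'" "i < length ms" "i' < length ms"
      using x y xy by auto
    show "?r (fst x) (snd x) = ?r (fst y) (snd y) \<longleftrightarrow> x = y"
    proof
      assume "?r (fst x) (snd x) = ?r (fst y) (snd y)"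
      then have "{letters (take i ms) + t + 1..<letters (take i ms) + t + 1 + k} =
          {letters (take i' ms) + t' + 1..<letters (take i' ms) + t' + 1 + k'}"
        by (simp add: xy)
      then have e: "letters (take i ms) + t = letters (take i' ms) + t'" "k = k'"
        using b(1,3) by (auto simp: atLeastLessThan_eq_iff)
      have "\<not> i < i'" "\<not> i' < i"
        using letters_take_mono[of i i' ms] letters_take_mono[of i' i ms] e(1) b by auto
      then show "x = y" using e xy by auto
    qed simp
  next
    fix x assume x: "x \<in> Sigma ?I ?J"
    then have "?r (fst x) (snd x) \<subseteq> ?S" by (intro sub) auto
    moreover have "?r (fst x) (snd x) \<noteq> {}" using x by auto
    ultimately show "?r (fst x) (snd x) \<in> ?B" by blast
  next
    fix R assume R: "R \<in> ?B"
    then obtain j k where jk: "R = {j..<j + k}" "R \<noteq> {}" by blast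
    then have k: "1 \<le> k" by (cases k) auto
    then obtain i t where "i < length ms" "t + k \<le> ms ! i" "j = letters (take i ms) + t + 1"
      using run_in_group[of j k 0 ms] R jk(1) k by auto
    then show "\<exists>x\<in>Sigma ?I ?J. R = ?r (fst x) (snd x)"
      using jk(1) k by (intro bexI[of _ "(i, t, k)"]) auto
  qed
  have "finsum G X (Pow ?S - {{}}) = finsum G X ?B"
    by (rule finsum_subset) (use closed zero in auto)
  also have "\<dots> = (\<Oplus>q\<in>Sigma ?I ?J. X (?r (fst q) (snd q)))"
    by (rule finsum_bij[OF bij]) (use closed in auto)
  also have "\<dots> = (\<Oplus>i\<in>?I. \<Oplus>p\<in>?J i. X (?r i p))"
    by (rule finsum_Sigma[symmetric]) (use fin closed sub in auto)
  finally show ?thesis .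
qed

text \<open>A proper subset with consecutive hats omits gaps of one group only and thereby cuts it
  into pieces \<open>ns\<close>. The trivial splitting is left out since it yields the full
  set.\<close>

lemma finsum_splits:
  assumes closed: "\<And>R. R \<subseteq> set (gaps 0 ms) \<Longrightarrow> X R \<in> carrier G"
    and zero: "\<And>R. R \<subseteq> set (gaps 0 ms) \<Longrightarrow> R \<noteq> set (gaps 0 ms) \<Longrightarrow>
      \<not> (\<exists>j. shift (gaps 0 ms) R = [j..<j + length (shift (gaps 0 ms) R)]) \<Longrightarrow> X R = \<zero>"
  shows "finsum G X (Pow (set (gaps 0 ms)) - {set (gaps 0 ms)}) =
    (\<Oplus>i\<in>{..<length ms}. \<Oplus>ns\<in>{ns. letters ns = ms ! i + 1} - {[ms ! i]}.
      X (set (gaps 0 (take i ms @ ns @ drop (Suc i) ms))))"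
    (is "_ = (\<Oplus>i\<in>?I. \<Oplus>ns\<in>?J i. X (?r i ns))")
proof -
  let ?is = "gaps 0 ms"
  let ?S = "set (gaps 0 ms)"
  let ?B = "{R. R \<subseteq> ?S \<and> R \<noteq> ?S \<and> (\<exists>j. shift ?is R = [j..<j + length (shift ?is R)])}"
  have lt: "letters (take i ms @ ns @ drop (Suc i) ms) = letters ms" if "i \<in> ?I" "ns \<in> ?J i" for i ns
  proof -
    have "letters ms = letters (take i ms @ ms ! i # drop (Suc i) ms)"
      using that(1) by (simp add: id_take_nth_drop[symmetric] del: letters_simps)
    then show ?thesis using that(2) by simp
  qed
  have ne: "?r i ns \<noteq> ?S" if "i \<in> ?I" "ns \<in> ?J i" for i ns
  proof
    assume "?r i ns = ?S"
    then have "gaps 0 (take i ms @ ns @ drop (Suc i) ms) = gaps 0 ms"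
      by (intro strict_sorted_equal sorted_gaps) simp
    then have "take i ms @ ns @ drop (Suc i) ms = ms" by (rule gaps_inj) (rule lt[OF that])
    then have "take i ms @ ns @ drop (Suc i) ms = take i ms @ [ms ! i] @ drop (Suc i) ms"
      by (rule trans) (use that(1) in \<open>simp add: id_take_nth_drop[symmetric]\<close>)
    then have "ns = [ms ! i]" by simp
    then show False using that by simp
  qed
  note sp = shift_split[of _ "ms ! i" _ "take i ms" "drop (Suc i) ms" for i]
  have sub: "?r i ns \<subseteq> ?S" "?S - ?r i ns \<subseteq> {letters (take i ms)<..letters (take i ms) + ms ! i}"
    "shift ?is (?r i ns) = [i + 1..<i + length ns]"
    if "i \<in> ?I" "ns \<in> ?J i" for i ns
  proof -
    have i: "i < length ms" and l: "letters ns = ms ! i + 1" using that by auto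
    show "?r i ns \<subseteq> ?S" "?S - ?r i ns \<subseteq> {letters (take i ms)<..letters (take i ms) + ms ! i}"
      "shift ?is (?r i ns) = [i + 1..<i + length ns]"
      using sp(4)[OF l refl] sp(5)[OF l refl] sp(2)[OF l refl] i
      unfolding split_group[OF i, symmetric] by (auto simp: min_def)
  qed
  have fin: "finite (?J i)" for i
  proof (rule finite_subset)
    show "?J i \<subseteq> {ns. set ns \<subseteq> {..ms ! i + 1} \<and> length ns \<le> ms ! i + 1}"
      by (auto simp: letters_def dest!: member_le_sum_list)
    show "finite {ns. set ns \<subseteq> {..ms ! i + 1} \<and> length ns \<le> ms ! i + 1}"
      by (rule finite_lists_length_le) simp
  qed
  have bij: "bij_betw (\<lambda>q. ?r (fst q) (snd q)) (Sigma ?I ?J) ?B"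
  proof (rule bij_betwI')
    fix x y assume x: "x \<in> Sigma ?I ?J" and y: "y \<in> Sigma ?I ?J"
    obtain i ns i' ns' where xy: "x = (i, ns)" "y = (i', ns')"
      by (cases x, cases y) auto
    have b: "i \<in> ?I" "i' \<in> ?I" "ns \<in> ?J i" "ns' \<in> ?J i'" using x y xy by auto
    show "?r (fst x) (snd x) = ?r (fst y) (snd y) \<longleftrightarrow> x = y"
    proof
      assume "?r (fst x) (snd x) = ?r (fst y) (snd y)"
      then have eq: "?r i ns = ?r i' ns'" by (simp add: xy)
      \<comment> \<open>An omitted gap reveals the group that is being split.\<close>
      obtain l where l: "l \<in> ?S - ?r i ns" using ne[OF b(1,3)] sub(1)[OF b(1,3)] by blast
      then have "l \<in> {letters (take i ms)<..letters (take i ms) + ms ! i}"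
          "l \<in> {letters (take i' ms)<..letters (take i' ms) + ms ! i'}"
        using sub(2)[OF b(1,3)] sub(2)[OF b(2,4)] eq by blast+
      then have "\<not> i < i'" "\<not> i' < i"
        using letters_take_mono[of i i' ms] letters_take_mono[of i' i ms] b by auto
      then have i: "i = i'" by simp
      have "gaps 0 (take i ms @ ns @ drop (Suc i) ms) = gaps 0 (take i' ms @ ns' @ drop (Suc i') ms)"
        using eq by (intro strict_sorted_equal sorted_gaps) simp
      then have "take i ms @ ns @ drop (Suc i) ms = take i' ms @ ns' @ drop (Suc i') ms"
        by (rule gaps_inj) (simp only: lt[OF b(1,3)] lt[OF b(2,4)])
      then show "x = y" using i xy by simp
    qed simp
  next
    fix x assume x: "x \<in> Sigma ?I ?J"
    obtain i ns where xy: "x = (i, ns)" "i \<in> ?I" "ns \<in> ?J i" using x by (cases x) auto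
    have "1 \<le> length ns" using xy(3) by (cases ns) auto
    then have "i + length ns = i + 1 + length [i + 1..<i + length ns]" by simp
    then have "[i + 1..<i + length ns] = [i + 1..<i + 1 + length [i + 1..<i + length ns]]"
      by (rule arg_cong)
    then have "shift ?is (?r i ns) = [i + 1..<i + 1 + length (shift ?is (?r i ns))]"
      unfolding sub(3)[OF xy(2,3)] .
    then have "?r i ns \<in> ?B" using sub(1)[OF xy(2,3)] ne[OF xy(2,3)] by blast
    then show "?r (fst x) (snd x) \<in> ?B" unfolding xy(1) fst_conv snd_conv .
  next
    fix R assume R: "R \<in> ?B"
    then obtain a k where ak: "1 \<le> k" "{a..<a + k} \<subseteq> ?S" "?S - R \<subseteq> {a..<a + k}"
      using shift_interval[OF sorted_gaps, of R 0 ms] by blast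
    then obtain i t where it: "i < length ms" "t + k \<le> ms ! i" "a = letters (take i ms) + t + 1"
      using run_in_group[of a k 0 ms] by auto
    define us m vs where "us = take i ms" and "m = ms ! i" and "vs = drop (Suc i) ms"
    have ms': "ms = us @ m # vs" using split_group[OF it(1)] by (simp add: us_def m_def vs_def)
    let ?p = "letters us"
    \<comment> \<open>The pieces are read off from those gaps of the group that stay in
      \<open>R\<close>.\<close>
    let ?g = "filter (\<lambda>l. l \<in> R) [?p + 1..<?p + m + 1]"
    have "sorted_wrt (<) ?g" by (simp add: sorted_wrt_filter del: upt_Suc)
    moreover have "set ?g \<subseteq> {?p<..<?p + (m + 1)}" by auto
    ultimately obtain n ns where ns: "letters (n # ns) = m + 1" "gaps ?p (n # ns) = ?g"
      using gaps_ex[of ?g ?p "m + 1"] by auto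
    have "set (gaps 0 us) \<subseteq> R"
    proof
      fix l assume l: "l \<in> set (gaps 0 us)"
      then have "l < a" using gaps_bounds[of l 0 us] it(3) by (simp add: us_def)
      then show "l \<in> R" using l ak(3) unfolding ms' gaps_group by auto
    qed
    moreover have "set (gaps (?p + m + 1) vs) \<subseteq> R"
    proof
      fix l assume l: "l \<in> set (gaps (?p + m + 1) vs)"
      then have "a + k \<le> l" using gaps_bounds[of l "?p + m + 1" vs] it(2,3) by (simp add: us_def m_def)
      then show "l \<in> R" using l ak(3) unfolding ms' gaps_group by auto
    qed
    moreover have "R \<subseteq> set (gaps 0 us) \<union> set [?p + 1..<?p + m + 1] \<union> set (gaps (?p + m + 1) vs)"
      using R unfolding ms' gaps_group by auto
    moreover have "gaps 0 (us @ (n # ns) @ vs) = gaps 0 us @ ?g @ gaps (?p + m + 1) vs"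
      unfolding gaps_append ns(1) add_0 ns(2) add.assoc ..
    ultimately have eq: "R = set (gaps 0 (us @ (n # ns) @ vs))" by (auto simp del: upt_Suc)
    moreover have "n # ns \<noteq> [m]" using R eq unfolding ms' by auto
    ultimately show "\<exists>x\<in>Sigma ?I ?J. R = ?r (fst x) (snd x)"
      using ns(1) it(1) by (intro bexI[of _ "(i, n # ns)"]) (auto simp: us_def m_def vs_def)
  qed
  have "finsum G X (Pow ?S - {?S}) = finsum G X ?B"
    by (rule finsum_subset) (use closed zero in auto)
  also have "\<dots> = (\<Oplus>q\<in>Sigma ?I ?J. X (?r (fst q) (snd q)))"
    by (rule finsum_bij[OF bij]) (use closed in auto)
  also have "\<dots> = (\<Oplus>i\<in>?I. \<Oplus>p\<in>?J i. X (?r i p))"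
    by (rule finsum_Sigma[symmetric]) (use fin closed sub(1) in auto)
  finally show ?thesis .
qed

end

section \<open>The maps of the tensor module on words\<close>

text \<open>For the identity this is the exponent \<gamma> of the tensor morphism, for
  \<open>Suc\<close> the exponent \<epsilon> in the relation for morphisms of
  \<open>A\<^sub>\<infinity>\<close>-algebras.\<close>

primrec pair_sum :: "(nat \<Rightarrow> nat) \<Rightarrow> nat list \<Rightarrow> nat" where
  "pair_sum g [] = 0"
| "pair_sum g (x # xs) = g x * sum_list xs + pair_sum g xs"

lemma pair_sum_eq: "(\<Sum>i<length xs - 1. g (xs ! i) * sum_list (drop (i + 1) xs)) = pair_sum g xs"
proof (induction xs)
  case (Cons x xs)
  show ?case
  proof (cases xs)
    case (Cons y ys)
    then have "length (x # xs) - 1 = Suc (length xs - 1)" by simp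
    then show ?thesis using Cons.IH
      by (simp only: sum.lessThan_Suc_shift) (simp add: Cons)
  qed simp
qed simp

text \<open>A group of one letter has no gap and contributes no block. Any other group contributes
  exactly one, maximal because the boundary behind it is not a gap.\<close>

primrec blocks_of :: "nat \<Rightarrow> nat list \<Rightarrow> nat list list" where
  "blocks_of p [] = []"
| "blocks_of p (m # ms) = (if m = 0 then blocks_of (p + 1) ms
     else [p + 1..<p + m + 1] # blocks_of (p + m + 1) ms)"

lemma blocks_run:
  "js = [] \<or> hd js > a + m + 1 \<Longrightarrow> blocks ([a..<a + m + 1] @ js) = [a..<a + m + 1] # blocks js"
proof (induction m arbitrary: a)
  case 0
  then show ?case by (cases js) auto
next
  case (Suc m)
  have "[a..<a + Suc m + 1] @ js = a # (a + 1) # ([a + 2..<a + Suc m + 1] @ js)"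
    by (simp add: upt_conv_Cons del: upt_Suc)
  moreover have "(a + 1) # ([a + 2..<a + Suc m + 1] @ js) = [a + 1..<a + 1 + m + 1] @ js"
    by (simp add: upt_conv_Cons del: upt_Suc)
  moreover have "blocks ([a + 1..<a + 1 + m + 1] @ js) = [a + 1..<a + 1 + m + 1] # blocks js"
    using Suc.prems by (intro Suc.IH) auto
  ultimately show ?case by (simp add: upt_conv_Cons del: upt_Suc)
qed

lemma blocks_gaps: "blocks (gaps p ms) = blocks_of p ms"
proof (induction ms arbitrary: p)
  case (Cons m ms)
  show ?case
  proof (cases m)
    case (Suc m')
    have "gaps (p + m + 1) ms = [] \<or> hd (gaps (p + m + 1) ms) > p + 1 + m' + 1"
    proof (cases "gaps (p + m + 1) ms")
      case (Cons a l)
      then show ?thesis using gaps_bounds[of a "p + m + 1" ms] Suc by auto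
    qed simp
    from blocks_run[OF this] show ?thesis using Cons.IH Suc by (simp del: upt_Suc)
  qed (use Cons in simp)
qed simp

lemma hd_blocks_of: "blocks_of p ms \<noteq> [] \<Longrightarrow> p < hd (hd (blocks_of p ms))"
  by (induction ms arbitrary: p) (fastforce simp: upt_conv_Cons simp del: upt_Suc)+

lemma map_length_blocks_of: "map length (blocks_of p ms) = filter (\<lambda>m. m \<noteq> 0) ms"
  by (induction ms arbitrary: p) auto

lemma block_sign_eq: "block_sign (blocks_of p ms) = pair_sum (\<lambda>m. m) ms"
proof -
  have f: "sum_list (filter ((<) 0) ms) = sum_list ms" for ms :: "nat list"
    by (induction ms) auto
  have "block_sign bs = pair_sum (\<lambda>m. m) (map length bs)" for bs
    unfolding block_sign_def pair_sum_eq[symmetric] by (auto simp: drop_map)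
  also have "pair_sum (\<lambda>m. m) (map length (blocks_of p ms)) = pair_sum (\<lambda>m. m) ms"
    unfolding map_length_blocks_of by (induction ms) (auto simp: f)
  finally show ?thesis .
qed

text \<open>Reads the formula with the numbers \<open>k\<^sub>i\<close> as one factor per group.
  \<open>gap\<close> is \<open>block_gap\<close> with a starting offset \<open>p\<close>, as the
  induction requires: a leading group of one letter raises the gap of the first block by one, and a
  leading longer group is itself a block with gap 1.\<close>

lemma block_factors:
  fixes g :: "nat \<Rightarrow> nat" and F :: "nat \<Rightarrow> 'c"
  defines "gap p bs i \<equiv> (if i = 0 then hd (bs ! 0) - p else hd (bs ! i) - last (bs ! (i - 1)) - 1)"
  shows "concat (map (\<lambda>i. replicate (gap p (blocks_of p ms) i - 1) (F 0)
        @ [F (length (blocks_of p ms ! i))]) [0..<length (blocks_of p ms)])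
      @ replicate (letters ms - (\<Sum>i<length (blocks_of p ms). gap p (blocks_of p ms) i) - sum_list ms) (F 0)
    = map F ms"
proof (induction ms arbitrary: p)
  case (Cons m ms)
  show ?case
  proof (cases "m = 0")
    case True
    let ?bs = "blocks_of (p + 1) ms"
    have bs: "blocks_of p (m # ms) = ?bs" using True by simp
    show ?thesis
    proof (cases ?bs)
      \<comment> \<open>Without blocks only the trailing copies of \<open>F 0\<close> remain, one
        for each letter.\<close>
      case Nil
      then have "map F ms = replicate (letters ms - sum_list ms) (F 0)"
        using Cons.IH[of "p + 1"] by simp
      moreover have "letters (m # ms) - sum_list (m # ms) = Suc (letters ms - sum_list ms)"
        using True by (simp add: letters_def)
      ultimately show ?thesis unfolding bs Nil using True by simp
    next
      case (Cons b bs')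
      then have h: "p + 1 < hd b" using hd_blocks_of[of "p + 1" ms] by simp
      have 0: "gap p ?bs 0 = Suc (gap (p + 1) ?bs 0)" "gap (p + 1) ?bs 0 \<noteq> 0"
        using h Cons by (auto simp: gap_def)
      have S: "gap p ?bs (Suc i) = gap (p + 1) ?bs (Suc i)" for i by (simp add: gap_def)
      have len: "length ?bs = Suc (length bs')" using Cons by simp
      have sums: "(\<Sum>i<length ?bs. gap p ?bs i) = Suc (\<Sum>i<length ?bs. gap (p + 1) ?bs i)"
        unfolding len sum.lessThan_Suc_shift by (simp only: 0(1) S add_Suc)
      obtain g' where g': "gap (p + 1) ?bs 0 = Suc g'" using 0(2) not0_implies_Suc by blast
      then have rep: "gap p ?bs 0 = Suc (Suc g')" using 0(1) by simp
      have l: "letters (m # ms) - Suc x - sum_list (m # ms) = letters ms - x - sum_list ms" for x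
        using True by simp
      have upt: "[0..<length ?bs] = 0 # map Suc [0..<length bs']"
        unfolding len by (simp add: upt_conv_Cons map_Suc_upt del: upt_Suc)
      show ?thesis
        using Cons.IH[of "p + 1"] unfolding bs sums l unfolding upt
        by (simp add: rep[simplified] g'[simplified] S[simplified] True comp_def)
    qed
  next
    case False
    let ?bs = "blocks_of (p + m + 1) ms"
    have bs: "blocks_of p (m # ms) = [p + 1..<p + m + 1] # ?bs" (is "_ = ?b # _") using False by simp
    have b: "hd ?b = p + 1" "last ?b = p + m" using False by (simp_all add: hd_upt last_upt del: upt_Suc)
    have 0: "gap p (?b # ?bs) 0 = 1" unfolding gap_def using b by simp
    have S: "gap p (?b # ?bs) (Suc i) = gap (p + m + 1) ?bs i" if "i < length ?bs" for i
      using b by (cases i) (auto simp: gap_def simp del: upt_Suc)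
    have sums: "(\<Sum>i<length (?b # ?bs). gap p (?b # ?bs) i) = Suc (\<Sum>i<length ?bs. gap (p + m + 1) ?bs i)"
    proof -
      have "(\<Sum>i<length ?bs. gap p (?b # ?bs) (Suc i)) = (\<Sum>i<length ?bs. gap (p + m + 1) ?bs i)"
        by (rule sum.cong[OF refl]) (rule S, simp)
      then show ?thesis unfolding length_Cons sum.lessThan_Suc_shift 0 by (simp only: add_Suc plus_1_eq_Suc)
    qed
    have l: "letters (m # ms) - Suc x - sum_list (m # ms) = letters ms - x - sum_list ms" for x
      by simp
    have upt: "[0..<length (?b # ?bs)] = 0 # map Suc [0..<length ?bs]"
      by (simp add: upt_conv_Cons map_Suc_upt del: upt_Suc)
    have "map (\<lambda>i. replicate (gap p (?b # ?bs) i - 1) (F 0) @ [F (length ((?b # ?bs) ! i))])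
        [0..<length (?b # ?bs)] =
      [F m] # map (\<lambda>i. replicate (gap (p + m + 1) ?bs i - 1) (F 0) @ [F (length (?bs ! i))])
        [0..<length ?bs]"
    proof -
      have "map (\<lambda>i. replicate (gap p (?b # ?bs) (Suc i) - 1) (F 0) @ [F (length ((?b # ?bs) ! Suc i))])
          [0..<length ?bs] =
        map (\<lambda>i. replicate (gap (p + m + 1) ?bs i - 1) (F 0) @ [F (length (?bs ! i))]) [0..<length ?bs]"
      proof (rule map_cong[OF refl])
        fix i assume "i \<in> set [0..<length ?bs]"
        then have "i < length ?bs" by simp
        then show "replicate (gap p (?b # ?bs) (Suc i) - 1) (F 0) @ [F (length ((?b # ?bs) ! Suc i))] =
            replicate (gap (p + m + 1) ?bs i - 1) (F 0) @ [F (length (?bs ! i))]"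
          by (simp only: S nth_Cons_Suc)
      qed
      then show ?thesis unfolding upt list.map map_map comp_def 0 by (simp del: upt_Suc)
    qed
    then show ?thesis
      using Cons.IH[of "p + m + 1"] unfolding bs sums l by (simp del: upt_Suc)
  qed
qed simp

sublocale graded_differential_module \<subseteq> graded_module K A
  by (intro graded_module.intro ground_ring.intro graded_module_axioms.intro module_A cring_axioms)

context graded_differential_module
begin

lemma diff_ok: "factor_ok K A A (diff_factor d)"
  by (rule diff_factor_ok) (rule d_hom)

sublocale self: graded_modules K A A ..

end

lemma factor_ok_simps [simp]:
  "fst id_factor = 1" "fst (snd id_factor) = 0"
  "fst (diff_factor d) = 1" "fst (snd (diff_factor d)) = -1"
  "fst (map_factor K A r e g) = r" "fst (snd (map_factor K A r e g)) = int e"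
  "fst (pi_factor K A \<pi> n) = n + 2" "fst (snd (pi_factor K A \<pi> n)) = int n"
  "fst (mor_factor K A f n) = n + 1" "fst (snd (mor_factor K A f n)) = int n"
  by (auto simp: id_factor_def diff_factor_def map_factor_def pi_factor_def mor_factor_def)

lemma id_factors [simp]:
  "arity (replicate n id_factor) = n" "factors_deg (replicate n id_factor) = 0"
  by (induction n) auto

lemma apply_id_factors: "length w = n \<Longrightarrow> apply_factors (replicate n id_factor) w = w"
proof (induction n arbitrary: w)
  case (Suc n)
  then obtain l v where w: "w = l # v" "length v = n" by (cases w) auto
  then show ?case using Suc.IH[of v] by (simp add: id_factor_def)
qed simp

lemma koszul_id_factors:
  fixes w :: "'a word"
  shows "koszul (replicate n id_factor) w = 0"
proof (induction n arbitrary: w)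
  case (Suc n)
  obtain g :: "'a word \<Rightarrow> 'a" where g: "id_factor = (1, 0, g)" by (simp add: id_factor_def)
  have "koszul ((1, 0, g) # replicate n id_factor) w = 0"
    using Suc.IH by simp
  then show ?case by (simp add: g)
qed simp

section \<open>Operations applied inside a word, and the faces\<close>

context A_infinity_algebra
begin

text \<open>The differential is treated as the operation of arity 1 missing from \<open>\<pi>\<close>: \<open>op_factor k\<close> is
  the map called \<open>\<pi>\<close> with index \<open>k - 1\<close> in the paper, and \<open>d\<close> for \<open>k = 0\<close>.\<close>

definition op_factor :: "nat \<Rightarrow> ('a, 'a) factor" where
  "op_factor k = (if k = 0 then diff_factor d else pi_factor K A \<pi> (k - 1))"

definition op :: "nat \<Rightarrow> 'a word \<Rightarrow> 'a" where
  "op k w = snd (snd (op_factor k)) w"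

text \<open>The word after applying the operation with \<open>k + 1\<close> inputs behind the first
  \<open>t\<close> letters. It carries no sign; the Koszul exponent is kept apart. The operation has
  degree \<open>k - 1\<close>, so that \<open>k = 0\<close> gives \<open>d\<close>.\<close>

definition contract :: "nat \<Rightarrow> nat \<Rightarrow> 'a word \<Rightarrow> 'a word" where
  "contract t k w = take t w @
     (wdeg (take (k + 1) (drop t w)) + int k - 1, op k (take (k + 1) (drop t w))) # drop (t + k + 1) w"

lemma op_factor_ok: "factor_ok K A A (op_factor k)"
proof (cases k)
  case (Suc n)
  have "factor_ok K A A (map_factor K A (n + 2) n (\<pi> n))"
    by (rule self.map_factor_ok) (rule pi_hom)
  then show ?thesis by (simp add: op_factor_def pi_factor_def Suc)
qed (simp add: op_factor_def diff_ok)

lemma op_factor_simps [simp]: "fst (op_factor k) = k + 1" "fst (snd (op_factor k)) = int k - 1"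
  by (auto simp: op_factor_def)

lemma op_factor_eq: "op_factor k = (k + 1, int k - 1, op k)"
  by (auto simp: op_def prod_eq_iff)

lemma op_closed: "wf_word A w \<Longrightarrow> length w = k + 1 \<Longrightarrow> op k w \<in> carrier (A (wdeg w + int k - 1))"
  using factor_ok_closed[of K A A "k + 1" "int k - 1" "op k" w] op_factor_ok[of k]
  by (simp add: op_factor_eq add_diff_eq)

lemma apply_insert:
  assumes "t + k < length w"
  shows "apply_factors (replicate t id_factor @ [op_factor k] @ replicate (length w - t - k - 1) id_factor) w
      = contract t k w"
    and "koszul (replicate t id_factor @ [op_factor k] @ replicate (length w - t - k - 1) id_factor) w
      = (int k - 1) * wdeg (take t w)"
proof -
  let ?x = "take t w" and ?y = "take (k + 1) (drop t w)" and ?z = "drop (t + k + 1) w"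
  have w: "w = ?x @ ?y @ ?z"
    by (metis add.assoc append_take_drop_id drop_drop add.commute)
  have len: "length ?x = t" "length ?y = k + 1" "length ?z = length w - t - k - 1"
    using assms by auto
  let ?n = "length w - t - k - 1"
  have "apply_factors (replicate t id_factor @ [op_factor k] @ replicate ?n id_factor) (?x @ ?y @ ?z)
      = contract t k w"
    using len by (subst apply_factors_append, simp)
      (subst apply_factors_append, simp, simp add: apply_id_factors op_factor_eq contract_def add_diff_eq)
  then show "apply_factors (replicate t id_factor @ [op_factor k] @ replicate ?n id_factor) w
      = contract t k w"
    using w by simp
  have "koszul (replicate t id_factor @ [op_factor k] @ replicate ?n id_factor) (?x @ ?y @ ?z)
      = (int k - 1) * wdeg ?x"
    using len by (subst koszul_append, simp)
      (subst koszul_append, simp, simp add: koszul_id_factors op_factor_eq)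
  then show "koszul (replicate t id_factor @ [op_factor k] @ replicate ?n id_factor) w
      = (int k - 1) * wdeg ?x"
    using w by simp
qed

lemma insert_ok:
  "\<forall>g\<in>set (replicate a id_factor @ [op_factor k] @ replicate b id_factor). factor_ok K A A g"
  using id_factor_ok op_factor_ok by auto

lemma insert_hom:
  assumes "a + k + 1 + b = n" "n - k = m" "q + int k - 1 = q'"
  shows "tensor_map K A (replicate a id_factor @ [op_factor k] @ replicate b id_factor) q
    \<in> lin_hom K (T n q) (T m q')"
  by (rule self.tensor_map_hom[OF insert_ok]) (use assms in auto)

lemma insert_pure:
  assumes "w \<in> words A n q" "t + k + 1 + b = n" "n - k = m" "q + int k - 1 = q'"
  shows "tensor_map K A (replicate t id_factor @ [op_factor k] @ replicate b id_factor) q (pure_tensor K A w)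
    = signed (T m q') ((int k - 1) * wdeg (take t w)) (pure_tensor K A (contract t k w))"
proof -
  have b: "b = length w - t - k - 1" "t + k < length w" using assms by (auto simp: words_iff)
  have "tensor_map K A (replicate t id_factor @ [op_factor k] @ replicate b id_factor) q (pure_tensor K A w)
    = signed (T m q') (koszul (replicate t id_factor @ [op_factor k] @ replicate b id_factor) w)
      (pure_tensor K A (apply_factors (replicate t id_factor @ [op_factor k] @ replicate b id_factor) w))"
    by (rule self.tensor_map_pure[OF insert_ok]) (use assms in auto)
  then show ?thesis unfolding b(1) apply_insert[OF b(2)] .
qed

lemma contract_words:
  assumes "w \<in> words A n q" "t + k < n"
  shows "contract t k w \<in> words A (n - k) (q + int k - 1)"
proof -
  let ?b = "n - t - k - 1"
  let ?gs = "replicate t id_factor @ [op_factor k] @ replicate ?b id_factor"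
  have l: "length w = n" "t + k < length w" using assms by (auto simp: words_iff)
  have "apply_factors ?gs w \<in> words A (length ?gs) (q + factors_deg ?gs)"
    by (rule self.apply_factors_words[OF insert_ok]) (use assms in auto)
  moreover have "length ?gs = n - k" "q + factors_deg ?gs = q + int k - 1"
    using assms(2) by auto
  moreover have "apply_factors ?gs w = contract t k w"
    using apply_insert(1)[OF l(2)] unfolding l(1) .
  ultimately show ?thesis by (simp only:)
qed

text \<open>Contractions are local, which allows a relation on a subword to be moved into a larger
  word.\<close>

lemma contract_append:
  assumes "t + k < length y"
  shows "contract (length x + t) k (x @ y @ z) = x @ contract t k y @ z"
  using assms by (simp add: contract_def)

lemma diff_factor_op: "diff_factor d = op_factor 0" by (simp add: op_factor_def)

lemma tensor_diff_hom: "tensor_diff K A d n q \<in> lin_hom K (T n q) (T n (q - 1))"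
  unfolding tensor_diff_def diff_factor_op
  by (intro lin_hom_finsum tensor_power_module insert_hom) auto

lemma tensor_diff_pure:
  assumes "w \<in> words A n q"
  shows "tensor_diff K A d n q (pure_tensor K A w) =
    (\<Oplus>\<^bsub>T n (q - 1)\<^esub>t\<in>{..<n}.
      signed (T n (q - 1)) (wdeg (take t w)) (pure_tensor K A (contract t 0 w)))"
proof -
  interpret Tn: module K "T n (q - 1)" by (rule tensor_power_module)
  show ?thesis
    unfolding tensor_diff_def diff_factor_op
  proof (rule Tn.finsum_eq_cong)
    fix t assume t: "t \<in> {..<n}"
    have "tensor_map K A (replicate t id_factor @ [op_factor 0] @ replicate (n - 1 - t) id_factor) q
        (pure_tensor K A w) =
      signed (T n (q - 1)) ((int 0 - 1) * wdeg (take t w)) (pure_tensor K A (contract t 0 w))"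
      by (rule insert_pure[OF assms]) (use t in auto)
    also have "\<dots> = signed (T n (q - 1)) (wdeg (take t w)) (pure_tensor K A (contract t 0 w))"
      by (rule signed_cong) simp
    finally show "tensor_map K A (replicate t id_factor @ [op_factor 0] @ replicate (n - 1 - t) id_factor) q
        (pure_tensor K A w) =
      signed (T n (q - 1)) (wdeg (take t w)) (pure_tensor K A (contract t 0 w))" .
    show "signed (T n (q - 1)) (wdeg (take t w)) (pure_tensor K A (contract t 0 w)) \<in> carrier (T n (q - 1))"
      using contract_words[OF assms, of t 0] t
      by (intro signed_closed[OF tensor_power_module] pure_tensor_closed) auto
  qed simp
qed

lemma tensor_face_run:
  assumes "t + k < n" "1 \<le> k"
  shows "tensor_face K A \<pi> n q [t + 1..<t + 1 + k] x =
    signed (T (n - k) (q + int k - 1)) (int k * (q - 1))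
      (tensor_map K A (replicate t id_factor @ [op_factor k] @ replicate (n - k - (t + 1)) id_factor) q x)"
proof -
  have "hd [t + 1..<t + 1 + k] = t + 1" using assms by (intro hd_upt) simp
  moreover have "t + 1 \<le> n - k" using assms by linarith
  ultimately show ?thesis
    using assms(2) by (simp add: tensor_face_def Let_def op_factor_def del: upt_Suc)
qed

text \<open>In terms of the number \<open>t = j - 1\<close> of letters to the left, the bounds
  \<open>1 \<le> j\<close> and \<open>j \<le> n - k\<close> for a nonzero face become
  \<open>t + k < n\<close>.\<close>

lemma tensor_face_zero:
  assumes "\<not> (\<exists>t. is = [t + 1..<t + 1 + length is] \<and> t + length is < n)"
  shows "tensor_face K A \<pi> n q is x = \<zero>\<^bsub>T (n - length is) (q + int (length is) - 1)\<^esub>"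
proof -
  have "\<not> (is = [hd is..<hd is + length is] \<and> 1 \<le> hd is \<and> hd is \<le> n - length is)"
  proof
    assume *: "is = [hd is..<hd is + length is] \<and> 1 \<le> hd is \<and> hd is \<le> n - length is"
    then obtain t where "hd is = t + 1" by (metis add.commute le_iff_add)
    then show False using * assms by auto
  qed
  then show ?thesis by (auto simp: tensor_face_def Let_def)
qed

lemma tensor_face_hom:
  assumes "is \<noteq> []" "k = length is"
  shows "tensor_face K A \<pi> n q is \<in> lin_hom K (T n q) (T (n - k) (q + int k - 1))"
proof (cases "\<exists>t. is = [t + 1..<t + 1 + length is] \<and> t + length is < n")
  case True
  then obtain t where t: "is = [t + 1..<t + 1 + k]" "t + k < n" using assms by auto
  have k: "1 \<le> k" using assms by (cases "is") auto
  have "(\<lambda>x. signed (T (n - k) (q + int k - 1)) (int k * (q - 1))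
      (tensor_map K A (replicate t id_factor @ [op_factor k] @ replicate (n - k - (t + 1)) id_factor) q x))
    \<in> lin_hom K (T n q) (T (n - k) (q + int k - 1))"
    by (intro lin_hom_signed tensor_power_module insert_hom) (use t k in auto)
  then show ?thesis unfolding t(1) using tensor_face_run[OF t(2) k] by presburger
next
  case False
  then have "tensor_face K A \<pi> n q is = (\<lambda>x. \<zero>\<^bsub>T (n - k) (q + int k - 1)\<^esub>)"
    using tensor_face_zero assms(2) by blast
  then show ?thesis by (simp add: lin_hom_zero_map tensor_power_module)
qed

lemma tensor_face_pure:
  assumes "w \<in> words A n q" "t + k < n" "1 \<le> k" "n - k = m" "q + int k - 1 = q'"
  shows "tensor_face K A \<pi> n q [t + 1..<t + 1 + k] (pure_tensor K A w) =
    signed (T m q') (int k * (q - 1) + (int k - 1) * wdeg (take t w)) (pure_tensor K A (contract t k w))"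
proof -
  have "contract t k w \<in> words A m q'" using contract_words[OF assms(1,2)] assms(4,5) by simp
  note cl = pure_tensor_closed[OF this]
  have "tensor_map K A (replicate t id_factor @ [op_factor k] @ replicate (n - k - (t + 1)) id_factor) q
      (pure_tensor K A w) = signed (T m q') ((int k - 1) * wdeg (take t w)) (pure_tensor K A (contract t k w))"
    by (rule insert_pure[OF assms(1)]) (use assms in auto)
  then show ?thesis
    unfolding tensor_face_run[OF assms(2,3)] assms(4,5)
    by (simp add: signed_signed[OF tensor_power_module cl])
qed

end

text \<open>Replaces the index \<open>m\<close> of the outer map by \<open>k = n - m\<close> and
  counts \<open>t\<close> from 0. The constant \<open>c\<close> is the number of inputs of the outer
  map minus its index: 2 for the operations, 1 for the components of a morphism.\<close>

lemma (in abelian_monoid) finsum_triangle: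
  fixes n c :: nat
  assumes "\<And>t k. 1 \<le> k \<Longrightarrow> k \<le> n \<Longrightarrow> t + k + 1 \<le> n + c \<Longrightarrow> X t k \<in> carrier G"
  shows "(\<Oplus>m\<in>{..<n}. \<Oplus>t\<in>{1..m + c}. X (t - 1) (n - m)) =
    (\<Oplus>p\<in>{(t, k). 1 \<le> k \<and> k \<le> n \<and> t + k + 1 \<le> n + c}. X (fst p) (snd p))"
proof -
  let ?S = "SIGMA m:{..<n}. {1..m + c}" and ?D = "{(t, k). 1 \<le> k \<and> k \<le> n \<and> t + k + 1 \<le> n + c}"
  have bij: "bij_betw (\<lambda>p. (snd p - 1, n - fst p)) ?S ?D"
    by (rule bij_betw_byWitness[where f' = "\<lambda>p. (n - snd p, fst p + 1)"]) auto
  have "(\<Oplus>m\<in>{..<n}. \<Oplus>t\<in>{1..m + c}. X (t - 1) (n - m)) =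
      (\<Oplus>p\<in>?S. X (snd p - 1) (n - fst p))"
    by (rule finsum_Sigma) (auto intro!: assms)
  also have "\<dots> = (\<Oplus>p\<in>?D. X (fst p) (snd p))"
    using finsum_bij[OF bij, of "\<lambda>p. X (fst p) (snd p)"] assms by auto
  finally show ?thesis .
qed

section \<open>The defining relations on words\<close>

text \<open>Splits off the terms in which the inserted operation is the differential.\<close>

lemma (in abelian_monoid) finsum_run_terms:
  assumes "\<And>t k. t + k \<le> m \<Longrightarrow> X t k \<in> carrier G"
  shows "(\<Oplus>p\<in>{(t, k). t + k \<le> (m :: nat)}. X (fst p) (snd p)) =
    (\<Oplus>t\<in>{..<m + 1}. X t 0) \<oplus> (\<Oplus>p\<in>{(t, k). 1 \<le> k \<and> t + k \<le> m}. X (fst p) (snd p))"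
proof -
  let ?P = "\<lambda>t. (t, 0 :: nat)"
  have eq: "{(t, k). t + k \<le> m} = ?P ` {..<m + 1} \<union> {(t, k). 1 \<le> k \<and> t + k \<le> m}" by auto
  have fin: "finite {(t, k). 1 \<le> k \<and> t + k \<le> m}"
    by (rule finite_subset[of _ "{..m} \<times> {..m}"]) auto
  have "(\<Oplus>p\<in>{(t, k). t + k \<le> m}. X (fst p) (snd p)) =
    (\<Oplus>p\<in>?P ` {..<m + 1}. X (fst p) (snd p)) \<oplus> (\<Oplus>p\<in>{(t, k). 1 \<le> k \<and> t + k \<le> m}. X (fst p) (snd p))"
    unfolding eq by (rule finsum_Un_disjoint) (use fin assms in auto)
  moreover have "(\<Oplus>p\<in>?P ` {..<m + 1}. X (fst p) (snd p)) = (\<Oplus>t\<in>{..<m + 1}. X (fst (?P t)) (snd (?P t)))"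
    by (rule finsum_reindex) (use assms in \<open>auto simp: inj_on_def\<close>)
  ultimately show ?thesis by simp
qed

lemma finite_letters: "finite {ns. letters ns = n}"
proof (rule finite_subset)
  show "{ns. letters ns = n} \<subseteq> {ns. set ns \<subseteq> {..n} \<and> length ns \<le> n}"
    by (auto simp: letters_def dest!: member_le_sum_list)
  show "finite {ns. set ns \<subseteq> {..n} \<and> length ns \<le> n}" by (rule finite_lists_length_le) simp
qed

lemma (in abelian_monoid) finsum_cong2:
  assumes "\<And>i j. i \<in> I \<Longrightarrow> j \<in> J i \<Longrightarrow> f i j = g i j"
    and "\<And>i j. i \<in> I \<Longrightarrow> j \<in> J i \<Longrightarrow> g i j \<in> carrier G"
  shows "(\<Oplus>i\<in>I. \<Oplus>j\<in>J i. f i j) = (\<Oplus>i\<in>I. \<Oplus>j\<in>J i. g i j)"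
proof (rule finsum_eq_cong[OF refl])
  fix i assume i: "i \<in> I"
  show "(\<Oplus>j\<in>J i. f i j) = (\<Oplus>j\<in>J i. g i j)"
    by (rule finsum_eq_cong[OF refl]) (use assms i in auto)
  show "(\<Oplus>j\<in>J i. g i j) \<in> carrier G"
    using assms(2)[OF i] by (intro finsum_closed) auto
qed

lemma finite_run_terms: "finite {(t, k). 1 \<le> k \<and> t + k \<le> (m :: nat)}" "finite {(t, k). t + k \<le> (m :: nat)}"
  by (rule finite_subset[of _ "{..m} \<times> {..m}"]; auto)+

lemma (in abelian_group) two_minus:
  assumes "a \<in> carrier G" "b \<in> carrier G" "c \<in> carrier G" "a \<oplus> b = c"
  shows "\<ominus> b \<oplus> (\<ominus> a \<oplus> c) = \<zero>"
proof -
  have "\<ominus> b \<oplus> (\<ominus> a \<oplus> (a \<oplus> b)) = \<zero>"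
    using assms(1,2) by (simp add: r_neg1 l_neg)
  then show ?thesis using assms(4) by simp
qed

context A_infinity_algebra
begin

lemma op_0: "op 0 [(p, a)] = d p a"
  by (simp add: op_def op_factor_def diff_factor_def)

lemma op_Suc: "op (Suc n) y = \<pi> n (wdeg y) (pure_tensor K A y)"
  by (simp add: op_def op_factor_def pi_factor_def map_factor_def)

text \<open>Treats both families of relations at once: \<open>g\<close> is either the family of
  operations, with \<open>c = 2\<close>, or the morphism, with \<open>c = 1\<close>. The exponent of
  \<open>X t k\<close> collects the sign of the relation, where \<open>t + 1\<close> is its index
  \<open>t\<close> and \<open>k\<close> is \<open>n - m\<close>, and the Koszul sign of the inserted
  operation. At \<open>k = 0\<close> this is the differential term with the opposite sign.\<close>

lemma insertion_terms:
  fixes g :: "nat \<Rightarrow> int \<Rightarrow> ('k, 'a) tensor \<Rightarrow> 'b"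
  assumes g: "\<And>n q. g n q \<in> lin_hom K (T (n + c) q) (B (q + int n))" and B: "\<And>q. module K (B q)"
    and y: "y \<in> words A (n + c) q" and G: "G = B (q + int n - 1)" and c: "1 \<le> c"
    and X: "\<And>t k. X t k = signed G (int n + (int t + 1) * int k + (int k - 1) * wdeg (take t y))
      (g (n - k) (q + int k - 1) (pure_tensor K A (contract t k y)))"
  shows "k \<le> n \<Longrightarrow> t + k < n + c \<Longrightarrow> X t k \<in> carrier G"
    and "signed G (int n - 1) (g n (q - 1) (tensor_diff K A d (n + c) q (pure_tensor K A y))) =
      \<ominus>\<^bsub>G\<^esub> (\<Oplus>\<^bsub>G\<^esub>t\<in>{..<n + c}. X t 0)"
    and "(\<Oplus>\<^bsub>G\<^esub>m\<in>{..<n}. \<Oplus>\<^bsub>G\<^esub>t\<in>{1..m + c}.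
         signed G (int (t * (n - m) + n)) (g m (q + int (n - 1 - m))
           (tensor_map K A (replicate (t - 1) id_factor @ [pi_factor K A \<pi> (n - 1 - m)]
              @ replicate (m + c - t) id_factor) q (pure_tensor K A y)))) =
      (\<Oplus>\<^bsub>G\<^esub>p\<in>{(t, k). 1 \<le> k \<and> k \<le> n \<and> t + k + 1 \<le> n + c}. X (fst p) (snd p))"
proof -
  let ?p = "\<lambda>t k. pure_tensor K A (contract t k y)"
  have Gm: "module K G" unfolding G by (rule B)
  interpret G: module K G by (rule Gm)
  have deg: "n + c - k = n - k + c" "q + int k - 1 + int (n - k) = q + int n - 1" if "k \<le> n" for k
    using that by (auto simp: of_nat_diff)
  have pc: "?p t k \<in> carrier (T (n - k + c) (q + int k - 1))" if "k \<le> n" "t + k < n + c" for t k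
    using pure_tensor_closed[OF contract_words[OF y that(2)]] unfolding deg[OF that(1)] .
  have h: "g (n - k) (q + int k - 1) \<in> lin_hom K (T (n - k + c) (q + int k - 1)) G" if "k \<le> n" for k
    using g[of "n - k" "q + int k - 1"] unfolding deg[OF that] G .
  note gc = lin_hom_closed[OF h pc]
  show Xc: "X t k \<in> carrier G" if "k \<le> n" "t + k < n + c" for t k
    unfolding X by (rule signed_closed[OF Gm gc]) (use that in auto)
  have q0: "q + int 0 - 1 = q - 1" by simp
  have sc: "signed (T (n + c) (q - 1)) (wdeg (take t y)) (?p t 0) \<in> carrier (T (n + c) (q - 1))" if "t < n + c" for t
    using pc[of 0 t] that by (intro signed_closed[OF tensor_power_module]) simp
  have h0: "g n (q - 1) \<in> lin_hom K (T (n + c) (q - 1)) G" using h[of 0] by simp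
  have "signed G (int n - 1) (g n (q - 1) (tensor_diff K A d (n + c) q (pure_tensor K A y))) =
      (\<Oplus>\<^bsub>G\<^esub>t\<in>{..<n + c}. signed G (int n - 1) (g n (q - 1) (signed (T (n + c) (q - 1)) (wdeg (take t y)) (?p t 0))))"
    unfolding tensor_diff_pure[OF y]
    by (subst lin_hom_finsum_apply[OF tensor_power_module Gm h0])
      (use sc lin_hom_closed[OF h0 sc] in \<open>auto intro!: signed_finsum[OF Gm]\<close>)
  also have "\<dots> = (\<Oplus>\<^bsub>G\<^esub>t\<in>{..<n + c}. \<ominus>\<^bsub>G\<^esub> X t 0)"
  proof (rule G.finsum_eq_cong[OF refl])
    fix t assume "t \<in> {..<n + c}"
    then have t: "0 \<le> n" "t + 0 < n + c" by auto
    note p0 = pc[OF t, unfolded q0 diff_zero] and g0 = gc[OF t(1) t, unfolded q0 diff_zero]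
    have "\<ominus>\<^bsub>G\<^esub> X t 0 = signed G (int n + (int t + 1) * int 0 + (int 0 - 1) * wdeg (take t y) + 1) (g n (q - 1) (?p t 0))"
      unfolding X using signed_Suc[OF Gm g0] unfolding q0 diff_zero ..
    also have "\<dots> = signed G (int n - 1) (signed G (wdeg (take t y)) (g n (q - 1) (?p t 0)))"
      unfolding signed_signed[OF Gm g0] by (rule signed_cong) simp
    finally show "signed G (int n - 1) (g n (q - 1) (signed (T (n + c) (q - 1)) (wdeg (take t y)) (?p t 0))) =
        \<ominus>\<^bsub>G\<^esub> X t 0"
      unfolding lin_hom_signed_apply[OF tensor_power_module Gm h0 p0] ..
    show "\<ominus>\<^bsub>G\<^esub> X t 0 \<in> carrier G" using Xc[OF t] by simp
  qed
  also have "\<dots> = \<ominus>\<^bsub>G\<^esub> (\<Oplus>\<^bsub>G\<^esub>t\<in>{..<n + c}. X t 0)" by (rule G.finsum_uminus) (rule Xc, auto)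
  finally show "signed G (int n - 1) (g n (q - 1) (tensor_diff K A d (n + c) q (pure_tensor K A y))) =
      \<ominus>\<^bsub>G\<^esub> (\<Oplus>\<^bsub>G\<^esub>t\<in>{..<n + c}. X t 0)" .
  have "(\<Oplus>\<^bsub>G\<^esub>m\<in>{..<n}. \<Oplus>\<^bsub>G\<^esub>t\<in>{1..m + c}.
         signed G (int (t * (n - m) + n)) (g m (q + int (n - 1 - m))
           (tensor_map K A (replicate (t - 1) id_factor @ [pi_factor K A \<pi> (n - 1 - m)]
              @ replicate (m + c - t) id_factor) q (pure_tensor K A y)))) =
      (\<Oplus>\<^bsub>G\<^esub>m\<in>{..<n}. \<Oplus>\<^bsub>G\<^esub>t\<in>{1..m + c}. X (t - 1) (n - m))"
  proof (rule G.finsum_cong2)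
    fix m t assume "m \<in> {..<n}" and t: "t \<in> {1..m + c}"
    then have m: "m < n" by simp
    define k where "k = n - m"
    have k: "k \<le> n" "t - 1 + k < n + c" "1 \<le> k" and mk: "m = n - k" "n - 1 - m = k - 1"
      using m t c by (auto simp: k_def)
    have q': "q + int (k - 1) = q + int k - 1" using k(3) by (simp add: of_nat_diff)
    have pf: "pi_factor K A \<pi> (k - 1) = op_factor k" using k(3) by (simp add: op_factor_def)
    note g1 = gc[OF k(1) k(1,2)]
    have "tensor_map K A (replicate (t - 1) id_factor @ [op_factor k] @ replicate (n - k + c - t) id_factor) q
        (pure_tensor K A y) = signed (T (n - k + c) (q + int k - 1)) ((int k - 1) * wdeg (take (t - 1) y)) (?p (t - 1) k)"
      by (rule insert_pure[OF y]) (use t k mk in auto)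
    then show "signed G (int (t * (n - m) + n)) (g m (q + int (n - 1 - m))
         (tensor_map K A (replicate (t - 1) id_factor @ [pi_factor K A \<pi> (n - 1 - m)]
            @ replicate (m + c - t) id_factor) q (pure_tensor K A y))) = X (t - 1) (n - m)"
      unfolding k_def[symmetric] mk(2) unfolding mk(1) q' pf X
      by (simp only: lin_hom_signed_apply[OF tensor_power_module Gm h[OF k(1)] pc[OF k(1,2)]] signed_signed[OF Gm g1])
        (rule signed_cong, use t in \<open>simp add: of_nat_diff algebra_simps\<close>)
    show "X (t - 1) (n - m) \<in> carrier G" unfolding k_def[symmetric] by (rule Xc[OF k(1,2)])
  qed
  also have "\<dots> = (\<Oplus>\<^bsub>G\<^esub>p\<in>{(t, k). 1 \<le> k \<and> k \<le> n \<and> t + k + 1 \<le> n + c}. X (fst p) (snd p))"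
    by (rule G.finsum_triangle) (use Xc in auto)
  finally show "(\<Oplus>\<^bsub>G\<^esub>m\<in>{..<n}. \<Oplus>\<^bsub>G\<^esub>t\<in>{1..m + c}.
         signed G (int (t * (n - m) + n)) (g m (q + int (n - 1 - m))
           (tensor_map K A (replicate (t - 1) id_factor @ [pi_factor K A \<pi> (n - 1 - m)]
              @ replicate (m + c - t) id_factor) q (pure_tensor K A y)))) =
      (\<Oplus>\<^bsub>G\<^esub>p\<in>{(t, k). 1 \<le> k \<and> k \<le> n \<and> t + k + 1 \<le> n + c}. X (fst p) (snd p))" .
qed

text \<open>The relations of an \<open>A\<^sub>\<infinity>\<close>-algebra, with the terms containing \<open>d\<close> written uniformly with the
  others; for \<open>m = 0\<close> this is \<open>d \<circ> d = 0\<close>.\<close>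

lemma op_relation:
  assumes y: "y \<in> words A (m + 1) q" and G: "G = A (q + int m - 2)"
  shows "(\<Oplus>\<^bsub>G\<^esub>p\<in>{(t, k). t + k \<le> m}.
    signed G (int m - 1 + (int (fst p) + 1) * int (snd p) + (int (snd p) - 1) * wdeg (take (fst p) y))
      (op (m - snd p) (contract (fst p) (snd p) y))) = \<zero>\<^bsub>G\<^esub>"
proof -
  interpret G: module K G unfolding G by (rule module_graded)
  show ?thesis
  proof (cases m)
    case 0
    have "{(t, k). t + k \<le> m} = {(0, 0)}" using 0 by auto
    moreover obtain p a where pa: "y = [(p, a)]" "a \<in> carrier (A p)" "p = q"
      using y 0 by (auto simp: words_iff length_Suc_conv)
    have "op 0 (contract 0 0 y) = \<zero>\<^bsub>G\<^esub>"
      using d_d[OF pa(2)] pa 0 unfolding G by (simp add: contract_def op_0)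
    ultimately show ?thesis using 0 by (simp add: signed_zero[OF G.module_axioms])
  next
    case (Suc n)
    let ?x = "pure_tensor K A y" and ?D = "{(t, k). 1 \<le> k \<and> k \<le> n \<and> t + k + 1 \<le> n + 2}"
    have y': "y \<in> words A (n + 2) q" using y Suc by simp
    have x: "?x \<in> carrier (T (n + 2) q)" by (rule pure_tensor_closed[OF y'])
    have G': "G = A (q + int n - 1)" unfolding G Suc by (simp add: algebra_simps)
    define X where "X t k = signed G (int n + (int t + 1) * int k + (int k - 1) * wdeg (take t y))
      (\<pi> (n - k) (q + int k - 1) (pure_tensor K A (contract t k y)))" for t k
    have "1 \<le> (2 :: nat)" by simp
    note ins = insertion_terms[OF pi_hom module_graded y' G' this X_def]
    have "\<pi> n q ?x \<in> carrier (A (q + int n))" by (rule lin_hom_closed[OF pi_hom x])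
    then have a: "d (q + int n) (\<pi> n q ?x) \<in> carrier G" unfolding G' by (rule lin_hom_closed[OF d_hom])
    \<comment> \<open>The one pair not of the form treated by \<open>X\<close> is
      \<open>t = 0\<close>, \<open>k = m\<close>: there \<open>\<pi> n\<close> takes the whole word
      and the outer operation is \<open>d\<close>.\<close>
    define Z where "Z t k = (if k \<le> n then X t k else \<ominus>\<^bsub>G\<^esub> (d (q + int n) (\<pi> n q ?x)))" for t k
    have Zc: "Z t k \<in> carrier G" if "t + k \<le> m" for t k
      unfolding Z_def using ins(1)[of k t] a that Suc by auto
    have Z: "signed G (int m - 1 + (int t + 1) * int k + (int k - 1) * wdeg (take t y)) (op (m - k) (contract t k y))
        = Z t k" if tk: "t + k \<le> m" for t k
    proof (cases "k \<le> n")
      case True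
      have "contract t k y \<in> words A (n + 2 - k) (q + int k - 1)"
        by (rule contract_words[OF y']) (use tk Suc in simp)
      then show ?thesis using True by (simp add: Z_def X_def Suc Suc_diff_le op_Suc words_iff)
    next
      case False
      then have k: "k = m" "t = 0" using tk Suc by auto
      have "contract 0 m y = [(q + int n, \<pi> n q ?x)]"
        using y' Suc by (simp add: contract_def words_iff op_Suc)
      then show ?thesis unfolding k Z_def using Suc by (simp add: op_0 signed_def)
    qed
    have "(\<Oplus>\<^bsub>G\<^esub>p\<in>{(t, k). t + k \<le> m}.
        signed G (int m - 1 + (int (fst p) + 1) * int (snd p) + (int (snd p) - 1) * wdeg (take (fst p) y))
          (op (m - snd p) (contract (fst p) (snd p) y))) = (\<Oplus>\<^bsub>G\<^esub>p\<in>{(t, k). t + k \<le> m}. Z (fst p) (snd p))"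
      by (rule G.finsum_eq_cong[OF refl]) (use Z Zc in auto)
    also have "\<dots> = (\<Oplus>\<^bsub>G\<^esub>t\<in>{..<m + 1}. Z t 0) \<oplus>\<^bsub>G\<^esub> (\<Oplus>\<^bsub>G\<^esub>p\<in>{(t, k). 1 \<le> k \<and> t + k \<le> m}. Z (fst p) (snd p))"
      by (rule G.finsum_run_terms[OF Zc])
    also have "{(t, k). 1 \<le> k \<and> t + k \<le> m} = insert (0, m) ?D" using Suc by auto
    also have "(\<Oplus>\<^bsub>G\<^esub>p\<in>insert (0, m) ?D. Z (fst p) (snd p)) = Z 0 m \<oplus>\<^bsub>G\<^esub> (\<Oplus>\<^bsub>G\<^esub>p\<in>?D. Z (fst p) (snd p))"
    proof -
      have "finite ?D" by (rule finite_subset[of _ "{..m} \<times> {..m}"]) (use Suc in auto)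
      then show ?thesis using Zc Suc by (subst G.finsum_insert) auto
    qed
    also have "(\<Oplus>\<^bsub>G\<^esub>p\<in>?D. Z (fst p) (snd p)) = (\<Oplus>\<^bsub>G\<^esub>p\<in>?D. X (fst p) (snd p))"
      by (rule G.finsum_eq_cong[OF refl]) (use ins(1) in \<open>auto simp: Z_def\<close>)
    also have "(\<Oplus>\<^bsub>G\<^esub>t\<in>{..<m + 1}. Z t 0) = (\<Oplus>\<^bsub>G\<^esub>t\<in>{..<n + 2}. X t 0)"
      by (rule G.finsum_eq_cong) (use Suc ins(1) in \<open>auto simp: Z_def\<close>)
    also have "\<dots> = \<ominus>\<^bsub>G\<^esub> (signed G (int n - 1) (\<pi> n (q - 1) (tensor_diff K A d (n + 2) q ?x)))"
      unfolding ins(2) using ins(1) by (intro G.minus_minus[symmetric] G.finsum_closed) auto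
    also have "Z 0 m = \<ominus>\<^bsub>G\<^esub> (d (q + int n) (\<pi> n q ?x))" unfolding Z_def using Suc by simp
    also have "\<ominus>\<^bsub>G\<^esub> (signed G (int n - 1) (\<pi> n (q - 1) (tensor_diff K A d (n + 2) q ?x))) \<oplus>\<^bsub>G\<^esub>
        (\<ominus>\<^bsub>G\<^esub> (d (q + int n) (\<pi> n q ?x)) \<oplus>\<^bsub>G\<^esub> (\<Oplus>\<^bsub>G\<^esub>p\<in>?D. X (fst p) (snd p))) = \<zero>\<^bsub>G\<^esub>"
    \<comment> \<open>The defining relation with its two differential terms moved across.\<close>
    proof (rule G.two_minus[OF a _ _ pi_relation[OF x, folded G', unfolded ins(3)]])
      show "signed G (int n - 1) (\<pi> n (q - 1) (tensor_diff K A d (n + 2) q ?x)) \<in> carrier G"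
        unfolding ins(2) using ins(1) by (intro G.a_inv_closed G.finsum_closed) auto
      show "(\<Oplus>\<^bsub>G\<^esub>p\<in>?D. X (fst p) (snd p)) \<in> carrier G" using ins(1) by (intro G.finsum_closed) auto
    qed
    finally show ?thesis .
  qed
qed

end

sublocale A_infinity_morphism \<subseteq> graded_modules K A A' ..

section \<open>Values of the morphism on words and its homogeneous relation\<close>

context A_infinity_morphism
begin

definition mor_val :: "nat \<Rightarrow> 'a word \<Rightarrow> 'b" where
  "mor_val m w = f m (wdeg w) (pure_tensor K A w)"

abbreviation mors :: "nat list \<Rightarrow> ('a, 'b) factor list" where
  "mors ms \<equiv> map (mor_factor K A f) ms"

lemma mor_factor_eq: "mor_factor K A f m = (m + 1, int m, mor_val m)"
  by (auto simp: mor_factor_def map_factor_def mor_val_def)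

lemma mors_ok: "\<forall>g\<in>set (mors ms). factor_ok K A A' g"
proof -
  have "factor_ok K A A' (mor_factor K A f m)" for m
    unfolding mor_factor_def by (rule map_factor_ok) (rule f_hom)
  then show ?thesis by auto
qed

lemma mors_simps [simp]: "arity (mors ms) = letters ms" "factors_deg (mors ms) = int (sum_list ms)"
  by (induction ms) auto

lemma mor_val_closed:
  "w \<in> words A (m + 1) q \<Longrightarrow> mor_val m w \<in> carrier (A' (q + int m))"
  using lin_hom_closed[OF f_hom source.pure_tensor_closed] by (auto simp: mor_val_def words_iff)

lemma mors_words:
  assumes "w \<in> words A (letters ms) q"
  shows "apply_factors (mors ms) w \<in> words A' (length ms) (q + int (sum_list ms))"
  using apply_factors_words[OF mors_ok _ assms] by simp

lemma mors_hom:
  assumes "letters ms = n" "length ms = m" "q + int (sum_list ms) = q'"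
  shows "tensor_map K A' (mors ms) q \<in> lin_hom K (source.T n q) (target.T m q')"
  by (rule tensor_map_hom[OF mors_ok]) (use assms in auto)

lemma mors_pure:
  assumes "w \<in> words A (letters ms) q" "length ms = m" "q + int (sum_list ms) = q'"
  shows "tensor_map K A' (mors ms) q (pure_tensor K A w) =
    signed (target.T m q') (koszul (mors ms) w) (pure_tensor K A' (apply_factors (mors ms) w))"
  by (rule tensor_map_pure[OF mors_ok _ _ _ assms(1)]) (use assms in auto)

text \<open>The splitting \<open>[m]\<close> on the left is \<open>d f\<close> and the pairs with
  \<open>k = 0\<close> on the right are \<open>f d\<close>, their sign absorbed in the exponent.
  With the terms in \<pi>' moved to the left, each side is a single sum and the differentials need
  no separate treatment.\<close>

lemma mor_relation:
  assumes y: "y \<in> words A (m + 1) q" and G: "G = A' (q + int m - 1)"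
  shows "(\<Oplus>\<^bsub>G\<^esub>ns\<in>{ns. letters ns = m + 1}.
      signed G (int (pair_sum Suc ns) + koszul (mors ns) y)
        (target.op (length ns - 1) (apply_factors (mors ns) y))) =
    (\<Oplus>\<^bsub>G\<^esub>p\<in>{(t, k). t + k \<le> m}.
      signed G (int m + (int (fst p) + 1) * int (snd p) + (int (snd p) - 1) * wdeg (take (fst p) y))
        (mor_val (m - snd p) (source.contract (fst p) (snd p) y)))"
    (is "(\<Oplus>\<^bsub>G\<^esub>ns\<in>?N. ?Y ns) = _")
proof -
  interpret G: module K G unfolding G by (rule target.module_graded)
  let ?x = "pure_tensor K A y"
  have x: "?x \<in> carrier (source.T (m + 1) q)" by (rule source.pure_tensor_closed[OF y])
  have wy: "wdeg y = q" "wf_word A y" "length y = m + 1" using y by (auto simp: words_iff)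
  define X where "X t k = signed G (int m + (int t + 1) * int k + (int k - 1) * wdeg (take t y))
      (mor_val (m - k) (source.contract t k y))" for t k
  have X': "X t k = signed G (int m + (int t + 1) * int k + (int k - 1) * wdeg (take t y))
      (f (m - k) (q + int k - 1) (pure_tensor K A (source.contract t k y)))" if "t + k \<le> m" for t k
    using source.contract_words[OF y, of t k] that by (simp add: X_def mor_val_def words_iff)
  \<comment> \<open>\<open>insertion_terms\<close> expects the degree of the argument as an explicit
    function of \<open>k\<close>. For admissible \<open>t\<close> and \<open>k\<close> it is the
    degree of the contracted word, so \<open>X\<close> and \<open>Z\<close> agree there.\<close>
  define Z where "Z t k = signed G (int m + (int t + 1) * int k + (int k - 1) * wdeg (take t y))
      (f (m - k) (q + int k - 1) (pure_tensor K A (source.contract t k y)))" for t k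
  have XZ: "X t k = Z t k" if "t + k \<le> m" for t k using X'[OF that] unfolding Z_def .
  note ins = source.insertion_terms[OF f_hom target.module_graded y G order_refl Z_def]
  have X: "X t k \<in> carrier G" if "t + k \<le> m" for t k using ins(1)[of k t] XZ[OF that] that by simp
  have N: "{ns. letters ns = m + 1} = insert [m] ({ns. letters ns = m + 1} - {[m]})" by auto
  have Y: "?Y ns \<in> carrier G" if "letters ns = m + 1" for ns
  proof -
    have w: "apply_factors (mors ns) y \<in> words A' (length ns) (q + int (sum_list ns))"
      using y that by (intro mors_words) simp
    have "1 \<le> length ns" using that by (cases ns) auto
    then have e: "wdeg (apply_factors (mors ns) y) + int (length ns - 1) - 1 = q + int m - 1"
      using that w by (simp add: letters_def of_nat_diff words_iff)
    have "target.op (length ns - 1) (apply_factors (mors ns) y) \<in>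
        carrier (A' (wdeg (apply_factors (mors ns) y) + int (length ns - 1) - 1))"
      by (rule target.op_closed) (use w \<open>1 \<le> length ns\<close> in \<open>auto simp: words_iff\<close>)
    then have "target.op (length ns - 1) (apply_factors (mors ns) y) \<in> carrier G" unfolding G e .
    then show ?thesis by (rule signed_closed[OF G.module_axioms])
  qed
  have diff: "signed G (int m - 1) (f m (q - 1) (tensor_diff K A d (m + 1) q ?x)) =
      \<ominus>\<^bsub>G\<^esub> (\<Oplus>\<^bsub>G\<^esub>t\<in>{..<m + 1}. X t 0)"
  proof -
    have "(\<Oplus>\<^bsub>G\<^esub>t\<in>{..<m + 1}. Z t 0) = (\<Oplus>\<^bsub>G\<^esub>t\<in>{..<m + 1}. X t 0)"
      by (rule G.finsum_eq_cong[OF refl]) (use X XZ in auto)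
    then show ?thesis unfolding ins(2) by simp
  qed
  have rest: "(\<Oplus>\<^bsub>G\<^esub>n\<in>{..<m}. \<Oplus>\<^bsub>G\<^esub>t\<in>{1..n + 1}.
       signed G (int (t * (m - n) + m)) (f n (q + int (m - 1 - n))
           (tensor_map K A (replicate (t - 1) id_factor @ [pi_factor K A \<pi> (m - 1 - n)]
              @ replicate (n + 1 - t) id_factor) q ?x))) =
    (\<Oplus>\<^bsub>G\<^esub>p\<in>{(t, k). 1 \<le> k \<and> t + k \<le> m}. X (fst p) (snd p))"
    unfolding ins(3) by (rule G.finsum_eq_cong) (use X XZ in auto)
  have top: "?Y [m] = d' (q + int m) (f m q ?x)"
    using wy by (simp add: mor_factor_eq mor_val_def target.op_0 signed_def)
  have tail: "(\<Oplus>\<^bsub>G\<^esub>ns\<in>{ns. letters ns = m + 1} - {[m]}. ?Y ns) =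
    (\<Oplus>\<^bsub>G\<^esub>n\<in>{..<m}. \<Oplus>\<^bsub>G\<^esub>ns\<in>{ns. length ns = n + 2 \<and> sum_list ns = m - 1 - n}.
      signed G (int (\<Sum>i<n + 1. (ns ! i + 1) * sum_list (drop (i + 1) ns)))
        (\<pi>' n (q + int (m - 1 - n)) (tensor_map K A' (mors ns) q ?x)))"
  proof -
    let ?I = "\<lambda>n. {ns. length ns = n + 2 \<and> sum_list ns = m - 1 - n}"
    \<comment> \<open>The index of the outer operation is the number of pieces minus 2; the only
      splitting into one piece is \<open>[m]\<close>.\<close>
    have bij: "bij_betw snd (Sigma {..<m} ?I) ({ns. letters ns = m + 1} - {[m]})"
    proof (rule bij_betw_byWitness[where f' = "\<lambda>ns. (length ns - 2, ns)"])
      show "(\<lambda>ns. (length ns - 2, ns)) ` ({ns. letters ns = m + 1} - {[m]}) \<subseteq> Sigma {..<m} ?I"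
      proof
        fix p assume "p \<in> (\<lambda>ns. (length ns - 2, ns)) ` ({ns. letters ns = m + 1} - {[m]})"
        then obtain ns where ns: "p = (length ns - 2, ns)" "letters ns = m + 1" "ns \<noteq> [m]" by auto
        have "2 \<le> length ns"
        proof (rule ccontr)
          assume "\<not> 2 \<le> length ns"
          then have "length ns = 0 \<or> length ns = 1" by linarith
          then show False using ns by (auto simp: length_Suc_conv)
        qed
        then show "p \<in> Sigma {..<m} ?I" using ns by (auto simp: letters_def)
      qed
    qed (auto simp: letters_def)
    have finI: "finite (?I n)" for n
      by (rule finite_subset[of _ "{ns. set ns \<subseteq> {..m - 1 - n} \<and> length ns = n + 2}"])
        (auto intro!: finite_lists_length_eq dest!: member_le_sum_list)
    have L: "letters ns = m + 1" if "n \<in> {..<m}" "ns \<in> ?I n" for n ns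
      using that by (auto simp: letters_def)
    have "(\<Oplus>\<^bsub>G\<^esub>ns\<in>{ns. letters ns = m + 1} - {[m]}. ?Y ns) = (\<Oplus>\<^bsub>G\<^esub>p\<in>Sigma {..<m} ?I. ?Y (snd p))"
      by (rule G.finsum_bij[OF bij]) (use Y in blast)
    also have "\<dots> = (\<Oplus>\<^bsub>G\<^esub>n\<in>{..<m}. \<Oplus>\<^bsub>G\<^esub>ns\<in>?I n. ?Y ns)"
      by (rule G.finsum_Sigma[symmetric]) (simp, rule finI, rule Y, rule L)
    also have "\<dots> = (\<Oplus>\<^bsub>G\<^esub>n\<in>{..<m}. \<Oplus>\<^bsub>G\<^esub>ns\<in>?I n.
      signed G (int (\<Sum>i<n + 1. (ns ! i + 1) * sum_list (drop (i + 1) ns)))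
        (\<pi>' n (q + int (m - 1 - n)) (tensor_map K A' (mors ns) q ?x)))"
    proof (rule G.finsum_cong2)
      fix n ns assume n: "n \<in> {..<m}" and ns: "ns \<in> ?I n"
      note l = L[OF n ns]
      have y': "y \<in> words A (letters ns) q" using y l by simp
      have len: "length ns = n + 2" "sum_list ns = m - 1 - n" using ns by auto
      let ?w = "apply_factors (mors ns) y"
      have w: "?w \<in> words A' (n + 2) (q + int (m - 1 - n))" using mors_words[OF y'] len by simp
      have h: "\<pi>' n (q + int (m - 1 - n)) \<in> lin_hom K (target.T (n + 2) (q + int (m - 1 - n))) G"
        unfolding G using target.pi_hom[of n "q + int (m - 1 - n)"] n
        by (simp add: of_nat_diff algebra_simps)
      have "tensor_map K A' (mors ns) q ?x =
        signed (target.T (n + 2) (q + int (m - 1 - n))) (koszul (mors ns) y) (pure_tensor K A' ?w)"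
        by (rule mors_pure[OF y']) (use len in auto)
      moreover have op: "\<pi>' n (q + int (m - 1 - n)) (pure_tensor K A' ?w) = target.op (length ns - 1) ?w"
        using w len by (simp add: target.op_Suc words_iff)
      moreover have "(\<Sum>i<n + 1. (ns ! i + 1) * sum_list (drop (i + 1) ns)) = pair_sum Suc ns"
        using pair_sum_eq[of Suc ns] len by simp
      ultimately have "signed G (int (\<Sum>i<n + 1. (ns ! i + 1) * sum_list (drop (i + 1) ns)))
        (\<pi>' n (q + int (m - 1 - n)) (tensor_map K A' (mors ns) q ?x)) =
        signed G (int (pair_sum Suc ns)) (signed G (koszul (mors ns) y) (target.op (length ns - 1) ?w))"
        by (simp only: lin_hom_signed_apply[OF target.tensor_power_module G.module_axioms h
              target.pure_tensor_closed[OF w]])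
      also have "\<dots> = ?Y ns"
      proof (rule signed_signed[OF G.module_axioms])
        show "target.op (length ns - 1) ?w \<in> carrier G"
          using lin_hom_closed[OF h target.pure_tensor_closed[OF w]] by (simp only: op)
      qed
      finally show "?Y ns = signed G (int (\<Sum>i<n + 1. (ns ! i + 1) * sum_list (drop (i + 1) ns)))
        (\<pi>' n (q + int (m - 1 - n)) (tensor_map K A' (mors ns) q ?x))" ..
      then show "signed G (int (\<Sum>i<n + 1. (ns ! i + 1) * sum_list (drop (i + 1) ns)))
        (\<pi>' n (q + int (m - 1 - n)) (tensor_map K A' (mors ns) q ?x)) \<in> carrier G"
        using Y[OF l] by argo
    qed
    finally show ?thesis .
  qed
  define a b R P where "a = d' (q + int m) (f m q ?x)"
    and "b = signed G (int m - 1) (f m (q - 1) (tensor_diff K A d (m + 1) q ?x))"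
    and "R = (\<Oplus>\<^bsub>G\<^esub>p\<in>{(t, k). 1 \<le> k \<and> t + k \<le> m}. X (fst p) (snd p))"
    and "P = (\<Oplus>\<^bsub>G\<^esub>ns\<in>{ns. letters ns = m + 1} - {[m]}. ?Y ns)"
  have rel: "a \<oplus>\<^bsub>G\<^esub> b = R \<ominus>\<^bsub>G\<^esub> P"
    unfolding a_def b_def R_def P_def rest[symmetric] tail unfolding G by (rule f_relation[OF x])
  have cl: "a \<in> carrier G" "b \<in> carrier G" "R \<in> carrier G" "P \<in> carrier G"
  proof -
    show "a \<in> carrier G" unfolding a_def G
      by (rule lin_hom_closed[OF target.d_hom lin_hom_closed[OF f_hom x]])
    show "b \<in> carrier G" unfolding b_def diff using X by (intro G.a_inv_closed G.finsum_closed) auto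
    show "R \<in> carrier G" unfolding R_def using X by (intro G.finsum_closed) auto
    show "P \<in> carrier G" unfolding P_def using Y by (intro G.finsum_closed) auto
  qed
  have "a = (R \<ominus>\<^bsub>G\<^esub> P) \<ominus>\<^bsub>G\<^esub> b"
    unfolding rel[symmetric] using cl by (simp add: a_minus_def G.a_assoc G.r_neg)
  also have "\<dots> = \<ominus>\<^bsub>G\<^esub> P \<oplus>\<^bsub>G\<^esub> (\<ominus>\<^bsub>G\<^esub> b \<oplus>\<^bsub>G\<^esub> R)"
    using cl by (simp add: a_minus_def G.a_ac)
  finally have "a \<oplus>\<^bsub>G\<^esub> P = P \<oplus>\<^bsub>G\<^esub> (\<ominus>\<^bsub>G\<^esub> P \<oplus>\<^bsub>G\<^esub> (\<ominus>\<^bsub>G\<^esub> b \<oplus>\<^bsub>G\<^esub> R))"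
    using cl by (simp add: G.a_comm)
  then have "a \<oplus>\<^bsub>G\<^esub> P = \<ominus>\<^bsub>G\<^esub> b \<oplus>\<^bsub>G\<^esub> R"
    using cl by (simp add: G.r_neg2)
  moreover have "(\<Oplus>\<^bsub>G\<^esub>ns\<in>?N. ?Y ns) = ?Y [m] \<oplus>\<^bsub>G\<^esub> P"
    unfolding P_def by (rule G.finsum_remove[OF finite_letters]) (use Y in auto)
  moreover have "(\<Oplus>\<^bsub>G\<^esub>p\<in>{(t, k). t + k \<le> m}. X (fst p) (snd p)) = \<ominus>\<^bsub>G\<^esub> b \<oplus>\<^bsub>G\<^esub> R"
  proof -
    have "(\<Oplus>\<^bsub>G\<^esub>t\<in>{..<m + 1}. X t 0) = \<ominus>\<^bsub>G\<^esub> b"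
      unfolding b_def diff using X by (intro G.minus_minus[symmetric] G.finsum_closed) auto
    then show ?thesis unfolding R_def by (subst G.finsum_run_terms[OF X]) auto
  qed
  ultimately show ?thesis unfolding top a_def[symmetric] X_def by simp
qed

text \<open>One factor per group. The empty tuple, defined separately, fits in: then all groups have
  one letter and both exponents vanish.\<close>

lemma tensor_morphism_gaps:
  assumes "letters ms = n" "length ms = m" "q + int (sum_list ms) = q'"
  shows "tensor_morphism K A A' f n q (gaps 0 ms) x =
    signed (target.T m q') (int (sum_list ms) * (q - 1) + int (pair_sum (\<lambda>m. m) ms))
      (tensor_map K A' (mors ms) q x)"
proof (cases "sum_list ms = 0")
  case True
  have z: "ms = replicate n 0"
  proof -
    have "\<forall>m\<in>set ms. m = 0" using True by simp
    then have "replicate (length ms) 0 = ms" by (rule replicate_length_same)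
    moreover have "length ms = n" using assms(1) unfolding letters_def True by simp
    ultimately show ?thesis by simp
  qed
  have "pair_sum (\<lambda>m. m) (replicate n 0) = 0" for n by (induction n) auto
  then show ?thesis unfolding z by (simp add: tensor_morphism_def signed_def sum_list_replicate)
next
  case False
  let ?is = "gaps 0 ms"
  have ne: "?is \<noteq> []" using False by (metis length_gaps length_0_conv)
  have "hd ?is \<noteq> 0" "last ?is \<noteq> n"
    using gaps_bounds[OF hd_in_set[OF ne]] gaps_bounds[OF last_in_set[OF ne]] assms(1) by auto
  moreover have "n - sum_list ms = m" using assms(1,2) by (simp add: letters_def)
  moreover have "concat (map (\<lambda>i. replicate (block_gap (blocks_of 0 ms) i - 1) (mor_factor K A f 0)
        @ [mor_factor K A f (length (blocks_of 0 ms ! i))]) [0..<length (blocks_of 0 ms)])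
      @ replicate (n - (\<Sum>i<length (blocks_of 0 ms). block_gap (blocks_of 0 ms) i) - sum_list ms)
          (mor_factor K A f 0) = mors ms"
    using block_factors[of 0 ms "mor_factor K A f"] unfolding block_gap_def diff_zero assms(1) .
  ultimately show ?thesis
    using False assms(3)
    unfolding tensor_morphism_def Let_def blocks_gaps block_sign_eq length_gaps
    by (simp del: sum_list_eq_0_iff)
qed

text \<open>In an increasing tuple bounded by \<open>n\<close>, the entry \<open>0\<close> can only
  come first and the entry \<open>n\<close> only last.\<close>

lemma tensor_morphism_boundary:
  assumes "0 \<in> set is \<or> n \<in> set is" "sorted_wrt (<) is" "set is \<subseteq> {..n}"
  shows "tensor_morphism K A A' f n q is x = \<zero>\<^bsub>target.T (n - length is) (q + int (length is))\<^esub>"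
proof -
  have ne: "is \<noteq> []" using assms(1) by auto
  have s: "sorted is" using assms(2) strict_sorted_iff by blast
  have "hd is = 0 \<or> last is = n"
  proof (cases "0 \<in> set is")
    case True
    then have "hd is \<le> 0" using s ne by (cases "is") auto
    then show ?thesis by simp
  next
    case False
    then have "n \<in> set is" using assms(1) by simp
    then have "n \<le> last is" using s by (cases "is" rule: rev_cases) (auto simp: sorted_append)
    then show ?thesis using assms(3) last_in_set[OF ne] by force
  qed
  then show ?thesis using ne by (simp add: tensor_morphism_def Let_def)
qed

lemma index_tuples_cases:
  assumes "is \<in> index_tuples n"
  shows "0 \<in> set is \<or> n \<in> set is \<and> n \<noteq> 0 \<or> (\<exists>ms. letters ms = n \<and> gaps 0 ms = is)"
proof (cases "0 \<in> set is \<or> n \<in> set is")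
  case False
  have "is": "sorted_wrt (<) is" "set is \<subseteq> {..n}" "length is \<le> n"
    using assms by (auto simp: index_tuples_def)
  show ?thesis
  proof (cases "n = 0")
    \<comment> \<open>For \<open>n = 0\<close> the bound on the length leaves only the empty tuple,
      which belongs to the composition without groups.\<close>
    case True
    then show ?thesis using "is"(3) by (intro disjI2 exI[of _ "[]"]) simp
  next
    case n: False
    have "set is \<subseteq> {0<..<0 + n}" using "is"(2) False by (force simp: subset_iff intro: le_neq_implies_less)
    moreover have "1 \<le> n" using n by simp
    ultimately show ?thesis using gaps_ex[OF "is"(1)] by blast
  qed
qed (use assms in \<open>auto simp: index_tuples_def\<close>)

lemma tensor_morphism_pure:
  assumes "w \<in> words A (letters ms) q" "length ms = m" "q + int (sum_list ms) = q'" "letters ms = n"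
  shows "tensor_morphism K A A' f n q (gaps 0 ms) (pure_tensor K A w) =
    signed (target.T m q')
      (int (sum_list ms) * (q - 1) + int (pair_sum (\<lambda>m. m) ms) + koszul (mors ms) w)
      (pure_tensor K A' (apply_factors (mors ms) w))"
proof -
  have "apply_factors (mors ms) w \<in> words A' m q'" using mors_words[OF assms(1)] assms(2,3) by simp
  note cl = target.pure_tensor_closed[OF this]
  show ?thesis
    unfolding tensor_morphism_gaps[OF assms(4,2,3)] mors_pure[OF assms(1-3)]
    by (rule signed_signed[OF target.tensor_power_module cl])
qed

lemma tensor_morphism_hom:
  assumes "is \<in> index_tuples n" "k = length is"
  shows "tensor_morphism K A A' f n q is \<in> lin_hom K (source.T n q) (target.T (n - k) (q + int k))"
proof (cases "0 \<in> set is \<or> n \<in> set is \<and> n \<noteq> 0")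
  case True
  then have "tensor_morphism K A A' f n q is = (\<lambda>x. \<zero>\<^bsub>target.T (n - k) (q + int k)\<^esub>)"
    using tensor_morphism_boundary[of "is" n q] assms by (auto simp: index_tuples_def)
  then show ?thesis by (simp add: lin_hom_zero_map target.tensor_power_module)
next
  case False
  then obtain ms where ms: "letters ms = n" "gaps 0 ms = is"
    using index_tuples_cases[OF assms(1)] by auto
  have len: "length ms = n - k" "sum_list ms = k"
    using ms assms(2) by (auto simp: letters_def)
  have "(\<lambda>x. signed (target.T (n - k) (q + int k)) (int (sum_list ms) * (q - 1) + int (pair_sum (\<lambda>m. m) ms))
      (tensor_map K A' (mors ms) q x)) \<in> lin_hom K (source.T n q) (target.T (n - k) (q + int k))"
    by (intro lin_hom_signed target.tensor_power_module mors_hom) (use ms len in auto)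
  moreover have "tensor_morphism K A A' f n q is = (\<lambda>x. signed (target.T (n - k) (q + int k))
      (int (sum_list ms) * (q - 1) + int (pair_sum (\<lambda>m. m) ms)) (tensor_map K A' (mors ms) q x))"
    using tensor_morphism_gaps[OF ms(1) len(1), of q "q + int k"] len(2) unfolding ms(2) by blast
  ultimately show ?thesis by simp
qed

end

section \<open>The morphism relation\<close>

text \<open>Transports a signed sum along a linear map, up to a common exponent \<open>b\<close>.
  The maps used below put a letter into a slot of a tensor, which is how a relation for one group
  becomes a relation for the whole word.\<close>

lemma finsum_signed_image:
  assumes T: "module K T" and G: "module K G" and s: "s \<in> lin_hom K G T"
    and g: "\<And>i. i \<in> I \<Longrightarrow> g i \<in> carrier G"
  shows "(\<Oplus>\<^bsub>T\<^esub>i\<in>I. signed T (b + e i) (s (g i))) = signed T b (s (\<Oplus>\<^bsub>G\<^esub>i\<in>I. signed G (e i) (g i)))"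
proof -
  interpret T: module K T by (rule T)
  note sg = signed_closed[OF G g]
  have "s (\<Oplus>\<^bsub>G\<^esub>i\<in>I. signed G (e i) (g i)) = (\<Oplus>\<^bsub>T\<^esub>i\<in>I. s (signed G (e i) (g i)))"
    by (rule lin_hom_finsum_apply[OF G T s sg])
  also have "signed T b \<dots> = (\<Oplus>\<^bsub>T\<^esub>i\<in>I. signed T b (s (signed G (e i) (g i))))"
    by (rule signed_finsum[OF T lin_hom_closed[OF s sg]])
  also have "\<dots> = (\<Oplus>\<^bsub>T\<^esub>i\<in>I. signed T (b + e i) (s (g i)))"
  proof (rule T.finsum_eq_cong)
    fix i assume i: "i \<in> I"
    have c: "s (g i) \<in> carrier T" by (rule lin_hom_closed[OF s g[OF i]])
    show "signed T b (s (signed G (e i) (g i))) = signed T (b + e i) (s (g i))"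
      unfolding lin_hom_signed_apply[OF G T s g[OF i]] signed_signed[OF T c] ..
    show "signed T (b + e i) (s (g i)) \<in> carrier T" by (rule signed_closed[OF T c])
  qed simp
  finally show ?thesis ..
qed

lemma pair_sum_append:
  "pair_sum (\<lambda>m. m) (us @ vs) = pair_sum (\<lambda>m. m) us + sum_list us * sum_list vs + pair_sum (\<lambda>m. m) vs"
  by (induction us) (auto simp: algebra_simps)

text \<open>Compared with the identity, \<open>Suc\<close> counts each entry once more for every
  earlier piece, and \<open>weight\<close> counts it once for every later piece. Together these are
  \<open>length ns - 1\<close> copies of each entry. This is the combinatorial input for the signs
  of a face after \<open>f\<close>.\<close>

lemma pair_sum_weight:
  "pair_sum Suc ns + weight ns = pair_sum (\<lambda>m. m) ns + (length ns - 1) * sum_list ns"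
proof (induction ns)
  case (Cons n ns)
  then show ?case by (cases ns) (auto simp: algebra_simps)
qed simp

text \<open>The elements of \<open>R\<close> between two remaining entries fit strictly between
  them, so subtracting the number of elements of \<open>R\<close> below is strictly increasing. The
  same count between an entry and \<open>n\<close> gives the bound
  \<open>n - card R\<close>.\<close>

lemma wf_shift:
  assumes "is": "sorted_wrt (<) is" "set is \<subseteq> {..n}" and R: "R \<subseteq> set is"
  shows "sorted_wrt (<) (shift is R)" "set (shift is R) \<subseteq> {..n - card R}"
    "length (shift is R) + card R = length is" "length (filter (\<lambda>i. i \<in> R) is) = card R"
proof -
  have dist: "distinct is" using "is"(1) strict_sorted_iff by auto
  have le: "card {r \<in> R. r < l} \<le> l" for l
    using card_mono[of "{..<l}" "{r \<in> R. r < l}"] by auto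
  have mono: "l - card {r \<in> R. r < l} < l' - card {r \<in> R. r < l'}" if "l < l'" "l \<notin> R" for l l'
  proof -
    have "{r \<in> R. r < l'} = {r \<in> R. r < l} \<union> {r \<in> R. l < r \<and> r < l'}"
      using that by (auto simp: not_less order_le_less)
    then have "card {r \<in> R. r < l'} \<le> card {r \<in> R. r < l} + card {r \<in> R. l < r \<and> r < l'}"
      using card_Un_le by metis
    moreover have "card {r \<in> R. l < r \<and> r < l'} \<le> card {l<..<l'}"
      by (rule card_mono) auto
    ultimately show ?thesis using le[of l] le[of l'] that(1) by simp
  qed
  have "sorted_wrt (\<lambda>l l'. l - card {r \<in> R. r < l} < l' - card {r \<in> R. r < l'}) (filter (\<lambda>l. l \<notin> R) is)"
    by (rule sorted_wrt_mono_rel[of _ "(<)"]) (use "is"(1) mono in \<open>auto simp: sorted_wrt_filter\<close>)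
  then show "sorted_wrt (<) (shift is R)" by (simp add: shift_def sorted_wrt_map)
  have "l - card {r \<in> R. r < l} \<le> n - card R" if "l \<in> set is" "l \<notin> R" for l
  proof -
    have "R = {r \<in> R. r < l} \<union> {r \<in> R. l < r}" using that(2) by (auto simp: not_less order_le_less)
    then have "card R \<le> card {r \<in> R. r < l} + card {r \<in> R. l < r}"
      using card_Un_le[of "{r \<in> R. r < l}" "{r \<in> R. l < r}"] by simp
    moreover have "card {r \<in> R. l < r} \<le> card {l<..n}"
      by (rule card_mono) (use R "is"(2) in auto)
    moreover have "l \<le> n" using that "is"(2) by auto
    ultimately show ?thesis using le[of l] by simp
  qed
  then show "set (shift is R) \<subseteq> {..n - card R}" by (auto simp: shift_def)
  have "set (filter (\<lambda>i. i \<in> R) is) = R" using R by auto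
  then show r: "length (filter (\<lambda>i. i \<in> R) is) = card R"
    using distinct_card[of "filter (\<lambda>i. i \<in> R) is"] dist by simp
  have "length (filter (\<lambda>i. i \<in> R) is) + length (filter (\<lambda>i. i \<notin> R) is) = length is"
    by (rule sum_length_filter_compl)
  then show "length (shift is R) + card R = length is" using r by (simp add: shift_def)
qed

lemma shift_index_tuples:
  assumes "is \<in> index_tuples n" "R \<subseteq> set is"
  shows "shift is R \<in> index_tuples (n - card R)" "filter (\<lambda>i. i \<in> R) is \<in> index_tuples n"
  using assms wf_shift[of "is" n R] by (auto simp: index_tuples_def sorted_wrt_filter)

text \<open>The entry \<open>0\<close> has nothing below it and stays \<open>0\<close>; the entry
  \<open>n\<close> has all of \<open>R\<close> below it and becomes the new top index
  \<open>n - card R\<close>.\<close>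

lemma shift_boundary:
  assumes "set is \<subseteq> {..n}" "b \<in> set is" "b \<notin> R" "b = 0 \<or> b = n" "R \<subseteq> set is"
  shows "0 \<in> set (shift is R) \<or> n - card R \<in> set (shift is R)"
proof -
  have mem: "b - card {r \<in> R. r < b} \<in> set (shift is R)" using assms(2,3) by (auto simp: shift_def)
  show ?thesis
  proof (cases "b = 0")
    case False
    then have b: "b = n" using assms(4) by simp
    have "{r \<in> R. r < b} = R"
      using assms(1,3,5) unfolding b by (auto simp: order_le_less subset_iff)
    then show ?thesis using mem unfolding b by metis
  qed (use mem in simp)
qed

context A_infinity_algebra
begin

lemma tensor_face_boundary:
  assumes "0 \<in> set is \<or> n \<in> set is"
  shows "tensor_face K A \<pi> n q is x = \<zero>\<^bsub>T (n - length is) (q + int (length is) - 1)\<^esub>"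
proof (rule tensor_face_zero)
  show "\<not> (\<exists>t. is = [t + 1..<t + 1 + length is] \<and> t + length is < n)"
  proof
    assume "\<exists>t. is = [t + 1..<t + 1 + length is] \<and> t + length is < n"
    then obtain t where t: "is = [t + 1..<t + 1 + length is]" "t + length is < n" by blast
    have "set is = {t + 1..<t + 1 + length is}" by (subst t(1)) (simp del: upt_Suc)
    then show False using assms t(2) by auto
  qed
qed

end

context A_infinity_morphism
begin

lemma mors_split:
  assumes "length x = letters us" "length y = letters ns"
  shows "apply_factors (mors (us @ ns @ vs)) (x @ y @ z) =
      apply_factors (mors us) x @ apply_factors (mors ns) y @ apply_factors (mors vs) z"
    and "koszul (mors (us @ ns @ vs)) (x @ y @ z) = koszul (mors us) x
      + int (sum_list ns + sum_list vs) * wdeg x + koszul (mors ns) y + int (sum_list vs) * wdeg y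
      + koszul (mors vs) z"
proof -
  show "apply_factors (mors (us @ ns @ vs)) (x @ y @ z) =
      apply_factors (mors us) x @ apply_factors (mors ns) y @ apply_factors (mors vs) z"
    using apply_factors_append[of x "mors us" "mors (ns @ vs)" "y @ z"]
      apply_factors_append[of y "mors ns" "mors vs" z] assms by simp
  have "koszul (mors us @ mors (ns @ vs)) (x @ (y @ z)) =
      koszul (mors us) x + int (sum_list ns + sum_list vs) * wdeg x + koszul (mors (ns @ vs)) (y @ z)"
    using koszul_append[of x "mors us" "mors (ns @ vs)" "y @ z"] assms by simp
  moreover have "koszul (mors ns @ mors vs) (y @ z) =
      koszul (mors ns) y + int (sum_list vs) * wdeg y + koszul (mors vs) z"
    using koszul_append[of y "mors ns" "mors vs" z] assms by simp
  ultimately show "koszul (mors (us @ ns @ vs)) (x @ y @ z) = koszul (mors us) x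
      + int (sum_list ns + sum_list vs) * wdeg x + koszul (mors ns) y + int (sum_list vs) * wdeg y
      + koszul (mors vs) z" by simp
qed

lemma mors_single:
  assumes "length y = m + 1"
  shows "apply_factors (mors [m]) y = [(wdeg y + int m, mor_val m y)]" "koszul (mors [m]) y = 0"
  using assms by (simp_all add: mor_factor_eq)

text \<open>\<open>SU\<close> and \<open>SV\<close> are the sums of \<open>us\<close> and
  \<open>vs\<close>, \<open>X\<close> and \<open>Y\<close> the degrees of the subwords
  \<open>x\<close> and \<open>y\<close>, \<open>P\<close> that of the first \<open>t\<close> letters
  of \<open>y\<close>, \<open>PU\<close> and \<open>PV\<close> the exponents \<gamma> of
  \<open>us\<close> and \<open>vs\<close>, \<open>kx\<close> and \<open>kz\<close> Koszul exponents.
  Crossings, face sign and morphism sign are compared with \<open>base_sign\<close> plus the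
  exponent of the inserted operation.\<close>

lemma parity_face_mor:
  fixes SU SV m k t q X Y P PU PV kx kz :: int
  shows "even ((k * (m - t - k + SV) + (k * (q - 1) + (k - 1) * (X + P))
      + ((SU + m + SV - k) * (q + k - 1 - 1) + (PU + SU * (m - k + SV) + ((m - k) * SV + PV))
        + (kx + (m - k + SV) * X + SV * (Y + k - 1) + kz)))
    - ((SU + m + SV) * q + (kx + (m + SV) * X + SV * Y + kz) + (PU + SU * (m + SV) + (m * SV + PV))
        + SV + X + ((t + 1) * k + (k - 1) * P)))" (is "even ?e")
proof -
  have "?e = 2 * (SV * k - SU - 2 * SV - X - k * k + k * m - k * t - m)"
    by (simp add: algebra_simps)
  then show ?thesis by (simp only: dvd_triv_left)
qed

text \<open>Here \<open>l\<close> is the number of pieces minus 1; \<open>KN\<close>,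
  \<open>PN\<close> and \<open>E\<close> are the Koszul exponent, \<gamma> and \<epsilon> of the
  splitting, and \<open>W\<close> is its \<open>weight\<close>. The hypothesis is the identity
  \<open>pair_sum_weight\<close>, which does not follow from the polynomial form of the
  exponents.\<close>

lemma parity_mor_face:
  fixes SU SV m l q X Y KN PU PV PN W E kx kz :: int
  assumes "E + W = PN + l * (m - l)"
  shows "even ((l * SU + W + (((SU + m + SV - l) * (q - 1) + (PU + SU * (m - l + SV) + (PN + (m - l) * SV + PV))
        + (kx + (m - l + SV) * X + KN + SV * Y + kz))
      + (l * (q + (SU + m + SV - l) - 1) + (l - 1) * (X + SU))))
    - ((SU + m + SV) * q + (kx + (m + SV) * X + SV * Y + kz) + (PU + SU * (m + SV) + (m * SV + PV))
        + SV + X + m + (E + KN)))" (is "even ?e")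
proof -
  have W: "W = PN + l * (m - l) - E" using assms by simp
  have "?e = 2 * (PN - E - SU + SU * l - SV - X - l * l + l * m - m)"
    unfolding W by (simp add: algebra_simps)
  then show ?thesis by (simp only: dvd_triv_left)
qed

text \<open>The common part of the signs of all terms in which only the group between \<open>us\<close> and \<open>vs\<close> is
  affected.\<close>

definition base_sign :: "nat list \<Rightarrow> nat \<Rightarrow> nat list \<Rightarrow> 'a word \<Rightarrow> 'a word \<Rightarrow> 'a word \<Rightarrow> int" where
  "base_sign us m vs x y z =
    (int (sum_list us) + int m + int (sum_list vs)) * wdeg (x @ y @ z)
    + (koszul (mors us) x + (int m + int (sum_list vs)) * wdeg x + int (sum_list vs) * wdeg y
        + koszul (mors vs) z)
    + (int (pair_sum (\<lambda>m. m) us) + int (sum_list us) * (int m + int (sum_list vs))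
        + (int m * int (sum_list vs) + int (pair_sum (\<lambda>m. m) vs)))
    + int (sum_list vs) + wdeg x"

section \<open>Terms affecting a single group of the word\<close>

context
  fixes us vs :: "nat list" and m n N :: nat and q Q :: int and x y z w :: "'a word"
  assumes lens: "length x = letters us" "length y = m + 1" "length z = letters vs"
    and wf: "wf_word A x" "wf_word A y" "wf_word A z" and w: "w = x @ y @ z"
    and n: "n = letters (us @ m # vs)" and N: "N = length us + 1 + length vs"
    and q: "q = wdeg w" and Q: "Q = q + int (sum_list us + m + sum_list vs) - 1"
begin

lemma group_words: "w \<in> words A n q" "y \<in> words A (m + 1) (wdeg y)"
  using lens wf by (auto simp: words_iff w n q)

abbreviation (input) "left_word \<equiv> apply_factors (mors us) x"
abbreviation (input) "right_word \<equiv> apply_factors (mors vs) z"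

lemma outer_words:
  "left_word \<in> words A' (length us) (wdeg x + int (sum_list us))"
  "right_word \<in> words A' (length vs) (wdeg z + int (sum_list vs))"
  using lens wf mors_words[of x us "wdeg x"] mors_words[of z vs "wdeg z"] by (simp_all add: words_iff)

text \<open>\<open>x\<close>, \<open>y\<close>, \<open>z\<close> are the letters before, in and
  after the affected group, \<open>N\<close> is the number of groups and \<open>Q\<close> the degree
  common to all terms. Every term for this group is, up to sign, the image under this map of a value
  of degree \<open>wdeg y + m - 1\<close>, the outputs of the other groups being fixed.\<close>

lemma slot_hom:
  "(\<lambda>a. pure_tensor K A' (left_word @ (wdeg y + int m - 1, a) # right_word))
    \<in> lin_hom K (A' (wdeg y + int m - 1)) (target.T N Q)"
proof (rule multilinear_slot[OF target.pure_tensor_multilinear])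
  show "wdeg left_word + (wdeg y + int m - 1) + wdeg right_word = Q"
    using outer_words by (simp add: words_iff Q q w)
qed (use outer_words in \<open>auto simp: words_iff N\<close>)

text \<open>A contraction inside the group changes only the middle factor, whose index drops from
  \<open>m\<close> to \<open>m - k\<close>. The outer outputs stay the same and only the exponents
  have to be followed.\<close>

lemma mor_contract:
  assumes tk: "t + k \<le> m"
  shows "source.contract (letters us + t) k w \<in> words A (n - k) (q + int k - 1)"
    and "mor_val (m - k) (source.contract t k y) \<in> carrier (A' (wdeg y + int m - 1))"
    and "tensor_morphism K A A' f (n - k) (q + int k - 1) (gaps 0 (us @ (m - k) # vs))
        (pure_tensor K A (source.contract (letters us + t) k w)) =
      signed (target.T N Q) ((int (sum_list us) + int m + int (sum_list vs) - int k) * (q + int k - 1 - 1)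
          + (int (pair_sum (\<lambda>m. m) us) + int (sum_list us) * (int m - int k + int (sum_list vs))
            + ((int m - int k) * int (sum_list vs) + int (pair_sum (\<lambda>m. m) vs)))
          + (koszul (mors us) x + (int m - int k + int (sum_list vs)) * wdeg x
            + int (sum_list vs) * (wdeg y + int k - 1) + koszul (mors vs) z))
        (pure_tensor K A' (left_word @ (wdeg y + int m - 1, mor_val (m - k) (source.contract t k y)) # right_word))"
proof -
  let ?y = "source.contract t k y"
  have yc: "?y \<in> words A (m - k + 1) (wdeg y + int k - 1)"
    using source.contract_words[OF group_words(2), of t k] tk by (simp add: Suc_diff_le)
  then have ly: "length ?y = (m - k) + 1" "wdeg ?y = wdeg y + int k - 1" by (auto simp: words_iff)
  have kn: "letters us + t + k < n" using tk by (simp add: n)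
  show wc: "source.contract (letters us + t) k w \<in> words A (n - k) (q + int k - 1)"
    by (rule source.contract_words[OF group_words(1) kn])
  have c: "source.contract (letters us + t) k w = x @ ?y @ z"
    unfolding w lens(1)[symmetric] by (rule source.contract_append) (use tk lens in simp)
  show "mor_val (m - k) ?y \<in> carrier (A' (wdeg y + int m - 1))"
    using mor_val_closed[OF yc] tk by (simp add: of_nat_diff algebra_simps)
  let ?ms = "us @ [m - k] @ vs"
  have L: "letters ?ms = n - k" using tk by (simp add: n)
  have "tensor_morphism K A A' f (n - k) (q + int k - 1) (gaps 0 ?ms)
        (pure_tensor K A (source.contract (letters us + t) k w)) =
      signed (target.T N Q) (int (sum_list ?ms) * (q + int k - 1 - 1) + int (pair_sum (\<lambda>m. m) ?ms)
          + koszul (mors ?ms) (source.contract (letters us + t) k w))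
        (pure_tensor K A' (apply_factors (mors ?ms) (source.contract (letters us + t) k w)))"
    by (rule tensor_morphism_pure) (use wc L tk in \<open>auto simp: N Q of_nat_diff\<close>)
  moreover have "apply_factors (mors ?ms) (source.contract (letters us + t) k w) =
      left_word @ (wdeg y + int m - 1, mor_val (m - k) ?y) # right_word"
    unfolding c using mors_split(1)[of x us ?y "[m - k]" vs z] mors_single(1)[OF ly(1)] lens ly tk
    by (simp add: of_nat_diff)
  moreover have "koszul (mors ?ms) (source.contract (letters us + t) k w) =
      koszul (mors us) x + (int m - int k + int (sum_list vs)) * wdeg x
            + int (sum_list vs) * (wdeg y + int k - 1) + koszul (mors vs) z"
    unfolding c using mors_split(2)[of x us ?y "[m - k]" vs z] mors_single(2)[OF ly(1)] lens ly tk
    by (simp add: of_nat_diff)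
  moreover have "int (sum_list ?ms) = int (sum_list us) + int m + int (sum_list vs) - int k"
    using tk by (simp add: of_nat_diff)
  moreover have "int (pair_sum (\<lambda>m. m) ?ms) =
      int (pair_sum (\<lambda>m. m) us) + int (sum_list us) * (int m - int k + int (sum_list vs))
            + ((int m - int k) * int (sum_list vs) + int (pair_sum (\<lambda>m. m) vs))"
    using tk by (simp add: pair_sum_append of_nat_diff)
  ultimately show "tensor_morphism K A A' f (n - k) (q + int k - 1) (gaps 0 (us @ (m - k) # vs))
        (pure_tensor K A (source.contract (letters us + t) k w)) =
      signed (target.T N Q) ((int (sum_list us) + int m + int (sum_list vs) - int k) * (q + int k - 1 - 1)
          + (int (pair_sum (\<lambda>m. m) us) + int (sum_list us) * (int m - int k + int (sum_list vs))
            + ((int m - int k) * int (sum_list vs) + int (pair_sum (\<lambda>m. m) vs)))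
          + (koszul (mors us) x + (int m - int k + int (sum_list vs)) * wdeg x
            + int (sum_list vs) * (wdeg y + int k - 1) + koszul (mors vs) z))
        (pure_tensor K A' (left_word @ (wdeg y + int m - 1, mor_val (m - k) (source.contract t k y)) # right_word))"
    by (simp only: append.simps)
qed

text \<open>For \<open>k = 0\<close> the left-hand side is a term of \<open>f d\<close>, otherwise a term of the sum over shuffles.\<close>

lemma mor_face_term:
  assumes tk: "t + k \<le> m"
  shows "signed (target.T N Q) (int (k * ((m - t - k) + sum_list vs)))
      (tensor_morphism K A A' f (n - k) (q + int k - 1) (gaps 0 (us @ (m - k) # vs))
        (signed (source.T (n - k) (q + int k - 1)) (int k * (q - 1) + (int k - 1) * wdeg (take (letters us + t) w))
          (pure_tensor K A (source.contract (letters us + t) k w)))) =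
    signed (target.T N Q) (base_sign us m vs x y z + ((int t + 1) * int k + (int k - 1) * wdeg (take t y)))
      (pure_tensor K A' (left_word @ (wdeg y + int m - 1, mor_val (m - k) (source.contract t k y)) # right_word))"
    (is "_ = signed _ _ ?p")
proof -
  note mc = mor_contract[OF tk]
  have T: "module K (target.T N Q)" by (rule target.tensor_power_module)
  have p: "?p \<in> carrier (target.T N Q)" using lin_hom_closed[OF slot_hom mc(2)] .
  have L: "letters (us @ (m - k) # vs) = n - k" using tk by (simp add: n)
  have len: "length (us @ (m - k) # vs) = N" "q + int k - 1 + int (sum_list (us @ (m - k) # vs)) = Q"
    using tk by (auto simp: N Q of_nat_diff)
  have "(\<lambda>v. signed (target.T N Q) (int (sum_list (us @ (m - k) # vs)) * (q + int k - 1 - 1)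
        + int (pair_sum (\<lambda>m. m) (us @ (m - k) # vs)))
      (tensor_map K A' (mors (us @ (m - k) # vs)) (q + int k - 1) v))
    \<in> lin_hom K (source.T (n - k) (q + int k - 1)) (target.T N Q)"
    by (rule lin_hom_signed[OF T mors_hom[OF L len]])
  moreover have "tensor_morphism K A A' f (n - k) (q + int k - 1) (gaps 0 (us @ (m - k) # vs)) =
    (\<lambda>v. signed (target.T N Q) (int (sum_list (us @ (m - k) # vs)) * (q + int k - 1 - 1)
        + int (pair_sum (\<lambda>m. m) (us @ (m - k) # vs)))
      (tensor_map K A' (mors (us @ (m - k) # vs)) (q + int k - 1) v))"
    by (rule ext) (rule tensor_morphism_gaps[OF L len])
  ultimately have h: "tensor_morphism K A A' f (n - k) (q + int k - 1) (gaps 0 (us @ (m - k) # vs))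
      \<in> lin_hom K (source.T (n - k) (q + int k - 1)) (target.T N Q)" by (simp only:)
  have wt: "wdeg (take (letters us + t) w) = wdeg x + wdeg (take t y)"
    using lens tk by (simp add: w)
  show ?thesis
    unfolding lin_hom_signed_apply[OF source.tensor_power_module T h source.pure_tensor_closed[OF mc(1)]] mc(3)
    unfolding signed_signed[OF T p] signed_signed[OF T p] wt base_sign_def
  proof (rule signed_cong)
    have i: "int (k * ((m - t - k) + sum_list vs)) = int k * (int m - int t - int k + int (sum_list vs))"
      using tk by (simp add: of_nat_diff)
    show "even (int (k * ((m - t - k) + sum_list vs)) +
        (int k * (q - 1) + (int k - 1) * (wdeg x + wdeg (take t y)) +
         ((int (sum_list us) + int m + int (sum_list vs) - int k) * (q + int k - 1 - 1)
          + (int (pair_sum (\<lambda>m. m) us) + int (sum_list us) * (int m - int k + int (sum_list vs))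
            + ((int m - int k) * int (sum_list vs) + int (pair_sum (\<lambda>m. m) vs)))
          + (koszul (mors us) x + (int m - int k + int (sum_list vs)) * wdeg x
            + int (sum_list vs) * (wdeg y + int k - 1) + koszul (mors vs) z))) -
      ((int (sum_list us) + int m + int (sum_list vs)) * wdeg (x @ y @ z)
    + (koszul (mors us) x + (int m + int (sum_list vs)) * wdeg x + int (sum_list vs) * wdeg y
        + koszul (mors vs) z)
    + (int (pair_sum (\<lambda>m. m) us) + int (sum_list us) * (int m + int (sum_list vs))
        + (int m * int (sum_list vs) + int (pair_sum (\<lambda>m. m) vs)))
    + int (sum_list vs) + wdeg x + ((int t + 1) * int k + (int k - 1) * wdeg (take t y))))"
      unfolding i w[symmetric] q[symmetric] add.assoc[symmetric]
      using parity_face_mor[of "int k" "int m" "int t" "int (sum_list vs)" q "wdeg x" "wdeg (take t y)"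
          "int (sum_list us)" "int (pair_sum (\<lambda>m. m) us)" "int (pair_sum (\<lambda>m. m) vs)"
          "koszul (mors us) x" "wdeg y" "koszul (mors vs) z"]
      unfolding add.assoc[symmetric] .
  qed
qed

text \<open>For \<open>length ns = 1\<close> the left-hand side is a term of \<open>d f\<close>.\<close>

lemma face_mor_term:
  assumes ns: "letters ns = m + 1"
  shows "signed (target.T N Q) (int ((length ns - 1) * sum_list us + weight ns))
      (signed (target.T N Q) (int (sum_list (us @ ns @ vs)) * (q - 1) + int (pair_sum (\<lambda>m. m) (us @ ns @ vs))
          + koszul (mors (us @ ns @ vs)) w)
        (signed (target.T N Q) (int (length ns - 1) * (q + int (sum_list (us @ ns @ vs)) - 1)
            + (int (length ns - 1) - 1) * wdeg (take (length us) (apply_factors (mors (us @ ns @ vs)) w)))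
          (pure_tensor K A' (target.contract (length us) (length ns - 1) (apply_factors (mors (us @ ns @ vs)) w))))) =
    signed (target.T N Q) (base_sign us m vs x y z + int m + (int (pair_sum Suc ns) + koszul (mors ns) y))
      (pure_tensor K A' (left_word @ (wdeg y + int m - 1,
        target.op (length ns - 1) (apply_factors (mors ns) y)) # right_word))"
    (is "_ = signed _ _ (pure_tensor K A' (_ @ (_, ?o) # _))")
  and "target.op (length ns - 1) (apply_factors (mors ns) y) \<in> carrier (A' (wdeg y + int m - 1))"
proof -
  have T: "module K (target.T N Q)" by (rule target.tensor_power_module)
  \<comment> \<open>The operation on the \<open>l + 1\<close> outputs is \<open>op l\<close>; since
    \<open>letters ns = m + 1\<close>, the pieces add up to \<open>m - l\<close>.\<close>
  define l where "l = length ns - 1"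
  have len: "length ns = l + 1" using ns by (cases ns) (auto simp: l_def)
  have sum: "sum_list ns = m - l" "l \<le> m" using ns len by (auto simp: letters_def)
  let ?y = "apply_factors (mors ns) y"
  have yw: "?y \<in> words A' (l + 1) (wdeg y + int (sum_list ns))"
    using mors_words[of y ns "wdeg y"] group_words(2) ns len by simp
  have deg: "wdeg y + int (sum_list ns) + int l - 1 = wdeg y + int m - 1" using sum by (simp add: of_nat_diff)
  have cy: "target.contract 0 l ?y = [(wdeg y + int m - 1, target.op l ?y)]"
    using yw deg by (simp add: target.contract_def words_iff)
  have "target.op l ?y \<in> carrier (A' (wdeg ?y + int l - 1))"
    by (rule target.op_closed) (use yw in \<open>auto simp: words_iff\<close>)
  then show o: "target.op (length ns - 1) ?y \<in> carrier (A' (wdeg y + int m - 1))"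
    using yw deg by (simp add: words_iff l_def)
  have ap: "apply_factors (mors (us @ ns @ vs)) w = left_word @ ?y @ right_word"
    unfolding w using mors_split(1)[of x us y ns vs z] lens ns by simp
  have lu: "length left_word = length us" by simp
  have c: "target.contract (length us) l (left_word @ ?y @ right_word) =
      left_word @ (wdeg y + int m - 1, target.op l ?y) # right_word"
    using target.contract_append[of 0 l ?y left_word right_word] yw cy lu by (simp add: words_iff)
  have p: "pure_tensor K A' (left_word @ (wdeg y + int m - 1, target.op l ?y) # right_word)
      \<in> carrier (target.T N Q)"
    using lin_hom_closed[OF slot_hom o] by (simp add: l_def)
  have tk: "wdeg (take (length us) (left_word @ ?y @ right_word)) = wdeg x + int (sum_list us)"
    using outer_words(1) by (simp add: words_iff)
  have S: "int (sum_list (us @ ns @ vs)) = int (sum_list us) + int m + int (sum_list vs) - int l"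
    using sum by (simp add: of_nat_diff)
  have Ks: "koszul (mors (us @ ns @ vs)) w = koszul (mors us) x + (int m - int l + int (sum_list vs)) * wdeg x
      + koszul (mors ns) y + int (sum_list vs) * wdeg y + koszul (mors vs) z"
    unfolding w using mors_split(2)[of x us y ns vs z] lens ns sum by (simp add: of_nat_diff)
  have Ps: "int (pair_sum (\<lambda>m. m) (us @ ns @ vs)) = int (pair_sum (\<lambda>m. m) us)
      + int (sum_list us) * (int m - int l + int (sum_list vs))
      + (int (pair_sum (\<lambda>m. m) ns) + (int m - int l) * int (sum_list vs) + int (pair_sum (\<lambda>m. m) vs))"
    using sum by (simp add: pair_sum_append of_nat_diff)
  have W: "int (pair_sum Suc ns) + int (weight ns) = int (pair_sum (\<lambda>m. m) ns) + int l * (int m - int l)"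
  proof -
    have "int (pair_sum Suc ns + weight ns) = int (pair_sum (\<lambda>m. m) ns + l * sum_list ns)"
      using pair_sum_weight[of ns] by (simp add: l_def)
    then show ?thesis using sum by (simp add: of_nat_diff)
  qed
  show "signed (target.T N Q) (int ((length ns - 1) * sum_list us + weight ns))
      (signed (target.T N Q) (int (sum_list (us @ ns @ vs)) * (q - 1) + int (pair_sum (\<lambda>m. m) (us @ ns @ vs))
          + koszul (mors (us @ ns @ vs)) w)
        (signed (target.T N Q) (int (length ns - 1) * (q + int (sum_list (us @ ns @ vs)) - 1)
            + (int (length ns - 1) - 1) * wdeg (take (length us) (apply_factors (mors (us @ ns @ vs)) w)))
          (pure_tensor K A' (target.contract (length us) (length ns - 1) (apply_factors (mors (us @ ns @ vs)) w))))) =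
    signed (target.T N Q) (base_sign us m vs x y z + int m + (int (pair_sum Suc ns) + koszul (mors ns) y))
      (pure_tensor K A' (left_word @ (wdeg y + int m - 1, ?o) # right_word))"
    unfolding l_def[symmetric] ap c tk S Ps Ks signed_signed[OF T p] base_sign_def
  proof (rule signed_cong)
    show "even (int (l * sum_list us + weight ns) +
      ((int (sum_list us) + int m + int (sum_list vs) - int l) * (q - 1) +
       (int (pair_sum (\<lambda>m. m) us) + int (sum_list us) * (int m - int l + int (sum_list vs))
      + (int (pair_sum (\<lambda>m. m) ns) + (int m - int l) * int (sum_list vs) + int (pair_sum (\<lambda>m. m) vs))) +
       (koszul (mors us) x + (int m - int l + int (sum_list vs)) * wdeg x
      + koszul (mors ns) y + int (sum_list vs) * wdeg y + koszul (mors vs) z) +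
       (int l * (q + (int (sum_list us) + int m + int (sum_list vs) - int l) - 1) +
        (int l - 1) * (wdeg x + int (sum_list us)))) -
      ((int (sum_list us) + int m + int (sum_list vs)) * wdeg (x @ y @ z)
    + (koszul (mors us) x + (int m + int (sum_list vs)) * wdeg x + int (sum_list vs) * wdeg y
        + koszul (mors vs) z)
    + (int (pair_sum (\<lambda>m. m) us) + int (sum_list us) * (int m + int (sum_list vs))
        + (int m * int (sum_list vs) + int (pair_sum (\<lambda>m. m) vs)))
    + int (sum_list vs) + wdeg x + int m + (int (pair_sum Suc ns) + koszul (mors ns) y)))"
      using parity_mor_face[OF W, of "int (sum_list us)" "int (sum_list vs)" q
          "int (pair_sum (\<lambda>m. m) us)" "int (pair_sum (\<lambda>m. m) vs)"
          "koszul (mors us) x" "wdeg x" "koszul (mors ns) y" "wdeg y" "koszul (mors vs) z"]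
      unfolding w[symmetric] q[symmetric] of_nat_add of_nat_mult add.assoc[symmetric] .
  qed
qed

text \<open>The morphism relation for the letters \<open>y\<close>, pushed into the slot with
  exponent \<open>base_sign\<close> plus \<open>m\<close>. On the right the relation supplies a
  second \<open>m\<close>, which cancels the first mod 2.\<close>

lemma group_relation:
  "(\<Oplus>\<^bsub>target.T N Q\<^esub>ns\<in>{ns. letters ns = m + 1}.
      signed (target.T N Q) (base_sign us m vs x y z + int m + (int (pair_sum Suc ns) + koszul (mors ns) y))
        (pure_tensor K A' (left_word @ (wdeg y + int m - 1,
          target.op (length ns - 1) (apply_factors (mors ns) y)) # right_word))) =
    (\<Oplus>\<^bsub>target.T N Q\<^esub>p\<in>{(t, k). t + k \<le> m}.
      signed (target.T N Q)
        (base_sign us m vs x y z + ((int (fst p) + 1) * int (snd p) + (int (snd p) - 1) * wdeg (take (fst p) y)))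
        (pure_tensor K A' (left_word @ (wdeg y + int m - 1,
          mor_val (m - snd p) (source.contract (fst p) (snd p) y)) # right_word)))"
proof -
  let ?T = "target.T N Q" and ?G = "A' (wdeg y + int m - 1)"
  let ?b = "base_sign us m vs x y z + int m"
  let ?s = "\<lambda>a. pure_tensor K A' (left_word @ (wdeg y + int m - 1, a) # right_word)"
  have T: "module K ?T" by (rule target.tensor_power_module)
  have G: "module K ?G" by (rule target.module_graded)
  interpret T: module K ?T by (rule T)
  note pull = finsum_signed_image[OF T G slot_hom]
  have "(\<Oplus>\<^bsub>?T\<^esub>ns\<in>{ns. letters ns = m + 1}.
      signed ?T (?b + (int (pair_sum Suc ns) + koszul (mors ns) y))
        (?s (target.op (length ns - 1) (apply_factors (mors ns) y)))) =
    signed ?T ?b (?s (\<Oplus>\<^bsub>?G\<^esub>ns\<in>{ns. letters ns = m + 1}.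
      signed ?G (int (pair_sum Suc ns) + koszul (mors ns) y)
        (target.op (length ns - 1) (apply_factors (mors ns) y))))"
    by (rule pull) (use face_mor_term(2) in blast)
  also have "(\<Oplus>\<^bsub>?G\<^esub>ns\<in>{ns. letters ns = m + 1}.
      signed ?G (int (pair_sum Suc ns) + koszul (mors ns) y)
        (target.op (length ns - 1) (apply_factors (mors ns) y))) =
    (\<Oplus>\<^bsub>?G\<^esub>p\<in>{(t, k). t + k \<le> m}.
      signed ?G (int m + (int (fst p) + 1) * int (snd p) + (int (snd p) - 1) * wdeg (take (fst p) y))
        (mor_val (m - snd p) (source.contract (fst p) (snd p) y)))"
    by (rule mor_relation[OF group_words(2) refl])
  also have "signed ?T ?b (?s \<dots>) = (\<Oplus>\<^bsub>?T\<^esub>p\<in>{(t, k). t + k \<le> m}.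
      signed ?T (?b + (int m + (int (fst p) + 1) * int (snd p) + (int (snd p) - 1) * wdeg (take (fst p) y)))
        (?s (mor_val (m - snd p) (source.contract (fst p) (snd p) y))))"
    by (rule pull[symmetric]) (use mor_contract(2) in fastforce)
  also have "\<dots> = (\<Oplus>\<^bsub>?T\<^esub>p\<in>{(t, k). t + k \<le> m}.
      signed ?T (base_sign us m vs x y z
          + ((int (fst p) + 1) * int (snd p) + (int (snd p) - 1) * wdeg (take (fst p) y)))
        (?s (mor_val (m - snd p) (source.contract (fst p) (snd p) y))))"
  proof (rule T.finsum_eq_cong)
    fix p assume p: "p \<in> {(t, k). t + k \<le> m}"
    show "signed ?T (?b + (int m + (int (fst p) + 1) * int (snd p) + (int (snd p) - 1) * wdeg (take (fst p) y)))
        (?s (mor_val (m - snd p) (source.contract (fst p) (snd p) y))) =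
      signed ?T (base_sign us m vs x y z
          + ((int (fst p) + 1) * int (snd p) + (int (snd p) - 1) * wdeg (take (fst p) y)))
        (?s (mor_val (m - snd p) (source.contract (fst p) (snd p) y)))"
      by (rule signed_cong) simp
    show "signed ?T (base_sign us m vs x y z
          + ((int (fst p) + 1) * int (snd p) + (int (snd p) - 1) * wdeg (take (fst p) y)))
        (?s (mor_val (m - snd p) (source.contract (fst p) (snd p) y))) \<in> carrier ?T"
      using p by (intro signed_closed[OF T] lin_hom_closed[OF slot_hom] mor_contract(2)) auto
  qed simp
  finally show ?thesis .
qed

end

end

text \<open>Sorts the letters to which a differential is applied by their groups. The induction
  appends groups at the end, which leaves the positions of the earlier ones unchanged.\<close>

lemma (in abelian_monoid) finsum_letters:
  assumes "\<And>j. j < letters ms \<Longrightarrow> g j \<in> carrier G"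
  shows "(\<Oplus>j\<in>{..<letters ms}. g j) =
    (\<Oplus>i\<in>{..<length ms}. \<Oplus>t\<in>{..<ms ! i + 1}. g (letters (take i ms) + t))"
  using assms
proof (induction ms rule: rev_induct)
  case (snoc m ms)
  let ?L = "letters ms"
  have split: "{..<letters (ms @ [m])} = {..<?L} \<union> (\<lambda>t. ?L + t) ` {..<m + 1}"
  proof (rule Set.set_eqI)
    fix j show "j \<in> {..<letters (ms @ [m])} \<longleftrightarrow> j \<in> {..<?L} \<union> (\<lambda>t. ?L + t) ` {..<m + 1}"
      by (cases "j < ?L") (auto simp: image_iff intro!: bexI[of _ "j - ?L"])
  qed
  have "(\<Oplus>j\<in>{..<letters (ms @ [m])}. g j) =
      (\<Oplus>j\<in>{..<?L}. g j) \<oplus> (\<Oplus>j\<in>(\<lambda>t. ?L + t) ` {..<m + 1}. g j)"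
    unfolding split by (rule finsum_Un_disjoint) (use snoc.prems in auto)
  also have "(\<Oplus>j\<in>(\<lambda>t. ?L + t) ` {..<m + 1}. g j) = (\<Oplus>t\<in>{..<m + 1}. g (?L + t))"
    by (rule finsum_reindex) (use snoc.prems in \<open>auto simp: inj_on_def\<close>)
  also have "(\<Oplus>j\<in>{..<?L}. g j) = (\<Oplus>i\<in>{..<length ms}. \<Oplus>t\<in>{..<ms ! i + 1}. g (letters (take i ms) + t))"
    by (rule snoc.IH) (use snoc.prems in auto)
  also have "\<dots> = (\<Oplus>i\<in>{..<length ms}. \<Oplus>t\<in>{..<(ms @ [m]) ! i + 1}. g (letters (take i (ms @ [m])) + t))"
  proof (rule finsum_eq_cong)
    fix i assume i: "i \<in> {..<length ms}"
    show "(\<Oplus>t\<in>{..<ms ! i + 1}. g (letters (take i ms) + t)) =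
        (\<Oplus>t\<in>{..<(ms @ [m]) ! i + 1}. g (letters (take i (ms @ [m])) + t))"
      using i by (simp add: nth_append)
    show "(\<Oplus>t\<in>{..<(ms @ [m]) ! i + 1}. g (letters (take i (ms @ [m])) + t)) \<in> carrier G"
    proof (rule finsum_closed, rule Pi_I)
      fix t assume t: "t \<in> {..<(ms @ [m]) ! i + 1}"
      have "letters ms = letters (take i ms @ ms ! i # drop (Suc i) ms)"
        using i by (simp add: id_take_nth_drop[symmetric] del: letters_simps)
      then show "g (letters (take i (ms @ [m])) + t) \<in> carrier G"
        using t i by (intro snoc.prems) (auto simp: nth_append)
    qed
  qed simp
  also have "\<dots> \<oplus> (\<Oplus>t\<in>{..<m + 1}. g (?L + t)) =
      (\<Oplus>i\<in>insert (length ms) {..<length ms}. \<Oplus>t\<in>{..<(ms @ [m]) ! i + 1}. g (letters (take i (ms @ [m])) + t))"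
  proof (subst finsum_insert)
    show "(\<lambda>i. \<Oplus>t\<in>{..<(ms @ [m]) ! i + 1}. g (letters (take i (ms @ [m])) + t)) \<in> {..<length ms} \<rightarrow> carrier G"
    proof (rule Pi_I, rule finsum_closed, rule Pi_I)
      fix i t assume i: "i \<in> {..<length ms}" and t: "t \<in> {..<(ms @ [m]) ! i + 1}"
      have "letters ms = letters (take i ms @ ms ! i # drop (Suc i) ms)"
        using i by (simp add: id_take_nth_drop[symmetric] del: letters_simps)
      then show "g (letters (take i (ms @ [m])) + t) \<in> carrier G"
        using t i by (intro snoc.prems) (auto simp: nth_append)
    qed
    then show "(\<Oplus>i\<in>{..<length ms}. \<Oplus>t\<in>{..<(ms @ [m]) ! i + 1}. g (letters (take i (ms @ [m])) + t)) \<oplus>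
        (\<Oplus>t\<in>{..<m + 1}. g (?L + t)) =
      (\<Oplus>t\<in>{..<(ms @ [m]) ! length ms + 1}. g (letters (take (length ms) (ms @ [m])) + t)) \<oplus>
      (\<Oplus>i\<in>{..<length ms}. \<Oplus>t\<in>{..<(ms @ [m]) ! i + 1}. g (letters (take i (ms @ [m])) + t))"
      using snoc.prems by (subst a_comm) (auto intro!: finsum_closed)
  qed (use snoc.prems in \<open>auto intro!: finsum_closed\<close>)
  finally show ?case by (simp add: lessThan_Suc)
qed simp

context A_infinity_morphism
begin

text \<open>The term given by \<open>R\<close>, without the overall minus sign of the relation.
  \<open>R = {}\<close> gives the face after the unindexed map of the morphism. The full set is
  excluded wherever this is used, as it would leave the empty tuple to the face.\<close>

definition face_mor :: "nat \<Rightarrow> int \<Rightarrow> nat list \<Rightarrow> nat set \<Rightarrow> ('k, 'a) tensor \<Rightarrow> ('k, 'b) tensor" where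
  "face_mor n q is R v =
    signed (target.T (n - length is) (q + int (length is) - 1)) (int (crossings is R))
      (tensor_face K A' \<pi>' (n - card R) (q + int (card R)) (shift is R)
        (tensor_morphism K A A' f n q (filter (\<lambda>i. i \<in> R) is) v))"

text \<open>Here the full set gives the unindexed map after the face, and it is the empty set that
  is excluded.\<close>

definition mor_face :: "nat \<Rightarrow> int \<Rightarrow> nat list \<Rightarrow> nat set \<Rightarrow> ('k, 'a) tensor \<Rightarrow> ('k, 'b) tensor" where
  "mor_face n q is R v =
    signed (target.T (n - length is) (q + int (length is) - 1)) (int (crossings is R))
      (tensor_morphism K A A' f (n - card R) (q + int (card R) - 1) (shift is R)
        (tensor_face K A \<pi> n q (filter (\<lambda>i. i \<in> R) is) v))"

lemma face_mor_hom:
  assumes "is": "is \<in> index_tuples n" and R: "R \<subseteq> set is" "R \<noteq> set is"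
  shows "face_mor n q is R \<in> lin_hom K (source.T n q) (target.T (n - length is) (q + int (length is) - 1))"
proof -
  have s: "sorted_wrt (<) is" "set is \<subseteq> {..n}" using "is" by (auto simp: index_tuples_def)
  note len = wf_shift(3,4)[OF s R(1)]
  have ne: "shift is R \<noteq> []" using R by (auto simp: shift_def filter_empty_conv)
  note F = tensor_morphism_hom[OF shift_index_tuples(2)[OF "is" R(1)], of "card R" q, OF len(2)[symmetric]]
  have "tensor_face K A' \<pi>' (n - card R) (q + int (card R)) (shift is R) \<in>
      lin_hom K (target.T (n - card R) (q + int (card R)))
        (target.T (n - card R - length (shift is R)) (q + int (card R) + int (length (shift is R)) - 1))"
    by (rule target.tensor_face_hom[OF ne refl])
  moreover have "n - card R - length (shift is R) = n - length is"
    "q + int (card R) + int (length (shift is R)) - 1 = q + int (length is) - 1"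
    using len by auto
  ultimately have "tensor_face K A' \<pi>' (n - card R) (q + int (card R)) (shift is R) \<in>
      lin_hom K (target.T (n - card R) (q + int (card R)))
        (target.T (n - length is) (q + int (length is) - 1))" by simp
  then show ?thesis
    unfolding face_mor_def by (intro lin_hom_signed[OF target.tensor_power_module] lin_hom_compose[OF F])
qed

lemma mor_face_hom:
  assumes "is": "is \<in> index_tuples n" and R: "R \<subseteq> set is" "R \<noteq> {}"
  shows "mor_face n q is R \<in> lin_hom K (source.T n q) (target.T (n - length is) (q + int (length is) - 1))"
proof -
  have s: "sorted_wrt (<) is" "set is \<subseteq> {..n}" using "is" by (auto simp: index_tuples_def)
  note len = wf_shift(3,4)[OF s R(1)]
  have ne: "filter (\<lambda>i. i \<in> R) is \<noteq> []" using R by (auto simp: filter_empty_conv)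
  note f = source.tensor_face_hom[OF ne, of "card R" n q, OF len(2)[symmetric]]
  have "tensor_morphism K A A' f (n - card R) (q + int (card R) - 1) (shift is R) \<in>
      lin_hom K (source.T (n - card R) (q + int (card R) - 1))
        (target.T (n - card R - length (shift is R)) (q + int (card R) - 1 + int (length (shift is R))))"
    by (rule tensor_morphism_hom[OF shift_index_tuples(1)[OF "is" R(1)] refl])
  moreover have "n - card R - length (shift is R) = n - length is"
    "q + int (card R) - 1 + int (length (shift is R)) = q + int (length is) - 1"
    using len by auto
  ultimately have "tensor_morphism K A A' f (n - card R) (q + int (card R) - 1) (shift is R) \<in>
      lin_hom K (source.T (n - card R) (q + int (card R) - 1))
        (target.T (n - length is) (q + int (length is) - 1))" by simp
  then show ?thesis
    unfolding mor_face_def by (intro lin_hom_signed[OF target.tensor_power_module] lin_hom_compose[OF f])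
qed

text \<open>For group \<open>i\<close> the left side runs over its splittings, the differential
  giving the trivial one and the faces all others. The right side runs over offsets \<open>t\<close>
  and lengths \<open>k\<close>, where \<open>k = 0\<close> comes from the differential of the word
  and \<open>k \<ge> 1\<close> from the faces. The two are equated by
  \<open>group_relation\<close>.\<close>

lemma word_relation:
  assumes w: "w \<in> words A n q" and n: "letters ms = n" and "is": "is = gaps 0 ms"
    and N: "N = n - length is" and Q: "Q = q + int (length is) - 1"
  shows "tensor_diff K A' d' N (q + int (length is)) (tensor_morphism K A A' f n q is (pure_tensor K A w))
      \<oplus>\<^bsub>target.T N Q\<^esub> (\<Oplus>\<^bsub>target.T N Q\<^esub>R\<in>Pow (set is) - {set is}. face_mor n q is R (pure_tensor K A w)) =
    tensor_morphism K A A' f n (q - 1) is (tensor_diff K A d n q (pure_tensor K A w))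
      \<oplus>\<^bsub>target.T N Q\<^esub> (\<Oplus>\<^bsub>target.T N Q\<^esub>R\<in>Pow (set is) - {{}}. mor_face n q is R (pure_tensor K A w))"
proof -
  let ?T = "target.T N Q" and ?w = "pure_tensor K A w"
  have T: "module K ?T" by (rule target.tensor_power_module)
  interpret T: module K ?T by (rule T)
  have k: "length is = sum_list ms" by (simp add: "is")
  have N': "length ms = N" using n unfolding N k by (simp add: letters_def)
  have w': "w \<in> words A (letters ms) q" using w n by simp
  have wl: "length w = n" "wf_word A w" "wdeg w = q" using w by (auto simp: words_iff)
  have idx: "is \<in> index_tuples n"
    using sorted_gaps[of 0 ms] gaps_bounds[of _ 0 ms] n k
    by (auto simp: index_tuples_def "is" letters_def intro: less_imp_le)
  define us vs x y z where "us i = take i ms" and "vs i = drop (Suc i) ms"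
    and "x i = take (letters (us i)) w" and "y i = take (ms ! i + 1) (drop (letters (us i)) w)"
    and "z i = drop (letters (us i) + ms ! i + 1) w" for i
  define u v where "u i = apply_factors (mors (us i)) (x i)" and "v i = apply_factors (mors (vs i)) (z i)" for i
  define b where "b i = base_sign (us i) (ms ! i) (vs i) (x i) (y i) (z i)" for i
  define W where "W i ns = signed ?T (b i + int (ms ! i) + (int (pair_sum Suc ns) + koszul (mors ns) (y i)))
        (pure_tensor K A' (u i @ (wdeg (y i) + int (ms ! i) - 1,
          target.op (length ns - 1) (apply_factors (mors ns) (y i))) # v i))" for i ns
  define Z where "Z i p = signed ?T
        (b i + ((int (fst p) + 1) * int (snd p) + (int (snd p) - 1) * wdeg (take (fst p) (y i))))
        (pure_tensor K A' (u i @ (wdeg (y i) + int (ms ! i) - 1,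
          mor_val (ms ! i - snd p) (source.contract (fst p) (snd p) (y i))) # v i))" for i p
  have ms: "us i @ ms ! i # vs i = ms" if "i < N" for i
    using that N' by (simp add: us_def vs_def id_take_nth_drop[symmetric])
  have lsum: "letters (us i) + (ms ! i + 1) + letters (vs i) = n" if "i < N" for i
    using ms[OF that] n by (metis add.assoc letters_simps(2,3))
  have sums: "sum_list (us i) + ms ! i + sum_list (vs i) = sum_list ms" if "i < N" for i
    using arg_cong[OF ms[OF that], of sum_list] by simp
  have lens: "length (x i) = letters (us i)" "length (y i) = ms ! i + 1" "length (z i) = letters (vs i)"
    if "i < N" for i
    using lsum[OF that] wl(1) by (auto simp: x_def y_def z_def)
  have wfs: "wf_word A (x i)" "wf_word A (y i)" "wf_word A (z i)" for i
    using wl(2) by (auto simp: x_def y_def z_def)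
  have wxyz: "w = x i @ y i @ z i" for i
  proof -
    have "z i = drop (ms ! i + 1) (drop (letters (us i)) w)"
      unfolding z_def drop_drop by (simp add: ac_simps)
    then show ?thesis unfolding x_def y_def by (simp only: append_take_drop_id)
  qed
  have ni: "n = letters (us i @ ms ! i # vs i)" if "i < N" for i using ms[OF that] n by simp
  have Ni: "N = length (us i) + 1 + length (vs i)" if "i < N" for i
    using ms[OF that] N' by (metis add.assoc length_Cons length_append plus_1_eq_Suc)
  have Qi: "Q = q + int (sum_list (us i) + ms ! i + sum_list (vs i)) - 1" if "i < N" for i
    using sums[OF that] Q k by simp
  \<comment> \<open>The assumptions of the single-group context, satisfied by every group
    \<open>i\<close>.\<close>
  note ctx = lens wfs wxyz ni Ni wl(3)[symmetric] Qi
  have us_len: "length (us i) = i" if "i < N" for i using that N' by (simp add: us_def)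
  have Zc: "Z i p \<in> carrier ?T" if i: "i < N" and p: "fst p + snd p \<le> ms ! i" for i p
    unfolding Z_def u_def v_def
    by (rule signed_closed[OF T lin_hom_closed[OF slot_hom[OF ctx] mor_contract(2)[OF ctx p]]]) (rule i)+
  have Wc: "W i ns \<in> carrier ?T" if i: "i < N" and ns: "letters ns = ms ! i + 1" for i ns
    unfolding W_def u_def v_def
    by (rule signed_closed[OF T lin_hom_closed[OF slot_hom[OF ctx] face_mor_term(2)[OF ctx ns]]]) (rule i)+
  have group: "(\<Oplus>\<^bsub>?T\<^esub>ns\<in>{ns. letters ns = ms ! i + 1}. W i ns) = (\<Oplus>\<^bsub>?T\<^esub>p\<in>{(t, k). t + k \<le> ms ! i}. Z i p)"
    if i: "i < N" for i
    unfolding W_def Z_def u_def v_def b_def by (rule group_relation[OF ctx]) (rule i)+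

  \<comment> \<open>A run of gaps in group \<open>i\<close>: \<open>shift_run\<close> identifies
    both tuples and \<open>mor_face_term\<close> the sign.\<close>
  have mf: "mor_face n q is {letters (us i) + t + 1..<letters (us i) + t + 1 + k} ?w = Z i (t, k)"
    if i: "i < N" and tk: "t + k \<le> ms ! i" and k1: "1 \<le> k" for i t k
  proof -
    let ?R = "{letters (us i) + t + 1..<letters (us i) + t + 1 + k}"
    note sr = shift_run[OF tk refl, of "us i" "vs i", unfolded ms[OF i], folded "is"]
    have ltn: "letters (us i) + t + k < n" using lsum[OF i] tk by simp
    have wt: "tensor_face K A \<pi> n q [letters (us i) + t + 1..<letters (us i) + t + 1 + k] ?w =
      signed (source.T (n - k) (q + int k - 1)) (int k * (q - 1) + (int k - 1) * wdeg (take (letters (us i) + t) w))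
        (pure_tensor K A (source.contract (letters (us i) + t) k w))"
      by (rule source.tensor_face_pure[OF w ltn k1 refl refl])
    have "card ?R = k" by simp
    then have "mor_face n q is ?R ?w = signed ?T (int (k * ((ms ! i - t - k) + sum_list (vs i))))
      (tensor_morphism K A A' f (n - k) (q + int k - 1) (gaps 0 (us i @ (ms ! i - k) # vs i))
        (signed (source.T (n - k) (q + int k - 1)) (int k * (q - 1) + (int k - 1) * wdeg (take (letters (us i) + t) w))
          (pure_tensor K A (source.contract (letters (us i) + t) k w))))"
      unfolding mor_face_def sr(1-3) wt[symmetric] N Q by simp
    also have "\<dots> = Z i (t, k)"
      unfolding Z_def u_def v_def b_def fst_conv snd_conv by (rule mor_face_term[OF ctx tk]) (rule i)+
    finally show ?thesis .
  qed
  have E: "tensor_morphism K A A' f n (q - 1) is (tensor_diff K A d n q ?w) =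
      (\<Oplus>\<^bsub>?T\<^esub>i\<in>{..<N}. \<Oplus>\<^bsub>?T\<^esub>t\<in>{..<ms ! i + 1}. Z i (t, 0))"
  proof -
    let ?S = "source.T n (q - 1)"
    let ?g = "\<lambda>j. signed ?S (wdeg (take j w)) (pure_tensor K A (source.contract j 0 w))"
    have S: "module K ?S" by (rule source.tensor_power_module)
    have cw: "source.contract j 0 w \<in> words A n (q - 1)" if "j < n" for j
      using source.contract_words[OF w, of j 0] that by simp
    have g: "?g j \<in> carrier ?S" if "j < n" for j
      by (rule signed_closed[OF S source.pure_tensor_closed[OF cw[OF that]]])
    have h: "tensor_morphism K A A' f n (q - 1) is \<in> lin_hom K ?S ?T"
      using tensor_morphism_hom[OF idx refl, of "q - 1"] unfolding N Q by (simp add: algebra_simps)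
    have "tensor_morphism K A A' f n (q - 1) is (tensor_diff K A d n q ?w) =
      (\<Oplus>\<^bsub>?T\<^esub>j\<in>{..<letters ms}. tensor_morphism K A A' f n (q - 1) is (?g j))"
      unfolding source.tensor_diff_pure[OF w] n by (rule lin_hom_finsum_apply[OF S T h]) (use g in auto)
    also have "\<dots> = (\<Oplus>\<^bsub>?T\<^esub>i\<in>{..<length ms}. \<Oplus>\<^bsub>?T\<^esub>t\<in>{..<ms ! i + 1}.
        tensor_morphism K A A' f n (q - 1) is (?g (letters (take i ms) + t)))"
      by (rule T.finsum_letters) (rule lin_hom_closed[OF h g], use n in simp)
    also have "\<dots> = (\<Oplus>\<^bsub>?T\<^esub>i\<in>{..<N}. \<Oplus>\<^bsub>?T\<^esub>t\<in>{..<ms ! i + 1}. Z i (t, 0))"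
      unfolding N'
    proof (rule T.finsum_cong2)
      fix i t assume "i \<in> {..<N}" "t \<in> {..<ms ! i + 1}"
      then have i: "i < N" and t: "t + 0 \<le> ms ! i" by auto
      have ltn: "letters (us i) + t < n" using lsum[OF i] t by simp
      have "Z i (t, 0) = signed ?T (int (0 * ((ms ! i - t - 0) + sum_list (vs i))))
      (tensor_morphism K A A' f (n - 0) (q + int 0 - 1) (gaps 0 (us i @ (ms ! i - 0) # vs i))
        (signed (source.T (n - 0) (q + int 0 - 1)) (int 0 * (q - 1) + (int 0 - 1) * wdeg (take (letters (us i) + t) w))
          (pure_tensor K A (source.contract (letters (us i) + t) 0 w))))"
        unfolding Z_def u_def v_def b_def fst_conv snd_conv
        by (rule mor_face_term[OF ctx t, symmetric]) (rule i)+
      also have "\<dots> = tensor_morphism K A A' f n (q - 1) is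
          (signed ?S (wdeg (take (letters (us i) + t) w)) (pure_tensor K A (source.contract (letters (us i) + t) 0 w)))"
        using ms[OF i] by (simp add: "is" signed_def)
      finally show "tensor_morphism K A A' f n (q - 1) is (?g (letters (take i ms) + t)) = Z i (t, 0)"
        unfolding us_def ..
      show "Z i (t, 0) \<in> carrier ?T" by (rule Zc[OF i]) (use t in simp)
    qed
    finally show ?thesis .
  qed
  have R: "(\<Oplus>\<^bsub>?T\<^esub>R\<in>Pow (set is) - {{}}. mor_face n q is R ?w) =
      (\<Oplus>\<^bsub>?T\<^esub>i\<in>{..<N}. \<Oplus>\<^bsub>?T\<^esub>p\<in>{(t, k). 1 \<le> k \<and> t + k \<le> ms ! i}. Z i p)"
  proof -
    have x: "?w \<in> carrier (source.T n q)" by (rule source.pure_tensor_closed[OF w])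
    \<comment> \<open>The empty set lies outside the sum; the value zero there provides closure on
      all subsets.\<close>
    define X where "X R = (if R = {} then \<zero>\<^bsub>?T\<^esub> else mor_face n q is R ?w)" for R
    have Xc: "X R \<in> carrier ?T" if "R \<subseteq> set (gaps 0 ms)" for R
    proof (cases "R = {}")
      case False
      have "mor_face n q is R ?w \<in> carrier (target.T (n - length is) (q + int (length is) - 1))"
        by (rule lin_hom_closed[OF mor_face_hom[OF idx _ False] x]) (use that in \<open>simp add: "is"\<close>)
      then show ?thesis using False unfolding X_def N Q by simp
    qed (simp add: X_def)
    have X0: "X R = \<zero>\<^bsub>?T\<^esub>" if "R \<subseteq> set (gaps 0 ms)" "R \<noteq> {}" "\<not> (\<exists>j k. R = {j..<j + k})" for R
    proof -
      have RS: "R \<subseteq> set is" using that(1) "is" by simp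
      let ?r = "filter (\<lambda>i. i \<in> R) is"
      have "tensor_face K A \<pi> n q ?r ?w = \<zero>\<^bsub>source.T (n - length ?r) (q + int (length ?r) - 1)\<^esub>"
      proof (rule source.tensor_face_zero)
        show "\<not> (\<exists>t. ?r = [t + 1..<t + 1 + length ?r] \<and> t + length ?r < n)"
        proof
          assume "\<exists>t. ?r = [t + 1..<t + 1 + length ?r] \<and> t + length ?r < n"
          then obtain t where "?r = [t + 1..<t + 1 + length ?r]" by blast
          then have "set ?r = {t + 1..<t + 1 + length ?r}" by (metis set_upt)
          moreover have "set ?r = R" using RS by auto
          ultimately show False using that(3) by blast
        qed
      qed
      moreover have "length ?r = card R"
        using wf_shift(4)[of "is" n R] RS idx by (simp add: index_tuples_def)
      ultimately have "mor_face n q is R ?w = signed ?T (int (crossings is R))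
          (tensor_morphism K A A' f (n - card R) (q + int (card R) - 1) (shift is R)
            \<zero>\<^bsub>source.T (n - card R) (q + int (card R) - 1)\<^esub>)"
        unfolding mor_face_def N Q by simp
      moreover have "tensor_morphism K A A' f (n - card R) (q + int (card R) - 1) (shift is R)
            \<zero>\<^bsub>source.T (n - card R) (q + int (card R) - 1)\<^esub> = \<zero>\<^bsub>?T\<^esub>"
      proof (rule lin_hom_zero[OF source.tensor_power_module T])
        have len: "length (shift is R) + card R = length is"
          using wf_shift(3)[of "is" n R] RS idx by (simp add: index_tuples_def)
        have "n - card R - length (shift is R) = N" "q + int (card R) - 1 + int (length (shift is R)) = Q"
          using len unfolding N Q by auto
        then show "tensor_morphism K A A' f (n - card R) (q + int (card R) - 1) (shift is R)
            \<in> lin_hom K (source.T (n - card R) (q + int (card R) - 1)) ?T"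
          using tensor_morphism_hom[OF shift_index_tuples(1)[OF idx RS] refl, of "q + int (card R) - 1"]
          by simp
      qed
      ultimately show ?thesis using that(2) by (simp add: X_def signed_zero[OF T])
    qed
    have "(\<Oplus>\<^bsub>?T\<^esub>R\<in>Pow (set is) - {{}}. mor_face n q is R ?w) = finsum ?T X (Pow (set (gaps 0 ms)) - {{}})"
      by (rule T.finsum_eq_cong) (simp add: "is", simp add: X_def "is", rule Xc, simp)
    also have "\<dots> = (\<Oplus>\<^bsub>?T\<^esub>i\<in>{..<length ms}. \<Oplus>\<^bsub>?T\<^esub>p\<in>{(t, k). 1 \<le> k \<and> t + k \<le> ms ! i}.
      X {letters (take i ms) + fst p + 1..<letters (take i ms) + fst p + 1 + snd p})"
      by (rule T.finsum_runs[OF Xc X0])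
    also have "\<dots> = (\<Oplus>\<^bsub>?T\<^esub>i\<in>{..<N}. \<Oplus>\<^bsub>?T\<^esub>p\<in>{(t, k). 1 \<le> k \<and> t + k \<le> ms ! i}. Z i p)"
      unfolding N'
    proof (rule T.finsum_cong2)
      fix i p assume "i \<in> {..<N}" "p \<in> {(t, k). 1 \<le> k \<and> t + k \<le> ms ! i}"
      then have p: "fst p + snd p \<le> ms ! i" "1 \<le> snd p" and i: "i < N" by auto
      show "X {letters (take i ms) + fst p + 1..<letters (take i ms) + fst p + 1 + snd p} = Z i p"
        using mf[OF i p] p(2) unfolding X_def us_def by simp
      show "Z i p \<in> carrier ?T" by (rule Zc[OF i p(1)])
    qed
    finally show ?thesis .
  qed
  have right: "tensor_morphism K A A' f n (q - 1) is (tensor_diff K A d n q ?w)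
      \<oplus>\<^bsub>?T\<^esub> (\<Oplus>\<^bsub>?T\<^esub>R\<in>Pow (set is) - {{}}. mor_face n q is R ?w) =
    (\<Oplus>\<^bsub>?T\<^esub>i\<in>{..<N}. \<Oplus>\<^bsub>?T\<^esub>p\<in>{(t, k). t + k \<le> ms ! i}. Z i p)"
  proof -
    have "(\<Oplus>\<^bsub>?T\<^esub>p\<in>{(t, k). t + k \<le> ms ! i}. Z i p) =
        (\<Oplus>\<^bsub>?T\<^esub>t\<in>{..<ms ! i + 1}. Z i (t, 0)) \<oplus>\<^bsub>?T\<^esub> (\<Oplus>\<^bsub>?T\<^esub>p\<in>{(t, k). 1 \<le> k \<and> t + k \<le> ms ! i}. Z i p)"
      if "i < N" for i
      using T.finsum_run_terms[of "ms ! i" "\<lambda>t k. Z i (t, k)"] Zc[OF that] by simp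
    then have "(\<Oplus>\<^bsub>?T\<^esub>i\<in>{..<N}. \<Oplus>\<^bsub>?T\<^esub>p\<in>{(t, k). t + k \<le> ms ! i}. Z i p) =
      (\<Oplus>\<^bsub>?T\<^esub>i\<in>{..<N}. (\<Oplus>\<^bsub>?T\<^esub>t\<in>{..<ms ! i + 1}. Z i (t, 0))
        \<oplus>\<^bsub>?T\<^esub> (\<Oplus>\<^bsub>?T\<^esub>p\<in>{(t, k). 1 \<le> k \<and> t + k \<le> ms ! i}. Z i p))"
      using Zc by (intro T.finsum_eq_cong) (auto intro!: T.finsum_closed T.a_closed)
    also have "\<dots> = (\<Oplus>\<^bsub>?T\<^esub>i\<in>{..<N}. \<Oplus>\<^bsub>?T\<^esub>t\<in>{..<ms ! i + 1}. Z i (t, 0)) \<oplus>\<^bsub>?T\<^esub>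
        (\<Oplus>\<^bsub>?T\<^esub>i\<in>{..<N}. \<Oplus>\<^bsub>?T\<^esub>p\<in>{(t, k). 1 \<le> k \<and> t + k \<le> ms ! i}. Z i p)"
      using Zc by (intro T.finsum_addf) (auto intro!: T.finsum_closed)
    finally show ?thesis unfolding E R ..
  qed

  have x: "?w \<in> carrier (source.T n q)" by (rule source.pure_tensor_closed[OF w])
  have D: "tensor_diff K A' d' N (q + int (length is)) (tensor_morphism K A A' f n q is ?w) =
      (\<Oplus>\<^bsub>?T\<^esub>i\<in>{..<N}. W i [ms ! i])"
  proof -
    let ?w' = "apply_factors (mors ms) w" and ?q = "q + int (length is)"
    let ?e = "int (sum_list ms) * (q - 1) + int (pair_sum (\<lambda>m. m) ms) + koszul (mors ms) w"
    have Tq: "target.T N (?q - 1) = ?T" unfolding Q ..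
    have ww: "?w' \<in> words A' N ?q" using mors_words[OF w'] unfolding N' k .
    have cw: "pure_tensor K A' (target.contract i 0 ?w') \<in> carrier ?T" if "i < N" for i
      using target.pure_tensor_closed[OF target.contract_words[OF ww, of i 0]] that Q by simp
    have F: "tensor_morphism K A A' f n q is ?w = signed (target.T N ?q) ?e (pure_tensor K A' ?w')"
      unfolding "is" by (rule tensor_morphism_pure[OF w' N' _ n]) simp
    have h: "tensor_diff K A' d' N ?q \<in> lin_hom K (target.T N ?q) ?T"
      using target.tensor_diff_hom[of N ?q] unfolding Tq .
    have "tensor_diff K A' d' N ?q (tensor_morphism K A A' f n q is ?w) =
        signed ?T ?e (tensor_diff K A' d' N ?q (pure_tensor K A' ?w'))"
      unfolding F by (rule lin_hom_signed_apply[OF target.tensor_power_module T h target.pure_tensor_closed[OF ww]])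
    also have "tensor_diff K A' d' N ?q (pure_tensor K A' ?w') =
        (\<Oplus>\<^bsub>?T\<^esub>i\<in>{..<N}. signed ?T (wdeg (take i ?w')) (pure_tensor K A' (target.contract i 0 ?w')))"
      using target.tensor_diff_pure[OF ww] unfolding Tq .
    also have "signed ?T ?e \<dots> =
        (\<Oplus>\<^bsub>?T\<^esub>i\<in>{..<N}. signed ?T ?e (signed ?T (wdeg (take i ?w')) (pure_tensor K A' (target.contract i 0 ?w'))))"
      by (rule signed_finsum[OF T]) (use cw in \<open>auto intro!: signed_closed[OF T]\<close>)
    also have "\<dots> = (\<Oplus>\<^bsub>?T\<^esub>i\<in>{..<N}. W i [ms ! i])"
    proof (rule T.finsum_eq_cong)
      fix i assume "i \<in> {..<N}"
      then have i: "i < N" by simp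
      have l: "letters [ms ! i] = ms ! i + 1" by simp
      have m1: "us i @ [ms ! i] @ vs i = ms" using ms[OF i] by simp
      have "W i [ms ! i] = signed ?T (int ((length [ms ! i] - 1) * sum_list (us i) + weight [ms ! i]))
      (signed ?T (int (sum_list ms) * (q - 1) + int (pair_sum (\<lambda>m. m) ms) + koszul (mors ms) w)
        (signed ?T (int (length [ms ! i] - 1) * (q + int (sum_list ms) - 1)
            + (int (length [ms ! i] - 1) - 1) * wdeg (take (length (us i)) ?w'))
          (pure_tensor K A' (target.contract (length (us i)) (length [ms ! i] - 1) ?w'))))"
        unfolding W_def u_def v_def b_def
        by (rule face_mor_term(1)[OF ctx l, unfolded m1, symmetric]) (rule i)+
      also have "\<dots> = signed ?T ?e (signed ?T (- wdeg (take i ?w')) (pure_tensor K A' (target.contract i 0 ?w')))"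
        using us_len[OF i] by (simp add: signed_def)
      also have "signed ?T (- wdeg (take i ?w')) (pure_tensor K A' (target.contract i 0 ?w')) =
          signed ?T (wdeg (take i ?w')) (pure_tensor K A' (target.contract i 0 ?w'))"
        by (rule signed_cong) simp
      finally show "signed ?T ?e (signed ?T (wdeg (take i ?w')) (pure_tensor K A' (target.contract i 0 ?w')))
          = W i [ms ! i]" ..
      show "W i [ms ! i] \<in> carrier ?T" by (rule Wc[OF i l])
    qed simp
    finally show ?thesis .
  qed
  \<comment> \<open>A nontrivial splitting of group \<open>i\<close>: \<open>shift_split\<close>
    identifies both tuples and \<open>face_mor_term\<close> the sign.\<close>
  have fm: "face_mor n q is (set (gaps 0 (us i @ ns @ vs i))) ?w = W i ns"
    if i: "i < N" and ns: "letters ns = ms ! i + 1" "ns \<noteq> [ms ! i]" for i ns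
  proof -
    let ?R = "set (gaps 0 (us i @ ns @ vs i))" and ?ns = "us i @ ns @ vs i"
    let ?w' = "apply_factors (mors ?ns) w"
    define l where "l = length ns - 1"
    have l: "1 \<le> l" "length ns = l + 1"
    proof -
      have "length ns \<noteq> 0" "length ns \<noteq> 1" using ns by (auto simp: length_Suc_conv)
      then show "1 \<le> l" "length ns = l + 1" unfolding l_def by linarith+
    qed
    note sp = shift_split[OF ns(1) refl, of "us i" "vs i", unfolded ms[OF i], folded "is"]
    have sl: "shift is ?R = [i + 1..<i + 1 + l]" using sp(2) l us_len[OF i] by (simp add: ac_simps)
    have "card ?R = length (filter (\<lambda>j. j \<in> ?R) is)"
      using wf_shift(4)[of "is" n ?R] sp(4) idx by (simp add: index_tuples_def)
    then have cR: "card ?R = sum_list ?ns" unfolding sp(1) by simp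
    have ln: "letters ?ns = n" using lsum[OF i] ns(1) by simp
    have len: "length ?ns = n - sum_list ?ns" using ln by (simp add: letters_def)
    have Nl: "length ?ns = N + l" using Ni[OF i] l by simp
    have wn: "w \<in> words A (letters ?ns) q" using w ln by simp
    have ww: "?w' \<in> words A' (n - sum_list ?ns) (q + int (sum_list ?ns))"
      using mors_words[OF wn] unfolding len .
    have sumsl: "sum_list ?ns + l = length is"
      using sums[OF i] ns(1) l k by (simp add: letters_def)
    have dN: "n - sum_list ?ns - l = N" "q + int (sum_list ?ns) + int l - 1 = Q"
      using sumsl unfolding N Q by auto
    have F: "tensor_morphism K A A' f n q (gaps 0 ?ns) ?w =
      signed (target.T (n - sum_list ?ns) (q + int (sum_list ?ns)))
        (int (sum_list ?ns) * (q - 1) + int (pair_sum (\<lambda>m. m) ?ns) + koszul (mors ?ns) w) (pure_tensor K A' ?w')"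
      by (rule tensor_morphism_pure[OF wn len refl ln])
    have il: "i + l < n - sum_list ?ns" using Nl len i by simp
    have h: "tensor_face K A' \<pi>' (n - sum_list ?ns) (q + int (sum_list ?ns)) [i + 1..<i + 1 + l]
        \<in> lin_hom K (target.T (n - sum_list ?ns) (q + int (sum_list ?ns))) ?T"
      using target.tensor_face_hom[of "[i + 1..<i + 1 + l]" l "n - sum_list ?ns" "q + int (sum_list ?ns)"] l(1)
      unfolding dN by (simp del: upt_Suc)
    have "face_mor n q is ?R ?w = signed ?T (int ((length ns - 1) * sum_list (us i) + weight ns))
      (tensor_face K A' \<pi>' (n - sum_list ?ns) (q + int (sum_list ?ns)) [i + 1..<i + 1 + l]
        (tensor_morphism K A A' f n q (gaps 0 ?ns) ?w))"
      unfolding face_mor_def cR sl sp(1) sp(3) N Q ..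
    also have "\<dots> = signed ?T (int ((length ns - 1) * sum_list (us i) + weight ns))
      (signed ?T (int (sum_list ?ns) * (q - 1) + int (pair_sum (\<lambda>m. m) ?ns) + koszul (mors ?ns) w)
        (signed ?T (int (length ns - 1) * (q + int (sum_list ?ns) - 1)
            + (int (length ns - 1) - 1) * wdeg (take (length (us i)) ?w'))
          (pure_tensor K A' (target.contract (length (us i)) (length ns - 1) ?w'))))"
      unfolding F lin_hom_signed_apply[OF target.tensor_power_module T h target.pure_tensor_closed[OF ww]]
        target.tensor_face_pure[OF ww il l(1) dN] l_def[symmetric] us_len[OF i] ..
    also have "\<dots> = W i ns"
      unfolding W_def u_def v_def b_def by (rule face_mor_term(1)[OF ctx ns(1)]) (rule i)+
    finally show ?thesis .
  qed
  have L: "(\<Oplus>\<^bsub>?T\<^esub>R\<in>Pow (set is) - {set is}. face_mor n q is R ?w) =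
      (\<Oplus>\<^bsub>?T\<^esub>i\<in>{..<N}. \<Oplus>\<^bsub>?T\<^esub>ns\<in>{ns. letters ns = ms ! i + 1} - {[ms ! i]}. W i ns)"
  proof -
    \<comment> \<open>This time the full set lies outside the sum and receives the value
      zero.\<close>
    define X where "X R = (if R = set is then \<zero>\<^bsub>?T\<^esub> else face_mor n q is R ?w)" for R
    have Xc: "X R \<in> carrier ?T" if "R \<subseteq> set (gaps 0 ms)" for R
    proof (cases "R = set is")
      case False
      have "face_mor n q is R ?w \<in> carrier (target.T (n - length is) (q + int (length is) - 1))"
        by (rule lin_hom_closed[OF face_mor_hom[OF idx _ False] x]) (use that in \<open>simp add: "is"\<close>)
      then show ?thesis using False unfolding X_def N Q by simp
    qed (simp add: X_def)
    have X0: "X R = \<zero>\<^bsub>?T\<^esub>" if "R \<subseteq> set (gaps 0 ms)" "R \<noteq> set (gaps 0 ms)"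
      "\<not> (\<exists>j. shift (gaps 0 ms) R = [j..<j + length (shift (gaps 0 ms) R)])" for R
    proof -
      have RS: "R \<subseteq> set is" "R \<noteq> set is" using that(1,2) "is" by auto
      have len: "length (shift is R) + card R = length is"
        using wf_shift(3)[of "is" n R] RS idx by (simp add: index_tuples_def)
      have "n - card R - length (shift is R) = N" "q + int (card R) + int (length (shift is R)) - 1 = Q"
        using len unfolding N Q by auto
      moreover have "\<not> (\<exists>t. shift is R = [t + 1..<t + 1 + length (shift is R)] \<and>
          t + length (shift is R) < n - card R)"
        using that(3) unfolding "is" by blast
      ultimately have "tensor_face K A' \<pi>' (n - card R) (q + int (card R)) (shift is R) v = \<zero>\<^bsub>?T\<^esub>" for v
        using target.tensor_face_zero by metis
      then have "face_mor n q is R ?w = \<zero>\<^bsub>?T\<^esub>"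
        unfolding face_mor_def N[symmetric] Q[symmetric] by (simp add: signed_zero[OF T])
      then show ?thesis by (simp add: X_def)
    qed
    have "(\<Oplus>\<^bsub>?T\<^esub>R\<in>Pow (set is) - {set is}. face_mor n q is R ?w) =
        finsum ?T X (Pow (set (gaps 0 ms)) - {set (gaps 0 ms)})"
      by (rule T.finsum_eq_cong) (simp add: "is", simp add: X_def "is", rule Xc, simp)
    also have "\<dots> = (\<Oplus>\<^bsub>?T\<^esub>i\<in>{..<length ms}. \<Oplus>\<^bsub>?T\<^esub>ns\<in>{ns. letters ns = ms ! i + 1} - {[ms ! i]}.
      X (set (gaps 0 (take i ms @ ns @ drop (Suc i) ms))))"
      by (rule T.finsum_splits[OF Xc X0])
    also have "\<dots> = (\<Oplus>\<^bsub>?T\<^esub>i\<in>{..<N}. \<Oplus>\<^bsub>?T\<^esub>ns\<in>{ns. letters ns = ms ! i + 1} - {[ms ! i]}. W i ns)"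
      unfolding N'
    proof (rule T.finsum_cong2)
      fix i ns assume "i \<in> {..<N}" "ns \<in> {ns. letters ns = ms ! i + 1} - {[ms ! i]}"
      then have i: "i < N" and ns: "letters ns = ms ! i + 1" "ns \<noteq> [ms ! i]" by auto
      \<comment> \<open>By injectivity of \<open>gaps\<close>, a nontrivial splitting omits at least
        one gap.\<close>
      have "set (gaps 0 (us i @ ns @ vs i)) \<noteq> set is"
      proof
        assume e: "set (gaps 0 (us i @ ns @ vs i)) = set is"
        have "gaps 0 (us i @ ns @ vs i) = gaps 0 ms"
          by (intro strict_sorted_equal sorted_gaps) (use e "is" in simp)
        moreover have "letters (us i @ ns @ vs i) = letters ms"
          using lsum[OF i] ns(1) n by simp
        ultimately have "us i @ ns @ vs i = us i @ [ms ! i] @ vs i"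
          using gaps_inj ms[OF i] by (metis append_Cons append_Nil)
        then show False using ns(2) by simp
      qed
      then show "X (set (gaps 0 (take i ms @ ns @ drop (Suc i) ms))) = W i ns"
        using fm[OF i ns] unfolding X_def us_def vs_def by simp
      show "W i ns \<in> carrier ?T" by (rule Wc[OF i ns(1)])
    qed
    finally show ?thesis .
  qed
  have left: "tensor_diff K A' d' N (q + int (length is)) (tensor_morphism K A A' f n q is ?w)
      \<oplus>\<^bsub>?T\<^esub> (\<Oplus>\<^bsub>?T\<^esub>R\<in>Pow (set is) - {set is}. face_mor n q is R ?w) =
    (\<Oplus>\<^bsub>?T\<^esub>i\<in>{..<N}. \<Oplus>\<^bsub>?T\<^esub>ns\<in>{ns. letters ns = ms ! i + 1}. W i ns)"
  proof -
    have "(\<Oplus>\<^bsub>?T\<^esub>ns\<in>{ns. letters ns = ms ! i + 1}. W i ns) =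
        W i [ms ! i] \<oplus>\<^bsub>?T\<^esub> (\<Oplus>\<^bsub>?T\<^esub>ns\<in>{ns. letters ns = ms ! i + 1} - {[ms ! i]}. W i ns)"
      if "i < N" for i
      by (rule T.finsum_remove[OF finite_letters]) (use Wc[OF that] in auto)
    then have "(\<Oplus>\<^bsub>?T\<^esub>i\<in>{..<N}. \<Oplus>\<^bsub>?T\<^esub>ns\<in>{ns. letters ns = ms ! i + 1}. W i ns) =
      (\<Oplus>\<^bsub>?T\<^esub>i\<in>{..<N}. W i [ms ! i]
        \<oplus>\<^bsub>?T\<^esub> (\<Oplus>\<^bsub>?T\<^esub>ns\<in>{ns. letters ns = ms ! i + 1} - {[ms ! i]}. W i ns))"
      using Wc by (intro T.finsum_eq_cong) (auto intro!: T.finsum_closed T.a_closed)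
    also have "\<dots> = (\<Oplus>\<^bsub>?T\<^esub>i\<in>{..<N}. W i [ms ! i]) \<oplus>\<^bsub>?T\<^esub>
        (\<Oplus>\<^bsub>?T\<^esub>i\<in>{..<N}. \<Oplus>\<^bsub>?T\<^esub>ns\<in>{ns. letters ns = ms ! i + 1} - {[ms ! i]}. W i ns)"
      using Wc by (intro T.finsum_addf) (auto intro!: T.finsum_closed)
    finally show ?thesis unfolding D L ..
  qed
  show ?thesis
    unfolding left right
    by (rule T.finsum_eq_cong) (use group Zc in \<open>auto intro!: T.finsum_closed\<close>)
qed

end

section \<open>From words to the relation for arbitrary tuples and tensors\<close>

lemma (in abelian_group) solve_difference:
  assumes "D \<in> carrier G" "E \<in> carrier G" "P \<in> carrier G" "Q \<in> carrier G" "D \<oplus> P = E \<oplus> Q"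
  shows "D \<ominus> E = \<ominus> P \<oplus> Q"
proof -
  have "D \<ominus> E = (D \<oplus> P) \<oplus> (\<ominus> P \<oplus> \<ominus> E)"
    using assms(1-4) by (simp add: a_minus_def a_assoc r_neg2)
  also have "\<dots> = E \<oplus> (\<ominus> E \<oplus> (\<ominus> P \<oplus> Q))"
    unfolding assms(5) using assms(1-4) by (simp add: a_ac)
  finally show ?thesis using assms(1-4) by (simp add: r_neg2)
qed

lemma (in abelian_group) finsum_difference:
  assumes "\<And>i. i \<in> I \<Longrightarrow> f i \<in> carrier G" "\<And>i. i \<in> I \<Longrightarrow> g i \<in> carrier G"
  shows "(\<Oplus>i\<in>I. \<ominus> f i \<oplus> g i) = \<ominus> finsum G f I \<oplus> finsum G g I"
proof -
  have "(\<Oplus>i\<in>I. \<ominus> f i \<oplus> g i) = (\<Oplus>i\<in>I. \<ominus> f i) \<oplus> finsum G g I"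
    by (rule finsum_addf) (use assms in auto)
  then show ?thesis using finsum_uminus[of I f, OF assms(1)] by simp
qed

lemma signed_minus:
  assumes "module K M" "a \<in> carrier M" "b \<in> carrier M"
  shows "signed M (e + 1) (a \<ominus>\<^bsub>M\<^esub> b) = \<ominus>\<^bsub>M\<^esub> signed M e a \<oplus>\<^bsub>M\<^esub> signed M e b"
proof -
  interpret M: module K M by fact
  show ?thesis using assms by (simp add: signed_def a_minus_def M.minus_add M.a_ac)
qed

context A_infinity_morphism
begin

text \<open>If the boundary entry lies in \<open>R\<close>, the inner map vanishes. Otherwise it
  survives as a boundary entry of \<open>shift is R\<close>, and the outer map vanishes.\<close>

lemma boundary_terms:
  assumes "is": "is \<in> index_tuples n" and b: "b \<in> set is" "b = 0 \<or> b = n"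
  shows "R \<subseteq> set is \<Longrightarrow> R \<noteq> set is \<Longrightarrow>
      face_mor n q is R v = \<zero>\<^bsub>target.T (n - length is) (q + int (length is) - 1)\<^esub>"
    and "R \<subseteq> set is \<Longrightarrow> R \<noteq> {} \<Longrightarrow>
      mor_face n q is R v = \<zero>\<^bsub>target.T (n - length is) (q + int (length is) - 1)\<^esub>"
proof -
  let ?T = "target.T (n - length is) (q + int (length is) - 1)"
  have T: "module K ?T" by (rule target.tensor_power_module)
  have s: "sorted_wrt (<) is" "set is \<subseteq> {..n}" using "is" by (auto simp: index_tuples_def)
  let ?r = "\<lambda>R. filter (\<lambda>i. i \<in> R) is"
  have br: "0 \<in> set (?r R) \<or> n \<in> set (?r R)" if "b \<in> R" for R using b that by auto
  show "face_mor n q is R v = \<zero>\<^bsub>?T\<^esub>" if R: "R \<subseteq> set is" "R \<noteq> set is"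
  proof -
    note len = wf_shift(3,4)[OF s R(1)]
    have deg: "n - card R - length (shift is R) = n - length is"
      "q + int (card R) + int (length (shift is R)) - 1 = q + int (length is) - 1" using len by auto
    have "tensor_face K A' \<pi>' (n - card R) (q + int (card R)) (shift is R) (tensor_morphism K A A' f n q (?r R) v)
        = \<zero>\<^bsub>?T\<^esub>"
    proof (cases "b \<in> R")
      case True
      have ne: "shift is R \<noteq> []" using R by (auto simp: shift_def filter_empty_conv)
      have "tensor_morphism K A A' f n q (?r R) v = \<zero>\<^bsub>target.T (n - card R) (q + int (card R))\<^esub>"
        using tensor_morphism_boundary[OF br[OF True]] s len by (auto simp: sorted_wrt_filter)
      then show ?thesis
        using lin_hom_zero[OF target.tensor_power_module T
            target.tensor_face_hom[OF ne refl, of "n - card R" "q + int (card R)", unfolded deg]]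
        by simp
    next
      case False
      have "tensor_face K A' \<pi>' (n - card R) (q + int (card R)) (shift is R) (tensor_morphism K A A' f n q (?r R) v)
        = \<zero>\<^bsub>target.T (n - card R - length (shift is R)) (q + int (card R) + int (length (shift is R)) - 1)\<^esub>"
        by (rule target.tensor_face_boundary[OF shift_boundary[OF s(2) b(1) False b(2) R(1)]])
      then show ?thesis unfolding deg .
    qed
    then show ?thesis unfolding face_mor_def by (simp add: signed_zero[OF T])
  qed
  show "mor_face n q is R v = \<zero>\<^bsub>?T\<^esub>" if R: "R \<subseteq> set is" "R \<noteq> {}"
  proof -
    note len = wf_shift(3,4)[OF s R(1)]
    have deg: "n - card R - length (shift is R) = n - length is"
      "q + int (card R) - 1 + int (length (shift is R)) = q + int (length is) - 1" using len by auto
    note idx = shift_index_tuples(1)[OF "is" R(1)]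
    have "tensor_morphism K A A' f (n - card R) (q + int (card R) - 1) (shift is R)
        (tensor_face K A \<pi> n q (?r R) v) = \<zero>\<^bsub>?T\<^esub>"
    proof (cases "b \<in> R")
      case True
      have "tensor_face K A \<pi> n q (?r R) v = \<zero>\<^bsub>source.T (n - card R) (q + int (card R) - 1)\<^esub>"
        using source.tensor_face_boundary[OF br[OF True]] len by simp
      then show ?thesis
        using lin_hom_zero[OF source.tensor_power_module T
            tensor_morphism_hom[OF idx refl, of "q + int (card R) - 1", unfolded deg]]
        by simp
    next
      case False
      then show ?thesis
        using tensor_morphism_boundary[OF shift_boundary[OF s(2) b(1) False b(2) R(1)]] idx
        unfolding deg[symmetric] by (auto simp: index_tuples_def)
    qed
    then show ?thesis unfolding mor_face_def by (simp add: signed_zero[OF T])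
  qed
qed

text \<open>Both sides are linear, so words suffice. A tuple that does not come from a composition
  contains \<open>0\<close> or \<open>n\<close>, and then every term is zero.\<close>

lemma morphism_relation:
  assumes "is": "is \<in> index_tuples n" and v: "v \<in> carrier (source.T n q)"
    and N: "N = n - length is" and Q: "Q = q + int (length is) - 1"
  shows "tensor_diff K A' d' N (q + int (length is)) (tensor_morphism K A A' f n q is v)
      \<oplus>\<^bsub>target.T N Q\<^esub> (\<Oplus>\<^bsub>target.T N Q\<^esub>R\<in>Pow (set is) - {set is}. face_mor n q is R v) =
    tensor_morphism K A A' f n (q - 1) is (tensor_diff K A d n q v)
      \<oplus>\<^bsub>target.T N Q\<^esub> (\<Oplus>\<^bsub>target.T N Q\<^esub>R\<in>Pow (set is) - {{}}. mor_face n q is R v)"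
proof -
  let ?T = "target.T N Q"
  have T: "module K ?T" and S: "module K (source.T n q)"
    by (rule target.tensor_power_module, rule source.tensor_power_module)
  interpret T: module K ?T by (rule T)
  have hD: "(\<lambda>v. tensor_diff K A' d' N (q + int (length is)) (tensor_morphism K A A' f n q is v))
      \<in> lin_hom K (source.T n q) ?T"
    unfolding N Q by (rule lin_hom_compose[OF tensor_morphism_hom[OF "is" refl] target.tensor_diff_hom])
  have hE: "(\<lambda>v. tensor_morphism K A A' f n (q - 1) is (tensor_diff K A d n q v)) \<in> lin_hom K (source.T n q) ?T"
  proof (rule lin_hom_compose[OF source.tensor_diff_hom])
    show "tensor_morphism K A A' f n (q - 1) is \<in> lin_hom K (source.T n (q - 1)) ?T"
      using tensor_morphism_hom[OF "is" refl, of "q - 1"] unfolding N Q by (simp add: algebra_simps)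
  qed
  show ?thesis
  proof (rule source.tensor_power_ext[OF T _ _ _ v])
    show "(\<lambda>v. tensor_diff K A' d' N (q + int (length is)) (tensor_morphism K A A' f n q is v)
      \<oplus>\<^bsub>?T\<^esub> (\<Oplus>\<^bsub>?T\<^esub>R\<in>Pow (set is) - {set is}. face_mor n q is R v)) \<in> lin_hom K (source.T n q) ?T"
      by (intro lin_hom_add[OF T hD] lin_hom_finsum[OF S T]) (use face_mor_hom[OF "is"] in \<open>auto simp: N Q\<close>)
    show "(\<lambda>v. tensor_morphism K A A' f n (q - 1) is (tensor_diff K A d n q v)
      \<oplus>\<^bsub>?T\<^esub> (\<Oplus>\<^bsub>?T\<^esub>R\<in>Pow (set is) - {{}}. mor_face n q is R v)) \<in> lin_hom K (source.T n q) ?T"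
      by (intro lin_hom_add[OF T hE] lin_hom_finsum[OF S T]) (use mor_face_hom[OF "is"] in \<open>auto simp: N Q\<close>)
    fix w assume w: "w \<in> words A n q"
    let ?w = "pure_tensor K A w"
    show "tensor_diff K A' d' N (q + int (length is)) (tensor_morphism K A A' f n q is ?w)
      \<oplus>\<^bsub>?T\<^esub> (\<Oplus>\<^bsub>?T\<^esub>R\<in>Pow (set is) - {set is}. face_mor n q is R ?w) =
    tensor_morphism K A A' f n (q - 1) is (tensor_diff K A d n q ?w)
      \<oplus>\<^bsub>?T\<^esub> (\<Oplus>\<^bsub>?T\<^esub>R\<in>Pow (set is) - {{}}. mor_face n q is R ?w)"
    proof (cases "\<exists>ms. letters ms = n \<and> gaps 0 ms = is")
      case True
      then obtain ms where ms: "letters ms = n" "is = gaps 0 ms" by blast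
      show ?thesis by (rule word_relation[OF w ms N Q])
    next
      case False
      then obtain b where b: "b \<in> set is" "b = 0 \<or> b = n"
        using index_tuples_cases[OF "is"] by blast
      have s: "sorted_wrt (<) is" "set is \<subseteq> {..n}" using "is" by (auto simp: index_tuples_def)
      have bb: "0 \<in> set is \<or> n \<in> set is" using b by auto
      have F: "tensor_morphism K A A' f n q' is v = \<zero>\<^bsub>target.T N (q' + int (length is))\<^esub>" for q' v
        unfolding N by (rule tensor_morphism_boundary[OF bb s])
      have "tensor_diff K A' d' N (q + int (length is)) \<zero>\<^bsub>target.T N (q + int (length is))\<^esub> = \<zero>\<^bsub>?T\<^esub>"
        unfolding Q by (rule lin_hom_zero[OF target.tensor_power_module target.tensor_power_module target.tensor_diff_hom])
      moreover have "target.T N (q - 1 + int (length is)) = ?T" unfolding Q by (simp add: algebra_simps)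
      moreover have "(\<Oplus>\<^bsub>?T\<^esub>R\<in>Pow (set is) - {set is}. face_mor n q is R ?w) = (\<Oplus>\<^bsub>?T\<^esub>R\<in>Pow (set is) - {set is}. \<zero>\<^bsub>?T\<^esub>)"
        by (rule T.finsum_eq_cong[OF refl]) (simp_all add: boundary_terms(1)[OF "is" b, where q = q, folded N Q])
      moreover have "(\<Oplus>\<^bsub>?T\<^esub>R\<in>Pow (set is) - {{}}. mor_face n q is R ?w) = (\<Oplus>\<^bsub>?T\<^esub>R\<in>Pow (set is) - {{}}. \<zero>\<^bsub>?T\<^esub>)"
        by (rule T.finsum_eq_cong[OF refl]) (simp_all add: boundary_terms(2)[OF "is" b, where q = q, folded N Q])
      ultimately show ?thesis unfolding F by simp
    qed
  qed
qed

lemma tensor_morphism_nil_relation: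
  assumes v: "v \<in> carrier (source.T n q)"
  shows "map_diff (tensor_power K A') (tensor_diff K A d) (tensor_diff K A' d') n n 0
    (\<lambda>q. tensor_morphism K A A' f n q []) q v = \<zero>\<^bsub>target.T n (q - 1)\<^esub>"
proof -
  let ?T = "target.T n (q - 1)"
  interpret T: module K ?T by (rule target.tensor_power_module)
  have nil: "[] \<in> index_tuples n" by (simp add: index_tuples_def)
  note h = tensor_morphism_hom[OF nil refl, unfolded list.size diff_zero of_nat_0 add_0_right]
  have c1: "tensor_diff K A' d' n q (tensor_morphism K A A' f n q [] v) \<in> carrier ?T"
    by (rule lin_hom_closed[OF target.tensor_diff_hom lin_hom_closed[OF h v]])
  have "tensor_diff K A' d' n q (tensor_morphism K A A' f n q [] v) =
      tensor_morphism K A A' f n (q - 1) [] (tensor_diff K A d n q v)"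
  proof -
    have "tensor_morphism K A A' f n (q - 1) [] (tensor_diff K A d n q v) \<in> carrier ?T"
      by (rule lin_hom_closed[OF h lin_hom_closed[OF source.tensor_diff_hom v]])
    \<comment> \<open>For the empty tuple both sums over \<open>R\<close> are empty.\<close>
    then show ?thesis using morphism_relation[OF nil v refl refl] c1 by simp
  qed
  then show ?thesis using c1 by (simp add: map_diff_def signed_def a_minus_def T.r_neg)
qed

lemma tensor_morphism_relation:
  assumes "is": "is \<in> index_tuples n" and ne: "is \<noteq> []" and k: "k = length is"
    and v: "v \<in> carrier (source.T n q)"
  shows "map_diff (tensor_power K A') (tensor_diff K A d) (tensor_diff K A' d') n (n - k) (int k)
      (\<lambda>q. tensor_morphism K A A' f n q is) q v =
      \<ominus>\<^bsub>target.T (n - k) (q + int k - 1)\<^esub>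
        (tensor_face K A' \<pi>' n q is (tensor_morphism K A A' f n q [] v))
      \<oplus>\<^bsub>target.T (n - k) (q + int k - 1)\<^esub>
        tensor_morphism K A A' f (n - k) (q + int k - 1) [] (tensor_face K A \<pi> n q is v)
      \<oplus>\<^bsub>target.T (n - k) (q + int k - 1)\<^esub>
      (\<Oplus>\<^bsub>target.T (n - k) (q + int k - 1)\<^esub>\<sigma>\<in>{\<sigma>. \<sigma> permutes {..<k}}.
       \<Oplus>\<^bsub>target.T (n - k) (q + int k - 1)\<^esub>m\<in>cuts (hat (permute_list \<sigma> is)).
         let l = take m (hat (permute_list \<sigma> is)); r = drop m (hat (permute_list \<sigma> is)) in
         signed (target.T (n - k) (q + int k - 1)) (perm_parity \<sigma> + 1)
           (tensor_face K A' \<pi>' (n - length r) (q + int (length r)) l (tensor_morphism K A A' f n q r v)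
            \<ominus>\<^bsub>target.T (n - k) (q + int k - 1)\<^esub>
            tensor_morphism K A A' f (n - length r) (q + int (length r) - 1) l (tensor_face K A \<pi> n q r v)))"
proof -
  let ?T = "target.T (n - k) (q + int k - 1)"
  have T: "module K ?T" by (rule target.tensor_power_module)
  interpret T: module K ?T by (rule T)
  have s: "sorted_wrt (<) is" "set is \<subseteq> {..n}" "length is \<le> n" using "is" by (auto simp: index_tuples_def)
  define a where "a R l r = tensor_face K A' \<pi>' (n - length r) (q + int (length r)) l (tensor_morphism K A A' f n q r v)"
    for R :: "nat set" and l r
  define b where "b R l r = tensor_morphism K A A' f (n - length r) (q + int (length r) - 1) l (tensor_face K A \<pi> n q r v)"
    for R :: "nat set" and l r
  \<comment> \<open>The shuffle summand as a function of its exponent. The shift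
    \<open>e + 1\<close> comes from the sign of the relation and turns the difference into
    \<open>\<ominus> face_mor \<oplus> mor_face\<close>.\<close>
  define h where "h e l r = signed ?T (e + 1) (a {} l r \<ominus>\<^bsub>?T\<^esub> b {} l r)" for e l r
  let ?r = "\<lambda>R. filter (\<lambda>i. i \<in> R) is"
  have cfm: "face_mor n q is R v \<in> carrier ?T" if "R \<subseteq> set is" "R \<noteq> set is" for R
    unfolding k by (rule lin_hom_closed[OF face_mor_hom[OF "is" that] v])
  have cmf: "mor_face n q is R v \<in> carrier ?T" if "R \<subseteq> set is" "R \<noteq> {}" for R
    unfolding k by (rule lin_hom_closed[OF mor_face_hom[OF "is" that] v])
  have fm: "face_mor n q is R v = signed ?T (int (crossings is R)) (a {} (shift is R) (?r R))"
    and mf: "mor_face n q is R v = signed ?T (int (crossings is R)) (b {} (shift is R) (?r R))"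
    if "R \<subseteq> set is" for R
    using wf_shift(4)[OF s(1,2) that] unfolding face_mor_def mor_face_def a_def b_def k by auto
  have ca: "a {} (shift is R) (?r R) \<in> carrier ?T" if R: "R \<subseteq> set is" "R \<noteq> set is" for R
  proof -
    note len = wf_shift(3,4)[OF s(1,2) R(1)]
    have ne': "shift is R \<noteq> []" using R by (auto simp: shift_def filter_empty_conv)
    have "tensor_morphism K A A' f n q (?r R) v \<in> carrier (target.T (n - card R) (q + int (card R)))"
      by (rule lin_hom_closed[OF tensor_morphism_hom[OF shift_index_tuples(2)[OF "is" R(1)] len(2)[symmetric]] v])
    note lin_hom_closed[OF target.tensor_face_hom[OF ne' refl] this]
    moreover have "n - card R - length (shift is R) = n - k"
      "q + int (card R) + int (length (shift is R)) - 1 = q + int k - 1" using len k by auto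
    ultimately show ?thesis unfolding a_def len(2) by (simp only:)
  qed
  have cb: "b {} (shift is R) (?r R) \<in> carrier ?T" if R: "R \<subseteq> set is" "R \<noteq> {}" for R
  proof -
    note len = wf_shift(3,4)[OF s(1,2) R(1)]
    have ne': "?r R \<noteq> []" using R by (auto simp: filter_empty_conv)
    have "tensor_face K A \<pi> n q (?r R) v \<in> carrier (source.T (n - card R) (q + int (card R) - 1))"
      by (rule lin_hom_closed[OF source.tensor_face_hom[OF ne' len(2)[symmetric]] v])
    note lin_hom_closed[OF tensor_morphism_hom[OF shift_index_tuples(1)[OF "is" R(1)] refl] this]
    moreover have "n - card R - length (shift is R) = n - k"
      "q + int (card R) - 1 + int (length (shift is R)) = q + int k - 1" using len k by auto
    ultimately show ?thesis unfolding b_def len(2) by (simp only:)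
  qed
  have hR: "h (int (crossings is R)) (shift is R) (?r R) =
      \<ominus>\<^bsub>?T\<^esub> face_mor n q is R v \<oplus>\<^bsub>?T\<^esub> mor_face n q is R v"
    if "R \<subseteq> set is" "R \<noteq> {}" "R \<noteq> set is" for R
    unfolding h_def fm[OF that(1)] mf[OF that(1)]
    by (rule signed_minus[OF T ca cb]) (use that in auto)
  let ?P = "Pow (set is) - {{}, set is}"
  have "(\<Oplus>\<^bsub>?T\<^esub>\<sigma>\<in>{\<sigma>. \<sigma> permutes {..<length is}}. \<Oplus>\<^bsub>?T\<^esub>m\<in>cuts (hat (permute_list \<sigma> is)).
      h (perm_parity \<sigma>) (take m (hat (permute_list \<sigma> is))) (drop m (hat (permute_list \<sigma> is)))) =
    (\<Oplus>\<^bsub>?T\<^esub>R\<in>?P. h (int (crossings is R)) (shift is R) (?r R))"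
  proof (rule T.finsum_shuffles[OF s(1)])
    show "h e l r = h e' l r" if "even (e - e')" for e e' l r
      unfolding h_def by (rule signed_cong) (use that in simp)
    show "h (int (crossings is R)) (shift is R) (?r R) \<in> carrier ?T"
      if "R \<subseteq> set is" "R \<noteq> {}" "R \<noteq> set is" for R
      unfolding hR[OF that] using cfm cmf that by (intro T.a_closed T.a_inv_closed) auto
  qed
  also have "\<dots> = (\<Oplus>\<^bsub>?T\<^esub>R\<in>?P. \<ominus>\<^bsub>?T\<^esub> face_mor n q is R v \<oplus>\<^bsub>?T\<^esub> mor_face n q is R v)"
  proof (rule T.finsum_eq_cong[OF refl])
    fix R assume R: "R \<in> ?P"
    show "h (int (crossings is R)) (shift is R) (?r R) =
        \<ominus>\<^bsub>?T\<^esub> face_mor n q is R v \<oplus>\<^bsub>?T\<^esub> mor_face n q is R v" by (rule hR) (use R in auto)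
    show "\<ominus>\<^bsub>?T\<^esub> face_mor n q is R v \<oplus>\<^bsub>?T\<^esub> mor_face n q is R v \<in> carrier ?T"
      using cfm cmf R by (intro T.a_closed T.a_inv_closed) auto
  qed
  also have "\<dots> = \<ominus>\<^bsub>?T\<^esub> (\<Oplus>\<^bsub>?T\<^esub>R\<in>?P. face_mor n q is R v) \<oplus>\<^bsub>?T\<^esub> (\<Oplus>\<^bsub>?T\<^esub>R\<in>?P. mor_face n q is R v)"
    by (rule T.finsum_difference) (use cfm cmf in auto)
  finally have sh: "(\<Oplus>\<^bsub>?T\<^esub>\<sigma>\<in>{\<sigma>. \<sigma> permutes {..<k}}. \<Oplus>\<^bsub>?T\<^esub>m\<in>cuts (hat (permute_list \<sigma> is)).
      h (perm_parity \<sigma>) (take m (hat (permute_list \<sigma> is))) (drop m (hat (permute_list \<sigma> is)))) =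
    \<ominus>\<^bsub>?T\<^esub> (\<Oplus>\<^bsub>?T\<^esub>R\<in>?P. face_mor n q is R v) \<oplus>\<^bsub>?T\<^esub> (\<Oplus>\<^bsub>?T\<^esub>R\<in>?P. mor_face n q is R v)"
    unfolding k .
  define D E a0 bS Sa Sb where
    "D = tensor_diff K A' d' (n - k) (q + int k) (tensor_morphism K A A' f n q is v)"
    and "E = tensor_morphism K A A' f n (q - 1) is (tensor_diff K A d n q v)"
    and "a0 = tensor_face K A' \<pi>' n q is (tensor_morphism K A A' f n q [] v)"
    and "bS = tensor_morphism K A A' f (n - k) (q + int k - 1) [] (tensor_face K A \<pi> n q is v)"
    and "Sa = (\<Oplus>\<^bsub>?T\<^esub>R\<in>?P. face_mor n q is R v)"
    and "Sb = (\<Oplus>\<^bsub>?T\<^esub>R\<in>?P. mor_face n q is R v)"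
  have set_ne: "{} \<noteq> set is" using ne by simp
  have f0: "face_mor n q is {} v = a0"
    using fm[of "{}"] unfolding a0_def a_def by (simp add: crossings_def shift_def signed_def)
  have mS: "mor_face n q is (set is) v = bS"
  proof -
    have "filter (\<lambda>i. i \<notin> set is) is = []" "filter (\<lambda>i. i \<in> set is) is = is"
      by (auto simp: filter_empty_conv filter_id_conv)
    then show ?thesis using mf[of "set is"] unfolding bS_def b_def k
      by (simp add: crossings_def shift_def signed_def)
  qed
  have c: "D \<in> carrier ?T" "E \<in> carrier ?T" "a0 \<in> carrier ?T" "bS \<in> carrier ?T" "Sa \<in> carrier ?T" "Sb \<in> carrier ?T"
  proof -
    show "D \<in> carrier ?T" unfolding D_def
      by (rule lin_hom_closed[OF target.tensor_diff_hom lin_hom_closed[OF tensor_morphism_hom[OF "is" k] v]])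
    have "E \<in> carrier (target.T (n - k) (q - 1 + int k))" unfolding E_def
      by (rule lin_hom_closed[OF tensor_morphism_hom[OF "is" k] lin_hom_closed[OF source.tensor_diff_hom v]])
    then show "E \<in> carrier ?T" by (simp add: algebra_simps)
    show "a0 \<in> carrier ?T" using cfm[of "{}"] set_ne f0 by simp
    show "bS \<in> carrier ?T" using cmf[of "set is"] set_ne mS by simp
    show "Sa \<in> carrier ?T" unfolding Sa_def using cfm by (intro T.finsum_closed) auto
    show "Sb \<in> carrier ?T" unfolding Sb_def using cmf by (intro T.finsum_closed) auto
  qed
  have "(\<Oplus>\<^bsub>?T\<^esub>R\<in>Pow (set is) - {set is}. face_mor n q is R v) = a0 \<oplus>\<^bsub>?T\<^esub> Sa"
  proof -
    have e: "Pow (set is) - {set is} - {{}} = ?P" by auto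
    show ?thesis
      using T.finsum_remove[of "Pow (set is) - {set is}" "{}" "\<lambda>R. face_mor n q is R v"] cfm set_ne
      unfolding e f0 Sa_def by auto
  qed
  moreover have "(\<Oplus>\<^bsub>?T\<^esub>R\<in>Pow (set is) - {{}}. mor_face n q is R v) = bS \<oplus>\<^bsub>?T\<^esub> Sb"
  proof -
    have e: "Pow (set is) - {{}} - {set is} = ?P" by auto
    show ?thesis
      using T.finsum_remove[of "Pow (set is) - {{}}" "set is" "\<lambda>R. mor_face n q is R v"] cmf set_ne
      unfolding e mS Sb_def by auto
  qed
  ultimately have rel: "D \<oplus>\<^bsub>?T\<^esub> (a0 \<oplus>\<^bsub>?T\<^esub> Sa) = E \<oplus>\<^bsub>?T\<^esub> (bS \<oplus>\<^bsub>?T\<^esub> Sb)"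
    using morphism_relation[OF "is" v refl refl] unfolding D_def E_def k by simp
  have "D \<ominus>\<^bsub>?T\<^esub> E = \<ominus>\<^bsub>?T\<^esub> (a0 \<oplus>\<^bsub>?T\<^esub> Sa) \<oplus>\<^bsub>?T\<^esub> (bS \<oplus>\<^bsub>?T\<^esub> Sb)"
    by (rule T.solve_difference[OF _ _ _ _ rel]) (use c in auto)
  also have "\<dots> = \<ominus>\<^bsub>?T\<^esub> a0 \<oplus>\<^bsub>?T\<^esub> bS \<oplus>\<^bsub>?T\<^esub> (\<ominus>\<^bsub>?T\<^esub> Sa \<oplus>\<^bsub>?T\<^esub> Sb)"
    using c by (simp add: T.minus_add T.a_ac)
  finally have "D \<ominus>\<^bsub>?T\<^esub> E = \<ominus>\<^bsub>?T\<^esub> a0 \<oplus>\<^bsub>?T\<^esub> bS \<oplus>\<^bsub>?T\<^esub> (\<ominus>\<^bsub>?T\<^esub> Sa \<oplus>\<^bsub>?T\<^esub> Sb)" .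
  \<comment> \<open>The map has total degree \<open>- k + k = 0\<close>, so its differential is the
    plain commutator.\<close>
  moreover have "map_diff (tensor_power K A') (tensor_diff K A d) (tensor_diff K A' d') n (n - k) (int k)
      (\<lambda>q. tensor_morphism K A A' f n q is) q v = D \<ominus>\<^bsub>?T\<^esub> E"
    using s(3) unfolding map_diff_def D_def E_def by (simp add: k signed_def of_nat_diff)
  ultimately show ?thesis
    unfolding Let_def a0_def[symmetric] bS_def[symmetric] using sh
    unfolding h_def a_def b_def Sa_def[symmetric] Sb_def[symmetric] by simp
qed

end

section \<open>The tensor module\<close>

text \<open>The last row and the last column cancel entry by entry. This serves for the square of
  the differential.\<close>

lemma (in abelian_group) finsum_antisym:
  assumes "\<And>i j. i < n \<Longrightarrow> j < n \<Longrightarrow> Z i j \<in> carrier G" "\<And>i. i < n \<Longrightarrow> Z i i = \<zero>"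
    and "\<And>i j. i < j \<Longrightarrow> j < n \<Longrightarrow> Z i j \<oplus> Z j i = \<zero>"
  shows "(\<Oplus>i\<in>{..<(n::nat)}. \<Oplus>j\<in>{..<n}. Z i j) = \<zero>"
  using assms
proof (induction n)
  case (Suc n)
  have c: "Z i j \<in> carrier G" if "i < Suc n" "j < Suc n" for i j using Suc.prems(1) that by blast
  have row: "(\<Oplus>j\<in>{..<Suc n}. Z i j) = Z i n \<oplus> (\<Oplus>j\<in>{..<n}. Z i j)" if "i < Suc n" for i
    unfolding lessThan_Suc using c[OF that] by (intro finsum_insert) auto
  have "(\<Oplus>i\<in>{..<Suc n}. \<Oplus>j\<in>{..<Suc n}. Z i j) =
      (\<Oplus>j\<in>{..<Suc n}. Z n j) \<oplus> (\<Oplus>i\<in>{..<n}. \<Oplus>j\<in>{..<Suc n}. Z i j)"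
    unfolding lessThan_Suc[of n] using c by (intro finsum_insert) (auto intro!: finsum_closed)
  also have "(\<Oplus>i\<in>{..<n}. \<Oplus>j\<in>{..<Suc n}. Z i j) = (\<Oplus>i\<in>{..<n}. Z i n \<oplus> (\<Oplus>j\<in>{..<n}. Z i j))"
    by (rule finsum_eq_cong[OF refl]) (use row c in \<open>auto intro!: finsum_closed a_closed\<close>)
  also have "\<dots> = (\<Oplus>i\<in>{..<n}. Z i n) \<oplus> (\<Oplus>i\<in>{..<n}. \<Oplus>j\<in>{..<n}. Z i j)"
    by (rule finsum_addf) (use c in \<open>auto intro!: finsum_closed\<close>)
  also have "(\<Oplus>i\<in>{..<n}. \<Oplus>j\<in>{..<n}. Z i j) = \<zero>"
    by (rule Suc.IH) (use Suc.prems in auto)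
  also have "(\<Oplus>j\<in>{..<Suc n}. Z n j) = (\<Oplus>j\<in>{..<n}. Z n j)"
    unfolding row[OF lessI] using Suc.prems(2) c by (auto intro!: l_zero finsum_closed)
  finally have "(\<Oplus>i\<in>{..<Suc n}. \<Oplus>j\<in>{..<Suc n}. Z i j) =
      (\<Oplus>j\<in>{..<n}. Z n j) \<oplus> (\<Oplus>i\<in>{..<n}. Z i n)"
    using c by (simp add: finsum_closed Pi_def)
  also have "\<dots> = (\<Oplus>j\<in>{..<n}. Z n j \<oplus> Z j n)"
    by (rule finsum_addf[symmetric]) (use c in auto)
  also have "\<dots> = (\<Oplus>j\<in>{..<n}. \<zero>)"
  proof (rule finsum_eq_cong[OF refl])
    fix j assume "j \<in> {..<n}"
    then have j: "j < n" by simp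
    have "Z n j \<oplus> Z j n = Z j n \<oplus> Z n j" using j c by (intro a_comm) auto
    then show "Z n j \<oplus> Z j n = \<zero>" using Suc.prems(3)[OF j] by simp
  qed simp
  finally show ?case by simp
qed simp

text \<open>Every subset is paired with its complement; the element \<open>\<mu>\<close> selects one
  member of each pair.\<close>

lemma (in abelian_group) finsum_complement:
  assumes "finite S" "\<mu> \<in> S"
    and closed: "\<And>R. R \<subseteq> S \<Longrightarrow> R \<noteq> {} \<Longrightarrow> R \<noteq> S \<Longrightarrow> f R \<in> carrier G"
    and cancel: "\<And>R. R \<subseteq> S \<Longrightarrow> R \<noteq> S \<Longrightarrow> \<mu> \<in> R \<Longrightarrow> f R \<oplus> f (S - R) = \<zero>"
  shows "finsum G f (Pow S - {{}, S}) = \<zero>"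
proof -
  let ?B = "{R. R \<subseteq> S \<and> R \<noteq> S \<and> \<mu> \<in> R}"
  have eq: "Pow S - {{}, S} = ?B \<union> (\<lambda>R. S - R) ` ?B"
  proof (rule Set.set_eqI)
    fix R show "R \<in> Pow S - {{}, S} \<longleftrightarrow> R \<in> ?B \<union> (\<lambda>R. S - R) ` ?B"
    proof (cases "\<mu> \<in> R")
      case False
      have "R \<in> (\<lambda>R. S - R) ` ?B" if "R \<in> Pow S - {{}, S}"
        by (rule image_eqI[of _ _ "S - R"]) (use that False assms(2) in auto)
      then show ?thesis using False assms(2) by auto
    qed (use assms(2) in auto)
  qed
  have finB: "finite ?B" by (rule finite_subset[of _ "Pow S"]) (use assms(1) in auto)
  have c1: "f R \<in> carrier G" if "R \<in> ?B" for R using that closed by auto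
  have c2: "f (S - R) \<in> carrier G" if "R \<in> ?B" for R using that assms(2) by (intro closed) auto
  have "finsum G f (Pow S - {{}, S}) = finsum G f ?B \<oplus> finsum G f ((\<lambda>R. S - R) ` ?B)"
    unfolding eq by (rule finsum_Un_disjoint) (use finB c1 c2 in auto)
  also have "finsum G f ((\<lambda>R. S - R) ` ?B) = (\<Oplus>R\<in>?B. f (S - R))"
    by (rule finsum_reindex) (use c2 in \<open>auto simp: inj_on_def\<close>)
  also have "finsum G f ?B \<oplus> \<dots> = (\<Oplus>R\<in>?B. f R \<oplus> f (S - R))"
    by (rule finsum_addf[symmetric]) (use c1 c2 in auto)
  also have "\<dots> = (\<Oplus>R\<in>?B. \<zero>)"
    by (rule finsum_eq_cong[OF refl]) (use cancel in auto)
  finally show ?thesis by simp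
qed

lemma interval_filter:
  assumes "sorted_wrt (<) is" "R \<subseteq> set is"
  shows "filter (\<lambda>i. i \<in> R) is = [a..<a + k] \<longleftrightarrow> R = {a..<a + k}"
proof
  assume "filter (\<lambda>i. i \<in> R) is = [a..<a + k]"
  then have "set (filter (\<lambda>i. i \<in> R) is) = {a..<a + k}" by (metis set_upt)
  then show "R = {a..<a + k}" using assms(2) by auto
next
  assume "R = {a..<a + k}"
  then show "filter (\<lambda>i. i \<in> R) is = [a..<a + k]"
    using assms by (intro strict_sorted_equal) (auto simp: sorted_wrt_filter)
qed

text \<open>If the set \<open>S\<close> of the entries of an index tuple is not an interval, a subset \<open>R\<close>
  containing its least element contributes to the sum over shuffles only if \<open>R\<close> and its complement are intervals, and then so does the complement.\<close>

definition separated :: "nat set \<Rightarrow> nat set \<Rightarrow> bool" where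
  "separated R L \<longleftrightarrow> (\<exists>a k b l. 1 \<le> k \<and> 1 \<le> l \<and> a + k < b \<and> R = {a..<a + k} \<and> L = {b..<b + l})"

text \<open>Two touching intervals would unite to a single one, which \<open>not\<close>
  forbids.\<close>

lemma separatedI:
  assumes S: "S = {a..<a + k} \<union> {b..<b + l}" and "1 \<le> k" "1 \<le> l" "a + k \<le> b"
    and not: "\<And>a k. S \<noteq> {a..<a + k}"
  shows "separated {a..<a + k} {b..<b + l}"
proof -
  have "b \<noteq> a + k"
  proof
    assume "b = a + k"
    then have "S = {a..<a + (k + l)}" unfolding S by auto
    then show False using not by blast
  qed
  then show ?thesis unfolding separated_def using assms(2-4) by (metis le_neq_implies_less)
qed

text \<open>As \<open>R\<close> is an interval containing the least element, all other entries lie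
  above it and are lowered by the same \<open>k\<close>. So they form an interval because their hats
  do.\<close>

lemma separated_low:
  assumes "is": "sorted_wrt (<) is" and R: "R \<subseteq> set is" "R \<noteq> set is" "\<mu> \<in> R" "\<And>i. i \<in> set is \<Longrightarrow> \<mu> \<le> i"
    and not: "\<And>a k. set is \<noteq> {a..<a + k}"
    and run: "filter (\<lambda>i. i \<in> R) is = [a..<a + k]" and shift: "shift is R = [j..<j + l]"
  shows "separated R (set is - R)"
proof -
  have Ra: "R = {a..<a + k}" using interval_filter[OF "is" R(1)] run by blast
  have k1: "1 \<le> k" using R(3) Ra by (cases k) auto
  have a: "a = \<mu>" using R(1,3,4) k1 unfolding Ra by (intro antisym) (auto simp: subset_iff)
  have above: "a + k \<le> i" if "i \<in> set is" "i \<notin> R" for i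
    using R(4)[OF that(1)] that(2) unfolding Ra a by auto
  have card: "card {r \<in> R. r < i} = k" if "i \<in> set is" "i \<notin> R" for i
  proof -
    have "{r \<in> R. r < i} = R" using above[OF that] unfolding Ra by auto
    then show ?thesis unfolding Ra by simp
  qed
  let ?L = "filter (\<lambda>i. i \<notin> R) is"
  have sh: "shift is R = map (\<lambda>i. i - k) ?L" unfolding shift_def using card by simp
  have "set is - R = {j + k..<j + k + l}"
  proof -
    have "(\<lambda>i. i - k) ` (set is - R) = {j..<j + l}"
      using arg_cong[OF shift[unfolded sh], of set] by auto
    moreover have "(\<lambda>i. i + k) ` (\<lambda>i. i - k) ` (set is - R) = set is - R"
    proof -
      have "(i - k) + k = i" if "i \<in> set is - R" for i using above[of i] that by auto
      then have "(\<lambda>i. (i - k) + k) ` (set is - R) = (\<lambda>i. i) ` (set is - R)" by (rule image_cong[OF refl])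
      then show ?thesis unfolding image_image by simp
    qed
    ultimately have "set is - R = (\<lambda>i. i + k) ` {j..<j + l}" by simp
    then show ?thesis by (simp add: add.commute add.left_commute)
  qed
  note L = this
  have l1: "1 \<le> l" using L R(1,2) by (cases l) auto
  have "j + k \<in> set is - R" unfolding L using l1 by simp
  then have "a + k \<le> j + k" using above by blast
  moreover have "set is = {a..<a + k} \<union> {j + k..<j + k + l}" using L Ra R(1) by auto
  ultimately show ?thesis using separatedI[OF _ k1 l1 _ not] unfolding L unfolding Ra by blast
qed

text \<open>Now the complement is an interval and the hats of \<open>R\<close> form a run. By
  \<open>shift_interval\<close>, the elements of \<open>R\<close> lie in an interval of entries. If
  one of them were above the complement, that interval would contain the complement too, and the
  whole set would be an interval. So \<open>R\<close> lies below and coincides with its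
  hats.\<close>

lemma separated_high:
  assumes "is": "sorted_wrt (<) is" and R: "R \<subseteq> set is" "R \<noteq> set is" "\<mu> \<in> R" "\<And>i. i \<in> set is \<Longrightarrow> \<mu> \<le> i"
    and not: "\<And>a k. set is \<noteq> {a..<a + k}"
    and run: "filter (\<lambda>i. i \<in> set is - R) is = [b..<b + l]" and shift: "shift is (set is - R) = [j..<j + k]"
  shows "separated R (set is - R)"
proof -
  let ?L = "set is - R"
  have Lb: "?L = {b..<b + l}" using interval_filter[OF "is", of ?L] run by blast
  have l1: "1 \<le> l" using Lb R(1,2) by (cases l) auto
  have LR: "set is - ?L = R" using R(1) by auto
  have "?L \<noteq> set is" using R(1,3) by auto
  moreover have "shift is ?L = [j..<j + length (shift is ?L)]" using shift by simp
  ultimately obtain c m where cm: "1 \<le> m" "{c..<c + m} \<subseteq> set is" "R \<subseteq> {c..<c + m}"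
    using shift_interval[OF "is", of ?L j] LR by auto
  have mb: "\<mu> < b"
  proof -
    have "b \<in> ?L" using Lb l1 by auto
    then show ?thesis using R(3,4) by (metis DiffD1 DiffD2 le_neq_implies_less)
  qed
  have below: "r < b" if r: "r \<in> R" for r
  proof (rule ccontr)
    assume nb: "\<not> r < b"
    have "r \<notin> ?L" using r by simp
    then have "r \<notin> {b..<b + l}" unfolding Lb .
    then have rb: "b + l \<le> r" using nb by simp
    have "c \<le> \<mu>" "r < c + m" using R(3) r cm(3) by auto
    then have "{b..<b + l} \<subseteq> {c..<c + m}" using mb rb by auto
    then have "set is \<subseteq> {c..<c + m}" using cm(3) Lb by blast
    then have "set is = {c..<c + m}" using cm(2) by blast
    then show False using not by blast
  qed
  have c0: "card {i \<in> ?L. i < r} = 0" if "r \<in> R" for r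
  proof -
    have "{i \<in> ?L. i < r} = {}" using below[OF that] unfolding Lb by auto
    then show ?thesis by simp
  qed
  have e1: "filter (\<lambda>i. i \<notin> ?L) is = filter (\<lambda>i. i \<in> R) is"
    by (rule filter_cong) auto
  have "shift is ?L = filter (\<lambda>i. i \<in> R) is"
    unfolding shift_def e1
  proof (rule map_idI)
    fix r assume "r \<in> set (filter (\<lambda>i. i \<in> R) is)"
    then have "r \<in> R" by simp
    then show "r - card {i \<in> ?L. i < r} = r" by (simp only: c0 diff_zero)
  qed
  then have Rj: "R = {j..<j + k}" using interval_filter[OF "is" R(1)] shift by metis
  have k1: "1 \<le> k" using R(3) Rj by (cases k) auto
  have "j + k - 1 \<in> R" unfolding Rj using k1 by auto
  then have "j + k \<le> b" using below[of "j + k - 1"] by linarith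
  moreover have "set is = {j..<j + k} \<union> {b..<b + l}" using Lb Rj R(1) by auto
  ultimately show ?thesis using separatedI[OF _ k1 l1 _ not] unfolding Lb unfolding Rj by blast
qed

text \<open>If \<open>R\<close> is the lower interval, each of the \<open>l\<close> upper entries
  has all \<open>k\<close> lower ones as inversions; if \<open>R\<close> is the upper interval,
  there are none. The exponent \<open>l * k\<close> has to match the Koszul rule for exchanging two
  operations.\<close>

lemma separated_shift:
  assumes "is": "sorted_wrt (<) is" "set is = {a..<a + k} \<union> {b..<b + l}" and ab: "a + k < b"
  shows "filter (\<lambda>i. i \<in> {a..<a + k}) is = [a..<a + k]" "shift is {a..<a + k} = [b - k..<b - k + l]"
    "crossings is {a..<a + k} = l * k"
    "filter (\<lambda>i. i \<in> {b..<b + l}) is = [b..<b + l]" "shift is {b..<b + l} = [a..<a + k]"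
    "crossings is {b..<b + l} = 0"
proof -
  have eq: "is = [a..<a + k] @ [b..<b + l]"
    by (rule strict_sorted_equal) (use "is" ab in \<open>auto simp: sorted_wrt_append\<close>)
  show "filter (\<lambda>i. i \<in> {a..<a + k}) is = [a..<a + k]" "filter (\<lambda>i. i \<in> {b..<b + l}) is = [b..<b + l]"
    by (rule interval_filter[OF "is"(1), THEN iffD2]; use "is"(2) in simp)+
  have "{r \<in> {a..<a + k}. r < i} = {a..<a + k}" if "b \<le> i" for i using that ab by auto
  then have c: "card {r \<in> {a..<a + k}. r < i} = k" if "b \<le> i" for i using that by simp
  have "shift [b..<b + l] {a..<a + k} = map (\<lambda>i. i - k) [b..<b + l]"
    "crossings [b..<b + l] {a..<a + k} = length [b..<b + l] * k"
    by (rule shift_const; use ab c in auto)+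
  moreover have "map (\<lambda>i. i - k) [b..<b + l] = [b - k..<b - k + l]"
    using ab by (subst map_upt_minus) auto
  moreover have "shift [a..<a + k] {a..<a + k} = []" "crossings [a..<a + k] {a..<a + k} = 0"
    by (rule shift_inside; simp)+
  ultimately show "shift is {a..<a + k} = [b - k..<b - k + l]" "crossings is {a..<a + k} = l * k"
    unfolding eq crossings_append by auto
  have "{r \<in> {b..<b + l}. r < i} = {}" if "i < a + k" for i using that ab by auto
  then have c: "card {r \<in> {b..<b + l}. r < i} = 0" if "i < a + k" for i using that by simp
  have "shift [a..<a + k] {b..<b + l} = map (\<lambda>i. i - 0) [a..<a + k]"
    "crossings [a..<a + k] {b..<b + l} = length [a..<a + k] * 0"
    by (rule shift_const; use ab c in auto)+
  moreover have "shift [b..<b + l] {b..<b + l} = []" "crossings [b..<b + l] {b..<b + l} = 0"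
    by (rule shift_inside; simp)+
  ultimately show "shift is {b..<b + l} = [a..<a + k]" "crossings is {b..<b + l} = 0"
    unfolding eq crossings_append by auto
qed

text \<open>\<open>l\<close> is the index of the inner operation and \<open>k - l\<close> that of
  the outer one, \<open>X\<close> the degree to the left of both, \<open>P\<close> that of the
  \<open>t\<close> letters between the two starting points. Up to \<open>k * (q + X)\<close>, which
  does not depend on the inner operation, the exponent of \<open>op_relation\<close>
  remains.\<close>

lemma parity_nested:
  fixes k l t q X P :: int
  shows "even ((l * (k - t - l) + ((l * (q - 1) + (l - 1) * (X + P)) + ((k - l) * (q + l - 1 - 1) + (k - l - 1) * X)))
    - (k * (q + X) + ((t + 1) * l + (l - 1) * P)))" (is "even ?e")
proof -
  have "?e = 2 * (k * l - X - k - l * l - l * t)" by (simp add: algebra_simps)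
  then show ?thesis by (simp only: dvd_triv_left)
qed

text \<open>\<open>X\<close> and \<open>Y\<close> are the degrees to the left of the two operations.
  In one order the right operation meets a prefix whose degree has changed by \<open>k - 1\<close>;
  together with the \<open>k * l\<close> crossings exactly one sign is left.\<close>

lemma parity_swap:
  fixes k l q X Y :: int
  shows "even ((k * l + ((k * (q - 1) + (k - 1) * X) + (l * (q + k - 1 - 1) + (l - 1) * (Y + k - 1))))
    - (((l * (q - 1) + (l - 1) * Y) + (k * (q + l - 1 - 1) + (k - 1) * X)) + 1))" (is "even ?e")
proof -
  have "?e = 2 * (k * l - l)" by (simp add: algebra_simps)
  then show ?thesis by (simp only: dvd_triv_left)
qed

context A_infinity_algebra
begin

text \<open>The exponent of a face on a word. At \<open>k = 0\<close> it has the parity of the sign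
  in the tensor differential, so \<open>d\<close> and the faces are handled together.\<close>

definition op_sign :: "nat \<Rightarrow> int \<Rightarrow> nat \<Rightarrow> 'a word \<Rightarrow> int" where
  "op_sign k q j w = int k * (q - 1) + (int k - 1) * wdeg (take j w)"

text \<open>First \<open>op k\<close> behind \<open>j\<close> letters, then \<open>op l\<close>
  behind \<open>i\<close> letters of the contracted word. Index 0 stands for the
  differential.\<close>

definition twice :: "nat \<Rightarrow> nat \<Rightarrow> nat \<Rightarrow> nat \<Rightarrow> 'a word \<Rightarrow> ('k, 'a) tensor" where
  "twice l i k j w = signed (T (length w - k - l) (wdeg w + int k + int l - 2))
      (op_sign k (wdeg w) j w + op_sign l (wdeg w + int k - 1) i (contract j k w))
      (pure_tensor K A (contract i l (contract j k w)))"

lemma twice_words: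
  assumes "w \<in> words A n q" "j + k < n" "i + l < n - k"
  shows "contract i l (contract j k w) \<in> words A (n - k - l) (q + int k + int l - 2)"
  using contract_words[OF contract_words[OF assms(1,2)] assms(3)] by (simp add: algebra_simps)

lemma twice_closed:
  assumes "w \<in> words A n q" "j + k < n" "i + l < n - k"
  shows "twice l i k j w \<in> carrier (T (n - k - l) (q + int k + int l - 2))"
  using pure_tensor_closed[OF twice_words[OF assms]] assms(1)
  by (auto simp: twice_def words_iff intro!: signed_closed[OF tensor_power_module])

text \<open>Two operations at disjoint places. Once the left one has been applied, the right one
  starts \<open>k\<close> letters earlier, at \<open>i - k\<close>. Both orders give the same word
  and, corrected by the crossing number \<open>k * l\<close>, opposite signs.\<close>

lemma twice_swap:
  assumes w: "w \<in> words A n q" and jk: "j + k < i" "i + l < n"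
  shows "signed (T (n - k - l) (q + int k + int l - 2)) (int k * int l) (twice l (i - k) k j w)
    \<oplus>\<^bsub>T (n - k - l) (q + int k + int l - 2)\<^esub> twice k j l i w = \<zero>\<^bsub>T (n - k - l) (q + int k + int l - 2)\<^esub>"
proof -
  let ?T = "T (n - k - l) (q + int k + int l - 2)"
  have T: "module K ?T" by (rule tensor_power_module)
  interpret T: module K ?T by (rule T)
  have wl: "length w = n" "wdeg w = q" using w by (auto simp: words_iff)
  define x b m c z where "x = take j w" and "b = take (k + 1) (drop j w)"
    and "m = take (i - j - k - 1) (drop (j + k + 1) w)" and "c = take (l + 1) (drop i w)"
    and "z = drop (i + l + 1) w"
  \<comment> \<open>\<open>b\<close> and \<open>c\<close> are the inputs of the two operations,
    \<open>m\<close> the letters between them.\<close>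
  have ws: "w = x @ b @ m @ c @ z"
  proof -
    have 1: "drop i w = c @ z"
      unfolding c_def z_def using append_take_drop_id[of "l + 1" "drop i w"] by (simp add: ac_simps)
    have "drop (i - j - k - 1) (drop (j + k + 1) w) = drop i w" using jk(1) by simp
    then have 2: "drop (j + k + 1) w = m @ c @ z"
      unfolding m_def using append_take_drop_id[of "i - j - k - 1" "drop (j + k + 1) w"] 1 by metis
    have "drop (k + 1) (drop j w) = drop (j + k + 1) w" by (simp add: ac_simps)
    then have "drop j w = b @ m @ c @ z"
      unfolding b_def using append_take_drop_id[of "k + 1" "drop j w"] 2 by metis
    then show ?thesis unfolding x_def using append_take_drop_id[of j w] by metis
  qed
  have len: "length x = j" "length b = k + 1" "length m = i - j - k - 1" "length c = l + 1"
    using jk wl(1) by (auto simp: x_def b_def m_def c_def)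
  have at: "contract (length u) e (u @ v @ t) = u @ (wdeg v + int e - 1, op e v) # t"
    if "length v = e + 1" for u v t e using that by (simp add: contract_def)
  have c1: "contract j k w = x @ (wdeg b + int k - 1, op k b) # m @ c @ z"
    using at[OF len(2), of x "m @ c @ z"] len(1) ws by simp
  have c2: "contract i l w = x @ b @ m @ (wdeg c + int l - 1, op l c) # z"
    using at[OF len(4), of "x @ b @ m" z] len jk(1) ws by simp
  have ik: "length (x @ (wdeg b + int k - 1, op k b) # m) = i - k" using len jk(1) by simp
  have c12: "contract (i - k) l (contract j k w) =
      x @ (wdeg b + int k - 1, op k b) # m @ (wdeg c + int l - 1, op l c) # z"
    using at[OF len(4), of "x @ (wdeg b + int k - 1, op k b) # m" z, unfolded ik] unfolding c1 by simp
  have c21: "contract j k (contract i l w) =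
      x @ (wdeg b + int k - 1, op k b) # m @ (wdeg c + int l - 1, op l c) # z"
    using at[OF len(2), of x "m @ (wdeg c + int l - 1, op l c) # z"] len(1) unfolding c2 by simp
  have t1: "wdeg (take (i - k) (contract j k w)) = wdeg (take i w) + int k - 1"
  proof -
    have "take (i - k) ((x @ (wdeg b + int k - 1, op k b) # m) @ c @ z) = x @ (wdeg b + int k - 1, op k b) # m"
      unfolding ik[symmetric] by (metis append_eq_conv_conj)
    then have "take (i - k) (contract j k w) = x @ (wdeg b + int k - 1, op k b) # m"
      unfolding c1 by simp
    moreover have "take i w = x @ b @ m" unfolding ws using len jk(1) by simp
    ultimately show ?thesis by simp
  qed
  have t2: "take j (contract i l w) = take j w" unfolding c2 using len(1) x_def by simp
  let ?p = "pure_tensor K A (contract j k (contract i l w))"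
  have p: "?p \<in> carrier ?T"
  proof -
    have "contract j k (contract i l w) \<in> words A (n - l - k) (q + int l + int k - 2)"
      by (rule twice_words[OF w jk(2)]) (use jk in simp)
    then show ?thesis using pure_tensor_closed by (simp add: algebra_simps)
  qed
  let ?e1 = "op_sign k q j w + op_sign l (q + int k - 1) (i - k) (contract j k w)"
  let ?e2 = "op_sign l q i w + op_sign k (q + int l - 1) j (contract i l w)"
  have a: "twice l (i - k) k j w = signed ?T ?e1 ?p" unfolding twice_def c12 c21 wl ..
  have b: "twice k j l i w = signed ?T ?e2 ?p"
    unfolding twice_def wl by (simp add: algebra_simps)
  have "signed ?T (int k * int l) (twice l (i - k) k j w) = signed ?T (?e2 + 1) ?p"
    unfolding a signed_signed[OF T p]
  proof (rule signed_cong)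
    show "even (int k * int l + ?e1 - (?e2 + 1))"
      using parity_swap[of "int k" "int l" q "wdeg (take j w)" "wdeg (take i w)"]
      unfolding op_sign_def t1 t2 by (simp only: add.assoc[symmetric])
  qed
  also have "\<dots> = \<ominus>\<^bsub>?T\<^esub> twice k j l i w" unfolding b by (rule signed_Suc[OF T p])
  finally have "signed ?T (int k * int l) (twice l (i - k) k j w) = \<ominus>\<^bsub>?T\<^esub> twice k j l i w" .
  then show ?thesis using T.l_neg[OF signed_closed[OF T p, of ?e2]] unfolding b by (simp only:)
qed

text \<open>All composites of two operations that together consume the \<open>k + 1\<close> letters
  behind the first \<open>t\<close>: this is \<open>op_relation\<close> for these letters, pushed
  into the slot they leave. For \<open>l = 0\<close> the inner operation is the differential, for
  \<open>l = k\<close> the outer one.\<close>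

lemma nested_sum:
  assumes w: "w \<in> words A n q" and tk: "t + k < n"
  shows "(\<Oplus>\<^bsub>T (n - k) (q + int k - 2)\<^esub>p\<in>{(s, l). s + l \<le> k}.
      signed (T (n - k) (q + int k - 2)) (int (snd p) * (int k - int (fst p) - int (snd p)))
        (twice (k - snd p) t (snd p) (t + fst p) w)) = \<zero>\<^bsub>T (n - k) (q + int k - 2)\<^esub>"
proof -
  let ?T = "T (n - k) (q + int k - 2)"
  have T: "module K ?T" by (rule tensor_power_module)
  interpret T: module K ?T by (rule T)
  have wl: "length w = n" "wdeg w = q" "wf_word A w" using w by (auto simp: words_iff)
  define x y z where "x = take t w" and "y = take (k + 1) (drop t w)" and "z = drop (t + k + 1) w"
  have ws: "w = x @ y @ z"
  proof -
    have "drop t w = y @ z"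
      unfolding y_def z_def using append_take_drop_id[of "k + 1" "drop t w"] by (simp add: ac_simps)
    then show ?thesis unfolding x_def using append_take_drop_id[of t w] by metis
  qed
  have len: "length x = t" "length y = k + 1" "length z = n - t - k - 1"
    using tk wl(1) by (auto simp: x_def y_def z_def)
  have wf: "wf_word A x" "wf_word A y" "wf_word A z" using wl(3) unfolding ws by auto
  have yw: "y \<in> words A (k + 1) (wdeg y)" using len wf by (simp add: words_iff)
  let ?G = "A (wdeg y + int k - 2)"
  have G: "module K ?G" by (rule module_graded)
  have slot: "(\<lambda>a. pure_tensor K A (x @ (wdeg y + int k - 2, a) # z)) \<in> lin_hom K ?G ?T"
    by (rule multilinear_slot[OF pure_tensor_multilinear])
      (use len wf tk wl(2) in \<open>auto simp: ws\<close>)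
  \<comment> \<open>The exponent common to all terms; \<open>k - 1\<close> is subtracted because the
    exponent in \<open>op_relation\<close> already contains it.\<close>
  let ?b = "int k * (q + wdeg x) - (int k - 1)"
  let ?e = "\<lambda>p. int k - 1 + (int (fst p) + 1) * int (snd p) + (int (snd p) - 1) * wdeg (take (fst p) y)"
  let ?o = "\<lambda>p. op (k - snd p) (contract (fst p) (snd p) y)"
  have oc: "?o p \<in> carrier ?G" if "p \<in> {(s, l). s + l \<le> k}" for p
  proof -
    have sl: "fst p + snd p \<le> k" using that by auto
    have cw: "contract (fst p) (snd p) y \<in> words A (k - snd p + 1) (wdeg y + int (snd p) - 1)"
      using contract_words[OF yw, of "fst p" "snd p"] sl by (simp add: Suc_diff_le)
    have "?o p \<in> carrier (A (wdeg (contract (fst p) (snd p) y) + int (k - snd p) - 1))"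
      by (rule op_closed) (use cw in \<open>auto simp: words_iff\<close>)
    moreover have "wdeg (contract (fst p) (snd p) y) + int (k - snd p) - 1 = wdeg y + int k - 2"
      using cw sl by (simp add: words_iff of_nat_diff)
    ultimately show ?thesis by (simp only:)
  qed
  have "(\<Oplus>\<^bsub>?T\<^esub>p\<in>{(s, l). s + l \<le> k}. signed ?T (int (snd p) * (int k - int (fst p) - int (snd p)))
        (twice (k - snd p) t (snd p) (t + fst p) w)) =
    (\<Oplus>\<^bsub>?T\<^esub>p\<in>{(s, l). s + l \<le> k}. signed ?T (?b + ?e p) (pure_tensor K A (x @ (wdeg y + int k - 2, ?o p) # z)))"
  proof (rule T.finsum_eq_cong[OF refl])
    fix p assume p: "p \<in> {(s, l). s + l \<le> k}"
    define s l where "s = fst p" and "l = snd p"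
    have sl: "s + l \<le> k" using p by (auto simp: s_def l_def)
    have c1: "contract (t + s) l w = x @ contract s l y @ z"
      using contract_append[of s l y x z] sl len ws by simp
    have cw: "contract s l y \<in> words A (k - l + 1) (wdeg y + int l - 1)"
      using contract_words[OF yw, of s l] sl by (simp add: Suc_diff_le)
    have "contract 0 (k - l) (contract s l y) = [(wdeg y + int k - 2, op (k - l) (contract s l y))]"
      using cw sl by (simp add: contract_def[of 0] words_iff of_nat_diff)
    then have c2: "contract t (k - l) (contract (t + s) l w) =
        x @ (wdeg y + int k - 2, op (k - l) (contract s l y)) # z"
      unfolding c1 using contract_append[of 0 "k - l" "contract s l y" x z] cw len by (simp add: words_iff)
    have t1: "wdeg (take (t + s) w) = wdeg x + wdeg (take s y)" unfolding ws using len sl by simp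
    have t2: "take t (contract (t + s) l w) = x" unfolding c1 using len by simp
    have Tt: "T (length w - l - (k - l)) (q + int l + int (k - l) - 2) = ?T"
      using sl wl by (simp add: of_nat_diff)
    let ?p = "pure_tensor K A (x @ (wdeg y + int k - 2, op (k - l) (contract s l y)) # z)"
    have pc: "?p \<in> carrier ?T" using lin_hom_closed[OF slot oc[OF p]] unfolding s_def l_def .
    have "signed ?T (int l * (int k - int s - int l)) (twice (k - l) t l (t + s) w) = signed ?T (?b + ?e (s, l)) ?p"
      unfolding twice_def c2 wl(2) unfolding Tt signed_signed[OF T pc] op_sign_def t1 t2 fst_conv snd_conv
    proof (rule signed_cong)
      have "int (k - l) = int k - int l" using sl by simp
      then show "even (int l * (int k - int s - int l) + (int l * (q - 1) + (int l - 1) * (wdeg x + wdeg (take s y)) +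
          (int (k - l) * (q + int l - 1 - 1) + (int (k - l) - 1) * wdeg x)) -
          (int k * (q + wdeg x) - (int k - 1) + (int k - 1 + (int s + 1) * int l + (int l - 1) * wdeg (take s y))))"
        using parity_nested[of "int l" "int k" "int s" q "wdeg x" "wdeg (take s y)"]
        by (simp add: add.assoc)
    qed
    then show "signed ?T (int (snd p) * (int k - int (fst p) - int (snd p)))
        (twice (k - snd p) t (snd p) (t + fst p) w) =
      signed ?T (?b + ?e p) (pure_tensor K A (x @ (wdeg y + int k - 2, ?o p) # z))"
      unfolding s_def l_def by simp
    show "signed ?T (?b + ?e p) (pure_tensor K A (x @ (wdeg y + int k - 2, ?o p) # z)) \<in> carrier ?T"
      by (rule signed_closed[OF T lin_hom_closed[OF slot oc[OF p]]])
  qed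
  also have "\<dots> = signed ?T ?b (pure_tensor K A (x @ (wdeg y + int k - 2,
      (\<Oplus>\<^bsub>?G\<^esub>p\<in>{(s, l). s + l \<le> k}. signed ?G (?e p) (?o p))) # z))"
    by (rule finsum_signed_image[OF T G slot oc])
  also have "(\<Oplus>\<^bsub>?G\<^esub>p\<in>{(s, l). s + l \<le> k}. signed ?G (?e p) (?o p)) = \<zero>\<^bsub>?G\<^esub>"
    by (rule op_relation[OF yw refl])
  finally show ?thesis
    using lin_hom_zero[OF G T slot] signed_zero[OF T] by simp
qed

end

lemma (in abelian_monoid) finsum_lessThan_add:
  assumes "\<And>i. i < a + b \<Longrightarrow> f i \<in> carrier G"
  shows "(\<Oplus>i\<in>{..<a + b}. f i) = (\<Oplus>i\<in>{..<a}. f i) \<oplus> (\<Oplus>j\<in>{..<(b :: nat)}. f (a + j))"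
  using assms
proof (induction b)
  case (Suc b)
  have "(\<Oplus>i\<in>{..<a + Suc b}. f i) = f (a + b) \<oplus> (\<Oplus>i\<in>{..<a + b}. f i)"
    unfolding add_Suc_right lessThan_Suc using Suc.prems by (intro finsum_insert) auto
  moreover have "(\<Oplus>j\<in>{..<Suc b}. f (a + j)) = f (a + b) \<oplus> (\<Oplus>j\<in>{..<b}. f (a + j))"
    unfolding lessThan_Suc using Suc.prems by (intro finsum_insert) auto
  moreover have "(\<Oplus>i\<in>{..<a}. f i) \<in> carrier G" "(\<Oplus>j\<in>{..<b}. f (a + j)) \<in> carrier G"
    using Suc.prems by (auto intro!: finsum_closed)
  ultimately show ?case using Suc.IH Suc.prems by (simp add: a_lcomm)
qed (simp add: finsum_closed Pi_def)

text \<open>\<open>D i\<close> stands for a face followed by the differential at letter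
  \<open>i\<close>, and \<open>E i\<close> for the opposite order. The face merges the letters from
  \<open>t\<close> to \<open>t + k\<close>: to the left of them the indices agree, to the right they
  differ by \<open>k\<close>. What does not cancel touches the merged letters.\<close>

lemma (in abelian_group) finsum_pairing:
  fixes m k t :: nat
  assumes D: "\<And>i. i < m \<Longrightarrow> D i \<in> carrier G" and E: "\<And>i. i < m + k \<Longrightarrow> E i \<in> carrier G"
    and t: "t < m" and low: "\<And>i. i < t \<Longrightarrow> E i \<oplus> D i = \<zero>"
    and high: "\<And>i. t < i \<Longrightarrow> i < m \<Longrightarrow> D i \<oplus> E (i + k) = \<zero>"
  shows "(\<Oplus>i\<in>{..<m}. D i) \<oplus> (\<Oplus>i\<in>{..<m + k}. E i) = D t \<oplus> (\<Oplus>s\<in>{..<k + 1}. E (t + s))"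
proof -
  define r where "r = m - t - 1"
  have m: "m = t + (1 + r)" using t by (simp add: r_def)
  let ?D1 = "\<Oplus>i\<in>{..<t}. D i" and ?D2 = "\<Oplus>j\<in>{..<r}. D (t + (1 + j))"
  let ?E1 = "\<Oplus>i\<in>{..<t}. E i" and ?E2 = "\<Oplus>s\<in>{..<k + 1}. E (t + s)"
    and ?E3 = "\<Oplus>j\<in>{..<r}. E (t + (k + 1 + j))"
  have c: "?D1 \<in> carrier G" "D t \<in> carrier G" "?D2 \<in> carrier G" "?E1 \<in> carrier G" "?E2 \<in> carrier G" "?E3 \<in> carrier G"
    using D E m by (auto intro!: finsum_closed)
  have "(\<Oplus>i\<in>{..<m}. D i) = ?D1 \<oplus> (\<Oplus>j\<in>{..<1 + r}. D (t + j))"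
    unfolding m by (rule finsum_lessThan_add) (use D m in auto)
  also have "(\<Oplus>j\<in>{..<1 + r}. D (t + j)) = (\<Oplus>j\<in>{..<1}. D (t + j)) \<oplus> ?D2"
    by (rule finsum_lessThan_add) (use D m in auto)
  also have "(\<Oplus>j\<in>{..<1}. D (t + j)) = D t" using c(2) by (simp add: lessThan_Suc)
  finally have sD: "(\<Oplus>i\<in>{..<m}. D i) = ?D1 \<oplus> (D t \<oplus> ?D2)" .
  have mk: "m + k = t + (k + 1 + r)" using m by simp
  have "(\<Oplus>i\<in>{..<m + k}. E i) = ?E1 \<oplus> (\<Oplus>j\<in>{..<k + 1 + r}. E (t + j))"
    unfolding mk by (rule finsum_lessThan_add) (use E m in auto)
  also have "(\<Oplus>j\<in>{..<k + 1 + r}. E (t + j)) = ?E2 \<oplus> ?E3"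
    by (rule finsum_lessThan_add) (use E m in auto)
  finally have sE: "(\<Oplus>i\<in>{..<m + k}. E i) = ?E1 \<oplus> (?E2 \<oplus> ?E3)" .
  have "?E1 \<oplus> ?D1 = (\<Oplus>i\<in>{..<t}. E i \<oplus> D i)"
    by (rule finsum_addf[symmetric]) (use D E m in auto)
  also have "\<dots> = (\<Oplus>i\<in>{..<t}. \<zero>)" by (rule finsum_eq_cong[OF refl]) (use low in auto)
  finally have z1: "?E1 \<oplus> ?D1 = \<zero>" by simp
  have "?D2 \<oplus> ?E3 = (\<Oplus>j\<in>{..<r}. D (t + (1 + j)) \<oplus> E (t + (k + 1 + j)))"
    by (rule finsum_addf[symmetric]) (use D E m in auto)
  also have "\<dots> = (\<Oplus>j\<in>{..<r}. \<zero>)"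
    by (rule finsum_eq_cong[OF refl]) (use high[of "t + (1 + j)" for j] m in \<open>auto simp: ac_simps\<close>)
  finally have z2: "?D2 \<oplus> ?E3 = \<zero>" by simp
  have "(?D1 \<oplus> (D t \<oplus> ?D2)) \<oplus> (?E1 \<oplus> (?E2 \<oplus> ?E3)) = (?E1 \<oplus> ?D1) \<oplus> ((?D2 \<oplus> ?E3) \<oplus> (D t \<oplus> ?E2))"
    using c by (simp add: a_ac)
  then show ?thesis unfolding sD sE z1 z2 using c by simp
qed

text \<open>This is \<open>finsum_runs\<close> for the composition of \<open>t\<close> groups of one
  letter followed by a single group of \<open>k + 1\<close> letters.\<close>

lemma (in abelian_monoid) finsum_subintervals:
  fixes t k :: nat
  assumes closed: "\<And>R. R \<subseteq> {t + 1..<t + 1 + k} \<Longrightarrow> X R \<in> carrier G"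
    and zero: "\<And>R. R \<subseteq> {t + 1..<t + 1 + k} \<Longrightarrow> R \<noteq> {} \<Longrightarrow> \<not> (\<exists>j l. R = {j..<j + l}) \<Longrightarrow> X R = \<zero>"
  shows "finsum G X (Pow {t + 1..<t + 1 + k} - {{}}) =
    (\<Oplus>p\<in>{(s, l). 1 \<le> l \<and> s + l \<le> k}. X {t + fst p + 1..<t + fst p + 1 + snd p})"
proof -
  let ?ms = "replicate t 0 @ [k]"
  have set: "set (gaps 0 ?ms) = {t + 1..<t + 1 + k}"
    unfolding gaps_append by (simp add: add.commute add.left_commute del: upt_Suc)
  have sub: "{t + s + 1..<t + s + 1 + l} \<subseteq> {t + 1..<t + 1 + k}" if "s + l \<le> k" for s l using that by auto
  have "finsum G X (Pow (set (gaps 0 ?ms)) - {{}}) =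
    (\<Oplus>i\<in>{..<length ?ms}. \<Oplus>p\<in>{(s, l). 1 \<le> l \<and> s + l \<le> ?ms ! i}.
      X {letters (take i ?ms) + fst p + 1..<letters (take i ?ms) + fst p + 1 + snd p})"
    by (rule finsum_runs) (use assms set in auto)
  also have "\<dots> = (\<Oplus>i\<in>{t}. \<Oplus>p\<in>{(s, l). 1 \<le> l \<and> s + l \<le> ?ms ! i}.
      X {letters (take i ?ms) + fst p + 1..<letters (take i ?ms) + fst p + 1 + snd p})"
  proof (rule finsum_subset)
    fix i assume "i \<in> {..<length ?ms} - {t}"
    then have "?ms ! i = 0" by (auto simp: nth_append)
    then have "{(s, l). 1 \<le> l \<and> s + l \<le> ?ms ! i} = {}" by auto
    then show "(\<Oplus>p\<in>{(s, l). 1 \<le> l \<and> s + l \<le> ?ms ! i}.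
      X {letters (take i ?ms) + fst p + 1..<letters (take i ?ms) + fst p + 1 + snd p}) = \<zero>"
      by (simp only: finsum_empty)
  next
    fix i assume "i \<in> {t}"
    then show "(\<Oplus>p\<in>{(s, l). 1 \<le> l \<and> s + l \<le> ?ms ! i}.
      X {letters (take i ?ms) + fst p + 1..<letters (take i ?ms) + fst p + 1 + snd p}) \<in> carrier G"
      using closed[OF sub] by (auto intro!: finsum_closed simp: nth_append)
  qed auto
  also have "\<dots> = (\<Oplus>p\<in>{(s, l). 1 \<le> l \<and> s + l \<le> k}. X {t + fst p + 1..<t + fst p + 1 + snd p})"
  proof -
    have "(\<Oplus>p\<in>{(s, l). 1 \<le> l \<and> s + l \<le> k}. X {t + fst p + 1..<t + fst p + 1 + snd p}) \<in> carrier G"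
      using closed[OF sub] by (auto intro!: finsum_closed)
    then show ?thesis by (simp add: nth_append)
  qed
  finally show ?thesis unfolding set .
qed

section \<open>Composites of the differential and the faces\<close>

context A_infinity_algebra
begin

lemma tensor_diff_pure':
  assumes "w \<in> words A n q"
  shows "tensor_diff K A d n q (pure_tensor K A w) =
    (\<Oplus>\<^bsub>T n (q - 1)\<^esub>t\<in>{..<n}. signed (T n (q - 1)) (op_sign 0 q t w) (pure_tensor K A (contract t 0 w)))"
  unfolding tensor_diff_pure[OF assms] op_sign_def
  by (intro arg_cong[where f = "\<lambda>h. finsum (T n (q - 1)) h {..<n}"] ext signed_cong) simp

lemma diff_twice:
  assumes w: "w \<in> words A n q" and jk: "j + k < n"
    and m: "m = n - k" and Q: "Q = q + int k - 1" and Q': "Q' = q + int k - 2"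
  shows "tensor_diff K A d m Q (signed (T m Q) (op_sign k q j w) (pure_tensor K A (contract j k w))) =
    (\<Oplus>\<^bsub>T m Q'\<^esub>i\<in>{..<m}. twice 0 i k j w)"
proof -
  have T: "module K (T m Q')" and S: "module K (T m Q)" by (rule tensor_power_module)+
  interpret T: module K "T m Q'" by (rule T)
  have wl: "length w = n" "wdeg w = q" using w by (auto simp: words_iff)
  have cw: "contract j k w \<in> words A m Q" using contract_words[OF w jk] unfolding m Q .
  have Q1: "Q - 1 = Q'" unfolding Q Q' by simp
  have h: "tensor_diff K A d m Q \<in> lin_hom K (T m Q) (T m Q')" using tensor_diff_hom[of m Q] unfolding Q1 .
  have c: "pure_tensor K A (contract i 0 (contract j k w)) \<in> carrier (T m Q')" if "i < m" for i
    using pure_tensor_closed[OF contract_words[OF cw, of i 0]] that Q1 by simp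
  have "tensor_diff K A d m Q (signed (T m Q) (op_sign k q j w) (pure_tensor K A (contract j k w))) =
    signed (T m Q') (op_sign k q j w) (\<Oplus>\<^bsub>T m Q'\<^esub>i\<in>{..<m}. signed (T m Q') (op_sign 0 Q i (contract j k w))
      (pure_tensor K A (contract i 0 (contract j k w))))"
    unfolding lin_hom_signed_apply[OF S T h pure_tensor_closed[OF cw]] tensor_diff_pure'[OF cw] Q1 ..
  also have "\<dots> = (\<Oplus>\<^bsub>T m Q'\<^esub>i\<in>{..<m}. signed (T m Q') (op_sign k q j w)
      (signed (T m Q') (op_sign 0 Q i (contract j k w)) (pure_tensor K A (contract i 0 (contract j k w)))))"
    by (rule signed_finsum[OF T]) (use c signed_closed[OF T] in auto)
  also have "\<dots> = (\<Oplus>\<^bsub>T m Q'\<^esub>i\<in>{..<m}. twice 0 i k j w)"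
  proof (rule T.finsum_eq_cong[OF refl])
    fix i assume "i \<in> {..<m}"
    then have i: "i < m" by simp
    have e: "twice 0 i k j w = signed (T m Q') (op_sign k q j w + op_sign 0 Q i (contract j k w))
      (pure_tensor K A (contract i 0 (contract j k w)))"
      unfolding twice_def wl m Q Q' by simp
    then show "signed (T m Q') (op_sign k q j w) (signed (T m Q') (op_sign 0 Q i (contract j k w))
        (pure_tensor K A (contract i 0 (contract j k w)))) = twice 0 i k j w"
      unfolding signed_signed[OF T c[OF i]] by simp
    show "twice 0 i k j w \<in> carrier (T m Q')" unfolding e by (rule signed_closed[OF T c[OF i]])
  qed
  finally show ?thesis .
qed

lemma face_twice:
  assumes w: "w \<in> words A n q" and jk: "j + k < n" and il: "i + l < m" "1 \<le> l"
    and m: "m = n - k" and Q: "Q = q + int k - 1"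
  shows "tensor_face K A \<pi> m Q [i + 1..<i + 1 + l]
      (signed (T m Q) (op_sign k q j w) (pure_tensor K A (contract j k w))) = twice l i k j w"
proof -
  let ?T = "T (m - l) (Q + int l - 1)"
  have T: "module K ?T" and S: "module K (T m Q)" by (rule tensor_power_module)+
  have wl: "length w = n" "wdeg w = q" using w by (auto simp: words_iff)
  have cw: "contract j k w \<in> words A m Q" using contract_words[OF w jk] unfolding m Q .
  have h: "tensor_face K A \<pi> m Q [i + 1..<i + 1 + l] \<in> lin_hom K (T m Q) ?T"
    by (rule tensor_face_hom) (use il(2) in auto)
  have c: "pure_tensor K A (contract i l (contract j k w)) \<in> carrier ?T"
    using pure_tensor_closed[OF contract_words[OF cw il(1)]] .
  have Q': "Q + int l - 1 = q + int k + int l - 2" unfolding Q by simp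
  show ?thesis
    unfolding lin_hom_signed_apply[OF S T h pure_tensor_closed[OF cw]]
      tensor_face_pure[OF cw il refl refl] signed_signed[OF T c]
    unfolding twice_def wl op_sign_def m[symmetric] Q[symmetric] unfolding Q' ..
qed

lemma face_pure:
  assumes "w \<in> words A n q" "t + k < n" "1 \<le> k" "n - k = m" "q + int k - 1 = q'"
  shows "tensor_face K A \<pi> n q [t + 1..<t + 1 + k] (pure_tensor K A w) =
    signed (T m q') (op_sign k q t w) (pure_tensor K A (contract t k w))"
  unfolding op_sign_def by (rule tensor_face_pure[OF assms])

text \<open>Some letter must have negative degree, where the module is zero.\<close>

lemma negative_word:
  "wf_word A w \<Longrightarrow> wdeg w < 0 \<Longrightarrow> \<exists>u p v. w = u @ (p, \<zero>\<^bsub>A p\<^esub>) # v"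
proof (induction w)
  case (Cons x w)
  obtain p a where x: "x = (p, a)" by (cases x)
  show ?case
  proof (cases "p < 0")
    case True
    then have "a = \<zero>\<^bsub>A p\<^esub>" using zero_A[OF True] Cons.prems(1) x by auto
    then have "x # w = [] @ (p, \<zero>\<^bsub>A p\<^esub>) # w" using x by simp
    then show ?thesis by blast
  next
    case False
    then have "wdeg w < 0" using Cons.prems(2) x by simp
    then obtain u p v where "w = u @ (p, \<zero>\<^bsub>A p\<^esub>) # v" using Cons.IH Cons.prems(1) x by auto
    then have "x # w = (x # u) @ (p, \<zero>\<^bsub>A p\<^esub>) # v" by simp
    then show ?thesis by blast
  qed
qed simp

lemma tensor_power_negative:
  assumes "q < 0"
  shows "carrier (T n q) = {\<zero>\<^bsub>T n q\<^esub>}"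
proof -
  have T: "module K (T n q)" by (rule tensor_power_module)
  interpret T: module K "T n q" by (rule T)
  have "x = \<zero>\<^bsub>T n q\<^esub>" if "x \<in> carrier (T n q)" for x
  proof (rule tensor_power_ext[OF T _ lin_hom_zero_map[OF T] _ that])
    show "(\<lambda>x. x) \<in> lin_hom K (T n q) (T n q)" by (rule lin_homI) auto
    fix w assume w: "w \<in> words A n q"
    then have "wf_word A w" "wdeg w < 0" using assms by (auto simp: words_iff)
    then obtain u p v where eq: "w = u @ (p, \<zero>\<^bsub>A p\<^esub>) # v" using negative_word by blast
    show "pure_tensor K A w = \<zero>\<^bsub>T n q\<^esub>"
      unfolding eq by (rule pure_slot_zero) (use w eq in \<open>auto simp: words_iff\<close>)
  qed
  then show ?thesis by auto
qed

text \<open>Differentials at different letters anticommute by \<open>twice_swap\<close>; at the same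
  letter the claim is \<open>nested_sum\<close> for \<open>k = 0\<close>.\<close>

lemma tensor_diff_diff:
  assumes v: "v \<in> carrier (T n q)"
  shows "tensor_diff K A d n (q - 1) (tensor_diff K A d n q v) = \<zero>\<^bsub>T n (q - 2)\<^esub>"
proof -
  let ?T = "T n (q - 2)"
  have T: "module K ?T" by (rule tensor_power_module)
  interpret T: module K ?T by (rule T)
  have h: "tensor_diff K A d n (q - 1) \<in> lin_hom K (T n (q - 1)) ?T"
    using tensor_diff_hom[of n "q - 1"] by (simp add: diff_diff_eq)
  show ?thesis
  proof (rule tensor_power_ext[OF T lin_hom_compose[OF tensor_diff_hom h] lin_hom_zero_map[OF T] _ v])
    fix w assume w: "w \<in> words A n q"
    have cw: "pure_tensor K A (contract j 0 w) \<in> carrier (T n (q - 1))" if "j < n" for j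
      using pure_tensor_closed[OF contract_words[OF w, of j 0]] that by simp
    have z: "twice 0 i 0 j w \<in> carrier ?T" if "i < n" "j < n" for i j
      using twice_closed[OF w, of j 0 i 0] that by simp
    have "tensor_diff K A d n (q - 1) (tensor_diff K A d n q (pure_tensor K A w)) =
      (\<Oplus>\<^bsub>?T\<^esub>j\<in>{..<n}. tensor_diff K A d n (q - 1)
        (signed (T n (q - 1)) (op_sign 0 q j w) (pure_tensor K A (contract j 0 w))))"
      unfolding tensor_diff_pure'[OF w]
      by (rule lin_hom_finsum_apply[OF tensor_power_module T h])
        (use cw signed_closed[OF tensor_power_module] in auto)
    also have "\<dots> = (\<Oplus>\<^bsub>?T\<^esub>j\<in>{..<n}. \<Oplus>\<^bsub>?T\<^esub>i\<in>{..<n}. twice 0 i 0 j w)"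
    proof (rule T.finsum_eq_cong[OF refl])
      fix j assume "j \<in> {..<n}"
      then show "tensor_diff K A d n (q - 1)
          (signed (T n (q - 1)) (op_sign 0 q j w) (pure_tensor K A (contract j 0 w))) =
        (\<Oplus>\<^bsub>?T\<^esub>i\<in>{..<n}. twice 0 i 0 j w)"
        by (intro diff_twice[OF w]) auto
      show "(\<Oplus>\<^bsub>?T\<^esub>i\<in>{..<n}. twice 0 i 0 j w) \<in> carrier ?T"
        using z \<open>j \<in> {..<n}\<close> by (auto intro!: T.finsum_closed)
    qed
    also have "\<dots> = \<zero>\<^bsub>?T\<^esub>"
    proof (rule T.finsum_antisym)
      fix j assume j: "j < n"
      have "{(s, l). s + l \<le> 0} = {(0 :: nat, 0 :: nat)}" by auto
      then have "twice 0 j 0 j w \<oplus>\<^bsub>?T\<^esub> \<zero>\<^bsub>?T\<^esub> = \<zero>\<^bsub>?T\<^esub>"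
        using nested_sum[OF w, of j 0] z[OF j j] j by (simp add: signed_def)
      then show "twice 0 j 0 j w = \<zero>\<^bsub>?T\<^esub>" using z[OF j j] by simp
    next
      fix j i assume ji: "j < i" "i < n"
      have "twice 0 i 0 j w \<oplus>\<^bsub>?T\<^esub> twice 0 j 0 i w = \<zero>\<^bsub>?T\<^esub>"
        using twice_swap[OF w, of j 0 i 0] ji by (simp add: signed_def)
      then show "twice 0 i 0 j w \<oplus>\<^bsub>?T\<^esub> twice 0 j 0 i w = \<zero>\<^bsub>?T\<^esub>" .
    qed (use z in auto)
    finally show "tensor_diff K A d n (q - 1) (tensor_diff K A d n q (pure_tensor K A w)) = \<zero>\<^bsub>?T\<^esub>" .
  qed
qed

lemma tensor_power_differential: "graded_differential_module K (T n) (tensor_diff K A d n)"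
  by (intro graded_differential_module.intro graded_differential_module_axioms.intro cring_axioms
      tensor_power_module tensor_power_negative tensor_diff_hom tensor_diff_diff)


text \<open>The shuffle term of \<open>R\<close> for two faces, without the overall minus sign. Both
  extreme subsets are excluded below, since either would make one of the tuples empty.\<close>

definition face_face :: "nat \<Rightarrow> int \<Rightarrow> nat list \<Rightarrow> nat set \<Rightarrow> ('k, 'a) tensor \<Rightarrow> ('k, 'a) tensor" where
  "face_face n q is R v =
    signed (T (n - length is) (q + int (length is) - 2)) (int (crossings is R))
      (tensor_face K A \<pi> (n - card R) (q + int (card R) - 1) (shift is R)
        (tensor_face K A \<pi> n q (filter (\<lambda>i. i \<in> R) is) v))"

lemma face_face_degrees:
  assumes "is": "is \<in> index_tuples n" and R: "R \<subseteq> set is"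
  shows "n - card R - length (shift is R) = n - length is"
    "q + int (card R) - 1 + int (length (shift is R)) - 1 = q + int (length is) - 2"
  using wf_shift(3)[of "is" n R] "is" R by (auto simp: index_tuples_def)

lemma face_face_hom:
  assumes "is": "is \<in> index_tuples n" and R: "R \<subseteq> set is" "R \<noteq> {}" "R \<noteq> set is"
  shows "face_face n q is R \<in> lin_hom K (T n q) (T (n - length is) (q + int (length is) - 2))"
proof -
  have s: "sorted_wrt (<) is" "set is \<subseteq> {..n}" using "is" by (auto simp: index_tuples_def)
  have ne: "filter (\<lambda>i. i \<in> R) is \<noteq> []" "shift is R \<noteq> []"
    using R by (auto simp: shift_def filter_empty_conv)
  note f = tensor_face_hom[OF ne(1), of "card R" n q, OF wf_shift(4)[OF s R(1), symmetric]]
  note g = tensor_face_hom[OF ne(2) refl, of "n - card R" "q + int (card R) - 1",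
      unfolded face_face_degrees[OF "is" R(1)]]
  show ?thesis unfolding face_face_def by (intro lin_hom_signed[OF tensor_power_module] lin_hom_compose[OF f g])
qed

text \<open>A vanishing inner face is sent to zero by the linear outer one, so in a nonzero term
  both tuples are runs within the bounds.\<close>

lemma face_face_runs:
  assumes "is": "is \<in> index_tuples n" and R: "R \<subseteq> set is" "R \<noteq> set is"
    and ne: "face_face n q is R v \<noteq> \<zero>\<^bsub>T (n - length is) (q + int (length is) - 2)\<^esub>"
  obtains j i where "filter (\<lambda>i. i \<in> R) is = [j + 1..<j + 1 + card R]" "j + card R < n"
    "shift is R = [i + 1..<i + 1 + length (shift is R)]" "i + length (shift is R) < n - card R"
proof -
  let ?T = "T (n - length is) (q + int (length is) - 2)" and ?r = "filter (\<lambda>i. i \<in> R) is"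
  have T: "module K ?T" by (rule tensor_power_module)
  have s: "sorted_wrt (<) is" "set is \<subseteq> {..n}" using "is" by (auto simp: index_tuples_def)
  note lr = wf_shift(4)[OF s R(1)] and deg = face_face_degrees[OF "is" R(1)]
  have "shift is R \<noteq> []" using R by (auto simp: shift_def filter_empty_conv)
  note g = tensor_face_hom[OF this refl, of "n - card R" "q + int (card R) - 1", unfolded deg]
  have "\<exists>j. ?r = [j + 1..<j + 1 + card R] \<and> j + card R < n"
  proof (rule ccontr)
    assume "\<nexists>j. ?r = [j + 1..<j + 1 + card R] \<and> j + card R < n"
    then have "tensor_face K A \<pi> n q ?r v = \<zero>\<^bsub>T (n - card R) (q + int (card R) - 1)\<^esub>"
      using tensor_face_zero[of ?r n q v] unfolding lr by blast
    then have "face_face n q is R v = \<zero>\<^bsub>?T\<^esub>"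
      unfolding face_face_def
      by (simp only: lin_hom_zero[OF tensor_power_module T g] signed_zero[OF T])
    then show False using ne by simp
  qed
  moreover have "\<exists>i. shift is R = [i + 1..<i + 1 + length (shift is R)] \<and> i + length (shift is R) < n - card R"
  proof (rule ccontr)
    assume "\<nexists>i. shift is R = [i + 1..<i + 1 + length (shift is R)] \<and> i + length (shift is R) < n - card R"
    note tensor_face_zero[OF this, of "q + int (card R) - 1" "tensor_face K A \<pi> n q ?r v", unfolded deg]
    then have "face_face n q is R v = \<zero>\<^bsub>?T\<^esub>" unfolding face_face_def by (simp only: signed_zero[OF T])
    then show False using ne by simp
  qed
  ultimately show ?thesis using that by blast
qed

lemma face_face_pure:
  assumes w: "w \<in> words A n q" and run: "filter (\<lambda>i. i \<in> R) is = [j + 1..<j + 1 + k]" "shift is R = [i + 1..<i + 1 + l]"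
    and "card R = k" "1 \<le> k" "1 \<le> l" "j + k < n" "i + l < n - k"
  shows "face_face n q is R (pure_tensor K A w) =
    signed (T (n - length is) (q + int (length is) - 2)) (int (crossings is R)) (twice l i k j w)"
  unfolding face_face_def run \<open>card R = k\<close> face_pure[OF w assms(7,5) refl refl]
  by (simp only: face_twice[OF w assms(7,8,6) refl refl])

text \<open>The boundary entry lands, as a boundary entry, in one of the two tuples, and a run
  within the bounds contains none.\<close>

lemma face_face_boundary:
  assumes "is": "is \<in> index_tuples n" and R: "R \<subseteq> set is" "R \<noteq> set is"
    and b: "b \<in> set is" "b = 0 \<or> b = n"
  shows "face_face n q is R v = \<zero>\<^bsub>T (n - length is) (q + int (length is) - 2)\<^esub>"
proof (rule ccontr)
  assume "face_face n q is R v \<noteq> \<zero>\<^bsub>T (n - length is) (q + int (length is) - 2)\<^esub>"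
  from face_face_runs[OF "is" R this] obtain j i where
    ji: "filter (\<lambda>i. i \<in> R) is = [j + 1..<j + 1 + card R]" "j + card R < n"
    "shift is R = [i + 1..<i + 1 + length (shift is R)]" "i + length (shift is R) < n - card R" .
  have s: "set is \<subseteq> {..n}" using "is" by (auto simp: index_tuples_def)
  show False
  proof (cases "b \<in> R")
    case True
    then have "b \<in> set (filter (\<lambda>i. i \<in> R) is)" using b(1) by simp
    then have "b \<in> {j + 1..<j + 1 + card R}" unfolding ji(1) set_upt .
    then show False using b(2) ji(2) by auto
  next
    case False
    have "set (shift is R) = {i + 1..<i + 1 + length (shift is R)}" by (subst ji(3)) (rule set_upt)
    then show False using shift_boundary[OF s b(1) False b(2) R(1)] ji(4) by auto
  qed
qed

text \<open>If \<open>R\<close> or its complement gives a nonzero term, the entries form two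
  intervals with a hole between them, and the two terms are the same two operations in either
  order.\<close>

lemma face_face_complement:
  assumes "is": "is \<in> index_tuples n" and w: "w \<in> words A n q" and not: "\<And>a k. set is \<noteq> {a..<a + k}"
    and m: "m = n - length is" and Q: "Q = q + int (length is) - 2"
  shows "(\<Oplus>\<^bsub>T m Q\<^esub>R\<in>Pow (set is) - {{}, set is}. face_face n q is R (pure_tensor K A w)) = \<zero>\<^bsub>T m Q\<^esub>"
proof -
  let ?T = "T m Q" and ?f = "\<lambda>R. face_face n q is R (pure_tensor K A w)"
  have T: "module K ?T" by (rule tensor_power_module)
  interpret T: module K ?T by (rule T)
  have s: "sorted_wrt (<) is" using "is" by (auto simp: index_tuples_def)
  have ne: "set is \<noteq> {}" using not[of 0 0] by simp
  define \<mu> where "\<mu> = Min (set is)"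
  have \<mu>: "\<mu> \<in> set is" "\<And>i. i \<in> set is \<Longrightarrow> \<mu> \<le> i" using ne by (auto simp: \<mu>_def)
  show ?thesis
  proof (rule T.finsum_complement[OF finite_set \<mu>(1)])
    show "?f R \<in> carrier ?T" if "R \<subseteq> set is" "R \<noteq> {}" "R \<noteq> set is" for R
      unfolding m Q by (rule lin_hom_closed[OF face_face_hom[OF "is" that] pure_tensor_closed[OF w]])
    fix R assume R: "R \<subseteq> set is" "R \<noteq> set is" "\<mu> \<in> R"
    let ?L = "set is - R"
    have L: "?L \<subseteq> set is" "?L \<noteq> set is" using R by auto
    show "?f R \<oplus>\<^bsub>?T\<^esub> ?f ?L = \<zero>\<^bsub>?T\<^esub>"
    proof (cases "?f R = \<zero>\<^bsub>?T\<^esub> \<and> ?f ?L = \<zero>\<^bsub>?T\<^esub>")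
      case False
      \<comment> \<open>Whichever of the two terms is nonzero supplies the intervals together with
        the bounds that make both terms composites of actual operations.\<close>
      obtain a k b l where sep: "1 \<le> k" "1 \<le> l" "a + k < b" "R = {a..<a + k}" "?L = {b..<b + l}"
        and bd: "1 \<le> a" "b + l \<le> n"
      proof (cases "?f R = \<zero>\<^bsub>?T\<^esub>")
        case True
        then have "?f ?L \<noteq> \<zero>\<^bsub>T (n - length is) (q + int (length is) - 2)\<^esub>" using False unfolding m Q by simp
        from face_face_runs[OF "is" L this] obtain j i where
          ji: "filter (\<lambda>i. i \<in> ?L) is = [j + 1..<j + 1 + card ?L]" "j + card ?L < n"
          "shift is ?L = [i + 1..<i + 1 + length (shift is ?L)]" .
        have "separated R ?L" by (rule separated_high[OF s R \<mu>(2) not ji(1,3)])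
        then obtain a k b l where sep: "1 \<le> k" "1 \<le> l" "a + k < b" "R = {a..<a + k}" "?L = {b..<b + l}"
          unfolding separated_def by blast
        have S: "set is = {a..<a + k} \<union> {b..<b + l}" using sep R(1) by blast
        note sh = separated_shift[OF s S sep(3)]
        have "[a..<a + k] = [i + 1..<i + 1 + length (shift is ?L)]" using ji(3) sh(5) sep(5) by metis
        then have "1 \<le> a" using sep(1) by (cases "length (shift is ?L)") (auto simp: upt_conv_Cons simp del: upt_Suc)
        moreover have "[b..<b + l] = [j + 1..<j + 1 + l]"
        proof -
          have "card ?L = l" unfolding sep(5) by simp
          then show ?thesis using ji(1) sh(4) sep(5) by metis
        qed
        then have "b = j + 1" using sep(2) by (simp add: upt_conv_Cons del: upt_Suc)
        moreover have "card ?L = l" unfolding sep(5) by simp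
        ultimately show thesis using that[OF sep] ji(2) by simp
      next
        case nz: False
        then have "?f R \<noteq> \<zero>\<^bsub>T (n - length is) (q + int (length is) - 2)\<^esub>" unfolding m Q .
        from face_face_runs[OF "is" R(1,2) this] obtain j i where
          ji: "filter (\<lambda>i. i \<in> R) is = [j + 1..<j + 1 + card R]"
          "shift is R = [i + 1..<i + 1 + length (shift is R)]" "i + length (shift is R) < n - card R" .
        have "separated R ?L" by (rule separated_low[OF s R \<mu>(2) not ji(1,2)])
        then obtain a k b l where sep: "1 \<le> k" "1 \<le> l" "a + k < b" "R = {a..<a + k}" "?L = {b..<b + l}"
          unfolding separated_def by blast
        have S: "set is = {a..<a + k} \<union> {b..<b + l}" using sep R(1) by blast
        note sh = separated_shift[OF s S sep(3)]
        have cR: "card R = k" unfolding sep(4) by simp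
        have shR: "shift is R = [b - k..<b - k + l]" using sh(2) sep(4) by metis
        then have lsh: "length (shift is R) = l" by simp
        have "[a..<a + k] = [j + 1..<j + 1 + k]" using ji(1) sh(1) sep(4) cR by metis
        then have "a = j + 1" using sep(1) by (simp add: upt_conv_Cons del: upt_Suc)
        moreover have "[b - k..<b - k + l] = [i + 1..<i + 1 + l]" using ji(2) shR lsh by metis
        then have "b - k = i + 1" using sep(2) by (simp add: upt_conv_Cons del: upt_Suc)
        ultimately show thesis using that[OF sep] ji(3) sep(3) unfolding cR lsh by simp
      qed
      \<comment> \<open>An operation placed at index \<open>a\<close> has \<open>a - 1\<close>
        letters to its left.\<close>
      define j i where "j = a - 1" and "i = b - 1"
      have a: "a = j + 1" and b: "b = i + 1" using bd sep(3) by (auto simp: j_def i_def)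
      have S: "set is = {a..<a + k} \<union> {b..<b + l}" using sep R(1) by blast
      note sh = separated_shift[OF s S sep(3)]
      have len: "length is = k + l"
      proof -
        have "length is = card (set is)" using s by (simp add: distinct_card strict_sorted_iff)
        moreover have "card ({a..<a + k} \<union> {b..<b + l}) = k + l"
          using sep(3) by (subst card_Un_disjoint) auto
        ultimately show ?thesis unfolding S by simp
      qed
      have bk: "b - k = i - k + 1" using sep(3) b by simp
      have shR: "shift is R = [i - k + 1..<i - k + 1 + l]" unfolding sep(4) sh(2) bk ..
      have mQ: "m = n - k - l" "Q = q + int k + int l - 2" unfolding m Q len by auto
      have "?f R = signed ?T (int (crossings is R)) (twice l (i - k) k j w)"
        unfolding m Q
        by (rule face_face_pure[OF w _ _ _ sep(1,2)])
          (use sh(1) shR sep bd a b in \<open>simp_all del: upt_Suc\<close>)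
      also have "int (crossings is R) = int k * int l" using sh(3) sep(4) by simp
      finally have fR: "?f R = signed ?T (int k * int l) (twice l (i - k) k j w)" .
      have "?f ?L = signed ?T (int (crossings is ?L)) (twice k j l i w)"
        unfolding m Q
        by (rule face_face_pure[OF w _ _ _ sep(2,1)])
          (use sh(4,5) sep bd a b in \<open>simp_all del: upt_Suc\<close>)
      also have "int (crossings is ?L) = 0" using sh(6) sep(5) by simp
      finally have fL: "?f ?L = twice k j l i w" by (simp add: signed_def)
      show ?thesis
        unfolding fR fL mQ by (rule twice_swap[OF w]) (use sep(3) bd a b in auto)
    qed simp
  qed
qed

text \<open>After \<open>finsum_pairing\<close> the differential contributes only terms inside the
  merged letters. Together with the composites of two faces they exhaust the pairs in
  \<open>nested_sum\<close>.\<close>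

lemma face_face_interval:
  assumes "is": "is \<in> index_tuples n" "is = [t + 1..<t + 1 + k]" and w: "w \<in> words A n q"
    and tk: "t + k < n" "1 \<le> k" and m: "m = n - k" and Q: "Q = q + int k - 2"
  shows "(\<Oplus>\<^bsub>T m Q\<^esub>j\<in>{..<m}. twice 0 j k t w) \<oplus>\<^bsub>T m Q\<^esub> (\<Oplus>\<^bsub>T m Q\<^esub>j\<in>{..<n}. twice k t 0 j w)
    \<oplus>\<^bsub>T m Q\<^esub> (\<Oplus>\<^bsub>T m Q\<^esub>R\<in>Pow (set is) - {{}, set is}. face_face n q is R (pure_tensor K A w)) = \<zero>\<^bsub>T m Q\<^esub>"
proof -
  let ?T = "T m Q" and ?ff = "\<lambda>R. face_face n q is R (pure_tensor K A w)"
  let ?R = "\<lambda>s l. {t + s + 1..<t + s + 1 + l}"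
  let ?Y = "\<lambda>s l. signed ?T (int l * (int k - int s - int l)) (twice (k - l) t l (t + s) w)"
  have T: "module K ?T" by (rule tensor_power_module)
  interpret T: module K ?T by (rule T)
  have s: "sorted_wrt (<) is" using "is" by (auto simp: index_tuples_def)
  have len: "length is = k" and S: "set is = {t + 1..<t + 1 + k}" unfolding "is"(2) by (simp_all only: length_upt set_upt)
  have tc: "twice l i e j w \<in> carrier ?T" if "j + e < n" "i + l < n - e" "e + l = k" for i j e l
  proof -
    have "n - e - l = m" "q + int e + int l - 2 = Q" using that(3) by (auto simp: m Q)
    then show ?thesis using twice_closed[OF w that(1,2)] by simp
  qed
  have Yc: "?Y s l \<in> carrier ?T" if "s + l \<le> k" for s l
    by (rule signed_closed[OF T tc]) (use that tk in auto)
  have ffc: "?ff R \<in> carrier ?T" if "R \<subseteq> set is" "R \<noteq> {}" "R \<noteq> set is" for R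
    unfolding m Q using lin_hom_closed[OF face_face_hom[OF "is"(1) that] pure_tensor_closed[OF w]] unfolding len .
  have ffY: "?ff (?R s l) = ?Y s l" if sl: "s + l \<le> k" "1 \<le> l" "l < k" for s l
  proof -
    let ?us = "replicate t (0 :: nat)"
    have g: "gaps 0 (?us @ e # []) = [t + 1..<t + 1 + e]" for e
      unfolding gaps_append by (simp add: add.commute add.left_commute del: upt_Suc)
    note sh = shift_run[OF sl(1) refl, of ?us "[]", unfolded letters_replicate_0 g, folded "is"(2)]
    have "?ff (?R s l) = signed ?T (int (crossings is (?R s l))) (twice (k - l) t l (t + s) w)"
      using face_face_pure[OF w sh(1,2)] sl tk unfolding m Q len by simp
    also have "int (crossings is (?R s l)) = int l * (int k - int s - int l)"
      unfolding sh(3) using sl by (simp add: of_nat_diff)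
    finally show ?thesis .
  qed
  \<comment> \<open>The full set receives the term with \<open>s = 0\<close> and
    \<open>l = k\<close>, in which \<open>d\<close> follows the face; then
    \<open>finsum_subintervals\<close> produces all pairs with \<open>l \<ge> 1\<close>.\<close>
  define X where "X R = (if R = set is then twice 0 t k t w else if R = {} then \<zero>\<^bsub>?T\<^esub> else ?ff R)" for R
  have Xc: "X R \<in> carrier ?T" if "R \<subseteq> set is" for R
    unfolding X_def using ffc that tc[of t k t 0] tk by auto
  have X0: "X R = \<zero>\<^bsub>?T\<^esub>" if R: "R \<subseteq> set is" "R \<noteq> {}" "\<nexists>j l. R = {j..<j + l}" for R
  proof -
    have RS: "R \<noteq> set is" using R(3) S by blast
    have "?ff R = \<zero>\<^bsub>?T\<^esub>"
    proof (rule ccontr)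
      assume "?ff R \<noteq> \<zero>\<^bsub>?T\<^esub>"
      then have "?ff R \<noteq> \<zero>\<^bsub>T (n - length is) (q + int (length is) - 2)\<^esub>" unfolding m Q len .
      from face_face_runs[OF "is"(1) R(1) RS this] obtain j where
        "filter (\<lambda>i. i \<in> R) is = [j + 1..<j + 1 + card R]" by metis
      then show False using interval_filter[OF s R(1)] R(3) by blast
    qed
    then show ?thesis unfolding X_def using RS R(2) by simp
  qed
  have ne: "set is \<noteq> {}" unfolding S using tk(2) by simp
  have "finsum ?T X (Pow {t + 1..<t + 1 + k} - {{}}) =
      (\<Oplus>\<^bsub>?T\<^esub>p\<in>{(s, l). 1 \<le> l \<and> s + l \<le> k}. X (?R (fst p) (snd p)))"
    by (rule T.finsum_subintervals) (use Xc X0 S in auto)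
  also have "\<dots> = (\<Oplus>\<^bsub>?T\<^esub>p\<in>{(s, l). 1 \<le> l \<and> s + l \<le> k}. ?Y (fst p) (snd p))"
  proof (rule T.finsum_eq_cong[OF refl])
    fix p assume "p \<in> {(s, l). 1 \<le> l \<and> s + l \<le> k}"
    then obtain s l where p: "p = (s, l)" and sl: "1 \<le> l" "s + l \<le> k" by auto
    have "X (?R s l) = ?Y s l"
    proof (cases "l = k")
      case True
      then have "s = 0" "?R s l = set is" using sl S by auto
      then show ?thesis unfolding X_def using True by (simp add: signed_def)
    next
      case False
      have "card (?R s l) = l" "card (set is) = k" unfolding S by auto
      then have "?R s l \<noteq> set is" "?R s l \<noteq> {}" using False sl(1) by (metis, auto)
      then show ?thesis unfolding X_def using ffY[OF sl(2,1)] False sl(2) by auto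
    qed
    then show "X (?R (fst p) (snd p)) = ?Y (fst p) (snd p)" unfolding p fst_conv snd_conv .
    show "?Y (fst p) (snd p) \<in> carrier ?T" unfolding p fst_conv snd_conv by (rule Yc[OF sl(2)])
  qed
  finally have runs: "finsum ?T X (Pow (set is) - {{}}) =
      (\<Oplus>\<^bsub>?T\<^esub>p\<in>{(s, l). 1 \<le> l \<and> s + l \<le> k}. ?Y (fst p) (snd p))" unfolding S .
  let ?P = "Pow (set is) - {{}, set is}"
  have "finsum ?T X (Pow (set is) - {{}}) = X (set is) \<oplus>\<^bsub>?T\<^esub> finsum ?T X (Pow (set is) - {{}} - {set is})"
    by (rule T.finsum_remove) (use Xc ne in auto)
  also have "Pow (set is) - {{}} - {set is} = ?P" by auto
  also have "finsum ?T X ?P = finsum ?T ?ff ?P"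
    by (rule T.finsum_eq_cong[OF refl]) (use ffc in \<open>auto simp: X_def\<close>)
  also have "X (set is) = twice 0 t k t w" unfolding X_def by simp
  finally have ff: "twice 0 t k t w \<oplus>\<^bsub>?T\<^esub> finsum ?T ?ff ?P =
      (\<Oplus>\<^bsub>?T\<^esub>p\<in>{(s, l). 1 \<le> l \<and> s + l \<le> k}. ?Y (fst p) (snd p))" unfolding runs ..
  have Dc: "twice 0 i k t w \<in> carrier ?T" if "i < m" for i
    by (rule tc) (use that tk m in auto)
  have Ec: "twice k t 0 i w \<in> carrier ?T" if "i < m + k" for i
    by (rule tc) (use that tk m in auto)
  have mk: "m + k = n" using tk m by simp
  \<comment> \<open>One of the two operations is the differential, so no crossing sign
    occurs.\<close>
  have swap: "twice l (i - e) e j w \<oplus>\<^bsub>?T\<^esub> twice e j l i w = \<zero>\<^bsub>?T\<^esub>"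
    if "j + e < i" "i + l < n" "e + l = k" "e = 0 \<or> l = 0" for i j e l
  proof -
    have "n - e - l = m" "q + int e + int l - 2 = Q" using that(3) by (auto simp: m Q)
    moreover have "signed ?T (int e * int l) x = x" for x using that(4) by (auto simp: signed_def)
    ultimately show ?thesis using twice_swap[OF w that(1,2)] by simp
  qed
  have pair: "(\<Oplus>\<^bsub>?T\<^esub>j\<in>{..<m}. twice 0 j k t w) \<oplus>\<^bsub>?T\<^esub> (\<Oplus>\<^bsub>?T\<^esub>j\<in>{..<m + k}. twice k t 0 j w) =
      twice 0 t k t w \<oplus>\<^bsub>?T\<^esub> (\<Oplus>\<^bsub>?T\<^esub>s\<in>{..<k + 1}. twice k t 0 (t + s) w)"
  proof (rule T.finsum_pairing[OF Dc Ec])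
    show "t < m" using tk m by simp
    show "twice k t 0 i w \<oplus>\<^bsub>?T\<^esub> twice 0 i k t w = \<zero>\<^bsub>?T\<^esub>" if "i < t" for i
      using swap[of i 0 t k] that tk by simp
    show "twice 0 i k t w \<oplus>\<^bsub>?T\<^esub> twice k t 0 (i + k) w = \<zero>\<^bsub>?T\<^esub>" if "t < i" "i < m" for i
      using swap[of t k "i + k" 0] that mk by simp
  qed
  let ?E = "\<Oplus>\<^bsub>?T\<^esub>s\<in>{..<k + 1}. twice k t 0 (t + s) w"
  have "(\<Oplus>\<^bsub>?T\<^esub>p\<in>{(s, l). s + l \<le> k}. ?Y (fst p) (snd p)) =
      (\<Oplus>\<^bsub>?T\<^esub>s\<in>{..<k + 1}. ?Y s 0) \<oplus>\<^bsub>?T\<^esub> (\<Oplus>\<^bsub>?T\<^esub>p\<in>{(s, l). 1 \<le> l \<and> s + l \<le> k}. ?Y (fst p) (snd p))"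
    by (rule T.finsum_run_terms[OF Yc])
  moreover have "(\<Oplus>\<^bsub>?T\<^esub>p\<in>{(s, l). s + l \<le> k}. ?Y (fst p) (snd p)) = \<zero>\<^bsub>?T\<^esub>"
    using nested_sum[OF w tk(1)] unfolding m Q .
  moreover have "(\<lambda>s. ?Y s 0) = (\<lambda>s. twice k t 0 (t + s) w)" by (simp add: signed_def)
  ultimately have nested: "?E \<oplus>\<^bsub>?T\<^esub> (twice 0 t k t w \<oplus>\<^bsub>?T\<^esub> finsum ?T ?ff ?P) = \<zero>\<^bsub>?T\<^esub>"
    unfolding ff by (simp only:)
  have c: "?E \<in> carrier ?T" "twice 0 t k t w \<in> carrier ?T" "finsum ?T ?ff ?P \<in> carrier ?T"
  proof -
    show "?E \<in> carrier ?T" by (intro T.finsum_closed) (use Ec mk tk in auto)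
    show "twice 0 t k t w \<in> carrier ?T" by (rule Dc) (use tk m in simp)
    show "finsum ?T ?ff ?P \<in> carrier ?T" by (intro T.finsum_closed) (use ffc in auto)
  qed
  show ?thesis using nested c pair[unfolded mk] by (simp add: T.a_ac)
qed

lemma face_sum_relation:
  assumes "is": "is \<in> index_tuples n" "is \<noteq> []" and v: "v \<in> carrier (T n q)"
    and k: "k = length is" and m: "m = n - k" and Q: "Q = q + int k - 2"
  shows "tensor_diff K A d m (q + int k - 1) (tensor_face K A \<pi> n q is v)
      \<oplus>\<^bsub>T m Q\<^esub> tensor_face K A \<pi> n (q - 1) is (tensor_diff K A d n q v)
      \<oplus>\<^bsub>T m Q\<^esub> (\<Oplus>\<^bsub>T m Q\<^esub>R\<in>Pow (set is) - {{}, set is}. face_face n q is R v) = \<zero>\<^bsub>T m Q\<^esub>"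
proof -
  let ?T = "T m Q" and ?P = "Pow (set is) - {{}, set is}"
  have T: "module K ?T" and S: "module K (T n q)" by (rule tensor_power_module)+
  interpret T: module K ?T by (rule T)
  have s: "sorted_wrt (<) is" "set is \<subseteq> {..n}" using "is"(1) by (auto simp: index_tuples_def)
  have k1: "1 \<le> k" using "is"(2) k by (cases "is") auto
  have deg: "q + int k - 1 - 1 = Q" "q - 1 + int k - 1 = Q" unfolding Q by auto
  note f = tensor_face_hom[OF "is"(2) k, of n q, folded m]
  have f': "tensor_face K A \<pi> n (q - 1) is \<in> lin_hom K (T n (q - 1)) ?T"
    using tensor_face_hom[OF "is"(2) k, of n "q - 1"] unfolding m deg .
  have d': "tensor_diff K A d m (q + int k - 1) \<in> lin_hom K (T m (q + int k - 1)) ?T"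
    using tensor_diff_hom[of m "q + int k - 1"] unfolding deg .
  have ff: "face_face n q is R \<in> lin_hom K (T n q) ?T" if "R \<in> ?P" for R
    using face_face_hom[OF "is"(1), of R q] that unfolding m Q k by auto
  show ?thesis
  proof (rule tensor_power_ext[OF T _ lin_hom_zero_map[OF T] _ v])
    show "(\<lambda>v. tensor_diff K A d m (q + int k - 1) (tensor_face K A \<pi> n q is v)
      \<oplus>\<^bsub>?T\<^esub> tensor_face K A \<pi> n (q - 1) is (tensor_diff K A d n q v)
      \<oplus>\<^bsub>?T\<^esub> (\<Oplus>\<^bsub>?T\<^esub>R\<in>?P. face_face n q is R v)) \<in> lin_hom K (T n q) ?T"
      by (intro lin_hom_add[OF T] lin_hom_finsum[OF S T] lin_hom_compose[OF f d']
          lin_hom_compose[OF tensor_diff_hom f'] ff)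
    fix w assume w: "w \<in> words A n q"
    let ?w = "pure_tensor K A w"
    show "tensor_diff K A d m (q + int k - 1) (tensor_face K A \<pi> n q is ?w)
      \<oplus>\<^bsub>?T\<^esub> tensor_face K A \<pi> n (q - 1) is (tensor_diff K A d n q ?w)
      \<oplus>\<^bsub>?T\<^esub> (\<Oplus>\<^bsub>?T\<^esub>R\<in>?P. face_face n q is R ?w) = \<zero>\<^bsub>?T\<^esub>"
    proof (cases "\<exists>t. is = [t + 1..<t + 1 + length is] \<and> t + length is < n")
      case True
      then obtain t where t: "is = [t + 1..<t + 1 + k]" "t + k < n" unfolding k by blast
      have "tensor_diff K A d m (q + int k - 1) (tensor_face K A \<pi> n q is ?w) =
          (\<Oplus>\<^bsub>?T\<^esub>j\<in>{..<m}. twice 0 j k t w)"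
        unfolding t(1) face_pure[OF w t(2) k1 m[symmetric] refl]
        by (rule diff_twice[OF w t(2) m refl Q])
      moreover have "tensor_face K A \<pi> n (q - 1) is (tensor_diff K A d n q ?w) =
          (\<Oplus>\<^bsub>?T\<^esub>j\<in>{..<n}. twice k t 0 j w)"
      proof -
        have c: "signed (T n (q - 1)) (op_sign 0 q j w) (pure_tensor K A (contract j 0 w)) \<in> carrier (T n (q - 1))"
          if "j \<in> {..<n}" for j
          using pure_tensor_closed[OF contract_words[OF w, of j 0]] that
          by (intro signed_closed[OF tensor_power_module]) auto
        have e: "tensor_face K A \<pi> n (q - 1) is
            (signed (T n (q - 1)) (op_sign 0 q j w) (pure_tensor K A (contract j 0 w))) = twice k t 0 j w"
          if "j \<in> {..<n}" for j
          unfolding t(1) by (rule face_twice[OF w]) (use that t(2) k1 in auto)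
        show ?thesis
          unfolding tensor_diff_pure'[OF w]
        proof (subst lin_hom_finsum_apply[OF tensor_power_module T f' c], assumption, rule T.finsum_eq_cong[OF refl e])
          show "twice k t 0 j w \<in> carrier ?T" if "j \<in> {..<n}" for j
            using lin_hom_closed[OF f' c[OF that]] unfolding e[OF that] .
        qed
      qed
      ultimately show ?thesis using face_face_interval[OF "is"(1) t(1) w t(2) k1 m Q] by (simp only:)
    next
      \<comment> \<open>Both faces of \<open>is\<close> vanish here. If the entries form an
        interval, it must contain \<open>0\<close> or \<open>n\<close>; otherwise the subsets cancel
        against their complements.\<close>
      case False
      have f0: "tensor_face K A \<pi> n q' is x = \<zero>\<^bsub>T m (q' + int k - 1)\<^esub>" for q' x
        unfolding m k by (rule tensor_face_zero[OF False])
      have "(\<Oplus>\<^bsub>?T\<^esub>R\<in>?P. face_face n q is R ?w) = \<zero>\<^bsub>?T\<^esub>"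
      proof (cases "\<exists>a l. set is = {a..<a + l}")
        case True
        then obtain a l where al: "set is = {a..<a + l}" by blast
        have "is = [a..<a + l]" using interval_filter[OF s(1), of "set is" a l] al by (simp add: filter_id_conv)
        then have len: "is = [a..<a + length is]" "l = k" by (auto simp: k)
        obtain b where b: "b \<in> set is" "b = 0 \<or> b = n"
        proof (cases a)
          case 0
          then show thesis using that[of 0] al len(2) k1 by auto
        next
          case (Suc t)
          then have "n \<le> t + k" using False len(1) unfolding k by (metis Suc_eq_plus1 not_less)
          moreover have "t + k \<le> n" using s(2) al len(2) Suc k1 by (auto simp: subset_iff)
          ultimately show thesis using that[of n] al len(2) Suc k1 by auto
        qed
        have "(\<Oplus>\<^bsub>?T\<^esub>R\<in>?P. face_face n q is R ?w) = (\<Oplus>\<^bsub>?T\<^esub>R\<in>?P. \<zero>\<^bsub>?T\<^esub>)"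
          by (rule T.finsum_eq_cong[OF refl])
            (use face_face_boundary[OF "is"(1) _ _ b, where q = q, folded k, folded m Q] in auto)
        then show ?thesis by simp
      next
        case False
        then show ?thesis using face_face_complement[OF "is"(1) w] m Q k by blast
      qed
      moreover have "tensor_diff K A d m (q + int k - 1) \<zero>\<^bsub>T m (q + int k - 1)\<^esub> = \<zero>\<^bsub>?T\<^esub>"
        by (rule lin_hom_zero[OF tensor_power_module T d'])
      ultimately show ?thesis unfolding f0 deg by simp
    qed
  qed
qed

lemma tensor_face_relation:
  assumes "is": "is \<in> index_tuples n" "is \<noteq> []" and k: "k = length is" and v: "v \<in> carrier (T n q)"
  shows "map_diff (tensor_power K A) (tensor_diff K A d) (tensor_diff K A d) n (n - k) (int k - 1)
      (\<lambda>q. tensor_face K A \<pi> n q is) q v =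
    (\<Oplus>\<^bsub>T (n - k) (q + int k - 2)\<^esub>\<sigma>\<in>{\<sigma>. \<sigma> permutes {..<k}}.
     \<Oplus>\<^bsub>T (n - k) (q + int k - 2)\<^esub>m\<in>cuts (hat (permute_list \<sigma> is)).
       let l = take m (hat (permute_list \<sigma> is)); r = drop m (hat (permute_list \<sigma> is)) in
       signed (T (n - k) (q + int k - 2)) (perm_parity \<sigma> + 1)
         (tensor_face K A \<pi> (n - length r) (q + int (length r) - 1) l (tensor_face K A \<pi> n q r v)))"
proof -
  let ?T = "T (n - k) (q + int k - 2)" and ?r = "\<lambda>R. filter (\<lambda>i. i \<in> R) is"
  let ?P = "Pow (set is) - {{}, set is}"
  have T: "module K ?T" by (rule tensor_power_module)
  interpret T: module K ?T by (rule T)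
  have s: "sorted_wrt (<) is" "set is \<subseteq> {..n}" "length is \<le> n" using "is"(1) by (auto simp: index_tuples_def)
  define b where "b l r = tensor_face K A \<pi> (n - length r) (q + int (length r) - 1) l (tensor_face K A \<pi> n q r v)"
    for l r
  define h where "h e l r = signed ?T (e + 1) (b l r)" for e l r
  have ffc: "face_face n q is R v \<in> carrier ?T" if "R \<in> ?P" for R
    using lin_hom_closed[OF face_face_hom[OF "is"(1), of R q] v] that unfolding k by auto
  have bc: "b (shift is R) (?r R) \<in> carrier ?T" if R: "R \<in> ?P" for R
  proof -
    have R': "R \<subseteq> set is" "R \<noteq> {}" "R \<noteq> set is" using R by auto
    have ne: "?r R \<noteq> []" "shift is R \<noteq> []" using R' by (auto simp: shift_def filter_empty_conv)
    note lr = wf_shift(4)[OF s(1,2) R'(1)]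
    note g = tensor_face_hom[OF ne(2) refl, of "n - card R" "q + int (card R) - 1",
        unfolded face_face_degrees[OF "is"(1) R'(1)]]
    show ?thesis
      unfolding b_def lr k by (rule lin_hom_closed[OF g lin_hom_closed[OF tensor_face_hom[OF ne(1) lr[symmetric]] v]])
  qed
  have hR: "h (int (crossings is R)) (shift is R) (?r R) = \<ominus>\<^bsub>?T\<^esub> face_face n q is R v" if R: "R \<in> ?P" for R
  proof -
    have "R \<subseteq> set is" using R by auto
    then have "face_face n q is R v = signed ?T (int (crossings is R)) (b (shift is R) (?r R))"
      using wf_shift(4)[OF s(1,2)] unfolding face_face_def b_def k by auto
    then show ?thesis unfolding h_def using signed_Suc[OF T bc[OF R]] by simp
  qed
  have "(\<Oplus>\<^bsub>?T\<^esub>\<sigma>\<in>{\<sigma>. \<sigma> permutes {..<length is}}. \<Oplus>\<^bsub>?T\<^esub>m\<in>cuts (hat (permute_list \<sigma> is)).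
      h (perm_parity \<sigma>) (take m (hat (permute_list \<sigma> is))) (drop m (hat (permute_list \<sigma> is)))) =
    (\<Oplus>\<^bsub>?T\<^esub>R\<in>?P. h (int (crossings is R)) (shift is R) (?r R))"
  proof (rule T.finsum_shuffles[OF s(1)])
    show "h e l r = h e' l r" if "even (e - e')" for e e' l r
      unfolding h_def by (rule signed_cong) (use that in simp)
    show "h (int (crossings is R)) (shift is R) (?r R) \<in> carrier ?T"
      if "R \<subseteq> set is" "R \<noteq> {}" "R \<noteq> set is" for R
      unfolding h_def by (rule signed_closed[OF T bc]) (use that in auto)
  qed
  also have "\<dots> = (\<Oplus>\<^bsub>?T\<^esub>R\<in>?P. \<ominus>\<^bsub>?T\<^esub> face_face n q is R v)"
    by (rule T.finsum_eq_cong[OF refl hR]) (use ffc in auto)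
  also have "\<dots> = \<ominus>\<^bsub>?T\<^esub> (\<Oplus>\<^bsub>?T\<^esub>R\<in>?P. face_face n q is R v)"
    by (rule T.finsum_uminus[OF ffc])
  finally have sh: "(\<Oplus>\<^bsub>?T\<^esub>\<sigma>\<in>{\<sigma>. \<sigma> permutes {..<k}}. \<Oplus>\<^bsub>?T\<^esub>m\<in>cuts (hat (permute_list \<sigma> is)).
      h (perm_parity \<sigma>) (take m (hat (permute_list \<sigma> is))) (drop m (hat (permute_list \<sigma> is)))) =
    \<ominus>\<^bsub>?T\<^esub> (\<Oplus>\<^bsub>?T\<^esub>R\<in>?P. face_face n q is R v)" unfolding k .
  define D E F where "D = tensor_diff K A d (n - k) (q + int k - 1) (tensor_face K A \<pi> n q is v)"
    and "E = tensor_face K A \<pi> n (q - 1) is (tensor_diff K A d n q v)"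
    and "F = (\<Oplus>\<^bsub>?T\<^esub>R\<in>?P. face_face n q is R v)"
  have deg: "q + int k - 1 - 1 = q + int k - 2" "q - 1 + int k - 1 = q + int k - 2"
    "q + (int k - 1) = q + int k - 1" by auto
  have c: "D \<in> carrier ?T" "E \<in> carrier ?T" "F \<in> carrier ?T"
  proof -
    show "D \<in> carrier ?T"
      using lin_hom_closed[OF tensor_diff_hom lin_hom_closed[OF tensor_face_hom[OF "is"(2) k] v]]
      unfolding D_def deg .
    show "E \<in> carrier ?T"
      using lin_hom_closed[OF tensor_face_hom[OF "is"(2) k] lin_hom_closed[OF tensor_diff_hom v]]
      unfolding E_def deg .
    show "F \<in> carrier ?T" unfolding F_def using ffc by (intro T.finsum_closed) auto
  qed
  have "D \<oplus>\<^bsub>?T\<^esub> E \<oplus>\<^bsub>?T\<^esub> F = \<zero>\<^bsub>?T\<^esub>"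
    using face_sum_relation[OF "is" v k refl refl] unfolding D_def E_def F_def .
  then have DE: "D \<oplus>\<^bsub>?T\<^esub> E = \<ominus>\<^bsub>?T\<^esub> F" using c by (intro T.minus_equality[symmetric]) auto
  \<comment> \<open>A face has total degree \<open>- k + (k - 1) = - 1\<close>, so its differential
    is the sum, not the difference, of the two composites with \<open>d\<close>.\<close>
  have odd: "odd (int (n - k) - int n + (int k - 1))" using s(3) k by (simp add: of_nat_diff)
  have "map_diff (tensor_power K A) (tensor_diff K A d) (tensor_diff K A d) n (n - k) (int k - 1)
      (\<lambda>q. tensor_face K A \<pi> n q is) q v = D \<ominus>\<^bsub>?T\<^esub> (\<ominus>\<^bsub>?T\<^esub> E)"
    unfolding map_diff_def deg D_def E_def signed_def using odd by simp
  also have "\<dots> = \<ominus>\<^bsub>?T\<^esub> F" using c DE by (simp add: a_minus_def)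
  finally show ?thesis using sh unfolding Let_def h_def b_def F_def by simp
qed

text \<open>Required for source and target alike, being part of what a morphism of such modules
  is.\<close>

lemma tensor_infinity_simplicial_module:
  "infinity_simplicial_module K (tensor_power K A) (tensor_diff K A d) (tensor_face K A \<pi>)"
  by (intro infinity_simplicial_module.intro infinity_simplicial_module_axioms.intro cring_axioms
      tensor_power_differential tensor_face_hom tensor_face_relation)

end

theorem theorem3p2:
  fixes K :: "'k ring"
    and A :: "int \<Rightarrow> ('k, 'a) module" and d :: "int \<Rightarrow> 'a \<Rightarrow> 'a"
    and \<pi> :: "nat \<Rightarrow> int \<Rightarrow> ('k, 'a) tensor \<Rightarrow> 'a"
    and A' :: "int \<Rightarrow> ('k, 'b) module" and d' :: "int \<Rightarrow> 'b \<Rightarrow> 'b"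
    and \<pi>' :: "nat \<Rightarrow> int \<Rightarrow> ('k, 'b) tensor \<Rightarrow> 'b"
    and f :: "nat \<Rightarrow> int \<Rightarrow> ('k, 'a) tensor \<Rightarrow> 'b"
  assumes "A_infinity_morphism K A d \<pi> A' d' \<pi>' f"
  shows "infinity_simplicial_morphism K
           (tensor_power K A) (tensor_diff K A d) (tensor_face K A \<pi>)
           (tensor_power K A') (tensor_diff K A' d') (tensor_face K A' \<pi>')
           (tensor_morphism K A A' f)"
proof -
  interpret A_infinity_morphism K A d \<pi> A' d' \<pi>' f by (rule assms)
  show ?thesis
    by (intro infinity_simplicial_morphism.intro infinity_simplicial_morphism_axioms.intro
        source.tensor_infinity_simplicial_module target.tensor_infinity_simplicial_module
        tensor_morphism_hom tensor_morphism_nil_relation tensor_morphism_relation)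
qed

end
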